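(* Let $\underline{\boldsymbol\lambda}\in\mathcal{P}_{r,n}^d$ and let $\mathfrak{t}$ be a standard $(r,d)$-tableau of shape $\underline{\boldsymbol\lambda}$; write $\mathrm{c}_i=\mathrm{c}_{\mathfrak{t}}(i)$ and $\mathrm{p}_i=\mathrm{p}^r_{\mathfrak{t}}(i)$. Then the idempotent $E_{\mathfrak{t}}$ of $Y_{r,n}^{d,\mathbb{K}}$ corresponding to $\mathfrak{t}$ can be derived by the following consecutive evaluations: $$E_{\mathfrak{t}}=\frac{1}{\mathrm{F}_{\underline{\boldsymbol{\lambda}}}^{T}\,\mathrm{F}_{\underline{\boldsymbol{\lambda}}}}\ \Phi(u_1,\ldots,u_{n},\underline{v_1},\ldots,\underline{v_n})\Big|_{\underline{v_1}=\zeta_{\mathrm{p}_{1}}}\cdots\Big|_{\underline{v_n}=\zeta_{\mathrm{p}_{n}}}\Big|_{u_{1}=\mathrm{c}_1}\cdots\Big|_{u_{n}=\mathrm{c}_{n}}.$$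
   Context: ALGEBRA. Let $r,n,d\ge1$ be integers and $\mathbb{K}$ an algebraically closed field of characteristic $p\ge0$ with $p\nmid r$; let $\zeta\in\mathbb{K}$ be a primitive $r$-th root of unity, $\zeta_k=\zeta^{k-1}$ for $1\le k\le r$, $S=\{\zeta_1,\ldots,\zeta_r\}$, and let $q,v_1,\ldots,v_d\in\mathbb{K}^*$ be such that $$\prod_{k=1}^{n}(1+q^{2}+\cdots+q^{2(k-1)})\prod_{1\leq i< j\leq d}\ \prod_{-n< l< n}(q^{2l}v_i-v_j)\neq 0.$$ $\mathfrak{S}_n$ acts on $\{1,\ldots,n\}$ on the right, $s_i=(i,i+1)$. $Y_{r,n}^{d,\mathbb{K}}$ is the associative $\mathbb{K}$-algebra generated by $t_1,\ldots,t_n,g_1,\ldots,g_{n-1},X_1^{\pm1}$ with relations: $g_ig_j=g_jg_i$ if $|i-j|\ge2$; $g_ig_{i+1}g_i=g_{i+1}g_ig_{i+1}$; $t_it_j=t_jt_i$; $g_it_j=t_{js_i}g_i$; $t_i^r=1$; $g_i^2=1+(q-q^{-1})e_ig_i$ with $e_i=\frac1r\sum_{s=0}^{r-1}t_i^st_{i+1}^{-s}$; $X_1X_1^{-1}=X_1^{-1}X_1=1$; $g_1X_1g_1X_1=X_1g_1X_1g_1$; $g_iX_1=X_1g_i$ for $i\ge2$; $t_jX_1=X_1t_j$; $(X_1-v_1)\cdots(X_1-v_d)=0$. One has $g_i^{-1}=g_i-(q-q^{-1})e_i$. Put $X_{i+1}=g_iX_ig_i$; all $X_i,t_j$ commute.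 COMBINATORICS. An $(r,d)$-partition of $n$ is $\underline{\boldsymbol\lambda}=((\lambda^{(1)}_1,\ldots,\lambda^{(1)}_d),\ldots,(\lambda^{(r)}_1,\ldots,\lambda^{(r)}_d))$ with all $\lambda^{(k)}_l$ partitions of total size $n$; $\mathcal{P}_{r,n}^d$ is the set of these. An $(r,d)$-node $\boldsymbol\theta=((x,y),k,l)$ of $\underline{\boldsymbol\lambda}$ is the node in row $x$, column $y$ of $\lambda^{(k)}_l$; $\mathrm{p}^{(r)}(\boldsymbol\theta)=k$, $\mathrm{p}^{(d)}(\boldsymbol\theta)=l$, and $\mathrm{cc}(\boldsymbol\theta)=y-x$. A standard $(r,d)$-tableau of shape $\underline{\boldsymbol\lambda}$ is a bijective filling of the nodes of $\underline{\boldsymbol\lambda}$ by $1,\ldots,n$ with entries increasing along rows and down columns in each component. If $i$ lies in the node $((x,y),k,l)$ of $\mathfrak{t}$, then $\mathrm{c}_{\mathfrak{t}}(i)=v_lq^{2(y-x)}$ and $\mathrm{p}^r_{\mathfrak{t}}(i)=k$. IDEMPOTENTS. Let $\mathcal{C}(k)=\{\mathrm{c}_{\mathfrak{t}}(k)\}$ and $\overline{\mathcal{C}(k)}=\{\zeta_{\mathrm{p}^r_{\mathfrak{t}}(k)}\}$, where $\mathfrak{t}$ runs over all standard $(r,d)$-tableaux of all shapes in $\mathcal{P}_{r,n}^d$, and $$E_{\mathfrak{t}}=\prod_{k=1}^{n}\Bigl(\prod_{c\in \mathcal{C}(k),\,c\neq \mathrm{c}_{\mathfrak{t}}(k)}\frac{X_{k}-c}{\mathrm{c}_{\mathfrak{t}}(k)-c}\cdot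 \prod_{\bar{c}\in \overline{\mathcal{C}(k)},\,\bar{c}\neq \zeta_{\mathrm{p}_{\mathfrak{t}}^{r}(k)}}\frac{t_{k}-\bar{c}}{\zeta_{\mathrm{p}_{\mathfrak{t}}^{r}(k)}-\bar{c}}\Bigr).$$ SCALARS. For a node $\boldsymbol\theta=((x,y),k,l)$ of $\underline{\boldsymbol\lambda}$ and a partition $\mu$ (with conjugate $\mu'$), put $h_{\underline{\boldsymbol\lambda}}^{\mu}(\boldsymbol\theta)=\lambda^{(k)}_{l,x}+\mu'_y-x-y+1$ and $h_{\underline{\boldsymbol\lambda}}(\boldsymbol\theta)=h_{\underline{\boldsymbol\lambda}}^{\lambda_l^{(k)}}(\boldsymbol\theta)$, where $\lambda^{(k)}_{l,x}$ is the $x$-th part of $\lambda^{(k)}_l$. With $[a]_q=q^{a-1}+q^{a-3}+\cdots+q^{-a+1}$, $$\mathrm{F}_{\underline{\boldsymbol{\lambda}}}^{T}=\prod_{\boldsymbol{\theta}\in \underline{\boldsymbol{\lambda}}}\ \prod_{\xi\in S,\ \xi\neq \zeta_{\mathrm{p}^{(r)}(\boldsymbol{\theta})}}(\zeta_{\mathrm{p}^{(r)}(\boldsymbol{\theta})}-\xi),$$ $$\mathrm{F}_{\underline{\boldsymbol{\lambda}}}=\prod_{\boldsymbol{\theta}\in \underline{\boldsymbol{\lambda}}} \Bigl(\frac{[h_{\underline{\boldsymbol{\lambda}}}(\boldsymbol{\theta})]_{q}}{q^{\mathrm{cc}(\boldsymbol{\theta})}}\prod_{1\leq k\leq d,\ k\neq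 \mathrm{p}^{(d)}(\boldsymbol{\theta})}\frac{v_{\mathrm{p}^{(d)}(\boldsymbol{\theta})}q^{h(\boldsymbol\theta,k)}-v_{k}q^{-h(\boldsymbol\theta,k)}}{q^{-\mathrm{cc}(\boldsymbol{\theta})}}\Bigr),\qquad h(\boldsymbol\theta,k)=h_{\underline{\boldsymbol{\lambda}}}^{\lambda^{(\mathrm{p}^{(r)}(\boldsymbol{\theta}))}_{k}}(\boldsymbol{\theta}).$$ RATIONAL FUNCTION. The $u_1,\ldots,u_n,\underline{v_1},\ldots,\underline{v_n}$ are variables (the $\underline{v_i}$ are unrelated to the parameters $v_i$). Put $g_i(a,b)=g_i+(q-q^{-1})\frac{b\,e_i}{a-b}$, $\phi_1(u)=\frac{(u-v_1)\cdots(u-v_d)}{u-X_1}$, and for $2\le k\le n$ $$\phi_k(u_1,\ldots,u_{k-1},u)=g_{k-1}(u,u_{k-1})g_{k-2}(u,u_{k-2})\cdots g_1(u,u_1)\,\phi_1(u)\,g_1^{-1}\cdots g_{k-1}^{-1},$$ $$\Gamma(\underline{v_1},\ldots,\underline{v_n})=\prod_{i=1}^n\frac{\prod_{\xi\in S}(\underline{v_i}-\xi)}{\underline{v_i}-t_i},$$ $$\Phi(u_1,\ldots,u_n,\underline{v_1},\ldots,\underline{v_n})=\phi_n(u_1,\ldots,u_n)\phi_{n-1}(u_1,\ldots,u_{n-1})\cdots\phi_1(u_1)\,\Gamma(\underline{v_1},\ldots,\underline{v_n}).$$ The evaluations are performed one after another from left to right (first $\underline{v_1}$, ..., $\underline{v_n}$,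 then $u_1$, ..., $u_n$).
   Formalization: The formal theorem additionally assumes q² ≠ 1 unless n = 1; for q² = 1 and n ≥ 2 the formula fails (e.g. r = d = 1, n = 2, q = v_1 = 1, λ = (2): E_t = Φ = 1 but F = 2). *)

theory Defs
  imports
    "HOL-Library.Poly_Mapping"
    "HOL-Computational_Algebra.Fraction_Field"
    "HOL-Computational_Algebra.Polynomial"
    "HOL-Algebra.QuotRing"
    "HOL-Combinatorics.Transposition"
begin

section \<open>The algebra given by generators and relations\<close>

datatype 'g word = Word (letters: "'g list")

instantiation word :: (type) monoid_add
begin

definition zero_word :: "'a word" where "0 = Word []"

definition plus_word :: "'a word \<Rightarrow> 'a word \<Rightarrow> 'a word"
  where "u + w = Word (letters u @ letters w)"

instance
  by standard (simp_all add: zero_word_def plus_word_def)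

end

datatype gen = GenT nat | GenG nat | GenX | GenXinv

definition gens :: "nat \<Rightarrow> gen set" where
  "gens n = GenT ` {1..n} \<union> GenG ` {1..<n} \<union> {GenX, GenXinv}"

text \<open>Finitely supported functions on words; multiplication is convolution along concatenation of
  words, so this is the free associative algebra on \<^typ>\<open>gen\<close>. The generators with an
  index out of range are removed in \<open>free_algebra\<close> by restricting the carrier.\<close>

type_synonym 'a falg = "gen word \<Rightarrow>\<^sub>0 'a"

definition scal :: "'a::ring_1 \<Rightarrow> 'a falg" where
  "scal c = Poly_Mapping.single 0 c"

definition letter :: "gen \<Rightarrow> 'a::ring_1 falg" where
  "letter g = Poly_Mapping.single (Word [g]) 1"

abbreviation tt :: "nat \<Rightarrow> 'a::ring_1 falg" where "tt j \<equiv> letter (GenT j)"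
abbreviation gg :: "nat \<Rightarrow> 'a::ring_1 falg" where "gg i \<equiv> letter (GenG i)"
abbreviation xx :: "'a::ring_1 falg" where "xx \<equiv> letter GenX"
abbreviation xx_inv :: "'a::ring_1 falg" where "xx_inv \<equiv> letter GenXinv"

definition free_algebra :: "nat \<Rightarrow> 'a::ring_1 falg ring" where
  "free_algebra n =
    \<lparr>carrier = {a. \<forall>w \<in> Poly_Mapping.keys a. set (letters w) \<subseteq> gens n},
     monoid.mult = (*), one = 1, ring.zero = 0, add = (+)\<rparr>"

text \<open>The free algebra has no inverse of \<open>tt (i + 1)\<close>; since \<open>tt (i + 1) ^ r = 1\<close> is one of
  the relations, its power with exponent \<open>- s\<close> is written with exponent \<open>r - s\<close>.\<close>

definition ee :: "nat \<Rightarrow> nat \<Rightarrow> 'a::field falg" where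
  "ee r i = scal (1 / of_nat r) * (\<Sum>s<r. tt i ^ s * tt (i + 1) ^ (r - s))"

definition yh_relations ::
  "nat \<Rightarrow> nat \<Rightarrow> nat \<Rightarrow> 'a::field \<Rightarrow> (nat \<Rightarrow> 'a) \<Rightarrow> 'a falg set" where
  "yh_relations r n d q v =
     {gg i * gg j - gg j * gg i | i j.
        i \<in> {1..<n} \<and> j \<in> {1..<n} \<and> \<bar>int i - int j\<bar> \<ge> 2} \<union>
     {gg i * gg (i + 1) * gg i - gg (i + 1) * gg i * gg (i + 1) | i.
        i \<in> {1..<n} \<and> i + 1 \<in> {1..<n}} \<union>
     {tt i * tt j - tt j * tt i | i j. i \<in> {1..n} \<and> j \<in> {1..n}} \<union>
     {gg i * tt j - tt (transpose i (i + 1) j) * gg i | i j. i \<in> {1..<n} \<and> j \<in> {1..n}} \<union>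
     {tt i ^ r - 1 | i. i \<in> {1..n}} \<union>
     {gg i ^ 2 - (1 + scal (q - inverse q) * ee r i * gg i) | i. i \<in> {1..<n}} \<union>
     {xx * xx_inv - 1, xx_inv * xx - 1} \<union>
     {gg i * xx * gg i * xx - xx * gg i * xx * gg i | i. i \<in> {1..<n} \<and> i = 1} \<union>
     {gg i * xx - xx * gg i | i. i \<in> {1..<n} \<and> i \<ge> 2} \<union>
     {tt j * xx - xx * tt j | j. j \<in> {1..n}} \<union>
     {prod_list (map (\<lambda>l. xx - scal (v l)) [1..<d + 1])}"

definition yh_ideal ::
  "nat \<Rightarrow> nat \<Rightarrow> nat \<Rightarrow> 'a::field \<Rightarrow> (nat \<Rightarrow> 'a) \<Rightarrow> 'a falg set" where
  "yh_ideal r n d q v = genideal (free_algebra n) (yh_relations r n d q v)"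

definition yh_algebra ::
  "nat \<Rightarrow> nat \<Rightarrow> nat \<Rightarrow> 'a::field \<Rightarrow> (nat \<Rightarrow> 'a) \<Rightarrow> 'a falg set ring" where
  "yh_algebra r n d q v = free_algebra n Quot yh_ideal r n d q v"

text \<open>Its \<open>'a\<close>-algebra structure is given by the classes of the elements \<open>scal c\<close>.\<close>

definition yh_class ::
  "nat \<Rightarrow> nat \<Rightarrow> nat \<Rightarrow> 'a::field \<Rightarrow> (nat \<Rightarrow> 'a) \<Rightarrow> 'a falg \<Rightarrow> 'a falg set" where
  "yh_class r n d q v a = yh_ideal r n d q v +>\<^bsub>free_algebra n\<^esub> a"

text \<open>Jucys--Murphy elements; only indices \<open>\<ge> 1\<close> are meaningful.\<close>

fun jm :: "nat \<Rightarrow> 'a::ring_1 falg" where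
  "jm 0 = 1"
| "jm (Suc 0) = xx"
| "jm (Suc (Suc i)) = gg (Suc i) * jm (Suc i) * gg (Suc i)"


section \<open>Combinatorics\<close>

definition is_partition :: "nat list \<Rightarrow> bool" where
  "is_partition p \<longleftrightarrow> sorted_wrt (\<ge>) p \<and> 0 \<notin> set p"

definition part :: "nat list \<Rightarrow> nat \<Rightarrow> nat" where
  "part p x = (if 1 \<le> x \<and> x \<le> length p then p ! (x - 1) else 0)"

definition conj_part :: "nat list \<Rightarrow> nat \<Rightarrow> nat" where
  "conj_part p y = card {x. 1 \<le> x \<and> x \<le> length p \<and> y \<le> part p x}"

text \<open>The component \<open>\<lambda>\<close> with superscript \<open>(k)\<close> and subscript \<open>l\<close> is \<open>\<Lambda> k l\<close>; the
  function is normalised to be empty outside the index range.\<close>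

type_synonym multipartition = "nat \<Rightarrow> nat \<Rightarrow> nat list"

type_synonym node = "(nat \<times> nat) \<times> nat \<times> nat"

definition rd_partitions :: "nat \<Rightarrow> nat \<Rightarrow> nat \<Rightarrow> multipartition set" where
  "rd_partitions r d n = {\<Lambda>.
     (\<forall>k l. is_partition (\<Lambda> k l)) \<and>
     (\<forall>k l. \<not> (k \<in> {1..r} \<and> l \<in> {1..d}) \<longrightarrow> \<Lambda> k l = []) \<and>
     (\<Sum>k=1..r. \<Sum>l=1..d. sum_list (\<Lambda> k l)) = n}"

definition nodes :: "multipartition \<Rightarrow> node set" where
  "nodes \<Lambda> = {((x, y), k, l). 1 \<le> x \<and> 1 \<le> y \<and> y \<le> part (\<Lambda> k l) x}"

definition standard_tableaux :: "nat \<Rightarrow> multipartition \<Rightarrow> (node \<Rightarrow> nat) set" where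
  "standard_tableaux n \<Lambda> = {T. bij_betw T (nodes \<Lambda>) {1..n} \<and>
     (\<forall>x y y' k l. ((x, y), k, l) \<in> nodes \<Lambda> \<and> ((x, y'), k, l) \<in> nodes \<Lambda> \<and> y < y'
        \<longrightarrow> T ((x, y), k, l) < T ((x, y'), k, l)) \<and>
     (\<forall>x x' y k l. ((x, y), k, l) \<in> nodes \<Lambda> \<and> ((x', y), k, l) \<in> nodes \<Lambda> \<and> x < x'
        \<longrightarrow> T ((x, y), k, l) < T ((x', y), k, l))}"

definition node_of :: "multipartition \<Rightarrow> (node \<Rightarrow> nat) \<Rightarrow> nat \<Rightarrow> node" where
  "node_of \<Lambda> T i = inv_into (nodes \<Lambda>) T i"

definition node_content :: "node \<Rightarrow> int" where
  "node_content = (\<lambda>((x, y), k, l). int y - int x)"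

definition pos_r :: "node \<Rightarrow> nat" where
  "pos_r = (\<lambda>((x, y), k, l). k)"

definition pos_d :: "node \<Rightarrow> nat" where
  "pos_d = (\<lambda>((x, y), k, l). l)"

definition tab_c ::
  "'a::field \<Rightarrow> (nat \<Rightarrow> 'a) \<Rightarrow> multipartition \<Rightarrow> (node \<Rightarrow> nat) \<Rightarrow> nat \<Rightarrow> 'a" where
  "tab_c q v \<Lambda> T i = v (pos_d (node_of \<Lambda> T i)) * q powi (2 * node_content (node_of \<Lambda> T i))"

definition tab_p :: "multipartition \<Rightarrow> (node \<Rightarrow> nat) \<Rightarrow> nat \<Rightarrow> nat" where
  "tab_p \<Lambda> T i = pos_r (node_of \<Lambda> T i)"


section \<open>Idempotents\<close>

definition root_k :: "'a::field \<Rightarrow> nat \<Rightarrow> 'a" where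
  "root_k \<zeta> k = \<zeta> ^ (k - 1)"

definition root_set :: "nat \<Rightarrow> 'a::field \<Rightarrow> 'a set" where
  "root_set r \<zeta> = root_k \<zeta> ` {1..r}"

definition c_set ::
  "nat \<Rightarrow> nat \<Rightarrow> nat \<Rightarrow> 'a::field \<Rightarrow> (nat \<Rightarrow> 'a) \<Rightarrow> nat \<Rightarrow> 'a set" where
  "c_set r n d q v k =
     {tab_c q v \<Lambda> T k | \<Lambda> T. \<Lambda> \<in> rd_partitions r d n \<and> T \<in> standard_tableaux n \<Lambda>}"

definition cbar_set :: "nat \<Rightarrow> nat \<Rightarrow> nat \<Rightarrow> 'a::field \<Rightarrow> nat \<Rightarrow> 'a set" where
  "cbar_set r n d \<zeta> k =
     {root_k \<zeta> (tab_p \<Lambda> T k) | \<Lambda> T. \<Lambda> \<in> rd_partitions r d n \<and> T \<in> standard_tableaux n \<Lambda>}"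

text \<open>The products over sets in the definition of the idempotents have as factors polynomials in
  a single algebra element, hence are written as a product in the commutative ring
  \<^typ>\<open>'a poly\<close> evaluated at that element.\<close>

definition interpolation :: "'a::field set \<Rightarrow> 'a \<Rightarrow> 'a poly" where
  "interpolation A c = (\<Prod>b\<in>A - {c}. smult (1 / (c - b)) [:- b, 1:])"

definition poly_at :: "'a::field poly \<Rightarrow> 'a falg \<Rightarrow> 'a falg" where
  "poly_at p a = (\<Sum>i\<le>degree p. scal (coeff p i) * a ^ i)"

definition idempotent_E ::
  "nat \<Rightarrow> nat \<Rightarrow> nat \<Rightarrow> 'a::field \<Rightarrow> 'a \<Rightarrow> (nat \<Rightarrow> 'a) \<Rightarrow>
   multipartition \<Rightarrow> (node \<Rightarrow> nat) \<Rightarrow> 'a falg set" where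
  "idempotent_E r n d \<zeta> q v \<Lambda> T = yh_class r n d q v
     (prod_list (map (\<lambda>k.
        poly_at (interpolation (c_set r n d q v k) (tab_c q v \<Lambda> T k)) (jm k) *
        poly_at (interpolation (cbar_set r n d \<zeta> k) (root_k \<zeta> (tab_p \<Lambda> T k))) (tt k))
        [1..<n + 1]))"


section \<open>Scalars\<close>

definition gen_hook :: "multipartition \<Rightarrow> nat list \<Rightarrow> node \<Rightarrow> int" where
  "gen_hook \<Lambda> \<mu> = (\<lambda>((x, y), k, l).
     int (part (\<Lambda> k l) x) + int (conj_part \<mu> y) - int x - int y + 1)"

definition hook :: "multipartition \<Rightarrow> node \<Rightarrow> int" where
  "hook \<Lambda> \<theta> = gen_hook \<Lambda> (\<Lambda> (pos_r \<theta>) (pos_d \<theta>)) \<theta>"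

definition q_number :: "'a::field \<Rightarrow> int \<Rightarrow> 'a" where
  "q_number q a = (\<Sum>j<nat a. q powi (a - 1 - 2 * int j))"

definition F_T :: "nat \<Rightarrow> 'a::field \<Rightarrow> multipartition \<Rightarrow> 'a" where
  "F_T r \<zeta> \<Lambda> = (\<Prod>\<theta>\<in>nodes \<Lambda>. \<Prod>\<xi>\<in>root_set r \<zeta> - {root_k \<zeta> (pos_r \<theta>)}.
     root_k \<zeta> (pos_r \<theta>) - \<xi>)"

definition F_lambda :: "nat \<Rightarrow> 'a::field \<Rightarrow> (nat \<Rightarrow> 'a) \<Rightarrow> multipartition \<Rightarrow> 'a" where
  "F_lambda d q v \<Lambda> = (\<Prod>\<theta>\<in>nodes \<Lambda>.
     q_number q (hook \<Lambda> \<theta>) / q powi node_content \<theta> *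
     (\<Prod>k\<in>{1..d} - {pos_d \<theta>}.
        let h = gen_hook \<Lambda> (\<Lambda> (pos_r \<theta>) k) \<theta>
        in (v (pos_d \<theta>) * q powi h - v k * q powi (- h)) / q powi (- node_content \<theta>)))"


section \<open>Rational functions and their evaluation\<close>

text \<open>Polynomials and rational functions in variables indexed by \<^typ>\<open>nat\<close>.
  The variables \<open>u\<^sub>i\<close> and \<open>\<underline>v\<^sub>i\<close> of the fusion formula have the
  indices \<open>u_ix i\<close> and \<open>v_ix i\<close>.\<close>

type_synonym 'a mpoly = "(nat \<Rightarrow>\<^sub>0 nat) \<Rightarrow>\<^sub>0 'a"
type_synonym 'a ratfun = "'a mpoly fract"

definition mconst :: "'a::field \<Rightarrow> 'a mpoly" where
  "mconst c = Poly_Mapping.single 0 c"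

definition mvar :: "nat \<Rightarrow> 'a::field mpoly" where
  "mvar i = Poly_Mapping.single (Poly_Mapping.single i 1) 1"

definition rconst :: "'a::field \<Rightarrow> 'a ratfun" where
  "rconst c = Fraction_Field.Fract (mconst c) 1"

definition rvar :: "nat \<Rightarrow> 'a::field ratfun" where
  "rvar i = Fraction_Field.Fract (mvar i) 1"

definition u_ix :: "nat \<Rightarrow> nat" where "u_ix i = 2 * i"
definition v_ix :: "nat \<Rightarrow> nat" where "v_ix i = 2 * i + 1"

text \<open>The substitution of the constant \<open>c\<close> for the variable \<open>x\<close>.\<close>

definition msubst :: "nat \<Rightarrow> 'a::field \<Rightarrow> 'a mpoly \<Rightarrow> 'a mpoly" where
  "msubst x c p = (\<Sum>m\<in>Poly_Mapping.keys p. mconst (Poly_Mapping.lookup p m) *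
     (\<Prod>i\<in>Poly_Mapping.keys m. (if i = x then mconst c else mvar i) ^ Poly_Mapping.lookup m i))"

text \<open>The rational function \<open>f\<close> is regular at \<open>x = c\<close>, and its evaluation there (again
  a rational function, in the remaining variables) is \<open>g\<close>.\<close>

definition rat_evaluates :: "nat \<Rightarrow> 'a::field \<Rightarrow> 'a ratfun \<Rightarrow> 'a ratfun \<Rightarrow> bool" where
  "rat_evaluates x c f g \<longleftrightarrow>
     (\<exists>a b. f = Fraction_Field.Fract a b \<and> msubst x c b \<noteq> 0 \<and>
        g = Fraction_Field.Fract (msubst x c a) (msubst x c b))"

text \<open>The presentation is compatible with extension of scalars, so the algebra of rational
  functions with values in the algebra over \<open>'a\<close> is the algebra over \<^typ>\<open>'a ratfun\<close> with
  the same (constant) parameters.\<close>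

definition yh_ratfun ::
  "nat \<Rightarrow> nat \<Rightarrow> nat \<Rightarrow> 'a::field \<Rightarrow> (nat \<Rightarrow> 'a) \<Rightarrow> 'a ratfun falg set ring" where
  "yh_ratfun r n d q v = yh_algebra r n d (rconst q) (\<lambda>l. rconst (v l))"

definition yh_rclass :: "nat \<Rightarrow> nat \<Rightarrow> nat \<Rightarrow> 'a::field \<Rightarrow> (nat \<Rightarrow> 'a) \<Rightarrow>
   'a ratfun falg \<Rightarrow> 'a ratfun falg set" where
  "yh_rclass r n d q v = yh_class r n d (rconst q) (\<lambda>l. rconst (v l))"

text \<open>The canonical embedding, as constant functions.\<close>

definition yh_const :: "nat \<Rightarrow> nat \<Rightarrow> nat \<Rightarrow> 'a::field \<Rightarrow> (nat \<Rightarrow> 'a) \<Rightarrow>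
   'a falg set \<Rightarrow> 'a ratfun falg set" where
  "yh_const r n d q v y = (\<Union>a\<in>y. yh_rclass r n d q v (Poly_Mapping.map rconst a))"

text \<open>\<open>\<Psi>\<close> is regular at \<open>x = c\<close> with evaluation \<open>\<Omega>\<close>: some linear combination of words
  representing \<open>\<Psi>\<close> has all coefficients regular at \<open>x = c\<close>, and the evaluation of the
  coefficients yields a representative of \<open>\<Omega>\<close>.\<close>

definition yh_evaluates :: "nat \<Rightarrow> nat \<Rightarrow> nat \<Rightarrow> 'a::field \<Rightarrow> (nat \<Rightarrow> 'a) \<Rightarrow>
   nat \<Rightarrow> 'a \<Rightarrow> 'a ratfun falg set \<Rightarrow> 'a ratfun falg set \<Rightarrow> bool" where
  "yh_evaluates r n d q v x c \<Psi> \<Omega> \<longleftrightarrow>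
     \<Psi> \<in> carrier (yh_ratfun r n d q v) \<and>
     (\<exists>a\<in>\<Psi>. \<exists>b. (\<forall>w. rat_evaluates x c (Poly_Mapping.lookup a w) (Poly_Mapping.lookup b w)) \<and>
        \<Omega> = yh_rclass r n d q v b)"

text \<open>Consecutive evaluations; the head of the list is performed first.\<close>

fun yh_evaluates_seq :: "nat \<Rightarrow> nat \<Rightarrow> nat \<Rightarrow> 'a::field \<Rightarrow> (nat \<Rightarrow> 'a) \<Rightarrow>
   (nat \<times> 'a) list \<Rightarrow> 'a ratfun falg set \<Rightarrow> 'a ratfun falg set \<Rightarrow> bool" where
  "yh_evaluates_seq r n d q v [] \<Psi> \<Omega> \<longleftrightarrow> \<Psi> = \<Omega>"
| "yh_evaluates_seq r n d q v ((x, c) # xs) \<Psi> \<Omega> \<longleftrightarrow>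
     (\<exists>\<Theta>. yh_evaluates r n d q v x c \<Psi> \<Theta> \<and> yh_evaluates_seq r n d q v xs \<Theta> \<Omega>)"


section \<open>The rational function of the fusion formula\<close>

definition baxter_g ::
  "nat \<Rightarrow> 'a::field \<Rightarrow> nat \<Rightarrow> 'a ratfun \<Rightarrow> 'a ratfun \<Rightarrow> 'a ratfun falg" where
  "baxter_g r q i a b =
     gg i + scal ((rconst q - inverse (rconst q)) * (b / (a - b))) * ee r i"

definition list_mult :: "('b, 'c) monoid_scheme \<Rightarrow> 'b list \<Rightarrow> 'b" where
  "list_mult R ys = foldr (monoid.mult R) ys (one R)"

definition phi_1 :: "nat \<Rightarrow> nat \<Rightarrow> nat \<Rightarrow> 'a::field \<Rightarrow> (nat \<Rightarrow> 'a) \<Rightarrow>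
   'a ratfun \<Rightarrow> 'a ratfun falg set" where
  "phi_1 r n d q v u =
     yh_rclass r n d q v (scal (\<Prod>l=1..d. u - rconst (v l)))
     \<otimes>\<^bsub>yh_ratfun r n d q v\<^esub>
     inv\<^bsub>yh_ratfun r n d q v\<^esub> (yh_rclass r n d q v (scal u - xx))"

definition phi :: "nat \<Rightarrow> nat \<Rightarrow> nat \<Rightarrow> 'a::field \<Rightarrow> (nat \<Rightarrow> 'a) \<Rightarrow>
   nat \<Rightarrow> (nat \<Rightarrow> 'a ratfun) \<Rightarrow> 'a ratfun \<Rightarrow> 'a ratfun falg set" where
  "phi r n d q v k us u = list_mult (yh_ratfun r n d q v)
     (map (\<lambda>i. yh_rclass r n d q v (baxter_g r q i u (us i))) (rev [1..<k]) @
      [phi_1 r n d q v u] @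
      map (\<lambda>i. inv\<^bsub>yh_ratfun r n d q v\<^esub> (yh_rclass r n d q v (gg i))) [1..<k])"

definition Gamma_T :: "nat \<Rightarrow> nat \<Rightarrow> nat \<Rightarrow> 'a::field \<Rightarrow> 'a \<Rightarrow> (nat \<Rightarrow> 'a) \<Rightarrow>
   (nat \<Rightarrow> 'a ratfun) \<Rightarrow> 'a ratfun falg set" where
  "Gamma_T r n d \<zeta> q v vs = list_mult (yh_ratfun r n d q v)
     (map (\<lambda>i.
        yh_rclass r n d q v (scal (\<Prod>\<xi>\<in>root_set r \<zeta>. vs i - rconst \<xi>))
        \<otimes>\<^bsub>yh_ratfun r n d q v\<^esub>
        inv\<^bsub>yh_ratfun r n d q v\<^esub> (yh_rclass r n d q v (scal (vs i) - tt i)))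
      [1..<n + 1])"

definition Phi :: "nat \<Rightarrow> nat \<Rightarrow> nat \<Rightarrow> 'a::field \<Rightarrow> 'a \<Rightarrow> (nat \<Rightarrow> 'a) \<Rightarrow>
   (nat \<Rightarrow> 'a ratfun) \<Rightarrow> (nat \<Rightarrow> 'a ratfun) \<Rightarrow> 'a ratfun falg set" where
  "Phi r n d \<zeta> q v us vs = list_mult (yh_ratfun r n d q v)
     (map (\<lambda>k. phi r n d q v k us (us k)) (rev [1..<n + 1]) @ [Gamma_T r n d \<zeta> q v vs])"


section \<open>Well-definedness\<close>

text \<open>The algebras are rings, the embedding of constants is injective
  (\<open>inj_on_yh_const\<close>), and evaluations are unique when they exist
  (\<open>yh_evaluates_unique\<close>, \<open>yh_evaluates_seq_unique\<close>), although
  \<open>yh_evaluates\<close> is defined through a choice of representative.\<close>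

lemma poly_mapping_sum_single:
  "p = (\<Sum>m\<in>Poly_Mapping.keys p. Poly_Mapping.single m (Poly_Mapping.lookup p m))"
  by (rule poly_mapping_eqI)
    (simp add: lookup_sum lookup_single when_def sum.delta in_keys_iff)

lemma poly_mapping_single_induct [case_names zero add_single]:
  fixes p :: "'b \<Rightarrow>\<^sub>0 'c::comm_monoid_add"
  assumes "P 0" and "\<And>m c p. P p \<Longrightarrow> P (p + Poly_Mapping.single m c)"
  shows "P p"
proof -
  have "P (\<Sum>m\<in>A. Poly_Mapping.single m (Poly_Mapping.lookup p m))" if "finite A" for A
    using that
  proof (induction A rule: finite_induct)
    case (insert m A)
    then show ?case
      using assms(2)[OF insert.IH, of m "Poly_Mapping.lookup p m"] by (simp add: add.commute)
  qed (simp add: assms(1))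
  then show ?thesis
    using poly_mapping_sum_single[of p] by (metis finite_keys)
qed

subsection \<open>The ring structure\<close>

lemma carrier_free_algebra [simp]:
  "a \<in> carrier (free_algebra n) \<longleftrightarrow> (\<forall>w \<in> Poly_Mapping.keys a. set (letters w) \<subseteq> gens n)"
  by (simp add: free_algebra_def)

lemma free_algebra_simps [simp]:
  "monoid.mult (free_algebra n) = (*)" "one (free_algebra n) = 1"
  "ring.zero (free_algebra n) = 0" "add (free_algebra n) = (+)"
  by (simp_all add: free_algebra_def)

lemma free_algebra_closed:
  "0 \<in> carrier (free_algebra n)"
  "1 \<in> carrier (free_algebra n)"
  "a \<in> carrier (free_algebra n) \<Longrightarrow> - a \<in> carrier (free_algebra n)"
  "\<lbrakk>a \<in> carrier (free_algebra n); b \<in> carrier (free_algebra n)\<rbrakk> \<Longrightarrow> a + b \<in> carrier (free_algebra n)"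
  "\<lbrakk>a \<in> carrier (free_algebra n); b \<in> carrier (free_algebra n)\<rbrakk> \<Longrightarrow> a - b \<in> carrier (free_algebra n)"
  "\<lbrakk>a \<in> carrier (free_algebra n); b \<in> carrier (free_algebra n)\<rbrakk> \<Longrightarrow> a * b \<in> carrier (free_algebra n)"
  "scal c \<in> carrier (free_algebra n)"
  "g \<in> gens n \<Longrightarrow> letter g \<in> carrier (free_algebra n)"
proof -
  show minus: "- a \<in> carrier (free_algebra n)" if "a \<in> carrier (free_algebra n)" for a
    using that by (simp add: in_keys_iff)
  show add: "a + b \<in> carrier (free_algebra n)"
    if "a \<in> carrier (free_algebra n)" "b \<in> carrier (free_algebra n)" for a b
    using that keys_add[of a b] by auto
  show "a - b \<in> carrier (free_algebra n)"
    if "a \<in> carrier (free_algebra n)" "b \<in> carrier (free_algebra n)" for a b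
    using add[OF that(1) minus[OF that(2)]] by simp
  show "a * b \<in> carrier (free_algebra n)"
    if "a \<in> carrier (free_algebra n)" "b \<in> carrier (free_algebra n)" for a b
    using that keys_mult[of a b] by (fastforce simp: plus_word_def)
qed (auto simp: scal_def letter_def zero_word_def)

lemma free_algebra_closed':
  "a \<in> carrier (free_algebra n) \<Longrightarrow> a ^ k \<in> carrier (free_algebra n)"
  "(\<And>x. x \<in> A \<Longrightarrow> f x \<in> carrier (free_algebra n)) \<Longrightarrow> sum f A \<in> carrier (free_algebra n)"
  "(\<And>x. x \<in> set xs \<Longrightarrow> x \<in> carrier (free_algebra n)) \<Longrightarrow>
     prod_list xs \<in> carrier (free_algebra n)"
proof -
  show "a \<in> carrier (free_algebra n) \<Longrightarrow> a ^ k \<in> carrier (free_algebra n)"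
    by (induction k) (simp_all add: free_algebra_closed del: carrier_free_algebra)
  show "(\<And>x. x \<in> A \<Longrightarrow> f x \<in> carrier (free_algebra n)) \<Longrightarrow> sum f A \<in> carrier (free_algebra n)"
    by (induction A rule: infinite_finite_induct)
      (simp_all add: free_algebra_closed del: carrier_free_algebra)
  show "(\<And>x. x \<in> set xs \<Longrightarrow> x \<in> carrier (free_algebra n)) \<Longrightarrow>
     prod_list xs \<in> carrier (free_algebra n)"
    by (induction xs) (simp_all add: free_algebra_closed del: carrier_free_algebra)
qed

lemma ring_free_algebra: "ring (free_algebra n :: 'a::ring_1 falg ring)"
proof (rule ringI)
  show "abelian_group (free_algebra n :: 'a falg ring)"
  proof (rule abelian_groupI)
    fix x :: "'a falg" assume x: "x \<in> carrier (free_algebra n)"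
    then show "\<exists>y\<in>carrier (free_algebra n). y \<oplus>\<^bsub>free_algebra n\<^esub> x = \<zero>\<^bsub>free_algebra n\<^esub>"
      by (intro bexI[of _ "- x"] free_algebra_closed) simp_all
  qed (simp_all add: free_algebra_closed add_ac del: carrier_free_algebra)
  show "monoid (free_algebra n :: 'a falg ring)"
    by (rule monoidI) (simp_all add: free_algebra_closed mult.assoc del: carrier_free_algebra)
qed (simp_all add: ring_distribs)

lemma yh_relations_closed: "yh_relations r n d q v \<subseteq> carrier (free_algebra n)"
proof -
  have t: "tt j \<in> carrier (free_algebra n)" if "j \<in> {1..n}" for j
    by (rule free_algebra_closed) (use that in \<open>simp add: gens_def\<close>)
  have g: "gg i \<in> carrier (free_algebra n)" if "i \<in> {1..<n}" for i
    by (rule free_algebra_closed) (use that in \<open>simp add: gens_def\<close>)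
  have x: "xx \<in> carrier (free_algebra n)" "xx_inv \<in> carrier (free_algebra n)"
    by (rule free_algebra_closed; simp add: gens_def)+
  have e: "ee r i \<in> carrier (free_algebra n)" if "i \<in> {1..<n}" for i
    unfolding ee_def by (intro free_algebra_closed free_algebra_closed' t) (use that in auto)
  have s: "transpose i (i + 1) j \<in> {1..n}" if "i \<in> {1..<n}" "j \<in> {1..n}" for i j
    using that by (auto simp: transpose_def)
  note cl = free_algebra_closed(2,4-7) free_algebra_closed'
  show ?thesis
  proof
    fix a assume "a \<in> yh_relations r n d q v"
    then show "a \<in> carrier (free_algebra n)"
      unfolding yh_relations_def
      by (elim UnE CollectE exE conjE insertE emptyE; hypsubst; (intro cl t g x e s)?;
          (auto intro!: free_algebra_closed(5,7) x simp del: carrier_free_algebra)?)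
  qed
qed

lemma ideal_yh_ideal: "ideal (yh_ideal r n d q v) (free_algebra n)"
  unfolding yh_ideal_def by (rule ring.genideal_ideal[OF ring_free_algebra yh_relations_closed])

lemma ring_yh_algebra: "ring (yh_algebra r n d q v)"
  unfolding yh_algebra_def by (rule ideal.quotient_is_ring[OF ideal_yh_ideal])

lemma yh_ideal_closed:
  "yh_ideal r n d q v \<subseteq> carrier (free_algebra n)"
  "yh_relations r n d q v \<subseteq> yh_ideal r n d q v"
  "0 \<in> yh_ideal r n d q v"
  "\<lbrakk>a \<in> yh_ideal r n d q v; b \<in> yh_ideal r n d q v\<rbrakk> \<Longrightarrow> a + b \<in> yh_ideal r n d q v"
  "\<lbrakk>a \<in> yh_ideal r n d q v; b \<in> yh_ideal r n d q v\<rbrakk> \<Longrightarrow> a - b \<in> yh_ideal r n d q v"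
  "\<lbrakk>a \<in> yh_ideal r n d q v; b \<in> carrier (free_algebra n)\<rbrakk> \<Longrightarrow> a * b \<in> yh_ideal r n d q v"
  "\<lbrakk>a \<in> yh_ideal r n d q v; b \<in> carrier (free_algebra n)\<rbrakk> \<Longrightarrow> b * a \<in> yh_ideal r n d q v"
proof -
  let ?I = "yh_ideal r n d q v"
  interpret ideal ?I "free_algebra n" by (rule ideal_yh_ideal)
  show sub: "?I \<subseteq> carrier (free_algebra n)" using a_subset .
  show "yh_relations r n d q v \<subseteq> ?I"
    unfolding yh_ideal_def by (rule ring.genideal_self[OF ring_free_algebra yh_relations_closed])
  show "0 \<in> ?I" using additive_subgroup.zero_closed[OF is_additive_subgroup] by simp
  show add: "a + b \<in> ?I" if "a \<in> ?I" "b \<in> ?I" for a b using additive_subgroup.a_closed[OF is_additive_subgroup that] by simp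
  show r: "a * b \<in> ?I" if "a \<in> ?I" "b \<in> carrier (free_algebra n)" for a b
    using I_r_closed[OF that] by simp
  show "b * a \<in> ?I" if "a \<in> ?I" "b \<in> carrier (free_algebra n)" for a b
    using I_l_closed[OF that] by simp
  show "a - b \<in> ?I" if "a \<in> ?I" "b \<in> ?I" for a b
    using add[OF that(1) r[OF that(2), of "- 1"]]
    by (simp add: free_algebra_closed del: carrier_free_algebra)
qed

lemma yh_class_alt: "yh_class r n d q v a = {i + a | i. i \<in> yh_ideal r n d q v}"
  by (auto simp: yh_class_def a_r_coset_def r_coset_def)

lemma yh_class_eq_iff: "yh_class r n d q v a = yh_class r n d q v b \<longleftrightarrow> a - b \<in> yh_ideal r n d q v"
proof
  assume "yh_class r n d q v a = yh_class r n d q v b"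
  moreover have "a \<in> yh_class r n d q v a"
    unfolding yh_class_alt using yh_ideal_closed(3) by force
  ultimately show "a - b \<in> yh_ideal r n d q v" by (auto simp: yh_class_alt)
next
  assume ab: "a - b \<in> yh_ideal r n d q v"
  have "\<exists>j. i + a = j + b \<and> j \<in> yh_ideal r n d q v" if "i \<in> yh_ideal r n d q v" for i
    by (rule exI[of _ "i + (a - b)"]) (use yh_ideal_closed(4)[OF that ab] in simp)
  moreover have "\<exists>j. i + b = j + a \<and> j \<in> yh_ideal r n d q v" if "i \<in> yh_ideal r n d q v" for i
    by (rule exI[of _ "i - (a - b)"]) (use yh_ideal_closed(5)[OF that ab] in simp)
  ultimately show "yh_class r n d q v a = yh_class r n d q v b"
    unfolding yh_class_alt by blast
qed

lemma carrier_yh_algebra: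
  "carrier (yh_algebra r n d q v) = yh_class r n d q v ` carrier (free_algebra n)"
  by (auto simp: yh_algebra_def FactRing_def A_RCOSETS_def' yh_class_def)

lemma mem_yh_class_iff: "a \<in> yh_class r n d q v b \<longleftrightarrow> a - b \<in> yh_ideal r n d q v"
  by (auto simp: yh_class_alt) (metis diff_add_cancel)

subsection \<open>Evaluation of rational functions\<close>

lemma mconst_hom [simp]:
  "mconst 0 = 0" "mconst 1 = 1"
  "mconst (a + b) = mconst a + mconst b"
  "mconst (a * b) = mconst a * mconst b"
  by (simp_all add: mconst_def single_add mult_single)

lemma mconst_eq_iff [simp]: "mconst a = mconst b \<longleftrightarrow> a = b"
  by (metis mconst_def lookup_single_eq)

lemma rconst_hom:
  "rconst 0 = 0" "rconst 1 = 1"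
  "rconst (a + b) = rconst a + rconst b"
  "rconst (a * b) = rconst a * rconst b"
  by (simp_all add: rconst_def Zero_fract_def One_fract_def)

lemma rconst_minus: "rconst (- a) = - rconst a"
  using rconst_hom(3)[of a "- a"] by (simp add: rconst_hom(1) eq_neg_iff_add_eq_0 add.commute)

lemma rconst_diff: "rconst (a - b) = rconst a - rconst b"
  using rconst_hom(3)[of a "- b"] by (simp add: rconst_minus)

lemma rconst_eq_iff [simp]: "rconst a = rconst b \<longleftrightarrow> a = b"
  by (simp add: rconst_def eq_fract)

lemma rconst_eq_0_iff [simp]: "rconst a = 0 \<longleftrightarrow> a = 0"
  using rconst_eq_iff[of a 0] by (simp add: rconst_hom)

lemma rconst_inverse: "rconst (inverse a) = inverse (rconst a)"
proof (cases "a = 0")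
  case False
  then have "rconst a * rconst (inverse a) = 1" by (metis rconst_hom(2,4) right_inverse)
  then show ?thesis by (metis inverse_unique)
qed (simp add: rconst_hom)

lemma rconst_of_nat: "rconst (of_nat k) = of_nat k"
  by (induction k) (simp_all add: rconst_hom)

lemma rconst_sum: "rconst (sum f A) = (\<Sum>x\<in>A. rconst (f x))"
  by (induction A rule: infinite_finite_induct) (simp_all add: rconst_hom)

definition mmonom :: "nat \<Rightarrow> 'a::field \<Rightarrow> (nat \<Rightarrow>\<^sub>0 nat) \<Rightarrow> 'a mpoly" where
  "mmonom x c m = (\<Prod>i\<in>Poly_Mapping.keys m.
     (if i = x then mconst c else mvar i) ^ Poly_Mapping.lookup m i)"

lemma mmonom_superset:
  assumes "finite A" "Poly_Mapping.keys m \<subseteq> A"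
  shows "mmonom x c m = (\<Prod>i\<in>A. (if i = x then mconst c else mvar i) ^ Poly_Mapping.lookup m i)"
  unfolding mmonom_def
  by (rule prod.mono_neutral_left[OF assms]) (simp add: in_keys_iff)

lemma mmonom_add: "mmonom x c (m + m') = mmonom x c m * mmonom x c m'"
proof -
  let ?A = "Poly_Mapping.keys m \<union> Poly_Mapping.keys m'"
  show ?thesis
    using mmonom_superset[of ?A "m + m'" x c] mmonom_superset[of ?A m x c]
      mmonom_superset[of ?A m' x c] keys_add[of m m']
    by (simp add: lookup_add power_add prod.distrib)
qed

lemma msubst_superset:
  assumes "finite A" "Poly_Mapping.keys p \<subseteq> A"
  shows "msubst x c p = (\<Sum>m\<in>A. mconst (Poly_Mapping.lookup p m) * mmonom x c m)"
  unfolding msubst_def mmonom_def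
  by (rule sum.mono_neutral_left[OF assms]) (simp add: in_keys_iff)

lemma msubst_0 [simp]: "msubst x c 0 = 0"
  by (simp add: msubst_def)

lemma msubst_single: "msubst x c (Poly_Mapping.single m k) = mconst k * mmonom x c m"
  using msubst_superset[of "{m}" "Poly_Mapping.single m k" x c] by simp

lemma msubst_add: "msubst x c (p + p') = msubst x c p + msubst x c p'"
proof -
  let ?A = "Poly_Mapping.keys p \<union> Poly_Mapping.keys p'"
  show ?thesis
    using msubst_superset[of ?A "p + p'" x c] msubst_superset[of ?A p x c]
      msubst_superset[of ?A p' x c] keys_add[of p p']
    by (simp add: lookup_add ring_distribs sum.distrib)
qed

lemma msubst_mult: "msubst x c (p * p') = msubst x c p * msubst x c p'"
proof (induction p rule: poly_mapping_single_induct)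
  case (add_single m k p)
  have "msubst x c (Poly_Mapping.single m k * p') = msubst x c (Poly_Mapping.single m k) * msubst x c p'"
  proof (induction p' rule: poly_mapping_single_induct)
    case (add_single m' k' p')
    then show ?case
      by (simp add: ring_distribs msubst_add mult_single msubst_single mmonom_add mult_ac)
  qed simp
  with add_single show ?case by (simp add: ring_distribs msubst_add)
qed simp

lemma msubst_mconst [simp]: "msubst x c (mconst k) = mconst k"
  unfolding mconst_def msubst_single by (simp add: mmonom_def mconst_def)

lemma msubst_1 [simp]: "msubst x c 1 = 1"
  using msubst_mconst[of x c 1] by simp

lemma rat_evaluates_unique:
  assumes "rat_evaluates x c f g" "rat_evaluates x c f g'"
  shows "g = g'"
proof -
  obtain a b where ab: "f = Fraction_Field.Fract a b" "msubst x c b \<noteq> 0"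
      "g = Fraction_Field.Fract (msubst x c a) (msubst x c b)"
    using assms(1) by (auto simp: rat_evaluates_def)
  obtain a' b' where ab': "f = Fraction_Field.Fract a' b'" "msubst x c b' \<noteq> 0"
      "g' = Fraction_Field.Fract (msubst x c a') (msubst x c b')"
    using assms(2) by (auto simp: rat_evaluates_def)
  have "b \<noteq> 0" "b' \<noteq> 0" using ab(2) ab'(2) by auto
  then have "a * b' = a' * b" using ab(1) ab'(1) by (simp add: eq_fract)
  then have "msubst x c a * msubst x c b' = msubst x c a' * msubst x c b"
    by (metis msubst_mult)
  then show ?thesis using ab ab' by (simp add: eq_fract)
qed

lemma rat_evaluates_rconst: "rat_evaluates x c (rconst k) (rconst k)"
  unfolding rat_evaluates_def rconst_def
  by (rule exI[of _ "mconst k"], rule exI[of _ 1]) simp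

lemma rat_evaluates_add:
  assumes "rat_evaluates x c f g" "rat_evaluates x c f' g'"
  shows "rat_evaluates x c (f + f') (g + g')"
proof -
  obtain a b where ab: "f = Fraction_Field.Fract a b" "msubst x c b \<noteq> 0"
      "g = Fraction_Field.Fract (msubst x c a) (msubst x c b)"
    using assms(1) by (auto simp: rat_evaluates_def)
  obtain a' b' where ab': "f' = Fraction_Field.Fract a' b'" "msubst x c b' \<noteq> 0"
      "g' = Fraction_Field.Fract (msubst x c a') (msubst x c b')"
    using assms(2) by (auto simp: rat_evaluates_def)
  have nz: "b \<noteq> 0" "b' \<noteq> 0" using ab(2) ab'(2) by auto
  show ?thesis unfolding rat_evaluates_def
    by (rule exI[of _ "a * b' + a' * b"], rule exI[of _ "b * b'"])
      (use ab ab' nz in \<open>simp add: msubst_add msubst_mult\<close>)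
qed

lemma rat_evaluates_mult:
  assumes "rat_evaluates x c f g" "rat_evaluates x c f' g'"
  shows "rat_evaluates x c (f * f') (g * g')"
proof -
  obtain a b where ab: "f = Fraction_Field.Fract a b" "msubst x c b \<noteq> 0"
      "g = Fraction_Field.Fract (msubst x c a) (msubst x c b)"
    using assms(1) by (auto simp: rat_evaluates_def)
  obtain a' b' where ab': "f' = Fraction_Field.Fract a' b'" "msubst x c b' \<noteq> 0"
      "g' = Fraction_Field.Fract (msubst x c a') (msubst x c b')"
    using assms(2) by (auto simp: rat_evaluates_def)
  have nz: "b \<noteq> 0" "b' \<noteq> 0" using ab(2) ab'(2) by auto
  show ?thesis unfolding rat_evaluates_def
    by (rule exI[of _ "a * a'"], rule exI[of _ "b * b'"])
      (use ab ab' nz in \<open>simp add: msubst_mult\<close>)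
qed

lemma rat_evaluates_0_iff [simp]: "rat_evaluates x c 0 g \<longleftrightarrow> g = 0"
  using rat_evaluates_unique rat_evaluates_rconst[of x c 0] by (auto simp: rconst_hom)

lemma rat_evaluates_diff:
  assumes "rat_evaluates x c f g" "rat_evaluates x c f' g'"
  shows "rat_evaluates x c (f - f') (g - g')"
  using rat_evaluates_add[OF assms(1) rat_evaluates_mult[OF rat_evaluates_rconst[of x c "- 1"] assms(2)]]
  by (simp add: rconst_minus rconst_hom)

lemma rat_evaluates_sum:
  assumes "\<And>i. i \<in> A \<Longrightarrow> rat_evaluates x c (f i) (g i)"
  shows "rat_evaluates x c (sum f A) (sum g A)"
  using assms by (induction A rule: infinite_finite_induct) (simp_all add: rat_evaluates_add)

subsection \<open>Extension of scalars\<close>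

abbreviation cmap :: "'a::field falg \<Rightarrow> 'a ratfun falg" where
  "cmap \<equiv> Poly_Mapping.map rconst"

lemma lookup_cmap [simp]: "Poly_Mapping.lookup (cmap a) w = rconst (Poly_Mapping.lookup a w)"
  by (simp add: Poly_Mapping.map.rep_eq when_def rconst_hom)

lemma keys_cmap [simp]: "Poly_Mapping.keys (cmap a) = Poly_Mapping.keys a"
  by (simp add: set_eq_iff in_keys_iff)

lemma cmap_single: "cmap (Poly_Mapping.single w k) = Poly_Mapping.single w (rconst k)"
  by (rule poly_mapping_eqI) (simp add: lookup_single when_def rconst_hom)

lemma cmap_hom:
  "cmap 0 = 0"
  "cmap (a + b) = cmap a + cmap b"
  "cmap (a - b) = cmap a - cmap b"
  by (rule poly_mapping_eqI, simp add: lookup_add lookup_minus rconst_hom rconst_diff)+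

lemma cmap_mult: "cmap (a * b) = cmap a * cmap b"
proof (induction a rule: poly_mapping_single_induct)
  case (add_single u k a)
  have "cmap (Poly_Mapping.single u k * b) = cmap (Poly_Mapping.single u k) * cmap b"
    by (induction b rule: poly_mapping_single_induct)
      (simp_all add: ring_distribs cmap_hom cmap_single mult_single rconst_hom)
  with add_single show ?case by (simp add: ring_distribs cmap_hom)
qed (simp add: cmap_hom)

lemma cmap_1: "cmap 1 = 1"
  by (rule poly_mapping_eqI) (simp add: lookup_one when_def rconst_hom)

lemma cmap_scal: "cmap (scal k) = scal (rconst k)"
  by (simp add: scal_def cmap_single)

lemma cmap_letter: "cmap (letter g) = letter g"
  by (simp add: letter_def cmap_single rconst_hom)

lemma cmap_power: "cmap (a ^ k) = cmap a ^ k"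
  by (induction k) (simp_all add: cmap_1 cmap_mult)

lemma cmap_sum: "cmap (sum f A) = (\<Sum>x\<in>A. cmap (f x))"
  by (induction A rule: infinite_finite_induct) (simp_all add: cmap_hom)

lemma cmap_prod_list: "cmap (prod_list xs) = prod_list (map cmap xs)"
  by (induction xs) (simp_all add: cmap_1 cmap_mult)

lemma cmap_ee: "cmap (ee r i) = ee r i"
  unfolding ee_def
  by (simp add: cmap_mult cmap_scal cmap_sum cmap_power cmap_letter divide_inverse
      rconst_inverse rconst_of_nat rconst_hom)

lemma image_setcompr1: "h ` {f i | i. P i} = {h (f i) | i. P i}"
  by blast

lemma image_setcompr2: "h ` {f i j | i j. P i j} = {h (f i j) | i j. P i j}"
  by blast

lemma cmap_yh_relations:
  "cmap ` yh_relations r n d q v = yh_relations r n d (rconst q) (\<lambda>l. rconst (v l))"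
  unfolding yh_relations_def
  by (simp only: image_Un image_setcompr1 image_setcompr2 image_insert image_empty cmap_hom
      cmap_mult cmap_1 cmap_scal cmap_letter cmap_power cmap_prod_list cmap_ee rconst_diff
      rconst_inverse map_map comp_def)

lemma idealI':
  assumes "J \<subseteq> carrier (free_algebra n)" "0 \<in> J"
    and "\<And>a b. a \<in> J \<Longrightarrow> b \<in> J \<Longrightarrow> a + b \<in> J"
    and "\<And>a x. a \<in> J \<Longrightarrow> x \<in> carrier (free_algebra n) \<Longrightarrow> x * a \<in> J"
    and "\<And>a x. a \<in> J \<Longrightarrow> x \<in> carrier (free_algebra n) \<Longrightarrow> a * x \<in> J"
  shows "ideal J (free_algebra n :: 'a::ring_1 falg ring)"
proof (rule idealI[OF ring_free_algebra])
  show "subgroup J (add_monoid (free_algebra n))"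
  proof (rule group.subgroupI)
    show "Group.group (add_monoid (free_algebra n :: 'a falg ring))"
      using abelian_group.a_group[OF ring.is_abelian_group[OF ring_free_algebra]] .
    show "inv\<^bsub>add_monoid (free_algebra n)\<^esub> a \<in> J" if a: "a \<in> J" for a
    proof -
      have ac: "a \<in> carrier (free_algebra n)" using a assms(1) by blast
      have "\<ominus>\<^bsub>free_algebra n\<^esub> a = - a"
        by (rule abelian_group.minus_equality[OF ring.is_abelian_group[OF ring_free_algebra]])
          (use ac in \<open>simp_all add: free_algebra_closed del: carrier_free_algebra\<close>)
      moreover have "- a \<in> J"
        using assms(4)[OF a, of "- 1"]
        by (simp add: free_algebra_closed del: carrier_free_algebra)
      ultimately show ?thesis by (simp add: a_inv_def)
    qed
  qed (use assms in auto)
qed (use assms in auto)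

lemma cmap_yh_ideal:
  assumes "a \<in> yh_ideal r n d q v"
  shows "cmap a \<in> yh_ideal r n d (rconst q) (\<lambda>l. rconst (v l))"
proof -
  let ?I = "yh_ideal r n d (rconst q) (\<lambda>l. rconst (v l))"
  let ?J = "{a \<in> carrier (free_algebra n). cmap a \<in> ?I}"
  have car: "cmap x \<in> carrier (free_algebra n)" if "x \<in> carrier (free_algebra n)" for x
    using that by simp
  have "ideal ?J (free_algebra n)"
    by (rule idealI') (auto simp: cmap_hom cmap_mult simp del: carrier_free_algebra
        intro: free_algebra_closed yh_ideal_closed car)
  moreover have "yh_relations r n d q v \<subseteq> ?J"
    using yh_relations_closed[of r n d q v] cmap_yh_relations[of r n d q v]
      yh_ideal_closed(2)[of r n d "rconst q" "\<lambda>l. rconst (v l)"] by blast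
  ultimately have "yh_ideal r n d q v \<subseteq> ?J"
    unfolding yh_ideal_def[of r n d q v] by (rule ring.genideal_minimal[OF ring_free_algebra])
  with assms show ?thesis by blast
qed

definition wpair :: "(gen word \<Rightarrow> 'a::field) \<Rightarrow> 'a falg \<Rightarrow> 'a" where
  "wpair f a = (\<Sum>w\<in>Poly_Mapping.keys a. Poly_Mapping.lookup a w * f w)"

lemma wpair_superset:
  assumes "finite A" "Poly_Mapping.keys a \<subseteq> A"
  shows "wpair f a = (\<Sum>w\<in>A. Poly_Mapping.lookup a w * f w)"
  unfolding wpair_def
  by (rule sum.mono_neutral_left[OF assms]) (simp add: in_keys_iff)

lemma wpair_0 [simp]: "wpair f 0 = 0"
  by (simp add: wpair_def)

lemma wpair_single: "wpair f (Poly_Mapping.single w k) = k * f w"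
  using wpair_superset[of "{w}" "Poly_Mapping.single w k" f] by simp

lemma wpair_add: "wpair f (a + b) = wpair f a + wpair f b"
proof -
  let ?A = "Poly_Mapping.keys a \<union> Poly_Mapping.keys b"
  show ?thesis
    using wpair_superset[of ?A "a + b" f] wpair_superset[of ?A a f]
      wpair_superset[of ?A b f] keys_add[of a b]
    by (simp add: lookup_add ring_distribs sum.distrib)
qed

lemma wpair_single_left:
  "wpair f (Poly_Mapping.single u k * a) = k * wpair (\<lambda>w. f (u + w)) a"
  by (induction a rule: poly_mapping_single_induct)
    (simp_all add: ring_distribs wpair_add mult_single wpair_single)

lemma wpair_single_right:
  "wpair f (a * Poly_Mapping.single u k) = k * wpair (\<lambda>w. f (w + u)) a"
  by (induction a rule: poly_mapping_single_induct)
    (simp_all add: ring_distribs wpair_add mult_single wpair_single)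

lemma wpair_sum: "wpair f (sum g A) = (\<Sum>x\<in>A. wpair f (g x))"
  by (induction A rule: infinite_finite_induct) (simp_all add: wpair_add)

lemma wpair_mult_left:
  "wpair f (x * a) = (\<Sum>u\<in>Poly_Mapping.keys x. Poly_Mapping.lookup x u * wpair (\<lambda>w. f (u + w)) a)"
  by (subst poly_mapping_sum_single[of x]) (simp add: sum_distrib_right wpair_sum wpair_single_left)

lemma wpair_mult_right:
  "wpair f (a * x) = (\<Sum>u\<in>Poly_Mapping.keys x. Poly_Mapping.lookup x u * wpair (\<lambda>w. f (w + u)) a)"
  by (subst poly_mapping_sum_single[of x]) (simp add: sum_distrib_left wpair_sum wpair_single_right)

lemma wpair_cmap: "wpair (\<lambda>w. rconst (f w)) (cmap a) = rconst (wpair f a)"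
  by (simp add: wpair_def rconst_sum rconst_hom)

definition annih ::
  "nat \<Rightarrow> nat \<Rightarrow> nat \<Rightarrow> 'a::field \<Rightarrow> (nat \<Rightarrow> 'a) \<Rightarrow> (gen word \<Rightarrow> 'a) set" where
  "annih r n d q v = {f. \<forall>a\<in>yh_ideal r n d q v. wpair f a = 0}"

lemma annih_shift:
  assumes "f \<in> annih r n d q v" "set (letters u) \<subseteq> gens n"
  shows "(\<lambda>w. f (u + w)) \<in> annih r n d q v" "(\<lambda>w. f (w + u)) \<in> annih r n d q v"
proof -
  have u: "Poly_Mapping.single u 1 \<in> carrier (free_algebra n :: 'a falg ring)"
    using assms(2) by simp
  show "(\<lambda>w. f (u + w)) \<in> annih r n d q v"
    unfolding annih_def
  proof clarify
    fix a assume "a \<in> yh_ideal r n d q v"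
    then have "wpair f (Poly_Mapping.single u 1 * a) = 0"
      using assms(1) yh_ideal_closed(7) u unfolding annih_def by blast
    then show "wpair (\<lambda>w. f (u + w)) a = 0" by (simp add: wpair_single_left)
  qed
  show "(\<lambda>w. f (w + u)) \<in> annih r n d q v"
    unfolding annih_def
  proof clarify
    fix a assume "a \<in> yh_ideal r n d q v"
    then have "wpair f (a * Poly_Mapping.single u 1) = 0"
      using assms(1) yh_ideal_closed(6) u unfolding annih_def by blast
    then show "wpair (\<lambda>w. f (w + u)) a = 0" by (simp add: wpair_single_right)
  qed
qed

lemma annih_ratfun:
  assumes "f \<in> annih r n d q v" "b \<in> yh_ideal r n d (rconst q) (\<lambda>l. rconst (v l))"
  shows "wpair (\<lambda>w. rconst (f w)) b = 0"
proof -
  let ?J = "{b \<in> carrier (free_algebra n).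
    \<forall>f \<in> annih r n d q v. wpair (\<lambda>w. rconst (f w)) b = 0}"
  have "ideal ?J (free_algebra n)"
  proof (rule idealI')
    show "x * b \<in> ?J" if b: "b \<in> ?J" and x: "x \<in> carrier (free_algebra n)" for b x
    proof (clarsimp simp del: carrier_free_algebra, intro conjI ballI)
      show "x * b \<in> carrier (free_algebra n)" using b x by (blast intro: free_algebra_closed)
      fix f assume f: "f \<in> annih r n d q v"
      show "wpair (\<lambda>w. rconst (f w)) (x * b) = 0"
        unfolding wpair_mult_left
        by (rule sum.neutral) (use b x annih_shift(1)[OF f] in auto)
    qed
    show "b * x \<in> ?J" if b: "b \<in> ?J" and x: "x \<in> carrier (free_algebra n)" for b x
    proof (clarsimp simp del: carrier_free_algebra, intro conjI ballI)
      show "b * x \<in> carrier (free_algebra n)" using b x by (blast intro: free_algebra_closed)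
      fix f assume f: "f \<in> annih r n d q v"
      show "wpair (\<lambda>w. rconst (f w)) (b * x) = 0"
        unfolding wpair_mult_right
        by (rule sum.neutral) (use b x annih_shift(2)[OF f] in auto)
    qed
  qed (auto simp: wpair_add simp del: carrier_free_algebra intro: free_algebra_closed)
  moreover have "yh_relations r n d (rconst q) (\<lambda>l. rconst (v l)) \<subseteq> ?J"
  proof
    fix b assume b: "b \<in> yh_relations r n d (rconst q) (\<lambda>l. rconst (v l))"
    then obtain a where a: "a \<in> yh_relations r n d q v" "b = cmap a"
      unfolding cmap_yh_relations[symmetric] by blast
    have "wpair f a = 0" if "f \<in> annih r n d q v" for f
      using that a(1) yh_ideal_closed(2) unfolding annih_def by blast
    then show "b \<in> ?J"
      using b subsetD[OF yh_relations_closed b] by (simp add: a(2) wpair_cmap rconst_hom)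
  qed
  ultimately have "yh_ideal r n d (rconst q) (\<lambda>l. rconst (v l)) \<subseteq> ?J"
    unfolding yh_ideal_def[of r n d "rconst q"] by (rule ring.genideal_minimal[OF ring_free_algebra])
  with assms show ?thesis by blast
qed

lemma scal_hom:
  "scal 0 = 0" "scal 1 = 1" "scal (a + b) = scal a + scal b" "scal (a * b) = scal a * scal b"
  by (simp_all add: scal_def single_add mult_single)

interpretation falg: vector_space "\<lambda>c a. scal c * (a :: 'a::field falg)"
  by unfold_locales (simp_all add: scal_hom ring_distribs mult.assoc)

lemma subspace_yh_ideal: "falg.subspace (yh_ideal r n d q v)"
  by (auto simp: falg.subspace_def simp del: carrier_free_algebra
      intro: yh_ideal_closed free_algebra_closed)

lemma wpair_representation:
  assumes "falg.independent B" "falg.span B = UNIV"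
  shows "wpair (\<lambda>w. falg.representation B (Poly_Mapping.single w 1) \<beta>) a = falg.representation B a \<beta>"
proof (induction a rule: poly_mapping_single_induct)
  case zero
  show ?case by (simp add: falg.representation_zero)
next
  case (add_single m c a)
  have "Poly_Mapping.single m c = scal c * Poly_Mapping.single m 1"
    by (simp add: scal_def mult_single)
  then have "falg.representation B (Poly_Mapping.single m c) \<beta> =
      c * falg.representation B (Poly_Mapping.single m 1) \<beta>"
    using falg.representation_scale[OF assms(1)] assms(2) by simp
  with add_single show ?case
    using falg.representation_add[OF assms(1)] assms(2) by (simp add: wpair_add wpair_single)
qed

text \<open>A basis of the ideal, extended to a basis of the free algebra.\<close>

lemma yh_ideal_basis:
  obtains B B' where "B \<subseteq> B'" "B \<subseteq> yh_ideal r n d q v" "falg.span B = yh_ideal r n d q v"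
    "falg.independent B'" "falg.span B' = UNIV"
    "\<And>\<beta>. \<beta> \<in> B' - B \<Longrightarrow>
       (\<lambda>w. falg.representation B' (Poly_Mapping.single w 1) \<beta>) \<in> annih r n d q v"
proof -
  let ?I = "yh_ideal r n d q v"
  obtain B where B: "B \<subseteq> ?I" "falg.independent B" "?I \<subseteq> falg.span B"
    using falg.maximal_independent_subset by metis
  have sp: "falg.span B = ?I"
    using B falg.span_minimal[OF B(1) subspace_yh_ideal] by blast
  define B' where "B' = falg.extend_basis B"
  have B': "B \<subseteq> B'" "falg.independent B'" "falg.span B' = UNIV"
    using falg.extend_basis_superset[OF B(2)] falg.independent_extend_basis[OF B(2)]
      falg.span_extend_basis[OF B(2)] by (auto simp: B'_def)
  have "(\<lambda>w. falg.representation B' (Poly_Mapping.single w 1) \<beta>) \<in> annih r n d q v"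
    if \<beta>: "\<beta> \<in> B' - B" for \<beta>
    unfolding annih_def
  proof clarify
    fix a assume "a \<in> ?I"
    then have "falg.representation B' a = falg.representation B a"
      by (intro falg.representation_extend[OF B'(2) _ B'(1)]) (simp add: sp)
    moreover have "falg.representation B a \<beta> = 0"
      using falg.representation_ne_zero[of B a \<beta>] \<beta> by blast
    ultimately show "wpair (\<lambda>w. falg.representation B' (Poly_Mapping.single w 1) \<beta>) a = 0"
      using wpair_representation[OF B'(2,3)] by simp
  qed
  then show thesis by (rule that[OF B'(1) B(1) sp B'(2,3)])
qed

lemma yh_ideal_annihI:
  assumes "\<And>f. f \<in> annih r n d q v \<Longrightarrow> wpair f a = 0"
  shows "a \<in> yh_ideal r n d q v"
proof -
  obtain B B' where B: "B \<subseteq> B'" "B \<subseteq> yh_ideal r n d q v" "falg.span B = yh_ideal r n d q v"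
    "falg.independent B'" "falg.span B' = UNIV"
    "\<And>\<beta>. \<beta> \<in> B' - B \<Longrightarrow>
       (\<lambda>w. falg.representation B' (Poly_Mapping.single w 1) \<beta>) \<in> annih r n d q v"
    by (fact yh_ideal_basis)
  let ?R = "falg.representation B' a"
  have sub: "{\<beta>. ?R \<beta> \<noteq> 0} \<subseteq> B"
  proof
    fix \<beta> assume \<beta>: "\<beta> \<in> {\<beta>. ?R \<beta> \<noteq> 0}"
    then have "\<beta> \<in> B'" using falg.representation_ne_zero by blast
    with \<beta> show "\<beta> \<in> B"
      using assms[OF B(6)] wpair_representation[OF B(4,5)] by fastforce
  qed
  have "a = (\<Sum>\<beta> | ?R \<beta> \<noteq> 0. scal (?R \<beta>) * \<beta>)"
    using falg.sum_nonzero_representation_eq[OF B(4)] B(5) by simp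
  also have "\<dots> \<in> falg.span B"
    using sub by (intro falg.span_sum falg.span_scale falg.span_base) auto
  finally show ?thesis using B(3) by simp
qed

lemma yh_ideal_ratfun_annihI:
  assumes "\<And>f. f \<in> annih r n d q v \<Longrightarrow> wpair (\<lambda>w. rconst (f w)) b = 0"
  shows "b \<in> yh_ideal r n d (rconst q) (\<lambda>l. rconst (v l))"
proof -
  let ?I = "yh_ideal r n d (rconst q) (\<lambda>l. rconst (v l))"
  obtain B B' where B: "B \<subseteq> B'" "B \<subseteq> yh_ideal r n d q v" "falg.span B = yh_ideal r n d q v"
    "falg.independent B'" "falg.span B' = UNIV"
    "\<And>\<beta>. \<beta> \<in> B' - B \<Longrightarrow>
       (\<lambda>w. falg.representation B' (Poly_Mapping.single w 1) \<beta>) \<in> annih r n d q v"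
    by (fact yh_ideal_basis)
  define R where "R w = falg.representation B' (Poly_Mapping.single w 1)" for w
  define S where "S = (\<Union>w\<in>Poly_Mapping.keys b. {\<beta>. R w \<beta> \<noteq> 0})"
  have finS: "finite S" unfolding S_def R_def by (intro finite_UN_I falg.finite_representation finite_keys)
  have SB: "S \<subseteq> B'" using falg.representation_ne_zero unfolding S_def R_def by blast
  have word: "Poly_Mapping.single w k = (\<Sum>\<beta>\<in>S. scal (k * rconst (R w \<beta>)) * cmap \<beta>)"
    if "w \<in> Poly_Mapping.keys b" for w k
  proof -
    have "Poly_Mapping.single w 1 = (\<Sum>\<beta> | R w \<beta> \<noteq> 0. scal (R w \<beta>) * \<beta>)"
      using falg.sum_nonzero_representation_eq[OF B(4)] B(5) unfolding R_def by simp
    also have "\<dots> = (\<Sum>\<beta>\<in>S. scal (R w \<beta>) * \<beta>)"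
      by (rule sum.mono_neutral_left[OF finS]) (use that in \<open>auto simp: S_def scal_hom\<close>)
    finally have "cmap (Poly_Mapping.single w 1) = cmap (\<Sum>\<beta>\<in>S. scal (R w \<beta>) * \<beta>)" by simp
    then have 1: "Poly_Mapping.single w 1 = (\<Sum>\<beta>\<in>S. scal (rconst (R w \<beta>)) * cmap \<beta>)"
      by (simp add: cmap_single cmap_sum cmap_mult cmap_scal rconst_hom)
    have "Poly_Mapping.single w k = scal k * Poly_Mapping.single w 1"
      by (simp add: scal_def mult_single)
    also have "\<dots> = (\<Sum>\<beta>\<in>S. scal (k * rconst (R w \<beta>)) * cmap \<beta>)"
      by (simp only: 1 sum_distrib_left scal_hom(4) mult.assoc)
    finally show ?thesis .
  qed
  have scal_sum: "scal (sum g A) = (\<Sum>x\<in>A. scal (g x))" for g :: "gen word \<Rightarrow> 'a ratfun" and A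
    by (induction A rule: infinite_finite_induct) (simp_all add: scal_hom)
  have "b = (\<Sum>w\<in>Poly_Mapping.keys b. Poly_Mapping.single w (Poly_Mapping.lookup b w))"
    by (rule poly_mapping_sum_single)
  also have "\<dots> = (\<Sum>w\<in>Poly_Mapping.keys b. \<Sum>\<beta>\<in>S.
      scal (Poly_Mapping.lookup b w * rconst (R w \<beta>)) * cmap \<beta>)"
    by (rule sum.cong[OF refl]) (rule word)
  also have "\<dots> = (\<Sum>\<beta>\<in>S. scal (wpair (\<lambda>w. rconst (R w \<beta>)) b) * cmap \<beta>)"
    unfolding wpair_def scal_sum sum_distrib_right by (rule sum.swap)
  also have "\<dots> \<in> ?I"
  proof -
    have "scal (wpair (\<lambda>w. rconst (R w \<beta>)) b) * cmap \<beta> \<in> ?I" if "\<beta> \<in> S" for \<beta>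
    proof (cases "\<beta> \<in> B")
      case True
      then show ?thesis using B(2) cmap_yh_ideal yh_ideal_closed(7) free_algebra_closed(7) by blast
    next
      case False
      then have "wpair (\<lambda>w. rconst (R w \<beta>)) b = 0"
        using assms[OF B(6)] that SB unfolding R_def by blast
      then show ?thesis by (simp add: scal_hom yh_ideal_closed(3))
    qed
    then show ?thesis
      by (induction S rule: infinite_finite_induct) (simp_all add: yh_ideal_closed(3,4))
  qed
  finally show ?thesis .
qed

lemma yh_const_class:
  "yh_const r n d q v (yh_class r n d q v a) = yh_rclass r n d q v (cmap a)"
proof -
  have "yh_rclass r n d q v (cmap a') = yh_rclass r n d q v (cmap a)"
    if "a' \<in> yh_class r n d q v a" for a'
    using cmap_yh_ideal[of "a' - a" r n d q v] that
    by (simp add: yh_rclass_def yh_class_eq_iff mem_yh_class_iff cmap_hom)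
  moreover have "a \<in> yh_class r n d q v a"
    by (simp add: mem_yh_class_iff yh_ideal_closed)
  ultimately show ?thesis unfolding yh_const_def by blast
qed

lemma inj_on_yh_const: "inj_on (yh_const r n d q v) (carrier (yh_algebra r n d q v))"
proof (rule inj_onI)
  fix y y' assume y: "y \<in> carrier (yh_algebra r n d q v)" "y' \<in> carrier (yh_algebra r n d q v)"
    and eq: "yh_const r n d q v y = yh_const r n d q v y'"
  obtain a a' where a: "y = yh_class r n d q v a" "y' = yh_class r n d q v a'"
    using y by (auto simp: carrier_yh_algebra)
  have "cmap (a - a') \<in> yh_ideal r n d (rconst q) (\<lambda>l. rconst (v l))"
    using eq unfolding a yh_const_class yh_rclass_def yh_class_eq_iff cmap_hom .
  then have "wpair f (a - a') = 0" if "f \<in> annih r n d q v" for f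
    using annih_ratfun[OF that] by (metis wpair_cmap rconst_eq_0_iff)
  then have "a - a' \<in> yh_ideal r n d q v" by (rule yh_ideal_annihI)
  then show "y = y'" using a by (simp add: yh_class_eq_iff)
qed

theorem yh_evaluates_unique:
  assumes "yh_evaluates r n d q v x c \<Psi> \<Omega>" "yh_evaluates r n d q v x c \<Psi> \<Omega>'"
  shows "\<Omega> = \<Omega>'"
proof -
  obtain a b where ab: "a \<in> \<Psi>" "\<Omega> = yh_rclass r n d q v b"
      "\<And>w. rat_evaluates x c (Poly_Mapping.lookup a w) (Poly_Mapping.lookup b w)"
    using assms(1) unfolding yh_evaluates_def by blast
  obtain a' b' where ab': "a' \<in> \<Psi>" "\<Omega>' = yh_rclass r n d q v b'"
      "\<And>w. rat_evaluates x c (Poly_Mapping.lookup a' w) (Poly_Mapping.lookup b' w)"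
    using assms(2) unfolding yh_evaluates_def by blast
  obtain e where e: "\<Psi> = yh_class r n d (rconst q) (\<lambda>l. rconst (v l)) e"
    using assms(1) unfolding yh_evaluates_def yh_ratfun_def carrier_yh_algebra by blast
  have I: "a - a' \<in> yh_ideal r n d (rconst q) (\<lambda>l. rconst (v l))"
    using yh_ideal_closed(5)[of "a - e" r n d "rconst q" "\<lambda>l. rconst (v l)" "a' - e"] ab(1) ab'(1)
    by (simp add: e mem_yh_class_iff)
  have "wpair (\<lambda>w. rconst (f w)) (b - b') = 0" if f: "f \<in> annih r n d q v" for f
  proof -
    let ?A = "Poly_Mapping.keys (a - a') \<union> Poly_Mapping.keys (b - b')"
    have "rat_evaluates x c (wpair (\<lambda>w. rconst (f w)) (a - a')) (wpair (\<lambda>w. rconst (f w)) (b - b'))"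
      unfolding wpair_superset[of ?A "a - a'", simplified] wpair_superset[of ?A "b - b'", simplified]
      by (intro rat_evaluates_sum rat_evaluates_mult rat_evaluates_rconst)
        (simp add: lookup_minus rat_evaluates_diff ab(3) ab'(3))
    then show ?thesis using annih_ratfun[OF f I] by simp
  qed
  then have "b - b' \<in> yh_ideal r n d (rconst q) (\<lambda>l. rconst (v l))"
    by (rule yh_ideal_ratfun_annihI)
  then show ?thesis by (simp add: ab ab' yh_rclass_def yh_class_eq_iff)
qed

theorem yh_evaluates_seq_unique:
  assumes "yh_evaluates_seq r n d q v xs \<Psi> \<Omega>" "yh_evaluates_seq r n d q v xs \<Psi> \<Omega>'"
  shows "\<Omega> = \<Omega>'"
  using assms
proof (induction xs arbitrary: \<Psi>)
  case (Cons p xs)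
  then show ?case by (cases p) (metis yh_evaluates_seq.simps(2) yh_evaluates_unique)
qed simp

declare carrier_free_algebra [simp del]

end

theory Submission
  imports Defs
begin

text \<open>Multiply from the left, over the field of rational functions, and call an element \<open>w\<close> of the algebra a
  weight vector for a standard sequence of boxes \<open>b\<^sub>1, \<dots>, b\<^sub>j\<close> if \<open>X\<^sub>i\<close> and \<open>t\<^sub>i\<close> act on it by the content and the colour
  of \<open>b\<^sub>i\<close> for \<open>i \<le> j\<close>, and \<open>t\<^sub>j\<^sub>+\<^sub>1\<close> by the root of unity of a colour \<open>p\<close>. Two facts about weight vectors carry the
  proof.

  The first one (\<open>spectrum\<close>): \<open>X\<^sub>j\<^sub>+\<^sub>1\<close> acts on \<open>w\<close> semisimply, with eigenvalues among the contents of the addable boxes of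
  colour \<open>p\<close>. Since \<open>X\<^sub>j\<^sub>+\<^sub>1 = g\<^sub>j X\<^sub>j g\<^sub>j\<close>, the eigenvalues are, by induction on \<open>j\<close>, addable contents of the sequence
  without \<open>b\<^sub>j\<close>, or \<open>q\<^sup>2 c\<close> or \<open>q\<^sup>-\<^sup>2 c\<close> for the content \<open>c\<close> of \<open>b\<^sub>j\<close>. The eigenvalue \<open>c\<close> itself is impossible because
  \<open>X\<^sub>j\<close> is semisimple. If \<open>q\<^sup>2 c\<close> or \<open>q\<^sup>-\<^sup>2 c\<close> does not belong to an addable box, then a box with this content was added before,
  and intertwiners move it next to \<open>b\<^sub>j\<close>; then two neighbouring generators act on a weight vector by scalars
  \<open>\<theta>\<close> and \<open>- 1 / \<theta>\<close>, which contradicts the braid relation. No basis of the algebra and no representation of it by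
  tableaux is constructed.

  The second one (\<open>fusion\<close>): \<open>\<phi>\<^sub>j\<^sub>+\<^sub>1(c\<^sub>1, \<dots>, c\<^sub>j, u) w = f(u) (u - X\<^sub>j\<^sub>+\<^sub>1)\<^sup>-\<^sup>1 w\<close> with an explicit scalar \<open>f\<close>. This follows by
  induction from \<open>(u - X\<^sub>i) g\<^sub>i(c, u) w = g\<^sub>i\<^sup>-\<^sup>1 (u - X\<^sub>i\<^sub>+\<^sub>1) w\<close>, valid if \<open>X\<^sub>i w = c w\<close>, and from the fact that \<open>g\<^sub>i(u, c) g\<^sub>i(c, u)\<close>
  acts on weight vectors by a scalar.

  By the first fact, \<open>(u - X\<^sub>j\<^sub>+\<^sub>1)\<^sup>-\<^sup>1 w\<close> is the sum of \<open>(u - a)\<^sup>-\<^sup>1 L\<^sub>a(X\<^sub>j\<^sub>+\<^sub>1) w\<close> over the addable contents \<open>a\<close>, with Lagrange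
  polynomials \<open>L\<^sub>a\<close>, and \<open>f\<close> vanishes at \<open>u = c\<^sub>j\<^sub>+\<^sub>1\<close>. The evaluation at this point thus leaves only the summand of the
  box \<open>b\<^sub>j\<^sub>+\<^sub>1\<close> (\<open>u_step\<close>). For the same reason the Lagrange polynomial for the addable contents may be replaced by the one
  for all contents in position \<open>j + 1\<close>, which is the factor of the idempotent, and the new vector is a weight vector for the longer sequence. The
  scalar that appears is the quotient of the hook products of two consecutive diagrams (\<open>hook_product_insert\<close>): \<open>f\<close> telescopes along the rows and
  columns of the diagram, and what remains are the changes of the hooks in the row and in the column of the new box.

  To calculate with the presented algebra as with an element of a type class, it is embedded into a ring type
  (\<open>yh_realisation\<close>).\<close>

section \<open>Polynomials and resolvents in an element of an algebra\<close>

locale scalar_ring =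
  fixes sc :: "'k::field \<Rightarrow> 'b::ring_1"
  assumes sc_1 [simp]: "sc 1 = 1"
    and sc_add: "sc (a + b) = sc a + sc b"
    and sc_mult: "sc (a * b) = sc a * sc b"
    and sc_comm: "x * sc a = sc a * x"
begin

lemma sc_0 [simp]: "sc 0 = 0"
  using sc_add[of 0 0] by simp

lemma sc_minus: "sc (- a) = - sc a"
  using sc_add[of a "- a"] by (simp add: eq_neg_iff_add_eq_0 add.commute)

lemma sc_diff: "sc (a - b) = sc a - sc b"
  using sc_add[of a "- b"] by (simp add: sc_minus)

lemma sc_sum: "sc (sum f A) = (\<Sum>x\<in>A. sc (f x))"
  by (induction A rule: infinite_finite_induct) (simp_all add: sc_add)

lemma sc_left_commute: "x * (sc a * y) = sc a * (x * y)"
  by (metis mult.assoc sc_comm)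

lemma sc_assoc: "sc a * (sc b * x) = sc (a * b) * x"
  by (simp add: sc_mult mult.assoc)

lemma sc_cancel:
  assumes "sc a * w = 0" "a \<noteq> 0"
  shows "w = 0"
proof -
  have "sc (inverse a) * (sc a * w) = w"
    using assms(2) by (simp add: sc_assoc)
  with assms(1) show ?thesis by simp
qed

text \<open>As rewrite rules for scalars, the equations above do not terminate; the following ones for
  scalar multiplication do.\<close>

definition smul :: "'k \<Rightarrow> 'b \<Rightarrow> 'b" where
  "smul a x = sc a * x"

lemma sc_smul: "sc a * x = smul a x" "x * sc a = smul a x"
  by (simp_all add: smul_def sc_comm)

lemma smul_simps:
  "x * smul a y = smul a (x * y)" "smul a x * y = smul a (x * y)"
  "smul a (smul b x) = smul (a * b) x"
  "smul a (x + y) = smul a x + smul a y" "smul a (x - y) = smul a x - smul a y"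
  "smul a (- x) = smul (- a) x" "- smul a x = smul (- a) x"
  "smul a 0 = 0" "smul 0 x = 0" "smul 1 x = x"
  by (simp_all only: smul_def sc_mult sc_left_commute[of x] mult.assoc ring_distribs sc_minus
      sc_0 sc_1 mult_1 mult_zero_left mult_zero_right mult_minus_left mult_minus_right)

lemma smul_distrib: "smul (a + b) x = smul a x + smul b x" "smul (a - b) x = smul a x - smul b x"
  by (simp_all add: smul_def sc_add sc_diff ring_distribs)

definition pe :: "'k poly \<Rightarrow> 'b \<Rightarrow> 'b" where
  "pe p x = (\<Sum>i\<le>degree p. sc (coeff p i) * x ^ i)"

lemma pe_superset:
  assumes "degree p \<le> N"
  shows "pe p x = (\<Sum>i\<le>N. sc (coeff p i) * x ^ i)"
  unfolding pe_def
  by (rule sum.mono_neutral_left) (use assms in \<open>auto simp: coeff_eq_0\<close>)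

lemma pe_pCons: "pe (pCons a p) x = sc a + x * pe p x"
proof -
  have "pe (pCons a p) x = (\<Sum>i\<le>Suc (degree p). sc (coeff (pCons a p) i) * x ^ i)"
    by (rule pe_superset) (rule degree_pCons_le)
  also have "\<dots> = sc a + x * pe p x"
    unfolding sum.atMost_Suc_shift
    by (simp add: pe_def sum_distrib_left sc_left_commute coeff_pCons_Suc)
  finally show ?thesis .
qed

lemma pe_0 [simp]: "pe 0 x = 0"
  by (simp add: pe_def)

lemma pe_1 [simp]: "pe 1 x = 1"
  by (simp add: pe_def)

lemma pe_add: "pe (p + p') x = pe p x + pe p' x"
  by (induction p p' rule: poly_induct2) (simp_all add: pe_pCons sc_add algebra_simps)

lemma pe_smult: "pe (smult a p) x = sc a * pe p x"
  by (induction p) (simp_all add: pe_pCons sc_mult sc_left_commute ring_distribs)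

lemma pe_mult: "pe (p * p') x = pe p x * pe p' x"
  by (induction p)
    (simp_all add: pe_pCons mult_pCons_left pe_add pe_smult ring_distribs mult.assoc)

lemma pe_linear: "pe [:- a, 1:] x = x - sc a"
  by (simp add: pe_pCons sc_minus)

lemma pe_sum: "pe (sum f A) x = (\<Sum>i\<in>A. pe (f i) x)"
  by (induction A rule: infinite_finite_induct) (simp_all add: pe_add)

lemma pe_commute:
  assumes "y * x = x * y"
  shows "y * pe p x = pe p x * y"
proof (induction p)
  case (pCons a p)
  have "y * (x * pe p x) = x * pe p x * y"
    by (metis assms pCons(2) mult.assoc)
  then show ?case by (simp add: pe_pCons ring_distribs sc_comm)
qed simp

lemma pe_eigen:
  assumes "x * w = sc a * w"
  shows "pe p x * w = sc (poly p a) * w"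
proof (induction p)
  case (pCons c p)
  have "x * (pe p x * w) = sc (poly p a) * (x * w)"
    by (simp add: pCons sc_left_commute)
  also have "\<dots> = sc (a * poly p a) * w"
    by (simp add: assms sc_assoc mult.commute)
  finally show ?case by (simp add: pe_pCons sc_add ring_distribs mult.assoc)
qed simp

text \<open>The map \<open>\<tau>\<close> need only intertwine on a set of vectors that is stable under
  \<open>y\<close>. This generality is used for intertwiners which satisfy their commutation rule on weight
  vectors only, where \<open>E\<close> acts by a scalar.\<close>

lemma pe_intertwine:
  assumes P: "P w" and step: "\<And>w. P w \<Longrightarrow> x * \<tau> w = \<tau> (y * w)" "\<And>w. P w \<Longrightarrow> P (y * w)"
    and lin: "\<And>a w w'. \<tau> (sc a * w + w') = sc a * \<tau> w + \<tau> w'"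
  shows "pe p x * \<tau> w = \<tau> (pe p y * w)"
proof -
  have [simp]: "\<tau> 0 = 0" using lin[of 0 0 0] lin[of 1 0 0] by simp
  show ?thesis using P
proof (induction p arbitrary: w)
  case (pCons c p)
  have c: "y * pe p y = pe p y * y" by (rule pe_commute) simp
  have c': "x * pe p x = pe p x * x" by (rule pe_commute) simp
  have "x * (pe p x * \<tau> w) = pe p x * \<tau> (y * w)"
    by (metis c' mult.assoc step(1) pCons.prems)
  also have "\<dots> = \<tau> (pe p y * (y * w))"
    by (rule pCons.IH) (rule step(2)[OF pCons.prems])
  finally have "x * (pe p x * \<tau> w) = \<tau> (y * (pe p y * w))"
    by (metis c mult.assoc)
  then show ?case by (simp add: pe_pCons ring_distribs lin mult.assoc)
qed simp
qed

definition roots_poly :: "'k set \<Rightarrow> 'k poly" where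
  "roots_poly A = (\<Prod>a\<in>A. [:- a, 1:])"

lemma roots_poly_insert: "finite A \<Longrightarrow> a \<notin> A \<Longrightarrow> roots_poly (insert a A) = [:- a, 1:] * roots_poly A"
  by (simp add: roots_poly_def)

lemma poly_roots_poly: "finite A \<Longrightarrow> poly (roots_poly A) x = 0 \<longleftrightarrow> x \<in> A"
  by (simp add: roots_poly_def poly_prod)

lemma pe_roots_poly_remove:
  assumes "finite A" "a \<in> A"
  shows "pe (roots_poly A) x = (x - sc a) * pe (roots_poly (A - {a})) x"
  using roots_poly_insert[of "A - {a}" a] assms
  by (simp add: insert_absorb pe_mult pe_linear del: mult_pCons_left)

lemma degree_interpolation: "finite A \<Longrightarrow> degree (interpolation A a) \<le> card (A - {a})"
proof -
  assume A: "finite A"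
  have "degree (interpolation A a) \<le> (\<Sum>b\<in>A - {a}. degree (smult (1 / (a - b)) [:- b, 1:]))"
    unfolding interpolation_def
    using degree_prod_sum_le[of "A - {a}" "\<lambda>b. smult (1 / (a - b)) [:- b, 1:]"] A unfolding comp_def by blast
  also have "\<dots> \<le> (\<Sum>b\<in>A - {a}. 1)"
    by (rule sum_mono) simp
  finally show ?thesis by simp
qed

lemma poly_interpolation:
  assumes "finite A" "x \<in> A"
  shows "poly (interpolation A a) x = (if x = a then 1 else 0)"
proof (cases "x = a")
  case True
  have "poly (smult (1 / (a - b)) [:- b, 1:]) a = 1" if "b \<in> A - {a}" for b
    using that by (auto simp: field_simps)
  then show ?thesis using True unfolding interpolation_def poly_prod by simp
next
  case False
  then show ?thesis using assms by (auto simp: interpolation_def poly_prod intro!: prod_zero bexI[of _ x])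
qed

lemma sum_interpolation:
  assumes "finite A" "A \<noteq> {}"
  shows "(\<Sum>a\<in>A. interpolation A a) = 1"
proof (rule poly_eqI_degree[of A])
  fix x assume "x \<in> A"
  then show "poly (\<Sum>a\<in>A. interpolation A a) x = poly 1 x"
    using assms by (simp add: poly_sum poly_interpolation)
next
  have "degree (\<Sum>a\<in>A. interpolation A a) \<le> card A - 1"
  proof (rule degree_sum_le[OF assms(1)])
    fix a assume "a \<in> A"
    then show "degree (interpolation A a) \<le> card A - 1"
      using degree_interpolation[OF assms(1), of a] assms(1) by simp
  qed
  moreover have "card A > 0" using assms by (simp add: card_gt_0_iff)
  ultimately show "degree (\<Sum>a\<in>A. interpolation A a) < card A" by linarith
qed (use assms in \<open>simp_all add: card_gt_0_iff\<close>)

lemma interpolation_roots_poly: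
  assumes "finite A" "a \<in> A"
  shows "\<exists>c. interpolation A a = smult c (roots_poly (A - {a}))"
  unfolding interpolation_def roots_poly_def prod_smult by (rule exI, rule refl)

lemma interpolation_eigen:
  assumes "finite A" "a \<in> A" "pe (roots_poly A) x * w = 0"
  shows "x * (pe (interpolation A a) x * w) = sc a * (pe (interpolation A a) x * w)"
proof -
  obtain c where c: "interpolation A a = smult c (roots_poly (A - {a}))"
    using interpolation_roots_poly[OF assms(1,2)] by blast
  have "(x - sc a) * (pe (interpolation A a) x * w) = sc c * (pe (roots_poly A) x * w)"
    unfolding c pe_smult pe_roots_poly_remove[OF assms(1,2)]
    by (simp add: sc_left_commute mult.assoc)
  then show ?thesis using assms(3) by (simp add: ring_distribs)
qed

lemma interpolation_decompose:
  assumes "finite A" "pe (roots_poly A) x * w = 0"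
  shows "w = (\<Sum>a\<in>A. pe (interpolation A a) x * w)"
proof (cases "A = {}")
  case True
  then show ?thesis using assms by (simp add: roots_poly_def)
next
  case False
  have "(\<Sum>a\<in>A. pe (interpolation A a) x * w) = pe (\<Sum>a\<in>A. interpolation A a) x * w"
    by (simp only: pe_sum sum_distrib_right)
  then show ?thesis by (simp only: sum_interpolation[OF assms(1) False] pe_1 mult_1)
qed

text \<open>The vector is a sum of eigenvectors of \<open>x\<close>, so an eigenvalue is superfluous as soon
  as its eigenvectors vanish.\<close>

lemma roots_poly_reduce:
  assumes "finite A" "pe (roots_poly A) x * w = 0" "B \<subseteq> A"
    and "\<And>a w'. a \<in> A - B \<Longrightarrow> w' = pe (interpolation A a) x * w \<Longrightarrow> x * w' = sc a * w' \<Longrightarrow> w' = 0"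
  shows "pe (roots_poly B) x * w = 0"
proof -
  have "pe (roots_poly B) x * w = (\<Sum>a\<in>A. pe (roots_poly B) x * (pe (interpolation A a) x * w))"
    by (subst interpolation_decompose[OF assms(1,2)]) (simp add: sum_distrib_left)
  also have "\<dots> = 0"
  proof (rule sum.neutral, rule)
    fix a assume a: "a \<in> A"
    note e = interpolation_eigen[OF assms(1) a assms(2)]
    show "pe (roots_poly B) x * (pe (interpolation A a) x * w) = 0"
    proof (cases "a \<in> B")
      case True
      then show ?thesis
        using pe_eigen[OF e, of "roots_poly B"] poly_roots_poly[of B a] finite_subset[OF assms(3,1)] by simp
    next
      case False
      then show ?thesis using assms(4)[OF _ refl e] a by simp
    qed
  qed
  finally show ?thesis .
qed

lemma eigen_nonroot:
  assumes "finite A" "pe (roots_poly A) x * w = 0" "x * w = sc a * w" "a \<notin> A"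
  shows "w = 0"
  using pe_eigen[OF assms(3), of "roots_poly A"] assms(2,4) poly_roots_poly[OF assms(1)]
  by (metis sc_cancel)

text \<open>On the eigenvectors with eigenvalue in \<open>B\<close> both Lagrange polynomials have the same
  values. This is why the idempotents may be formed with all contents that occur in a position, whatever the
  tableau.\<close>

lemma interpolation_superset:
  assumes "finite A" "B \<subseteq> A" "a \<in> B" "pe (roots_poly B) x * w = 0"
  shows "pe (interpolation A a) x * w = pe (interpolation B a) x * w"
proof -
  have fB: "finite B" using assms finite_subset by blast
  have "pe (interpolation A a) x * w = (\<Sum>b\<in>B. pe (interpolation A a) x * (pe (interpolation B b) x * w))"
    by (subst interpolation_decompose[OF fB assms(4)]) (simp add: sum_distrib_left)
  also have "\<dots> = (\<Sum>b\<in>B. if b = a then pe (interpolation B a) x * w else 0)"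
  proof (rule sum.cong[OF refl])
    fix b assume b: "b \<in> B"
    show "pe (interpolation A a) x * (pe (interpolation B b) x * w) = (if b = a then pe (interpolation B a) x * w else 0)"
      using pe_eigen[OF interpolation_eigen[OF fB b assms(4)], of "interpolation A a"]
        poly_interpolation[OF assms(1), of b a] b assms(2) by auto
  qed
  also have "\<dots> = pe (interpolation B a) x * w"
    using fB assms(3) by simp
  finally show ?thesis .
qed

text \<open>On vectors killed by \<open>roots_poly A\<close> this is \<open>(u - x)\<^sup>-\<^sup>1\<close>. The Lagrange form makes sense although \<open>u - x\<close> need not be
  invertible in the ring, and it displays the poles.\<close>

definition resolvent :: "'k set \<Rightarrow> 'k \<Rightarrow> 'b \<Rightarrow> 'b" where
  "resolvent A u x = (\<Sum>a\<in>A. sc (1 / (u - a)) * pe (interpolation A a) x)"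

lemma resolvent:
  assumes "finite A" "pe (roots_poly A) x * w = 0" "u \<notin> A"
  shows "(sc u - x) * (resolvent A u x * w) = w"
proof -
  have "(sc u - x) * (resolvent A u x * w) =
      (\<Sum>a\<in>A. sc (1 / (u - a)) * ((sc u - x) * (pe (interpolation A a) x * w)))"
    unfolding resolvent_def sum_distrib_right sum_distrib_left
    by (rule sum.cong) (simp_all add: mult.assoc sc_left_commute)
  also have "\<dots> = (\<Sum>a\<in>A. pe (interpolation A a) x * w)"
  proof (rule sum.cong[OF refl])
    fix a assume a: "a \<in> A"
    have "(sc u - x) * (pe (interpolation A a) x * w) = sc (u - a) * (pe (interpolation A a) x * w)"
      using interpolation_eigen[OF assms(1) a assms(2)] by (simp add: ring_distribs sc_diff)
    moreover have "u \<noteq> a" using a assms(3) by blast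
    ultimately show "sc (1 / (u - a)) * ((sc u - x) * (pe (interpolation A a) x * w)) = pe (interpolation A a) x * w"
      by (simp add: sc_assoc)
  qed
  finally show ?thesis using interpolation_decompose[OF assms(1,2)] by simp
qed

lemma resolvent_commute: "y * x = x * y \<Longrightarrow> y * resolvent A u x = resolvent A u x * y"
  unfolding resolvent_def sum_distrib_right sum_distrib_left
  by (rule sum.cong) (simp_all add: mult.assoc sc_left_commute pe_commute)

end

section \<open>Jucys--Murphy elements\<close>

lemma commute_mult:
  fixes y :: "'b::semigroup_mult"
  assumes "y * a = a * y" "y * b = b * y"
  shows "y * (a * b) = a * b * y"
  by (metis assms mult.assoc)

text \<open>The relations in a ring of any type, with the scalars as a central image \<open>sc\<close> of
  the field, so that rewriting in type classes applies. The exponent \<open>r - s\<close> stands for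
  \<open>- s\<close>.\<close>

locale yokonuma_hecke = scalar_ring sc for sc :: "'k::field \<Rightarrow> 'b::ring_1" +
  fixes r n :: nat and q :: 'k and G T :: "nat \<Rightarrow> 'b" and X1 :: 'b
  assumes r_nz: "of_nat r \<noteq> (0 :: 'k)"
    and q_nz: "q \<noteq> 0"
    and GG: "\<lbrakk>i \<in> {1..<n}; j \<in> {1..<n}; i + 2 \<le> j\<rbrakk> \<Longrightarrow> G i * G j = G j * G i"
    and braid: "\<lbrakk>i \<in> {1..<n}; i + 1 \<in> {1..<n}\<rbrakk> \<Longrightarrow> G i * G (i + 1) * G i = G (i + 1) * G i * G (i + 1)"
    and TT: "\<lbrakk>i \<in> {1..n}; j \<in> {1..n}\<rbrakk> \<Longrightarrow> T i * T j = T j * T i"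
    and GT: "\<lbrakk>i \<in> {1..<n}; j \<in> {1..n}\<rbrakk> \<Longrightarrow> G i * T j = T (transpose i (i + 1) j) * G i"
    and T_power: "i \<in> {1..n} \<Longrightarrow> T i ^ r = 1"
    and G_square: "i \<in> {1..<n} \<Longrightarrow> G i ^ 2 = 1 + sc (q - inverse q) *
      (sc (1 / of_nat r) * (\<Sum>s<r. T i ^ s * T (i + 1) ^ (r - s))) * G i"
    and GXGX: "2 \<le> n \<Longrightarrow> G 1 * X1 * G 1 * X1 = X1 * G 1 * X1 * G 1"
    and GX1: "\<lbrakk>i \<in> {1..<n}; 2 \<le> i\<rbrakk> \<Longrightarrow> G i * X1 = X1 * G i"
    and TX1: "j \<in> {1..n} \<Longrightarrow> T j * X1 = X1 * T j"
begin

definition \<kappa> :: 'k where "\<kappa> = q - inverse q"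

definition E :: "nat \<Rightarrow> 'b" where
  "E i = sc (1 / of_nat r) * (\<Sum>s<r. T i ^ s * T (i + 1) ^ (r - s))"

fun X :: "nat \<Rightarrow> 'b" where
  "X 0 = 1"
| "X (Suc 0) = X1"
| "X (Suc (Suc i)) = G (Suc i) * X (Suc i) * G (Suc i)"

lemma X_Suc: "1 \<le> i \<Longrightarrow> X (Suc i) = G i * X i * G i"
  by (cases i) auto

lemma GG': "\<lbrakk>i \<in> {1..<n}; j \<in> {1..<n}; i + 2 \<le> j \<or> j + 2 \<le> i\<rbrakk> \<Longrightarrow> G i * G j = G j * G i"
  using GG by metis

lemma GT_other: "\<lbrakk>i \<in> {1..<n}; j \<in> {1..n}; j \<noteq> i; j \<noteq> Suc i\<rbrakk> \<Longrightarrow> G i * T j = T j * G i"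
  using GT[of i j] by simp

lemma GT_left: "i \<in> {1..<n} \<Longrightarrow> G i * T i = T (Suc i) * G i"
  using GT[of i i] by simp

lemma GT_right: "i \<in> {1..<n} \<Longrightarrow> G i * T (Suc i) = T i * G i"
  using GT[of i "Suc i"] by simp

lemma G_X_low: "\<lbrakk>i \<in> {1..<n}; 1 \<le> j; j < i\<rbrakk> \<Longrightarrow> G i * X j = X j * G i"
proof (induction j)
  case (Suc j)
  show ?case
  proof (cases "j = 0")
    case True
    then show ?thesis using GX1[of i] Suc.prems by simp
  next
    case False
    then have "X (Suc j) = G j * X j * G j" using X_Suc by simp
    moreover have "G i * G j = G j * G i" using Suc.prems False by (intro GG') auto
    moreover have "G i * X j = X j * G i" using Suc False by auto
    ultimately show ?thesis by (metis commute_mult)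
  qed
qed simp

text \<open>Only the step \<open>j = i + 2\<close> is not formal: there the braid relation moves \<open>G
  i\<close> through \<open>G (i + 1) G i X i G i G (i + 1)\<close>.\<close>

lemma G_X_high: "\<lbrakk>i \<in> {1..<n}; Suc i < j; j \<le> n\<rbrakk> \<Longrightarrow> G i * X j = X j * G i"
proof (induction j)
  case (Suc j)
  then have j: "X (Suc j) = G j * X j * G j" using X_Suc by simp
  show ?case
  proof (cases "j = Suc i")
    case True
    then have i: "X j = G i * X i * G i" using X_Suc Suc.prems by auto
    have b: "G i * (G j * G i) = G j * (G i * G j)"
      using braid[of i] True Suc.prems by (auto simp: mult.assoc)
    have b': "G i * (G j * (G i * x)) = G j * (G i * (G j * x))" for x
      using b by (metis mult.assoc)
    have c: "G j * (X i * x) = X i * (G j * x)" for x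
      using G_X_low[of j i] True Suc.prems by (auto simp: mult.assoc[symmetric])
    show ?thesis unfolding j i by (simp add: mult.assoc b b' c)
  next
    case False
    then have "G i * X j = X j * G i" using Suc by auto
    moreover have "G i * G j = G j * G i" using Suc.prems False by (intro GG') auto
    ultimately show ?thesis unfolding j by (metis commute_mult)
  qed
qed simp

lemma G_X: "\<lbrakk>i \<in> {1..<n}; 1 \<le> j; j \<le> n; j \<noteq> i; j \<noteq> Suc i\<rbrakk> \<Longrightarrow> G i * X j = X j * G i"
  using G_X_low[of i j] G_X_high[of i j] by (metis linorder_neqE_nat Suc_lessI)

lemma T_X: "\<lbrakk>1 \<le> i; i \<le> n; j \<in> {1..n}\<rbrakk> \<Longrightarrow> T j * X i = X i * T j"
proof (induction i arbitrary: j)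
  case (Suc i)
  show ?case
  proof (cases "i = 0")
    case True
    then show ?thesis using TX1 Suc.prems by simp
  next
    case False
    then have i: "X (Suc i) = G i * X i * G i" using X_Suc by simp
    define j' where "j' = transpose i (i + 1) j"
    have j': "j' \<in> {1..n}" "transpose i (i + 1) j' = j"
      using Suc.prems False by (auto simp: j'_def transpose_def)
    have i': "i \<in> {1..<n}" using Suc.prems False by auto
    have 1: "T j * G i = G i * T j'" using GT[OF i' j'(1)] j'(2) by simp
    have 2: "T j' * G i = G i * T j" using GT[OF i' Suc.prems(3)] unfolding j'_def by simp
    have 3: "T j' * X i = X i * T j'" using Suc.IH[OF _ _ j'(1)] i' by simp
    have "T j * (G i * X i * G i) = G i * (T j' * X i) * G i"
      by (simp add: 1 mult.assoc[symmetric])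
    also have "\<dots> = G i * X i * (T j' * G i)" by (simp add: 3 mult.assoc)
    finally show ?thesis unfolding i by (simp add: 2 mult.assoc)
  qed
qed simp

lemma X1_X: "\<lbrakk>2 \<le> k; k \<le> n\<rbrakk> \<Longrightarrow> X k * X1 = X1 * X k"
proof (induction k)
  case (Suc k)
  show ?case
  proof (cases "k = 1")
    case True
    then show ?thesis using GXGX Suc.prems by (simp add: mult.assoc)
  next
    case False
    then have i: "X (Suc k) = G k * X k * G k" using X_Suc Suc.prems by simp
    have 1: "X1 * G k = G k * X1" using GX1[of k] Suc.prems False by simp
    have 2: "X1 * X k = X k * X1" using Suc.IH Suc.prems False by simp
    show ?thesis unfolding i using 1 2 by (metis commute_mult)
  qed
qed simp

lemma X_X_less: "\<lbrakk>1 \<le> j; j < k; k \<le> n\<rbrakk> \<Longrightarrow> X k * X j = X j * X k"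
proof (induction j)
  case (Suc j)
  show ?case
  proof (cases "j = 0")
    case True
    then show ?thesis using X1_X Suc.prems by simp
  next
    case False
    then have j: "X (Suc j) = G j * X j * G j" using X_Suc by simp
    have "X k * X j = X j * X k" using Suc False by auto
    moreover have "X k * G j = G j * X k" using G_X_high[of j k] Suc.prems False by auto
    ultimately show ?thesis unfolding j by (metis commute_mult)
  qed
qed simp

lemma X_X: "\<lbrakk>1 \<le> j; j \<le> n; 1 \<le> k; k \<le> n\<rbrakk> \<Longrightarrow> X k * X j = X j * X k"
  using X_X_less by (metis linorder_neqE_nat)

lemma commute_E:
  assumes "y * T i = T i * y" "y * T (Suc i) = T (Suc i) * y"
  shows "y * E i = E i * y"
proof -
  have "y * T i ^ a = T i ^ a * y" "y * T (Suc i) ^ a = T (Suc i) ^ a * y" for a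
    using assms power_commuting_commutes by metis+
  then have "y * (T i ^ s * T (i + 1) ^ (r - s)) = T i ^ s * T (i + 1) ^ (r - s) * y" for s
    by (metis Suc_eq_plus1 commute_mult)
  then have "y * (\<Sum>s<r. T i ^ s * T (i + 1) ^ (r - s)) = (\<Sum>s<r. T i ^ s * T (i + 1) ^ (r - s)) * y"
    by (simp add: sum_distrib_left sum_distrib_right)
  then show ?thesis unfolding E_def by (simp add: sc_smul smul_simps)
qed

lemma E_X: "\<lbrakk>i \<in> {1..<n}; 1 \<le> j; j \<le> n\<rbrakk> \<Longrightarrow> X j * E i = E i * X j"
  by (rule commute_E; rule T_X[symmetric]) auto

lemma r_pos: "0 < r"
  using r_nz by (cases r) auto

lemma G_E: 
  assumes i: "i \<in> {1..<n}"
  shows "G i * E i = E i * G i"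
proof -
  have 1: "G i * T i ^ a = T (Suc i) ^ a * G i" for a
  proof (induction a)
    case (Suc a)
    have "G i * T i ^ Suc a = T (Suc i) * (G i * T i ^ a)"
      by (simp only: power_Suc mult.assoc[symmetric] GT_left[OF i])
    then show ?case by (simp add: Suc mult.assoc)
  qed simp
  have 2: "G i * T (Suc i) ^ a = T i ^ a * G i" for a
  proof (induction a)
    case (Suc a)
    have "G i * T (Suc i) ^ Suc a = T i * (G i * T (Suc i) ^ a)"
      by (simp only: power_Suc mult.assoc[symmetric] GT_right[OF i])
    then show ?case by (simp add: Suc mult.assoc)
  qed simp
  have c: "T (Suc i) ^ a * T i ^ b = T i ^ b * T (Suc i) ^ a" for a b
  proof -
    have "T i * T (Suc i) = T (Suc i) * T i" using TT[of i "Suc i"] i by simp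
    from power_commuting_commutes[OF this, of b, symmetric] show ?thesis
      by (rule power_commuting_commutes)
  qed
  have "G i * (\<Sum>s<r. T i ^ s * T (i + 1) ^ (r - s)) = (\<Sum>s<r. T (Suc i) ^ s * T i ^ (r - s)) * G i"
  proof -
    have "G i * (T i ^ s * T (Suc i) ^ (r - s)) = T (Suc i) ^ s * T i ^ (r - s) * G i" for s
      by (simp only: mult.assoc[symmetric] 1) (simp only: mult.assoc 2)
    then show ?thesis by (simp add: sum_distrib_left sum_distrib_right)
  qed
  also have "(\<Sum>s<r. T (Suc i) ^ s * T i ^ (r - s)) = (\<Sum>s<r. T i ^ s * T (i + 1) ^ (r - s))"
  proof -
    have nz: "T i ^ r = 1" "T (Suc i) ^ r = 1" using T_power[of i] T_power[of "Suc i"] i by auto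
    have "(\<Sum>s<r. T (Suc i) ^ s * T i ^ (r - s)) = (\<Sum>s\<in>{0<..<r}. T (Suc i) ^ s * T i ^ (r - s)) + 1"
    proof -
      have "{..<r} = insert 0 {0<..<r}" using r_pos by auto
      then show ?thesis by (simp add: nz)
    qed
    also have "(\<Sum>s\<in>{0<..<r}. T (Suc i) ^ s * T i ^ (r - s)) = (\<Sum>s\<in>{0<..<r}. T i ^ s * T (Suc i) ^ (r - s))"
      by (rule sum.reindex_bij_witness[where i="\<lambda>s. r - s" and j="\<lambda>s. r - s"]) (auto simp: c)
    also have "\<dots> + 1 = (\<Sum>s<r. T i ^ s * T (Suc i) ^ (r - s))"
    proof -
      have "{..<r} = insert 0 {0<..<r}" using r_pos by auto
      then show ?thesis by (simp add: nz)
    qed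
    finally show ?thesis by simp
  qed
  finally show ?thesis unfolding E_def by (simp add: sc_smul smul_simps)
qed

text \<open>For distinct roots of unity this is the vanishing of a geometric sum, written as \<open>z ^ r -
  z' ^ r\<close> divided by \<open>z - z'\<close>.\<close>

lemma E_eigen:
  assumes "T i * w = sc z * w" "T (Suc i) * w = sc z' * w" "z ^ r = 1" "z' ^ r = 1"
  shows "E i * w = sc (if z = z' then 1 else 0) * w"
proof -
  have p: "x ^ a * w = sc (c ^ a) * w" if "x * w = sc c * w" for x a c
  proof (induction a)
    case (Suc a)
    then show ?case using that by (simp add: mult.assoc sc_smul smul_simps mult.commute)
  qed simp
  have "T i ^ s * T (i + 1) ^ (r - s) * w = sc (z ^ s * z' ^ (r - s)) * w" for s
    using p[OF assms(1)] p[OF assms(2)] by (simp add: mult.assoc sc_smul smul_simps mult.commute)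
  then have "(\<Sum>s<r. T i ^ s * T (i + 1) ^ (r - s)) * w = sc (\<Sum>s<r. z ^ s * z' ^ (r - s)) * w"
    unfolding sum_distrib_right sc_sum by (rule sum.cong[OF refl])
  then have "E i * w = sc (1 / of_nat r * (\<Sum>s<r. z ^ s * z' ^ (r - s))) * w"
    unfolding E_def sc_mult mult.assoc by (rule arg_cong)
  also have "1 / of_nat r * (\<Sum>s<r. z ^ s * z' ^ (r - s)) = (if z = z' then 1 else 0)"
  proof (cases "z = z'")
    case True
    have "z ^ s * z' ^ (r - s) = 1" if "s < r" for s
      using that assms(3) unfolding True by (simp flip: power_add)
    then show ?thesis using True r_nz by simp
  next
    case False
    have z': "z' \<noteq> 0" using assms(4) r_pos by (auto simp: zero_power)
    have 1: "z ^ s * z' ^ (r - s) = z' * (z' ^ (r - Suc s) * z ^ s)" if "s < r" for s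
      using power_Suc[of z' "r - Suc s"] Suc_diff_Suc[OF that] by (simp add: mult_ac)
    have "(z - z') * (\<Sum>s<r. z ^ s * z' ^ (r - s)) = z' * ((z - z') * (\<Sum>s<r. z' ^ (r - Suc s) * z ^ s))"
      unfolding sum_distrib_left by (rule sum.cong[OF refl]) (use 1 in \<open>simp add: mult_ac\<close>)
    also have "\<dots> = z' * (z ^ r - z' ^ r)"
      by (simp only: power_diff_sumr2)
    finally show ?thesis using assms False by simp
  qed
  finally show ?thesis .
qed

definition Ginv :: "nat \<Rightarrow> 'b" where "Ginv i = G i - sc \<kappa> * E i"

lemma GGE: "i \<in> {1..<n} \<Longrightarrow> G i * G i = 1 + sc \<kappa> * (E i * G i)"
  using G_square[of i] unfolding E_def[symmetric] \<kappa>_def[symmetric] by (simp add: power2_eq_square mult.assoc)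

lemma G_Ginv: "i \<in> {1..<n} \<Longrightarrow> G i * Ginv i = 1" "i \<in> {1..<n} \<Longrightarrow> Ginv i * G i = 1"
  using GGE[of i] G_E[of i] by (simp_all add: Ginv_def ring_distribs sc_smul smul_simps mult.assoc)

lemma X_G: "i \<in> {1..<n} \<Longrightarrow> X i * G i = Ginv i * X (Suc i)"
  using G_Ginv(2)[of i] X_Suc[of i] by (simp add: mult.assoc[symmetric])

lemma G_X': "i \<in> {1..<n} \<Longrightarrow> G i * X i = X (Suc i) * Ginv i"
  using G_Ginv(1)[of i] X_Suc[of i] by (simp add: mult.assoc)

end

section \<open>Weight vectors and intertwiners\<close>

context yokonuma_hecke begin

text \<open>Weight vectors: \<open>X\<close> and \<open>T\<close> act by the given pairs of scalars in the
  first positions, and the second list holds the eigenvalues of the next \<open>T\<close>'s. All scalars of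
  \<open>T\<close> are required to be roots of unity, since the idempotents \<open>E\<close> are evaluated
  on such vectors.\<close>

definition WV :: "('k \<times> 'k) list \<Rightarrow> 'k list \<Rightarrow> 'b \<Rightarrow> bool" where
  "WV ws zs w \<longleftrightarrow> length ws + length zs \<le> n \<and>
    (\<forall>j<length ws. X (Suc j) * w = sc (fst (ws ! j)) * w \<and>
       T (Suc j) * w = sc (snd (ws ! j)) * w \<and> snd (ws ! j) ^ r = 1) \<and>
    (\<forall>j<length zs. T (Suc (length ws + j)) * w = sc (zs ! j) * w \<and> zs ! j ^ r = 1)"

lemma WV_append:
  assumes "WV (ws @ ws') zs w"
  shows "WV ws (map snd ws' @ zs) w"
  unfolding WV_def
proof (intro conjI allI impI)
  show "length ws + length (map snd ws' @ zs) \<le> n" using assms by (simp add: WV_def)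
next
  fix j assume "j < length ws"
  then show "X (Suc j) * w = sc (fst (ws ! j)) * w" "T (Suc j) * w = sc (snd (ws ! j)) * w" "snd (ws ! j) ^ r = 1"
    using assms by (auto simp: WV_def nth_append dest!: spec[of _ j])
next
  fix j assume j: "j < length (map snd ws' @ zs)"
  have "T (Suc (length ws + j)) * w = sc ((map snd ws' @ zs) ! j) * w \<and> (map snd ws' @ zs) ! j ^ r = 1"
  proof (cases "j < length ws'")
    case True
    have "\<forall>j<length (ws @ ws'). T (Suc j) * w = sc (snd ((ws @ ws') ! j)) * w \<and> snd ((ws @ ws') ! j) ^ r = 1"
      using assms unfolding WV_def by blast
    from this[rule_format, of "length ws + j"] True show ?thesis by (simp add: nth_append)
  next
    case False
    have "\<forall>j<length zs. T (Suc (length (ws @ ws') + j)) * w = sc (zs ! j) * w \<and> zs ! j ^ r = 1"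
      using assms unfolding WV_def by blast
    from this[rule_format, of "j - length ws'"] False j show ?thesis by (simp add: nth_append)
  qed
  then show "T (Suc (length ws + j)) * w = sc ((map snd ws' @ zs) ! j) * w" "(map snd ws' @ zs) ! j ^ r = 1" by auto
qed

lemma WV_drop: "WV ws (zs @ zs') w \<Longrightarrow> WV ws zs w"
  unfolding WV_def by (auto simp: nth_append dest: spec[of _ "_ :: nat"] split: if_splits)

lemma WV_prefix: "WV (ws @ ws') zs w \<Longrightarrow> WV ws [] w"
  using WV_append[of ws ws' zs w] WV_drop[of ws "[]" "map snd ws' @ zs" w] by simp

lemma WV_commuting:
  assumes "WV ws zs w" "\<And>j. j \<in> {1..n} \<Longrightarrow> X j * y = y * X j" "\<And>j. j \<in> {1..n} \<Longrightarrow> T j * y = y * T j"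
  shows "WV ws zs (y * w)"
proof -
  have "X j * (y * w) = sc a * (y * w)" if "X j * w = sc a * w" "j \<in> {1..n}" for j a
    using assms(2)[OF that(2)] that(1) by (metis mult.assoc sc_left_commute)
  moreover have "T j * (y * w) = sc a * (y * w)" if "T j * w = sc a * w" "j \<in> {1..n}" for j a
    using assms(3)[OF that(2)] that(1) by (metis mult.assoc sc_left_commute)
  ultimately show ?thesis
    using assms(1) unfolding WV_def by auto
qed

lemma WV_pe_X: "WV ws zs w \<Longrightarrow> i \<in> {1..n} \<Longrightarrow> WV ws zs (pe p (X i) * w)"
  by (rule WV_commuting) (auto intro!: pe_commute X_X T_X)

lemma WV_X: "WV ws zs w \<Longrightarrow> i \<in> {1..n} \<Longrightarrow> WV ws zs (X i * w)"
  by (rule WV_commuting) (auto intro!: X_X T_X)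

lemma WV_resolvent: "WV ws zs w \<Longrightarrow> i \<in> {1..n} \<Longrightarrow> WV ws zs (resolvent A u (X i) * w)"
  by (rule WV_commuting) (auto intro!: resolvent_commute X_X T_X)

lemma WV_scale_add: "WV ws zs w \<Longrightarrow> WV ws zs w' \<Longrightarrow> WV ws zs (sc a * w + w')"
  unfolding WV_def by (simp add: ring_distribs sc_smul smul_simps mult.commute)

lemma WV_scale: "WV ws zs w \<Longrightarrow> WV ws zs (sc a * w)"
  unfolding WV_def by (simp add: sc_smul smul_simps mult.commute)

lemma WV_last:
  assumes "WV (ws @ [(a, z)]) zs w"
  shows "X (Suc (length ws)) * w = sc a * w" "T (Suc (length ws)) * w = sc z * w" "z ^ r = 1"
  using assms unfolding WV_def by (auto dest!: spec[of _ "length ws"])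

lemma WV_next:
  assumes "WV ws (z # zs) w"
  shows "T (Suc (length ws)) * w = sc z * w" "z ^ r = 1"
  using assms unfolding WV_def by (auto dest!: spec[of _ 0])

lemma WV_snoc:
  assumes "WV ws (z # zs) w" "X (Suc (length ws)) * w = sc a * w"
  shows "WV (ws @ [(a, z)]) zs w"
  unfolding WV_def
proof (intro conjI allI impI)
  show "length (ws @ [(a, z)]) + length zs \<le> n" using assms(1) by (simp add: WV_def)
next
  fix j assume "j < length (ws @ [(a, z)])"
  then show "X (Suc j) * w = sc (fst ((ws @ [(a, z)]) ! j)) * w"
    "T (Suc j) * w = sc (snd ((ws @ [(a, z)]) ! j)) * w" "snd ((ws @ [(a, z)]) ! j) ^ r = 1"
    using assms WV_next[OF assms(1)] by (auto simp: WV_def nth_append less_Suc_eq)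
next
  fix j assume "j < length zs"
  then show "T (Suc (length (ws @ [(a, z)]) + j)) * w = sc (zs ! j) * w" "zs ! j ^ r = 1"
    using assms(1) by (auto simp: WV_def dest!: spec[of _ "Suc j"])
qed

text \<open>The scalar \<open>k\<close> is chosen such that \<open>G i + k\<close> exchanges the eigenvalues
  \<open>a\<close> and \<open>b\<close>. The last equation expresses that applying an intertwiner twice
  multiplies by a scalar.\<close>

lemma swap_step:
  assumes i: "i \<in> {1..<n}"
    and ev: "X i * w = sc a * w" "X (Suc i) * w = sc b * w" "T i * w = sc z * w" "T (Suc i) * w = sc z' * w"
      "z ^ r = 1" "z' ^ r = 1"
    and ab: "z = z' \<Longrightarrow> a \<noteq> b"
    and k: "k = (if z = z' then \<kappa> * b / (a - b) else 0)"
    and s: "s = G i * w + sc k * w"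
  shows "X i * s = sc b * s" "X (Suc i) * s = sc a * s" "T i * s = sc z' * s" "T (Suc i) * s = sc z * s"
    "G i * s = sc ((if z = z' then \<kappa> else 0) + k) * s + sc (1 - k * ((if z = z' then \<kappa> else 0) + k)) * w"
proof -
  define \<delta> :: 'k where "\<delta> = (if z = z' then 1 else 0)"
  have E: "E i * w = smul \<delta> w"
    using E_eigen[OF ev(3-6)] by (simp add: \<delta>_def smul_def)
  note ev' = ev(1-4)[unfolded sc_smul]
  have k1: "k * (a - b) = \<kappa> * \<delta> * b" using ab by (auto simp: k \<delta>_def)
  have Gi: "Ginv i * w = G i * w - smul (\<kappa> * \<delta>) w"
    by (simp add: Ginv_def ring_distribs mult.assoc sc_smul smul_simps E)
  have "X i * (G i * w) = smul b (Ginv i * w)"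
    using X_G[OF i] ev'(2) by (metis mult.assoc smul_simps(1))
  then have "X i * s = smul b (G i * w) + smul (k * a - \<kappa> * \<delta> * b) w"
    by (simp add: s ring_distribs sc_smul smul_simps ev' Gi smul_distrib(2) mult_ac)
  also have "k * a - \<kappa> * \<delta> * b = b * k" using k1 by (simp add: algebra_simps)
  finally show "X i * s = sc b * s" by (simp add: s sc_smul smul_simps)
  have Y: "X (Suc i) * G i = G i * X i + sc \<kappa> * (X (Suc i) * E i)"
  proof -
    have "G i = Ginv i + sc \<kappa> * E i" by (simp add: Ginv_def)
    then have "X (Suc i) * G i = X (Suc i) * Ginv i + X (Suc i) * (sc \<kappa> * E i)"
      by (metis distrib_left)
    then show ?thesis by (simp add: G_X'[OF i] sc_smul smul_simps)
  qed
  have "X (Suc i) * (G i * w) = G i * (X i * w) + sc \<kappa> * (X (Suc i) * (E i * w))"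
    using arg_cong[OF Y, of "\<lambda>x. x * w"] by (simp add: ring_distribs mult.assoc)
  then have "X (Suc i) * (G i * w) = smul a (G i * w) + smul (\<kappa> * \<delta> * b) w"
    by (simp add: E ev' sc_smul smul_simps mult_ac)
  then have "X (Suc i) * s = smul a (G i * w) + smul (k * b + \<kappa> * \<delta> * b) w"
    by (simp add: s ring_distribs sc_smul smul_simps ev' smul_distrib(1))
  also have "k * b + \<kappa> * \<delta> * b = a * k" using k1 by (simp add: algebra_simps)
  finally show "X (Suc i) * s = sc a * s" by (simp add: s sc_smul smul_simps)
  have t: "T i * (G i * w) = smul z' (G i * w)" "T (Suc i) * (G i * w) = smul z (G i * w)"
    using GT_left[OF i] GT_right[OF i] ev'(3,4) by (metis mult.assoc smul_simps(1))+
  have k0: "k = 0 \<or> z = z'" by (simp add: k)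
  then show "T i * s = sc z' * s" "T (Suc i) * s = sc z * s"
    using k0 by (auto simp: s ring_distribs sc_smul smul_simps ev' t mult_ac)
  have "G i * (G i * w) = w + smul \<kappa> (E i * (G i * w))"
    using arg_cong[OF GGE[OF i], of "\<lambda>x. x * w"] by (simp add: ring_distribs mult.assoc sc_smul smul_simps)
  also have "E i * (G i * w) = smul \<delta> (G i * w)"
    using G_E[OF i] E by (metis mult.assoc smul_simps(1))
  finally have "G i * s = smul (\<kappa> * \<delta> + k) (G i * w) + w"
    by (simp add: s ring_distribs sc_smul smul_simps smul_distrib(1) algebra_simps)
  also have "\<dots> = smul (\<kappa> * \<delta> + k) s + smul (1 - k * (\<kappa> * \<delta> + k)) w"
    by (simp add: s sc_smul smul_simps smul_distrib mult.commute)
  finally show "G i * s = sc ((if z = z' then \<kappa> else 0) + k) * s + sc (1 - k * ((if z = z' then \<kappa> else 0) + k)) * w"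
    by (simp add: smul_def \<delta>_def split: if_splits)
qed

text \<open>The square of the intertwiner is a scalar multiple of \<open>(a - q\<^sup>2 b) (q\<^sup>2 a - b)
  / (a - b)\<^sup>2\<close>, hence the intertwiner is injective unless the two contents are
  adjacent.\<close>

lemma swap_zero:
  assumes i: "i \<in> {1..<n}"
    and ev: "X i * w = sc a * w" "X (Suc i) * w = sc b * w" "T i * w = sc z * w" "T (Suc i) * w = sc z' * w"
      "z ^ r = 1" "z' ^ r = 1"
    and ab: "z = z' \<Longrightarrow> a \<noteq> b \<and> a \<noteq> q\<^sup>2 * b \<and> b \<noteq> q\<^sup>2 * a"
    and k: "k = (if z = z' then \<kappa> * b / (a - b) else 0)"
    and s: "G i * w + sc k * w = 0"
  shows "w = 0"
proof (rule sc_cancel)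
  show "sc (1 - k * ((if z = z' then \<kappa> else 0) + k)) * w = 0"
    using swap_step(5)[OF i ev _ k refl] ab s by simp
  show "1 - k * ((if z = z' then \<kappa> else 0) + k) \<noteq> 0"
  proof (cases "z = z'")
    case True
    then have n: "a - b \<noteq> 0" "a - q\<^sup>2 * b \<noteq> 0" "q\<^sup>2 * a - b \<noteq> 0" using ab by auto
    \<comment> \<open>Cleared of denominators, the square of the intertwiner is a product of linear factors.\<close>
    have "q\<^sup>2 * (a - b)\<^sup>2 * (1 - k * ((if z = z' then \<kappa> else 0) + k)) = (a - q\<^sup>2 * b) * (q\<^sup>2 * a - b)"
    proof -
      have 1: "k * (a - b) = \<kappa> * b" using n(1) True by (simp add: k)
      have 2: "q * \<kappa> = q\<^sup>2 - 1" using q_nz by (simp add: \<kappa>_def power2_eq_square field_simps)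
      have "q\<^sup>2 * (a - b)\<^sup>2 * (1 - k * (\<kappa> + k)) = q\<^sup>2 * (a - b)\<^sup>2 - q\<^sup>2 * (k * (a - b)) * (\<kappa> * (a - b) + k * (a - b))"
        by (simp add: power2_eq_square ring_distribs mult_ac)
      also have "\<dots> = q\<^sup>2 * (a - b)\<^sup>2 - (q * \<kappa>)\<^sup>2 * a * b" unfolding 1 by (simp add: power2_eq_square algebra_simps)
      also have "\<dots> = (a - q\<^sup>2 * b) * (q\<^sup>2 * a - b)" unfolding 2 by (simp add: power2_eq_square algebra_simps)
      finally show ?thesis using True by simp
    qed
    with n show ?thesis by auto
  qed (simp add: k)
qed

lemma eigen_other:
  assumes "y * g = g * y" "y * w = sc c * w"
  shows "y * (g * w + sc k * w) = sc c * (g * w + sc k * w)"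
proof -
  have "y * (g * w) = g * (y * w)" using assms(1) by (metis mult.assoc)
  then show ?thesis by (simp add: ring_distribs assms(2) sc_smul smul_simps mult.commute assms(2)[unfolded sc_smul])
qed

lemma WV_swap:
  assumes w: "WV (pre @ (a, z) # (b, z') # post) zs w" and ab: "z = z' \<Longrightarrow> a \<noteq> b"
    and k: "k = (if z = z' then \<kappa> * b / (a - b) else 0)" and i: "i = Suc (length pre)"
  shows "WV (pre @ (b, z') # (a, z) # post) zs (G i * w + sc k * w)"
proof -
  let ?ws = "pre @ (a, z) # (b, z') # post" and ?ws' = "pre @ (b, z') # (a, z) # post"
  let ?s = "G i * w + sc k * w"
  have i': "i \<in> {1..<n}" using w i by (simp add: WV_def)
  have ev: "X i * w = sc a * w" "X (Suc i) * w = sc b * w" "T i * w = sc z * w" "T (Suc i) * w = sc z' * w"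
      "z ^ r = 1" "z' ^ r = 1"
    using WV_last[of pre a z "z' # map snd post @ zs" w]
      WV_last[of "pre @ [(a, z)]" b z' "map snd post @ zs" w]
      WV_append[of "pre @ [(a, z)]" "(b, z') # post" zs w]
      WV_append[of "pre @ [(a, z), (b, z')]" "post" zs w] w by (simp_all add: i)
  note st = swap_step(1-4)[OF i' ev ab k refl]
  show ?thesis
    unfolding WV_def
  proof (intro conjI allI impI)
    show "length ?ws' + length zs \<le> n" using w by (simp add: WV_def)
  next
    fix j assume j: "j < length ?ws'"
    have *: "X (Suc j) * ?s = sc (fst (?ws' ! j)) * ?s \<and> T (Suc j) * ?s = sc (snd (?ws' ! j)) * ?s \<and> snd (?ws' ! j) ^ r = 1"
    proof -
      consider "j = length pre" | "j = Suc (length pre)" | "Suc j \<noteq> i" "Suc j \<noteq> Suc i" using i by auto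
      then show ?thesis
      proof cases
        case 3
        then have eq: "?ws' ! j = ?ws ! j" by (auto simp: nth_append i nth_Cons split: nat.splits)
        have e: "X (Suc j) * w = sc (fst (?ws ! j)) * w" "T (Suc j) * w = sc (snd (?ws ! j)) * w" "snd (?ws ! j) ^ r = 1"
          using w j unfolding WV_def by auto
        have jn: "Suc j \<le> n" using j w by (simp add: WV_def)
        show ?thesis unfolding eq
          using eigen_other[OF G_X[OF i', of "Suc j", symmetric] e(1)] eigen_other[OF GT_other[OF i', of "Suc j", symmetric] e(2)]
            e(3) jn 3 by simp
      qed (use st ev in \<open>simp_all add: i nth_append\<close>)
    qed
    from * show "X (Suc j) * ?s = sc (fst (?ws' ! j)) * ?s" "T (Suc j) * ?s = sc (snd (?ws' ! j)) * ?s" "snd (?ws' ! j) ^ r = 1"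
      by blast+
  next
    fix j assume j: "j < length zs"
    have e: "T (Suc (length ?ws + j)) * w = sc (zs ! j) * w" "zs ! j ^ r = 1" using w j unfolding WV_def by blast+
    show "zs ! j ^ r = 1" by fact
    have "Suc (length ?ws + j) \<le> n" using j w unfolding WV_def by linarith
    then show "T (Suc (length ?ws' + j)) * ?s = sc (zs ! j) * ?s"
      using eigen_other[OF GT_other[OF i', of "Suc (length ?ws + j)", symmetric] e(1)] i by simp
  qed
qed

lemma WV_G:
  assumes w: "WV ws (z # z' # zs) w" and i: "i = Suc (length ws)" and k: "z = z' \<or> k = 0"
  shows "WV ws (z' # z # zs) (G i * w + sc k * w)"
proof -
  let ?s = "G i * w + sc k * w"
  have i': "i \<in> {1..<n}" using w i by (simp add: WV_def)
  have zs: "\<forall>j<length (z # z' # zs). T (Suc (length ws + j)) * w = sc ((z # z' # zs) ! j) * w \<and> (z # z' # zs) ! j ^ r = 1"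
    using w unfolding WV_def by blast
  have t: "T i * w = smul z w" "T (Suc i) * w = smul z' w" "z ^ r = 1" "z' ^ r = 1"
    using zs[rule_format, of 0] zs[rule_format, of 1] by (simp_all add: i smul_def)
  have t': "T i * (G i * w) = smul z' (G i * w)" "T (Suc i) * (G i * w) = smul z (G i * w)"
    using GT_left[OF i'] GT_right[OF i'] t(1,2) by (metis mult.assoc smul_simps(1))+
  have st: "T i * ?s = sc z' * ?s" "T (Suc i) * ?s = sc z * ?s"
    using k by (auto simp: ring_distribs sc_smul smul_simps t t' mult_ac)
  show ?thesis
    unfolding WV_def
  proof (intro conjI allI impI)
    show "length ws + length (z' # z # zs) \<le> n" using w by (simp add: WV_def)
  next
    fix j assume j: "j < length ws"
    have e: "X (Suc j) * w = sc (fst (ws ! j)) * w" "T (Suc j) * w = sc (snd (ws ! j)) * w" "snd (ws ! j) ^ r = 1"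
      using w j unfolding WV_def by auto
    show "X (Suc j) * ?s = sc (fst (ws ! j)) * ?s" "T (Suc j) * ?s = sc (snd (ws ! j)) * ?s" "snd (ws ! j) ^ r = 1"
      using eigen_other[OF G_X[OF i', of "Suc j", symmetric] e(1)] eigen_other[OF GT_other[OF i', of "Suc j", symmetric] e(2)]
        e(3) j w i by (simp_all add: WV_def)
  next
    fix j assume j: "j < length (z' # z # zs)"
    consider "j = 0" | "j = 1" | j' where "j = Suc (Suc j')" by (metis One_nat_def not0_implies_Suc)
    then have "T (Suc (length ws + j)) * ?s = sc ((z' # z # zs) ! j) * ?s \<and> (z' # z # zs) ! j ^ r = 1"
    proof cases
      case 3
      have "T (Suc (length ws + j)) * w = sc (zs ! j') * w" "zs ! j' ^ r = 1" using zs[rule_format, of j] j 3 by auto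
      moreover have "Suc (length ws + j) \<le> n" using j w unfolding WV_def by simp
      ultimately show ?thesis
        using eigen_other[OF GT_other[OF i', of "Suc (length ws + j)", symmetric], of w "zs ! j'" k] i 3 by simp
    qed (use st t i in auto)
    then show "T (Suc (length ws + j)) * ?s = sc ((z' # z # zs) ! j) * ?s" "(z' # z # zs) ! j ^ r = 1" by blast+
  qed
qed

lemma pe_intertwine':
  assumes P: "P w" and step: "\<And>w. P w \<Longrightarrow> x * (\<tau> * w) = \<tau> * (y * w)" "\<And>w. P w \<Longrightarrow> P (y * w)"
  shows "pe p x * (\<tau> * w) = \<tau> * (pe p y * w)"
  by (rule pe_intertwine[where P = P and \<tau> = "\<lambda>w. \<tau> * w"]) (use assms in \<open>auto simp: ring_distribs sc_left_commute\<close>)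

text \<open>If the colours differ, then \<open>E i\<close> kills the vector, \<open>G i\<close> is an
  involution there and conjugates \<open>X (i + 1)\<close> to \<open>X i\<close>.\<close>

lemma spectrum_distinct_colour:
  assumes w: "WV (ws @ [(c, z)]) (z' # zs) w" and z: "z \<noteq> z'"
    and IH: "\<And>w. WV ws [z'] w \<Longrightarrow> pe p (X (Suc (length ws))) * w = 0"
  shows "pe p (X (Suc (Suc (length ws)))) * w = 0"
proof -
  define i where "i = Suc (length ws)"
  have i: "i \<in> {1..<n}" using w by (simp add: WV_def i_def)
  have w1: "WV ws (z # z' # zs) w" using WV_append[OF w] by simp
  have Ew: "E i * w = 0"
    using E_eigen[of i w z z'] WV_last[OF w] WV_next[OF w] z by (simp add: i_def)
  define y where "y = G i * w"
  have Ey: "E i * y = 0" unfolding y_def using G_E[OF i] Ew by (metis mult.assoc mult_zero_right)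
  have "WV ws (z' # z # zs) y"
    using WV_G[OF w1 i_def, of 0] by (simp add: y_def)
  then have "WV ws [z'] y" using WV_drop[of ws "[z']"] by simp
  then have Py: "pe p (X i) * y = 0" using IH by (simp add: i_def)
  have Gy: "G i * y = w"
    using arg_cong[OF GGE[OF i], of "\<lambda>x. x * w"] Ey
    by (simp add: ring_distribs mult.assoc y_def)
  have "pe p (X (Suc i)) * (G i * y) = G i * (pe p (X i) * y)"
  proof (rule pe_intertwine'[where P = "\<lambda>u. E i * u = 0"])
    fix u assume u: "E i * u = 0"
    have "E i * (G i * u) = 0" using G_E[OF i] u by (metis mult.assoc mult_zero_right)
    then have "G i * (G i * u) = u"
      using arg_cong[OF GGE[OF i], of "\<lambda>x. x * u"] by (simp add: ring_distribs mult.assoc)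
    then show "X (Suc i) * (G i * u) = G i * (X i * u)"
      using X_Suc[of i] i by (simp add: mult.assoc)
    show "E i * (X i * u) = 0"
      using E_X[OF i, of i] u i by (metis mult.assoc mult_zero_right atLeastLessThan_iff less_imp_le)
  qed (rule Ey)
  then show ?thesis using Py Gy by (simp add: i_def)
qed

text \<open>With \<open>Y = X (i + 1)\<close>, the map \<open>w \<mapsto> G (c - Y) w + \<kappa> Y w\<close>
  intertwines \<open>Y\<close> with \<open>X i\<close>, so the eigenvectors of \<open>Y\<close> whose
  eigenvalue is not a root of \<open>p\<close> are in its kernel; the quadratic relation of \<open>G\<close>
  leaves \<open>q\<^sup>2 c\<close> and \<open>c / q\<^sup>2\<close> as eigenvalues there.\<close>

lemma spectrum_same_colour:
  assumes w: "WV (ws @ [(c, z)]) (z # zs) w" and c: "c \<noteq> 0"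
    and IH: "\<And>w. WV ws [z] w \<Longrightarrow> pe p (X (Suc (length ws))) * w = 0"
  shows "pe ([:- (q\<^sup>2 * c), 1:] * ([:- (c / q\<^sup>2), 1:] * p)) (X (Suc (Suc (length ws)))) * w = 0"
proof -
  define i where "i = Suc (length ws)"
  have i: "i \<in> {1..<n}" using w by (simp add: WV_def i_def)
  define Y where "Y = X (Suc i)"
  have Y: "pe p Y * Y = Y * pe p Y" by (rule pe_commute[symmetric]) simp
  have *: "G i * (smul c (pe p Y * w) - Y * (pe p Y * w)) + smul \<kappa> (Y * (pe p Y * w)) = 0 \<and>
      E i * (pe p Y * w) = pe p Y * w"
    if w: "WV (ws @ [(c, z)]) (z # zs) w" for w
  proof -
    have w1: "WV ws (z # z # zs) w" using WV_append[OF w] by simp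
    define P where "P u \<longleftrightarrow> WV (ws @ [(c, z)]) (z # zs) u" for u
    have E: "E i * u = u" if "P u" for u
      using E_eigen[of i u z z] WV_last[OF that[unfolded P_def]] WV_next[OF that[unfolded P_def]] by (simp add: i_def)
    have PY: "P (Y * u)" if "P u" for u
      using that i unfolding P_def Y_def by (intro WV_X) auto
    define \<tau> where "\<tau> u = G i * (smul c u - Y * u) + smul \<kappa> (Y * u)" for u
    have "pe p (X i) * \<tau> w = \<tau> (pe p Y * w)"
    proof (rule pe_intertwine[where P = P])
      show "P w" using w by (simp add: P_def)
      fix u assume u: "P u"
      show "P (Y * u)" by (rule PY[OF u])
      have XG: "X i * (G i * x) = G i * (Y * x) - smul \<kappa> (E i * (Y * x))" for x
        using arg_cong[OF X_G[OF i], of "\<lambda>y. y * x"]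
        by (simp add: Y_def Ginv_def mult.assoc ring_distribs sc_smul smul_simps)
      have XY: "X i * (Y * u) = smul c (Y * u)" 
        using WV_last(1)[OF PY[OF u, unfolded P_def]] by (simp add: i_def sc_smul)
      show "X i * \<tau> u = \<tau> (Y * u)"
        unfolding \<tau>_def distrib_left XG
        by (simp add: ring_distribs XY smul_simps E[OF PY[OF u]] E[OF PY[OF PY[OF u]]] mult.assoc mult.commute[of c])
    next
      show "\<tau> (sc a * u + u') = sc a * \<tau> u + \<tau> u'" for a u u'
        by (simp add: \<tau>_def ring_distribs sc_smul smul_simps mult_ac(2,3) mult.commute algebra_simps)
    qed
    moreover have "WV ws [z] (\<tau> w)"
    proof -
      have "WV ws (z # z # zs) (Y * w)" unfolding Y_def using w1 i by (intro WV_X) auto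
      then have "WV ws (z # z # zs) (sc (-1) * (G i * (Y * w) + sc (-\<kappa>) * (Y * w)) + sc c * (G i * w + sc 0 * w))"
        by (intro WV_scale_add WV_scale WV_G w1 i_def) auto
      also have "sc (-1) * (G i * (Y * w) + sc (-\<kappa>) * (Y * w)) + sc c * (G i * w + sc 0 * w) = \<tau> w"
        by (simp add: \<tau>_def sc_smul smul_simps ring_distribs sc_minus)
      finally show ?thesis using WV_drop[of ws "[z]" "z # zs"] by simp
    qed
    ultimately have "\<tau> (pe p Y * w) = 0" using IH by (simp add: i_def)
    moreover have "P (pe p Y * w)" unfolding P_def Y_def using w i by (intro WV_pe_X) auto
    ultimately show ?thesis using E by (simp add: \<tau>_def)
  qed
  define x where "x = pe p Y * w"
  have x: "G i * (smul c x - Y * x) + smul \<kappa> (Y * x) = 0" "E i * x = x"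
    using *[OF w] by (auto simp: x_def)
  have "WV (ws @ [(c, z)]) (z # zs) (Y * w)" unfolding Y_def using w i by (intro WV_X) auto
  from *[OF this] have Yx: "G i * (smul c (Y * x) - Y * (Y * x)) + smul \<kappa> (Y * (Y * x)) = 0" "E i * (Y * x) = Y * x"
    using Y by (auto simp: x_def mult.assoc[symmetric])
  have step: "smul c x - Y * x + smul (\<kappa> * c) (G i * x) = 0"
    if x: "G i * (smul c x - Y * x) + smul \<kappa> (Y * x) = 0" "E i * x = x" "E i * (Y * x) = Y * x" for x
  proof -
    have GG: "G i * (G i * u) = u + smul \<kappa> (G i * u)" if "E i * u = u" for u
    proof -
      have "E i * (G i * u) = G i * (E i * u)" by (simp only: mult.assoc[symmetric] G_E[OF i])
      then have "E i * (G i * u) = G i * u" using that by simp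
      then have "(1 + sc \<kappa> * (E i * G i)) * u = u + smul \<kappa> (G i * u)"
        by (simp add: distrib_right mult.assoc sc_smul(1) smul_simps(2))
      then show ?thesis unfolding GGE[OF i, symmetric] by (simp only: mult.assoc)
    qed
    have "E i * (smul c x - Y * x) = smul c x - Y * x"
      by (simp add: ring_distribs smul_simps x)
    from GG[OF this] have "G i * (G i * (smul c x - Y * x) + smul \<kappa> (Y * x)) =
        smul c x - Y * x + smul (\<kappa> * c) (G i * x)"
      by (simp add: ring_distribs smul_simps)
    then show ?thesis using x(1) by simp
  qed
  have "Y * E i = E i * Y" unfolding Y_def using i by (intro E_X) auto
  then have "E i * (Y * (Y * x)) = Y * (E i * (Y * x))" by (simp only: mult.assoc[symmetric])
  then have "E i * (Y * (Y * x)) = Y * (Y * x)" using Yx(2) by simp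
  note A = step[OF x(1,2) Yx(2)] and B = step[OF Yx this]
  have C: "smul (\<kappa> * c) (G i * (smul c x - Y * x)) + smul (\<kappa> * c * \<kappa>) (Y * x) = 0"
    using arg_cong[OF x(1), of "smul (\<kappa> * c)"] by (simp add: smul_simps)
  have A0: "smul (\<kappa> * c) (G i * x) = Y * x - smul c x" using A by (simp add: algebra_simps)
  have A': "smul (\<kappa> * c * c) (G i * x) = smul c (Y * x) - smul (c * c) x"
    using arg_cong[OF A0, of "smul c"] by (simp add: smul_simps mult_ac)
  have B': "smul (\<kappa> * c) (G i * (Y * x)) = Y * (Y * x) - smul c (Y * x)" using B by (simp add: algebra_simps)
  have "Y * (Y * x) - smul (2 * c + c * \<kappa>\<^sup>2) (Y * x) + smul (c * c) x = 0"
  proof -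
    have "smul (\<kappa> * c * c) (G i * x) - smul (\<kappa> * c) (G i * (Y * x)) + smul (\<kappa> * c * \<kappa>) (Y * x) = 0"
      using C by (simp add: ring_distribs smul_simps)
    from this[unfolded A' B'] have "smul c (Y * x) - smul (c * c) x - (Y * (Y * x) - smul c (Y * x))
        + smul (\<kappa> * c * \<kappa>) (Y * x) = 0" .
    moreover have "smul (2 * c + c * \<kappa>\<^sup>2) (Y * x) = smul c (Y * x) + smul c (Y * x) + smul (\<kappa> * c * \<kappa>) (Y * x)"
      unfolding smul_distrib(1)[symmetric] by (simp add: power2_eq_square algebra_simps)
    ultimately show ?thesis by (simp add: algebra_simps)
  qed
  also have "2 * c + c * \<kappa>\<^sup>2 = q\<^sup>2 * c + c / q\<^sup>2"
    using q_nz by (simp add: \<kappa>_def field_simps power2_eq_square)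
  finally have "(Y - sc (q\<^sup>2 * c)) * ((Y - sc (c / q\<^sup>2)) * x) = 0"
    using q_nz by (simp add: ring_distribs smul_simps sc_smul smul_distrib algebra_simps power2_eq_square)
  then show ?thesis
    by (simp add: pe_mult pe_linear mult.assoc x_def Y_def i_def del: mult_pCons_left)
qed

text \<open>If \<open>X i\<close> and \<open>X (i + 1)\<close> had the same eigenvalue on \<open>w\<close>,
  then \<open>w\<close> and \<open>G i w\<close> would span a nontrivial Jordan block of \<open>X i\<close>,
  contrary to semisimplicity.\<close>

lemma no_repeat:
  assumes w: "WV (ws @ [(c, z), (c, z)]) zs w" and c: "c \<noteq> 0" "\<kappa> \<noteq> 0" and A: "finite A" "c \<in> A"
    and IH: "\<And>w. WV ws [z] w \<Longrightarrow> pe (roots_poly A) (X (Suc (length ws))) * w = 0"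
  shows "w = 0"
proof -
  define i where "i = Suc (length ws)"
  have i: "i \<in> {1..<n}" using w by (simp add: WV_def i_def)
  have w1: "WV ws (z # z # zs) w" using WV_append[OF w] by simp
  have w2: "WV (ws @ [(c, z)]) (z # zs) w" using WV_append[of "ws @ [(c, z)]" "[(c, z)]"] w by simp
  have E: "E i * w = w"
    using E_eigen[of i w z z] WV_last[OF w2] WV_next[OF w2] by (simp add: i_def)
  have X: "X i * w = smul c w" "X (Suc i) * w = smul c w"
    using WV_last(1)[OF w2] WV_last(1)[of "ws @ [(c, z)]" c z zs w] w by (simp_all add: i_def sc_smul)
  have "WV ws (z # z # zs) (G i * w)"
    using WV_G[OF w1 i_def, of 0] by simp
  then have "WV ws [z] (G i * w)" using WV_drop[of ws "[z]" "z # zs"] by simp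
  then have "0 = pe (roots_poly A) (X i) * (G i * w)" using IH by (simp add: i_def)
  also have "\<dots> = pe (roots_poly (A - {c})) (X i) * ((X i - sc c) * (G i * w))"
    using pe_roots_poly_remove[OF A, of "X i"] pe_commute[of "X i - sc c" "X i" "roots_poly (A - {c})"]
    by (simp add: mult.assoc[symmetric] ring_distribs sc_comm)
  also have "(X i - sc c) * (G i * w) = smul (- (\<kappa> * c)) w"
    using arg_cong[OF X_G[OF i], of "\<lambda>x. x * w"]
    by (simp add: ring_distribs mult.assoc Ginv_def sc_smul smul_simps X E mult.commute)
  also have "pe (roots_poly (A - {c})) (X i) * smul (- (\<kappa> * c)) w = sc (- (\<kappa> * c) * poly (roots_poly (A - {c})) c) * w"
    using pe_eigen[of "X i" w c "roots_poly (A - {c})"] X(1) by (simp add: sc_smul smul_simps)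
  finally show ?thesis
    by (rule sc_cancel[OF sym]) (use c A poly_roots_poly[of "A - {c}" c] in auto)
qed

text \<open>Both sides of the braid relation act on \<open>w\<close> by scalars, \<open>1 / \<theta>\<close>
  and \<open>- \<theta>\<close>.\<close>

lemma braid_vanish:
  assumes i: "i \<in> {1..<n}" "Suc i \<in> {1..<n}" and \<theta>: "\<theta> \<noteq> 0" "\<theta>\<^sup>2 \<noteq> - 1"
    and w: "G i * w = sc (- inverse \<theta>) * w" "G (Suc i) * w = sc \<theta> * w"
  shows "w = 0"
proof -
  note w' = w[unfolded sc_smul]
  have "G i * (G (Suc i) * (G i * w)) = G (Suc i) * (G i * (G (Suc i) * w))"
    using arg_cong[OF braid[of i], of "\<lambda>x. x * w"] i by (simp add: mult.assoc)
  then have "smul (inverse \<theta>) w = smul (- \<theta>) w"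
    using \<theta>(1) by (simp add: w' smul_simps)
  then have "smul (inverse \<theta> + \<theta>) w = 0"
    using smul_distrib(1)[of "- \<theta>" \<theta> w] by (simp add: smul_distrib(1) smul_simps)
  moreover have "inverse \<theta> + \<theta> \<noteq> 0"
    using \<theta> by (auto simp: field_simps power2_eq_square add_eq_0_iff)
  ultimately show ?thesis unfolding smul_def by (rule sc_cancel)
qed

text \<open>The pairs of weights for which the intertwiner of two neighbouring positions may fail to exist
  or to be injective.\<close>

definition linked :: "'k \<times> 'k \<Rightarrow> 'k \<times> 'k \<Rightarrow> bool" where
  "linked x y \<longleftrightarrow> snd x = snd y \<and> (fst x = fst y \<or> fst x = q\<^sup>2 * fst y \<or> fst y = q\<^sup>2 * fst x)"

text \<open>A weight that is not linked to those after it is moved to the right by intertwiners. They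
  commute with \<open>G h\<close>, whose eigenvalue is therefore kept.\<close>

lemma transport:
  assumes "WV (pre @ x # mid @ post) zs w" "\<And>y. y \<in> set mid \<Longrightarrow> \<not> linked x y"
    "length pre + length mid + 1 < h" "h < n" "G h * w = sc \<theta> * w"
  shows "\<exists>w'. WV (pre @ mid @ x # post) zs w' \<and> G h * w' = sc \<theta> * w' \<and> (w' = 0 \<longrightarrow> w = 0)"
  using assms
proof (induction mid arbitrary: pre w)
  case (Cons y mid)
  obtain a z b z' where xy: "x = (a, z)" "y = (b, z')" by (cases x; cases y)
  define i where "i = Suc (length pre)"
  define k where "k = (if z = z' then \<kappa> * b / (a - b) else 0)"
  define s where "s = G i * w + sc k * w"
  have w: "WV (pre @ (a, z) # (b, z') # mid @ post) zs w" using Cons.prems(1) xy by simp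
  have nl: "\<not> linked (a, z) (b, z')" using Cons.prems(2)[of y] xy by simp
  have s1: "WV (pre @ (b, z') # (a, z) # mid @ post) zs s"
    unfolding s_def by (rule WV_swap[OF w _ k_def i_def]) (use nl in \<open>auto simp: linked_def\<close>)
  have i': "i \<in> {1..<n}" using w by (simp add: WV_def i_def)
  have "G h * G i = G i * G h" using Cons.prems(3,4) i' by (intro GG') (auto simp: i_def)
  then have s2: "G h * s = sc \<theta> * s" unfolding s_def by (rule eigen_other) (rule Cons.prems(5))
  have s3: "w = 0" if "s = 0"
  proof (rule swap_zero[OF i'])
    show "X i * w = sc a * w" "X (Suc i) * w = sc b * w" "T i * w = sc z * w" "T (Suc i) * w = sc z' * w"
      "z ^ r = 1" "z' ^ r = 1"
    using WV_last[of pre a z "z' # map snd (mid @ post) @ zs" w]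
      WV_last[of "pre @ [(a, z)]" b z' "map snd (mid @ post) @ zs" w]
      WV_append[of "pre @ [(a, z)]" "(b, z') # (mid @ post)" zs w]
      WV_append[of "pre @ [(a, z), (b, z')]" "mid @ post" zs w] w by (simp_all add: i_def)
  qed (use that nl k_def in \<open>auto simp: s_def linked_def\<close>)
  have "\<exists>w'. WV ((pre @ [y]) @ mid @ x # post) zs w' \<and> G h * w' = sc \<theta> * w' \<and> (w' = 0 \<longrightarrow> s = 0)"
    by (rule Cons.IH) (use s1 s2 Cons.prems xy in auto)
  then show ?case using s3 by auto
qed auto

text \<open>The contents \<open>\<theta>\<^sup>2 c, \<dots>, c, \<theta>\<^sup>2 c\<close> cannot occur in
  this way. By \<open>H1\<close> the exchange of the last two weights gives zero, so the last generator acts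
  by \<open>\<theta>\<close>; the first weight is moved next to \<open>c\<close>, and by \<open>H2\<close>
  exchanging it with \<open>c\<close> also gives zero, so the generator before acts by \<open>- 1 /
  \<theta>\<close>; now the braid relation applies. Both \<open>\<theta> = q\<close> and \<open>\<theta> = -
  1 / q\<close> satisfy the hypotheses, which treats rows and columns at once.\<close>

lemma exclude_linked:
  assumes \<theta>: "\<theta> \<noteq> 0" "\<theta>\<^sup>2 \<noteq> - 1" "\<theta>\<^sup>2 \<noteq> 1" "\<kappa> = \<theta> - inverse \<theta>" and c: "c \<noteq> 0"
    and w: "WV (pre @ (\<theta>\<^sup>2 * c, z) # mid @ [(c, z), (\<theta>\<^sup>2 * c, z)]) zs w"
    and mid: "\<And>y. y \<in> set mid \<Longrightarrow> \<not> linked (\<theta>\<^sup>2 * c, z) y"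
    and H1: "\<And>s. WV (pre @ (\<theta>\<^sup>2 * c, z) # mid @ [(\<theta>\<^sup>2 * c, z)]) [] s \<Longrightarrow> s = 0"
    and H2: "\<And>s. WV (pre @ mid @ [(c, z)]) [] s \<Longrightarrow> s = 0"
  shows "w = 0"
proof -
  define h where "h = Suc (Suc (length pre + length mid))"
  have h: "h < n" using w by (simp add: WV_def h_def)
  have k1: "\<kappa> * (\<theta>\<^sup>2 * c) / (c - \<theta>\<^sup>2 * c) = - \<theta>"
  proof -
    have "\<kappa> * (\<theta>\<^sup>2 * c) = - \<theta> * (c - \<theta>\<^sup>2 * c)" using \<theta>(1) by (simp add: \<theta>(4) field_simps power2_eq_square)
    moreover have "c - \<theta>\<^sup>2 * c \<noteq> 0" using \<theta>(3) c by simp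
    ultimately show ?thesis by (simp add: eq_divide_eq)
  qed
  have k2: "\<kappa> * c / (\<theta>\<^sup>2 * c - c) = inverse \<theta>"
  proof -
    have "\<kappa> * c = inverse \<theta> * (\<theta>\<^sup>2 * c - c)" using \<theta>(1) by (simp add: \<theta>(4) field_simps power2_eq_square)
    moreover have "\<theta>\<^sup>2 * c - c \<noteq> 0" using \<theta>(3) c by simp
    ultimately show ?thesis by (simp add: eq_divide_eq)
  qed
  have "WV ((pre @ (\<theta>\<^sup>2 * c, z) # mid) @ (\<theta>\<^sup>2 * c, z) # (c, z) # []) zs (G h * w + sc (- \<theta>) * w)"
    by (rule WV_swap) (use w \<theta>(3) c k1 in \<open>simp_all add: h_def\<close>)
  then have "G h * w + sc (- \<theta>) * w = 0"
    by (intro H1 WV_prefix[of "pre @ (\<theta>\<^sup>2 * c, z) # mid @ [(\<theta>\<^sup>2 * c, z)]" "[(c, z)]" zs]) simp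
  then have "G h * w = sc \<theta> * w" by (simp add: sc_minus)
  from transport[OF w mid _ h this] obtain w' where w': "WV (pre @ mid @ (\<theta>\<^sup>2 * c, z) # [(c, z), (\<theta>\<^sup>2 * c, z)]) zs w'"
      "G h * w' = sc \<theta> * w'" "w' = 0 \<Longrightarrow> w = 0" by (auto simp: h_def)
  have "WV ((pre @ mid) @ (c, z) # (\<theta>\<^sup>2 * c, z) # [(\<theta>\<^sup>2 * c, z)]) zs (G (h - 1) * w' + sc (inverse \<theta>) * w')"
    by (rule WV_swap) (use w' \<theta>(3) c k2 in \<open>simp_all add: h_def\<close>)
  then have "G (h - 1) * w' + sc (inverse \<theta>) * w' = 0"
    by (intro H2 WV_prefix[of "pre @ mid @ [(c, z)]" "[(\<theta>\<^sup>2 * c, z), (\<theta>\<^sup>2 * c, z)]" zs]) simp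
  then have "G (h - 1) * w' = sc (- inverse \<theta>) * w'" by (simp add: sc_minus eq_neg_iff_add_eq_0)
  then have "w' = 0"
    using braid_vanish[of "h - 1" \<theta> w'] \<theta> w'(2) h by (simp add: h_def)
  then show ?thesis by (rule w'(3))
qed

end

section \<open>Diagrams and standard sequences of boxes\<close>

definition young :: "node set \<Rightarrow> bool" where
  "young D \<longleftrightarrow> finite D \<and> (\<forall>x y k l. ((x, y), k, l) \<in> D \<longrightarrow> 1 \<le> x \<and> 1 \<le> y \<and>
     (\<forall>x' y'. 1 \<le> x' \<and> x' \<le> x \<and> 1 \<le> y' \<and> y' \<le> y \<longrightarrow> ((x', y'), k, l) \<in> D))"

lemma youngD:
  assumes "young D" "((x, y), k, l) \<in> D"
  shows "1 \<le> x" "1 \<le> y" "\<lbrakk>1 \<le> x'; x' \<le> x; 1 \<le> y'; y' \<le> y\<rbrakk> \<Longrightarrow> ((x', y'), k, l) \<in> D"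
  using assms unfolding young_def by blast+

lemma young_finite: "young D \<Longrightarrow> finite D"
  by (simp add: young_def)

lemma young_empty [simp]: "young {}"
  by (simp add: young_def)

lemma young_Un: "young D \<Longrightarrow> young D' \<Longrightarrow> young (D \<union> D')"
  unfolding young_def by blast

definition standard :: "node list \<Rightarrow> bool" where
  "standard bs \<longleftrightarrow> distinct bs \<and> (\<forall>j\<le>length bs. young (set (take j bs)))"

lemma standard_Nil [simp]: "standard []"
  by (simp add: standard_def)

lemma standard_snoc: "standard (bs @ [b]) \<longleftrightarrow> standard bs \<and> b \<notin> set bs \<and> young (insert b (set bs))"
  unfolding standard_def by (auto simp: le_Suc_eq)

lemma standard_take: "standard bs \<Longrightarrow> standard (take j bs)"
  unfolding standard_def by (auto simp: min_def)

lemma standard_prefix: "standard (bs @ bs') \<Longrightarrow> standard bs"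
  using standard_take[of "bs @ bs'" "length bs"] by simp

lemma standard_young: "standard bs \<Longrightarrow> young (set bs)"
  unfolding standard_def by force

definition addable :: "nat \<Rightarrow> nat \<Rightarrow> node set \<Rightarrow> node set" where
  "addable d p D = {b. b \<notin> D \<and> young (insert b D) \<and> pos_r b = p \<and> pos_d b \<in> {1..d}}"

text \<open>The first column and the first row up to the larger coordinates are contained in the
  component.\<close>

lemma card_component:
  assumes D: "young D" and b: "((x, y), k, l) \<in> D" "((x', y'), k, l) \<in> D"
  shows "\<bar>node_content ((x, y), k, l) - node_content ((x', y'), k, l)\<bar> + 1
    \<le> int (card {b \<in> D. pos_r b = k \<and> pos_d b = l})"
proof -
  define m where "m = max x x'"
  define m' where "m' = max y y'"
  let ?A = "(\<lambda>i. ((i, 1), k, l)) ` {1..m} :: node set" and ?B = "(\<lambda>j. ((1, j), k, l)) ` {2..m'} :: node set"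
  have "?A \<union> ?B \<subseteq> {b \<in> D. pos_r b = k \<and> pos_d b = l}"
    using youngD[OF D b(1)] youngD[OF D b(2)] unfolding m_def m'_def
    by (auto simp: pos_r_def pos_d_def max_def split: if_splits)
  then have "card (?A \<union> ?B) \<le> card {b \<in> D. pos_r b = k \<and> pos_d b = l}"
    by (intro card_mono) (use young_finite[OF D] in auto)
  also have "card (?A \<union> ?B) = card ?A + card ?B"
    by (intro card_Un_disjoint) auto
  also have "card ?A = m" by (subst card_image) (auto simp: inj_on_def)
  also have "card ?B = m' - 1" by (subst card_image) (auto simp: inj_on_def)
  finally show ?thesis
    using youngD(1,2)[OF D b(1)] youngD(1,2)[OF D b(2)] unfolding m_def m'_def node_content_def by simp
qed

lemma content_bound:
  assumes D: "young D" and b: "((x, y), k, l) \<in> D"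
  shows "\<bar>node_content ((x, y), k, l)\<bar> + 1 \<le> int (card {b \<in> D. pos_r b = k \<and> pos_d b = l})"
  using card_component[OF D b, of 1 1] youngD[OF D b] by (simp add: node_content_def)

lemma finite_addable: 
  assumes "finite D"
  shows "finite (addable d p D)"
proof -
  have "addable d p D \<subseteq> (\<lambda>((x, y), l). ((x, y), p, l)) ` (({1..Suc (card D)} \<times> {1..Suc (card D)}) \<times> {1..d})"
  proof
    fix b assume "b \<in> addable d p D"
    moreover obtain x y k l where b: "b = ((x, y), k, l)" by (metis prod.collapse)
    ultimately have b': "young (insert b D)" "b \<notin> D" "k = p" "l \<in> {1..d}"
      by (auto simp: addable_def pos_r_def pos_d_def)
    have bb: "((x, y), k, l) \<in> insert b D" using b by simp
    note Y = youngD[OF b'(1) bb]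
    have "(\<lambda>i. ((i, y), k, l)) ` {1..x} \<subseteq> insert b D" "(\<lambda>i. ((x, i), k, l)) ` {1..y} \<subseteq> insert b D"
      by (rule image_subsetI, rule Y(3); use Y(1,2) in simp)+
    then have "card ((\<lambda>i. ((i, y), k, l)) ` {1..x}) \<le> card (insert b D)"
      "card ((\<lambda>i. ((x, i), k, l)) ` {1..y}) \<le> card (insert b D)"
      using assms by (auto intro!: card_mono)
    moreover have "card ((\<lambda>i. ((i, y), k, l)) ` {1..x}) = x" "card ((\<lambda>i. ((x, i), k, l)) ` {1..y}) = y"
      by (subst card_image; auto simp: inj_on_def)+
    ultimately have "x \<le> Suc (card D)" "y \<le> Suc (card D)" using assms b'(2) by auto
    then show "b \<in> (\<lambda>((x, y), l). ((x, y), p, l)) ` (({1..Suc (card D)} \<times> {1..Suc (card D)}) \<times> {1..d})"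
      using youngD(1,2)[OF b'(1), of x y k l] b' b by force
  qed
  then show ?thesis by (rule finite_subset) auto
qed

text \<open>Boxes of different colours do not interact.\<close>

lemma addable_insert_other:
  assumes "young D" "young (insert b D)" "pos_r b \<noteq> p"
  shows "addable d p (insert b D) = addable d p D"
proof -
  have "young (insert c (insert b D)) \<longleftrightarrow> young (insert c D)" if "pos_r c = p" for c
  proof
    assume "young (insert c D)"
    then show "young (insert c (insert b D))"
      using young_Un[OF _ assms(2), of "insert c D"] by (simp add: insert_commute Un_commute insert_absorb)
  next
    assume Y: "young (insert c (insert b D))"
    obtain cx cy ck cl where c: "c = ((cx, cy), ck, cl)" by (metis prod.collapse)
    obtain bx "by" bk bl where b: "b = ((bx, by), bk, bl)" by (metis prod.collapse)
    have bc: "bk \<noteq> ck" using assms(3) that by (simp add: b c pos_r_def)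
    show "young (insert c D)"
      unfolding young_def
    proof (intro conjI allI impI)
      show "finite (insert c D)" using young_finite[OF assms(1)] by simp
      fix x y k l assume x: "((x, y), k, l) \<in> insert c D"
      have x': "((x, y), k, l) \<in> insert c (insert b D)" using x by auto
      show "1 \<le> x" "1 \<le> y" using youngD[OF Y x'] by auto
      fix x'' y'' assume *: "1 \<le> x'' \<and> x'' \<le> x \<and> 1 \<le> y'' \<and> y'' \<le> y"
      show "((x'', y''), k, l) \<in> insert c D"
      proof (cases "((x, y), k, l) = c")
        case True
        then show ?thesis using youngD(3)[OF Y x', of x'' y''] * bc by (auto simp: b c)
      next
        case False
        then show ?thesis using youngD(3)[OF assms(1), of x y k l x'' y''] * x by auto
      qed
    qed
  qed
  then show ?thesis using assms(3) by (auto simp: addable_def)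
qed

lemma addable_insert_mono:
  assumes "c \<in> addable d p D" "young (insert b D)" "c \<noteq> b"
  shows "c \<in> addable d p (insert b D)"
proof -
  have "young (insert c D \<union> insert b D)" using assms by (intro young_Un) (auto simp: addable_def)
  also have "insert c D \<union> insert b D = insert c (insert b D)" by auto
  finally show ?thesis using assms by (auto simp: addable_def)
qed

lemma young_remove:
  assumes D: "young D" and max: "((Suc x, y), k, l) \<notin> D" "((x, Suc y), k, l) \<notin> D" and x: "1 \<le> x" "1 \<le> y"
  shows "young (D - {((x, y), k, l)})"
  unfolding young_def
proof (intro conjI allI impI)
  show "finite (D - {((x, y), k, l)})" using young_finite[OF D] by simp
  fix x1 y1 k1 l1 assume b: "((x1, y1), k1, l1) \<in> D - {((x, y), k, l)}"
  show "1 \<le> x1" "1 \<le> y1" using youngD[OF D, of x1 y1 k1 l1] b by auto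
  fix x2 y2 assume *: "1 \<le> x2 \<and> x2 \<le> x1 \<and> 1 \<le> y2 \<and> y2 \<le> y1"
  have "((x2, y2), k1, l1) \<noteq> ((x, y), k, l)"
  proof
    assume eq: "((x2, y2), k1, l1) = ((x, y), k, l)"
    then have "x < x1 \<or> y < y1" using * b by auto
    then show False
      using youngD(3)[OF D, of x1 y1 k l "Suc x" y] youngD(3)[OF D, of x1 y1 k l x "Suc y"] max * b eq x by auto
  qed
  then show "((x2, y2), k1, l1) \<in> D - {((x, y), k, l)}"
    using youngD(3)[OF D, of x1 y1 k1 l1 x2 y2] * b by auto
qed

lemma young_insert_right:
  assumes D: "young D" "young (insert ((x, y), k, l) D)"
    and h: "x = 1 \<or> ((x - 1, Suc y), k, l) \<in> D"
  shows "young (insert ((x, Suc y), k, l) (insert ((x, y), k, l) D))"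
proof -
  let ?b = "((x, y), k, l)"
  let ?L = "insert ?b D"
  note Y = youngD[OF D(2) insertI1]
  show ?thesis
    unfolding young_def
  proof (intro conjI allI impI)
    show "finite (insert ((x, Suc y), k, l) ?L)" using young_finite[OF D(1)] by simp
    fix x1 y1 k1 l1 assume b: "((x1, y1), k1, l1) \<in> insert ((x, Suc y), k, l) ?L"
    have in_L: "((x2, y2), k1, l1) \<in> ?L" if "1 \<le> x2" "x2 \<le> x1" "1 \<le> y2" "y2 \<le> y1"
      "((x1, y1), k1, l1) \<in> ?L" for x2 y2
      using youngD(3)[OF D(2) that(5,1-4)] .
    show "1 \<le> x1" "1 \<le> y1" using b Y(1,2) youngD(1,2)[OF D(1), of x1 y1 k1 l1] by auto
    fix x2 y2 assume c: "1 \<le> x2 \<and> x2 \<le> x1 \<and> 1 \<le> y2 \<and> y2 \<le> y1"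
    show "((x2, y2), k1, l1) \<in> insert ((x, Suc y), k, l) ?L"
    proof (cases "((x1, y1), k1, l1) \<in> ?L")
      case True
      then show ?thesis using in_L c by blast
    next
      case False
      then have t: "x1 = x" "y1 = Suc y" "k1 = k" "l1 = l" using b by auto
      have "(x2 = x \<and> y2 = Suc y) \<or> y2 \<le> y \<or> (x2 \<le> x - 1 \<and> x \<noteq> 1)" using c t by linarith
      then show ?thesis
      proof (elim disjE conjE)
        assume "y2 \<le> y"
        then have "((x2, y2), k, l) \<in> ?L" using Y(3)[of x2 y2] c t by blast
        then show ?thesis using t by blast
      next
        assume "x2 \<le> x - 1" "x \<noteq> 1"
        then have "((x2, y2), k, l) \<in> D" using youngD(3)[OF D(1), of "x - 1" "Suc y" k l x2 y2] c t h by blast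
        then show ?thesis using t by blast
      qed (use t in auto)
    qed
  qed
qed

text \<open>If no box can be added to the right of the last box, then the box above the last one has the
  content in question. It can be left out, and the boxes of its component that were added after it have
  contents far away from its own: this is the combinatorial input for excluding an eigenvalue.\<close>

lemma addable_right_blocked:
  assumes std: "standard (bs @ [((x, y), k, l)])"
    and na: "\<not> young (insert ((x, Suc y), k, l) (insert ((x, y), k, l) (set bs)))"
  obtains pre mid where "1 < x" "bs = pre @ ((x - 1, y), k, l) # mid"
    "\<And>x' y'. ((x', y'), k, l) \<in> set mid \<Longrightarrow> 2 \<le> \<bar>(int y' - int x') - (int y - int x + 1)\<bar>"
    "standard (pre @ mid)"
    "\<And>x' y'. young (insert ((x', y'), k, l) (set (pre @ mid))) \<Longrightarrow> ((x', y'), k, l) \<notin> set (pre @ mid) \<Longrightarrow>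
       int y' - int x' \<noteq> int y - int x"
proof -
  let ?\<beta> = "((x, y), k, l)"
  define D where "D = set bs"
  have D: "young D" "?\<beta> \<notin> D" "young (insert ?\<beta> D)" "standard bs"
    using std standard_young by (auto simp: D_def standard_snoc)
  have pos: "1 \<le> x" "1 \<le> y" using youngD[OF D(3), of x y k l] by auto
  have "\<not> (x = 1 \<or> ((x - 1, Suc y), k, l) \<in> D)"
    using young_insert_right[OF D(1,3)] na unfolding D_def by blast
  then have x1: "1 < x" and nD: "((x - 1, Suc y), k, l) \<notin> D" using pos by auto
  let ?\<alpha> = "((x - 1, y), k, l)"
  have "?\<alpha> \<in> insert ?\<beta> D" by (rule youngD(3)[OF D(3), of x y k l]) (use x1 pos in auto)
  then have aD: "?\<alpha> \<in> set bs" using x1 by (auto simp: D_def)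
  then obtain pre mid where bs: "bs = pre @ ?\<alpha> # mid" by (meson split_list)
  have dist: "distinct bs" using D(4) by (simp add: standard_def)
  have "standard (pre @ [?\<alpha>])" using D(4) standard_prefix[of "pre @ [?\<alpha>]" mid] by (simp add: bs)
  then have pre: "young (insert ?\<alpha> (set pre))" by (simp add: standard_snoc)
  have nb: "((x', y'), k, l) \<notin> set mid" if "1 \<le> x'" "x' \<le> x - 1" "1 \<le> y'" "y' \<le> y" for x' y'
    using youngD(3)[OF pre, of "x - 1" y k l x' y'] that dist by (auto simp: bs)
  show thesis
  proof (rule that[OF x1 bs])
    fix x' y' assume m: "((x', y'), k, l) \<in> set mid"
    then have mD: "((x', y'), k, l) \<in> D" by (simp add: D_def bs)
    note Y = youngD[OF D(1) mD]
    have "1 \<le> x - 1" "1 \<le> Suc y" using x1 by auto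
    then have n1: "\<not> (x - 1 \<le> x' \<and> Suc y \<le> y')" using Y(3)[of "x - 1" "Suc y"] nD by blast
    have n2: "\<not> (x \<le> x' \<and> y \<le> y')" using Y(3)[of x y] D(2) pos by auto
    have n3: "\<not> (x' \<le> x - 1 \<and> y' \<le> y)" using nb[of x' y'] Y(1,2) m by auto
    show "2 \<le> \<bar>(int y' - int x') - (int y - int x + 1)\<bar>"
    proof -
      have "x' < x - 1 \<or> y' \<le> y" "x' < x \<or> y' < y" "x - 1 < x' \<or> y < y'"
        using n1 n2 n3 by linarith+
      then show ?thesis using x1 by (elim disjE) linarith+
    qed
  next
    have rm: "young (E - {?\<alpha>})" if "young E" "E \<subseteq> D" for E
    proof -
      have "((Suc (x - 1), y), k, l) \<notin> E" "((x - 1, Suc y), k, l) \<notin> E" "1 \<le> x - 1" "1 \<le> y"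
        using that(2) nD D(2) x1 pos by auto
      from young_remove[OF that(1) this] show ?thesis .
    qed
    show "standard (pre @ mid)"
      unfolding standard_def
    proof (intro conjI allI impI)
      show "distinct (pre @ mid)" using dist by (simp add: bs)
      fix j assume j: "j \<le> length (pre @ mid)"
      show "young (set (take j (pre @ mid)))"
      proof (cases "j \<le> length pre")
        case True
        then have "take j (pre @ mid) = take j bs" "j \<le> length bs" by (simp_all add: bs)
        then show ?thesis using D(4) unfolding standard_def by simp
      next
        case False
        then have t: "take (Suc j) bs = pre @ ?\<alpha> # take (j - length pre) mid" by (simp add: bs Suc_diff_le)
        have "young (set (take (Suc j) bs))" using D(4) j unfolding standard_def by (simp add: bs)
        then have "young (set (take (Suc j) bs) - {?\<alpha>})"
          by (rule rm) (use set_take_subset[of "Suc j" bs] in \<open>auto simp: D_def\<close>)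
        also have "set (take (Suc j) bs) - {?\<alpha>} = set (take j (pre @ mid))"
          using False dist set_take_subset[of "j - length pre" mid] unfolding t by (auto simp: bs)
        finally show ?thesis .
      qed
    qed
  next
    fix x' y' assume Y: "young (insert ((x', y'), k, l) (set (pre @ mid)))" and nin: "((x', y'), k, l) \<notin> set (pre @ mid)"
    show "int y' - int x' \<noteq> int y - int x"
    proof
      assume e: "int y' - int x' = int y - int x"
      have an: "?\<alpha> \<notin> set (pre @ mid)" using dist by (simp add: bs)
      have bn: "?\<beta> \<notin> set (pre @ mid)" using D(2) by (auto simp: bs D_def)
      show False
      proof (cases "x \<le> x'")
        case True
        then have "?\<alpha> \<in> insert ((x', y'), k, l) (set (pre @ mid))"
          by (intro youngD(3)[OF Y insertI1]) (use True e x1 pos in linarith)+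
        moreover have "?\<alpha> \<noteq> ((x', y'), k, l)" using True x1 by auto
        ultimately show False using an by blast
      next
        case False
        have "((x', y'), k, l) \<in> insert ?\<beta> D"
          by (intro youngD(3)[OF D(3) insertI1] youngD(1,2)[OF Y insertI1]) (use False e in linarith)+
        moreover have "((x', y'), k, l) \<noteq> ?\<alpha>" "((x', y'), k, l) \<noteq> ?\<beta>" using e x1 False by auto
        ultimately have "((x', y'), k, l) \<in> D" "((x', y'), k, l) \<noteq> ?\<alpha>" by blast+
        then show False using nin by (auto simp: D_def bs)
      qed
    qed
  qed
qed

text \<open>Conjugation of diagrams. It exchanges rows and columns and changes the sign of contents, so that
  statements about the box below follow from those about the box to the right.\<close>

definition flip :: "node \<Rightarrow> node" where
  "flip = (\<lambda>((x, y), k, l). ((y, x), k, l))"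

lemma flip_simps [simp]: "flip ((x, y), k, l) = ((y, x), k, l)"
  by (simp add: flip_def)

lemma flip_flip [simp]: "flip (flip b) = b"
  by (cases b) (auto simp: flip_def)

lemma inj_flip: "inj flip"
  by (rule inj_on_inverseI[of _ flip]) simp

lemma flip_image_iff: "b \<in> flip ` D \<longleftrightarrow> flip b \<in> D"
proof
  assume "flip b \<in> D"
  then have "flip (flip b) \<in> flip ` D" by (rule imageI)
  then show "b \<in> flip ` D" by simp
qed auto

lemma young_flip: "young D \<Longrightarrow> young (flip ` D)"
proof -
  assume D: "young D"
  show ?thesis
    unfolding young_def flip_image_iff flip_simps
  proof (intro conjI allI impI)
    fix x y k l assume b: "((y, x), k, l) \<in> D"
    show "1 \<le> x" "1 \<le> y" by (fact youngD(2)[OF D b], fact youngD(1)[OF D b])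
    fix x' y' assume "1 \<le> x' \<and> x' \<le> x \<and> 1 \<le> y' \<and> y' \<le> y"
    then show "((y', x'), k, l) \<in> D" by (intro youngD(3)[OF D b]) blast+
  qed (use young_finite[OF D] in simp)
qed

lemma young_flip_iff: "young (flip ` D) \<longleftrightarrow> young D"
proof
  have "flip ` flip ` D = D" by (simp add: image_image)
  then show "young (flip ` D) \<Longrightarrow> young D" using young_flip[of "flip ` D"] by simp
qed (rule young_flip)

lemma standard_flip_iff: "standard (map flip bs) \<longleftrightarrow> standard bs"
  unfolding standard_def by (simp add: distinct_map inj_on_subset[OF inj_flip] take_map young_flip_iff)

lemma addable_below_blocked:
  assumes std: "standard (bs @ [((x, y), k, l)])"
    and na: "\<not> young (insert ((Suc x, y), k, l) (insert ((x, y), k, l) (set bs)))"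
  obtains pre mid where "1 < y" "bs = pre @ ((x, y - 1), k, l) # mid"
    "\<And>x' y'. ((x', y'), k, l) \<in> set mid \<Longrightarrow> 2 \<le> \<bar>(int y' - int x') - (int y - int x - 1)\<bar>"
    "standard (pre @ mid)"
    "\<And>x' y'. young (insert ((x', y'), k, l) (set (pre @ mid))) \<Longrightarrow> ((x', y'), k, l) \<notin> set (pre @ mid) \<Longrightarrow>
       int y' - int x' \<noteq> int y - int x"
proof -
  have 1: "standard (map flip bs @ [((y, x), k, l)])"
    using standard_flip_iff[of "bs @ [((x, y), k, l)]"] std by simp
  have 2: "\<not> young (insert ((y, Suc x), k, l) (insert ((y, x), k, l) (set (map flip bs))))"
    using young_flip_iff[of "insert ((Suc x, y), k, l) (insert ((x, y), k, l) (set bs))"] na by simp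
  show thesis
  proof (rule addable_right_blocked[OF 1 2])
  fix pre mid assume *: "1 < y" "map flip bs = pre @ ((y - 1, x), k, l) # mid"
    "\<And>x' y'. ((x', y'), k, l) \<in> set mid \<Longrightarrow> 2 \<le> \<bar>(int y' - int x') - (int x - int y + 1)\<bar>"
    "standard (pre @ mid)"
    "\<And>x' y'. young (insert ((x', y'), k, l) (set (pre @ mid))) \<Longrightarrow> ((x', y'), k, l) \<notin> set (pre @ mid) \<Longrightarrow>
       int y' - int x' \<noteq> int x - int y"
  have bs: "bs = map flip pre @ ((x, y - 1), k, l) # map flip mid"
    using arg_cong[OF *(2), of "map flip"] by (simp add: comp_def)
  show thesis
  proof (rule that[OF *(1) bs])
    fix x' y' assume "((x', y'), k, l) \<in> set (map flip mid)"
    then have "((y', x'), k, l) \<in> set mid" by (simp add: flip_image_iff)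
    from *(3)[OF this] show "2 \<le> \<bar>(int y' - int x') - (int y - int x - 1)\<bar>" by linarith
  next
    show "standard (map flip pre @ map flip mid)"
      using standard_flip_iff[of "pre @ mid"] *(4) by simp
  next
    fix x' y' assume 1: "young (insert ((x', y'), k, l) (set (map flip pre @ map flip mid)))"
      and 2: "((x', y'), k, l) \<notin> set (map flip pre @ map flip mid)"
    have "young (insert ((y', x'), k, l) (set (pre @ mid)))"
      using young_flip[OF 1] by (simp add: image_Un image_image)
    moreover have "((y', x'), k, l) \<notin> set (pre @ mid)"
      using 2 by (simp add: flip_image_iff)
    ultimately show "int y' - int x' \<noteq> int y - int x"
      using *(5)[of y' x'] by linarith
  qed
  qed
qed

section \<open>Contents\<close>

lemma addable_not_adjacent:
  assumes "young (insert ((x, y), k, l) D)" "young (insert ((x', y'), k, l) D)"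
    "((x, y), k, l) \<notin> D" "((x', y'), k, l) \<notin> D"
  shows "int y' - int x' \<noteq> int y - int x + 1"
proof
  assume e: "int y' - int x' = int y - int x + 1"
  note Y = youngD[OF assms(1) insertI1] and Y' = youngD[OF assms(2) insertI1]
  show False
  proof (cases "x' < x")
    case True
    then have "((x', y'), k, l) \<in> insert ((x, y), k, l) D"
      by (intro Y(3) Y'(1,2)) (use e in linarith)+
    then show False using assms(4) True by auto
  next
    case False
    then have "((x, y), k, l) \<in> insert ((x', y'), k, l) D"
      by (intro Y'(3) Y(1,2)) (use e in linarith)+
    then show False using assms(3) e by auto
  qed
qed

text \<open>The form in which the nonvanishing of the product of parameters is used.\<close>

locale separated_parameters =
  fixes n d :: nat and q :: "'k::field" and v :: "nat \<Rightarrow> 'k"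
  assumes q_nonzero: "q \<noteq> 0"
    and v_nonzero: "l \<in> {1..d} \<Longrightarrow> v l \<noteq> 0"
    and q_separated: "\<lbrakk>2 \<le> n; 1 \<le> j; j \<le> n\<rbrakk> \<Longrightarrow> q ^ (2 * j) \<noteq> 1"
    and v_separated: "\<lbrakk>l \<in> {1..d}; l' \<in> {1..d}; l \<noteq> l'; \<bar>m\<bar> < int n\<rbrakk> \<Longrightarrow> v l \<noteq> q powi (2 * m) * v l'"
begin

definition cont :: "node \<Rightarrow> 'k" where
  "cont b = v (pos_d b) * q powi (2 * node_content b)"

lemma cont_nonzero: "pos_d b \<in> {1..d} \<Longrightarrow> cont b \<noteq> 0"
  using v_nonzero q_nonzero by (simp add: cont_def)

lemma q_powi_separated: "\<lbrakk>2 \<le> n; j \<noteq> 0; \<bar>j\<bar> \<le> int n\<rbrakk> \<Longrightarrow> q powi (2 * j) \<noteq> 1"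
proof -
  assume n: "2 \<le> n" and j: "j \<noteq> 0" "\<bar>j\<bar> \<le> int n"
  define m where "m = nat \<bar>j\<bar>"
  have "q ^ (2 * m) \<noteq> 1" using q_separated[OF n, of m] j by (simp add: m_def)
  moreover have "q powi (2 * j) = q ^ (2 * m) \<or> q powi (2 * j) = inverse (q ^ (2 * m))"
  proof (cases "0 \<le> j")
    case True
    then have "2 * j = int (2 * m)" by (simp add: m_def)
    then show ?thesis by (metis power_int_of_nat)
  next
    case False
    then have "2 * j = - int (2 * m)" by (simp add: m_def)
    then show ?thesis by (metis power_int_of_nat power_int_minus)
  qed
  ultimately show ?thesis by (metis inverse_eq_1_iff)
qed

text \<open>A diagram with two boxes in different components of the same colour has enough other boxes to
  keep the difference of their contents within the range in which the parameters are separated.\<close>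

lemma cont_separated:
  assumes n: "2 \<le> n" and D: "young D" "int (card D) + \<bar>e\<bar> \<le> int n + 1" and b: "b \<in> D" "b' \<in> D"
    and r: "pos_r b = pos_r b'" and d: "pos_d b \<in> {1..d}" "pos_d b' \<in> {1..d}"
    and eq: "cont b = q powi (2 * e) * cont b'"
  shows "pos_d b = pos_d b' \<and> node_content b = node_content b' + e"
proof -
  obtain x y k l where b': "b = ((x, y), k, l)" by (metis prod.collapse)
  obtain x' y' k' l' where b'': "b' = ((x', y'), k', l')" by (metis prod.collapse)
  have k: "k' = k" using r by (simp add: b' b'' pos_r_def)
  define j where "j = node_content b' + e - node_content b"
  have eq': "v (pos_d b) = q powi (2 * j) * v (pos_d b')"
  proof -
    have "v (pos_d b) * (q powi (2 * node_content b) * q powi (- (2 * node_content b))) =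
        q powi (2 * e) * q powi (2 * node_content b') * q powi (- (2 * node_content b)) * v (pos_d b')"
      using eq unfolding cont_def by (simp add: mult_ac)
    also have "q powi (2 * node_content b) * q powi (- (2 * node_content b)) = 1"
      using q_nonzero by (simp flip: power_int_add)
    also have "q powi (2 * e) * q powi (2 * node_content b') * q powi (- (2 * node_content b)) = q powi (2 * j)"
      using q_nonzero by (simp add: j_def power_int_add[symmetric] algebra_simps)
    finally show ?thesis by simp
  qed
  let ?C = "\<lambda>l. {b \<in> D. pos_r b = k \<and> pos_d b = l}"
  have fin: "finite D" using young_finite[OF D(1)] .
  have ll: "pos_d b = pos_d b'"
  proof (rule ccontr)
    assume ne: "pos_d b \<noteq> pos_d b'"
    then have "card (?C l) + card (?C l') = card (?C l \<union> ?C l')"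
      using fin by (subst card_Un_disjoint) (auto simp: b' b'' pos_d_def)
    also have "\<dots> \<le> card D" using fin by (intro card_mono) auto
    finally have "\<bar>j\<bar> < int n"
      using content_bound[OF D(1), of x y k l] content_bound[OF D(1), of x' y' k l'] b D(2)
      by (simp add: j_def b' b'' k)
    with v_separated[OF d ne, of j] eq' show False by simp
  qed
  then have "l' = l" by (simp add: b' b'' pos_d_def)
  have "card (?C l) \<le> card D" using fin by (intro card_mono) auto
  then have "\<bar>j\<bar> \<le> int n"
    using card_component[OF D(1), of x y k l x' y'] b D(2) by (simp add: j_def b' b'' k \<open>l' = l\<close>)
  moreover have "q powi (2 * j) = 1" using eq' v_nonzero[OF d(2)] unfolding ll by simp
  ultimately have "j = 0" using q_powi_separated[OF n] by blast
  then show ?thesis using ll by (simp add: j_def)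
qed

end

definition tableau :: "nat \<Rightarrow> nat \<Rightarrow> node list \<Rightarrow> bool" where
  "tableau r d bs \<longleftrightarrow> standard bs \<and> (\<forall>b\<in>set bs. pos_r b \<in> {1..r} \<and> pos_d b \<in> {1..d})"

section \<open>The spectrum of the Jucys--Murphy elements\<close>

locale cyclotomic_yokonuma_hecke = yokonuma_hecke sc r n q G T X1 + separated_parameters n d q v
  for sc :: "'k::field \<Rightarrow> 'b::ring_1" and r n q G T X1 d v +
  fixes \<zeta> :: 'k
  assumes zeta_root: "\<zeta> ^ r = 1" and zeta_primitive: "\<lbrakk>0 < j; j < r\<rbrakk> \<Longrightarrow> \<zeta> ^ j \<noteq> 1"
    and X1_cyclotomic: "prod_list (map (\<lambda>l. X1 - sc (v l)) [1..<d + 1]) = 0"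
begin

lemma zeta_nonzero: "\<zeta> \<noteq> 0"
  using zeta_root r_pos by (auto simp: zero_power)

lemma root_k_inj: "\<lbrakk>k \<in> {1..r}; k' \<in> {1..r}; root_k \<zeta> k = root_k \<zeta> k'\<rbrakk> \<Longrightarrow> k = k'"
proof (induction k k' rule: linorder_wlog)
  case (le k k')
  have "\<zeta> ^ (k' - 1) = \<zeta> ^ (k - 1) * \<zeta> ^ (k' - k)"
    using le by (simp flip: power_add)
  then have "\<zeta> ^ (k' - k) = 1" using le zeta_nonzero by (simp add: root_k_def)
  then show ?case using zeta_primitive[of "k' - k"] le by force
qed simp

lemma root_k_power: "root_k \<zeta> k ^ r = 1"
  unfolding root_k_def by (metis mult.commute power_mult power_one zeta_root)

definition wt :: "node \<Rightarrow> 'k \<times> 'k" where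
  "wt b = (cont b, root_k \<zeta> (pos_r b))"

lemma node_cases:
  assumes "pos_r b = k" "pos_d b = l"
  shows "\<exists>x y. b = ((x, y), k, l)"
  using assms by (cases b) (auto simp: pos_r_def pos_d_def)

lemma pe_roots_poly_list:
  "distinct as \<Longrightarrow> pe (roots_poly (set as)) x = prod_list (map (\<lambda>a. x - sc a) as)"
  by (induction as) (simp_all add: roots_poly_insert pe_mult pe_linear roots_poly_def del: mult_pCons_left)

lemma pe_X1: "n \<ge> 1 \<Longrightarrow> pe (roots_poly (v ` {1..d})) X1 = 0"
proof -
  assume n: "n \<ge> 1"
  have "inj_on v {1..d}"
  proof (rule inj_onI, rule ccontr)
    fix l l' assume "l \<in> {1..d}" "l' \<in> {1..d}" "v l = v l'" "l \<noteq> l'"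
    then show False using v_separated[of l l' 0] n by simp
  qed
  moreover have "set [1..<d + 1] = {1..d}" by auto
  ultimately have "distinct (map v [1..<d + 1])"
    unfolding distinct_map by (simp only: distinct_upt)
  moreover have "set (map v [1..<d + 1]) = v ` {1..d}" by auto
  ultimately have "pe (roots_poly (v ` {1..d})) X1 = prod_list (map (\<lambda>l. X1 - sc (v l)) [1..<d + 1])"
    using pe_roots_poly_list[of "map v [1..<d + 1]" X1] by (simp add: comp_def)
  then show ?thesis using X1_cyclotomic by simp
qed

lemma addable_empty: "addable d p {} = (\<lambda>l. ((1, 1), p, l)) ` {1..d}"
proof -
  have "young {((x, y), k, l)} \<longleftrightarrow> x = 1 \<and> y = 1" for x y k l
  proof
    assume Y: "young {((x, y), k, l)}"
    show "x = 1 \<and> y = 1" using youngD(1,2)[OF Y, of x y k l] youngD(3)[OF Y, of x y k l 1 1] by simp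
  qed (auto simp: young_def)
  then show ?thesis by (force simp: addable_def pos_r_def pos_d_def)
qed

lemma roots_poly_superset:
  assumes "finite A" "B \<subseteq> A" "pe (roots_poly B) x * w = 0"
  shows "pe (roots_poly A) x * w = 0"
proof -
  have "roots_poly A = roots_poly (A - B) * roots_poly B"
    unfolding roots_poly_def by (rule prod.subset_diff[OF assms(2,1)])
  then show ?thesis using assms(3) by (simp add: pe_mult mult.assoc)
qed

text \<open>Induction over the sequence. If \<open>p\<close> differs from the colour of the last box
  \<open>b\<close>, then \<open>G\<close> transports the claim from the shorter sequence. If not, then the
  eigenvalues \<open>c\<close>, \<open>q\<^sup>2 c\<close> and \<open>c / q\<^sup>2\<close>, where
  \<open>c\<close> is the content of \<open>b\<close>, have to be compared with the contents that are
  addable after \<open>b\<close>.\<close>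

theorem spectrum:
  assumes "tableau r d bs" "length bs < n" "p \<in> {1..r}" "WV (map wt bs) [root_k \<zeta> p] w"
  shows "pe (roots_poly (cont ` addable d p (set bs))) (X (Suc (length bs))) * w = 0"
  using assms
proof (induction "length bs" arbitrary: bs w p rule: less_induct)
  case less
  show ?case
  proof (cases bs rule: rev_cases)
    case Nil
    have "cont ` addable d p {} = v ` {1..d}"
      unfolding addable_empty by (simp add: image_image cont_def node_content_def pos_d_def)
    then show ?thesis using pe_X1 less.prems(2) by (simp add: Nil)
  next
    case (snoc bs' b)
    obtain x y k l where b: "b = ((x, y), k, l)" by (metis prod.collapse)
    define D where "D = set bs'"
    have std: "standard (bs' @ [b])" using less.prems(1) by (simp add: tableau_def snoc)
    then have std': "standard bs'" "b \<notin> D" "young (insert b D)" "young D"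
      using standard_young[of bs'] by (auto simp: standard_snoc D_def)
    have tab': "tableau r d bs'" using less.prems(1) std' by (simp add: tableau_def snoc)
    have kl: "k \<in> {1..r}" "l \<in> {1..d}" using less.prems(1) by (auto simp: tableau_def snoc b pos_r_def pos_d_def)
    have n2: "2 \<le> n" using less.prems(2) snoc by simp
    have cD: "card D = length bs'" "card (insert b D) = Suc (length bs')"
      using std std' by (auto simp: D_def standard_def distinct_card)
    have IH: "pe (roots_poly (cont ` addable d p' D)) (X (Suc (length bs'))) * w = 0"
      if "p' \<in> {1..r}" "WV (map wt bs') [root_k \<zeta> p'] w" for p' w
      using less.hyps[of bs' p' w] that tab' less.prems(2) by (simp add: snoc D_def)
    define c where "c = cont b"
    have c0: "c \<noteq> 0" using cont_nonzero[of b] kl by (simp add: c_def b pos_d_def)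
    have w: "WV (map wt bs' @ [(c, root_k \<zeta> k)]) [root_k \<zeta> p] w"
      using less.prems(4) by (simp add: snoc wt_def c_def b pos_r_def)
    have fin: "finite (addable d p' E)" if "finite E" for p' E using finite_addable[OF that] .
    have finD: "finite D" by (simp add: D_def)
    show ?thesis
    proof (cases "p = k")
      case False
      then have "root_k \<zeta> k \<noteq> root_k \<zeta> p" using root_k_inj kl less.prems(3) by blast
      moreover have "addable d p (set bs) = addable d p D"
        using addable_insert_other[OF std'(4,3), of p d] False by (simp add: snoc D_def b pos_r_def)
      moreover have "pe (roots_poly (cont ` addable d p D)) (X (Suc (length (map wt bs')))) * w = 0"
        if "WV (map wt bs') [root_k \<zeta> p] w" for w
        using IH[OF less.prems(3) that] by simp
      ultimately show ?thesis
        using spectrum_distinct_colour[OF w] by (simp add: snoc)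
    next
      case True
      define A where "A = cont ` addable d p D"
      define z where "z = root_k \<zeta> p"
      have finA: "finite A" unfolding A_def using fin[OF finD] by simp
      have cA: "c \<in> A" using std' kl by (auto simp: A_def c_def addable_def b True pos_r_def pos_d_def)
      have z_wt: "wt b' = (cont b', z) \<longleftrightarrow> pos_r b' = p" if "pos_r b' \<in> {1..r}" for b'
        using root_k_inj[OF that less.prems(3)] by (auto simp: wt_def z_def)
      have wt_b: "wt b = (c, z)" by (simp add: wt_def c_def z_def True b pos_r_def)
      have q2: "q\<^sup>2 \<noteq> 1" "q\<^sup>2 \<noteq> -1" "q\<^sup>2 * q\<^sup>2 \<noteq> 1" using q_separated[OF n2, of 1] q_separated[OF n2, of 2] n2 
        by (auto simp: power4_eq_xxxx power2_eq_square mult.assoc)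
      have kap: "\<kappa> \<noteq> 0" using q2(1) q_nz by (auto simp: \<kappa>_def field_simps power2_eq_square)
      have adj: "q\<^sup>2 * cont b1 \<noteq> cont b2" if "b1 \<in> addable d p D" "b2 \<in> addable d p D" for b1 b2
      proof
        assume e: "q\<^sup>2 * cont b1 = cont b2"
        have Y: "young (insert b1 D)" "young (insert b2 D)" "b1 \<notin> D" "b2 \<notin> D"
          using that by (auto simp: addable_def)
        have "insert b1 (insert b2 D) = insert b1 D \<union> insert b2 D" by auto
        then have Y': "young (insert b1 (insert b2 D))" using young_Un[OF Y(1,2)] by simp
        have "card (insert b1 (insert b2 D)) \<le> n"
          using card_insert_le_m1[of "card D + 2" "insert b2 D" b1] card_insert_le_m1[of "card D + 1" D b2]
            less.prems(2) cD snoc by simp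
        then have "pos_d b2 = pos_d b1 \<and> node_content b2 = node_content b1 + 1"
          using cont_separated[OF n2 Y', of 1 b2 b1] that e by (simp add: addable_def)
        moreover obtain x1 y1 k1 l1 where "b1 = ((x1, y1), k1, l1)" by (metis prod.collapse)
        moreover obtain x2 y2 k2 l2 where "b2 = ((x2, y2), k2, l2)" by (metis prod.collapse)
        ultimately show False
          using addable_not_adjacent[of x1 y1 k1 l1 D x2 y2] Y that
          by (simp add: addable_def pos_r_def pos_d_def node_content_def)
      qed
      have b_add: "b \<in> addable d p D" using std' kl by (auto simp: addable_def b True pos_r_def pos_d_def)
      have nA: "q\<^sup>2 * c \<notin> A" "c / q\<^sup>2 \<notin> A"
      proof -
        show "q\<^sup>2 * c \<notin> A" unfolding A_def c_def using adj[OF b_add] by blast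
        show "c / q\<^sup>2 \<notin> A"
        proof
          assume "c / q\<^sup>2 \<in> A"
          then obtain e where e: "e \<in> addable d p D" "cont e = c / q\<^sup>2" unfolding A_def by (metis imageE)
          then have "q\<^sup>2 * cont e = cont b" using q_nz by (simp add: c_def)
          with adj[OF e(1) b_add] show False by blast
        qed
      qed
      have ne: "q\<^sup>2 * c \<noteq> c / q\<^sup>2" using q2(3) c0 q_nz by (auto simp: field_simps)
      \<comment> \<open>The set \<open>?B\<close> holds all candidates for eigenvalues, and \<open>?C\<close> those which should remain.\<close>
      let ?B = "insert (q\<^sup>2 * c) (insert (c / q\<^sup>2) A)" and ?C = "cont ` addable d p (insert b D)"
      let ?i = "Suc (Suc (length bs'))"
      have finB: "finite ?B" using finA by simp
      have 1: "pe (roots_poly ?B) (X ?i) * w = 0"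
      proof -
        have "pe (roots_poly A) (X (Suc (length (map wt bs')))) * w = 0" if "WV (map wt bs') [z] w" for w
          using IH[OF less.prems(3), folded A_def z_def, OF that] by simp
        moreover have "WV (map wt bs' @ [(c, z)]) [z] w" using w True by (simp add: z_def)
        ultimately show ?thesis
          using spectrum_same_colour[of "map wt bs'" c z "[]" w "roots_poly A"] c0 nA ne finA
          by (simp add: roots_poly_insert del: mult_pCons_left)
      qed
      have "pe (roots_poly (?C \<inter> ?B)) (X ?i) * w = 0"
      proof (rule roots_poly_reduce[OF finB 1])
        fix a w' assume a: "a \<in> ?B - (?C \<inter> ?B)" and w': "w' = pe (interpolation ?B a) (X ?i) * w"
          "X ?i * w' = sc a * w'"
        have len: "?i \<in> {1..n}" using less.prems(2) snoc by simp
        have "WV (map wt bs' @ [(c, z)]) [z] w'"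
          unfolding w'(1) by (rule WV_pe_X[OF _ len]) (use w True in \<open>simp add: z_def\<close>)
        then have W: "WV (map wt bs' @ [(c, z), (a, z)]) [] w'"
          using WV_snoc[of "map wt bs' @ [(c, z)]" z "[]" w' a] w'(2) by simp
        have eigen: "s = 0" if s: "WV (map wt bs1 @ [(a1, z)]) [] s" and bs1: "tableau r d bs1" "length bs1 \<le> length bs'"
          and a1: "a1 \<notin> cont ` addable d p (set bs1)" for s bs1 a1
        proof (rule eigen_nonroot[OF _ _ _ a1])
          show "finite (cont ` addable d p (set bs1))" using fin by simp
          show "X (Suc (length bs1)) * s = sc a1 * s" using WV_last(1)[OF s] by simp
          have "WV (map wt bs1) [z] s" using WV_append[OF s] by simp
          then show "pe (roots_poly (cont ` addable d p (set bs1))) (X (Suc (length bs1))) * s = 0"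
            using less.hyps[of bs1 p s] bs1 less.prems(2,3) by (simp add: snoc z_def)
        qed
        have linked_D: "pos_d b2 = pos_d b1 \<and> \<bar>node_content b2 - node_content b1\<bar> \<le> 1"
          if "linked (cont b1, z) (wt b2)" "b1 \<in> D" "b2 \<in> D" "pos_r b1 = p" for b1 b2
        proof -
          have in_range: "pos_r b2 \<in> {1..r}" "pos_d b1 \<in> {1..d}" "pos_d b2 \<in> {1..d}"
            using tab' that by (auto simp: tableau_def D_def)
          have "pos_r b2 = p" using that(1) root_k_inj[OF in_range(1) less.prems(3)] by (auto simp: linked_def wt_def z_def)
          then have rr: "pos_r b1 = pos_r b2" using that(4) by simp
          have card: "int (card D) + \<bar>0\<bar> \<le> int n + 1" "int (card D) + \<bar>1\<bar> \<le> int n + 1"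
            using cD less.prems(2) snoc by auto
          have powi: "q powi (2 * 0) = 1" "q powi (2 * 1) = q\<^sup>2"
            using power_int_of_nat[of q 2] by simp_all
          have "cont b1 = q powi (2 * 0) * cont b2 \<or> cont b1 = q powi (2 * 1) * cont b2 \<or> cont b2 = q powi (2 * 1) * cont b1"
            using that(1) unfolding powi by (auto simp: linked_def wt_def)
          then show ?thesis
          proof (elim disjE)
            assume "cont b1 = q powi (2 * 0) * cont b2"
            from cont_separated[OF n2 std'(4) card(1) that(2,3) rr in_range(2,3) this] show ?thesis by simp
          next
            assume "cont b1 = q powi (2 * 1) * cont b2"
            from cont_separated[OF n2 std'(4) card(2) that(2,3) rr in_range(2,3) this] show ?thesis by simp
          next
            assume "cont b2 = q powi (2 * 1) * cont b1"
            from cont_separated[OF n2 std'(4) card(2) that(3,2) rr[symmetric] in_range(3,2) this] show ?thesis by simp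
          qed
        qed
        have not_cont: "c \<notin> cont ` addable d p (set bs1)"
          if bs1: "set bs1 \<subseteq> D" "\<And>x' y'. young (insert ((x', y'), k, l) (set bs1)) \<Longrightarrow> ((x', y'), k, l) \<notin> set bs1 \<Longrightarrow>
             int y' - int x' \<noteq> int y - int x" for bs1
        proof
          assume "c \<in> cont ` addable d p (set bs1)"
          then obtain e where e: "e \<in> addable d p (set bs1)" "cont e = c" by auto
          have Y: "young (insert e (set bs1))" "e \<notin> set bs1" "pos_r e = p" "pos_d e \<in> {1..d}" using e by (auto simp: addable_def)
          have "insert e (set bs1) \<union> insert b D = insert e (insert b D)" using bs1(1) by auto
          then have Y': "young (insert e (insert b D))" using young_Un[OF Y(1) std'(3)] by simp
          have "card (insert e (insert b D)) \<le> n + 1"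
            using card_insert_le_m1[of "card D + 2" "insert b D" e] less.prems(2) cD snoc by simp
          then have eb: "pos_d e = pos_d b \<and> node_content e = node_content b"
            using cont_separated[OF n2 Y', of 0 e b] Y e(2) kl by (simp add: c_def b True pos_d_def pos_r_def)
          obtain x' y' where "e = ((x', y'), k, l)"
            using Y(3) eb by (cases e) (auto simp: pos_r_def pos_d_def b True)
          then show False using bs1(2)[of x' y'] Y eb by (simp add: b node_content_def)
        qed
        have blocked: "w' = 0"
          if \<theta>: "\<theta> \<noteq> 0" "\<theta>\<^sup>2 \<noteq> -1" "\<theta>\<^sup>2 \<noteq> 1" "\<kappa> = \<theta> - inverse \<theta>" "a = \<theta>\<^sup>2 * c" "a \<notin> A"
            and bs': "bs' = pre @ a' # mid" and a': "cont a' = \<theta>\<^sup>2 * c" "pos_r a' = k" "pos_d a' = l"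
            and mid: "\<And>e. \<lbrakk>e \<in> set mid; pos_r e = k; pos_d e = l\<rbrakk> \<Longrightarrow> 2 \<le> \<bar>node_content e - node_content a'\<bar>"
            and pm: "standard (pre @ mid)"
            and next_content: "\<And>x' y'. young (insert ((x', y'), k, l) (set (pre @ mid))) \<Longrightarrow> ((x', y'), k, l) \<notin> set (pre @ mid) \<Longrightarrow>
               int y' - int x' \<noteq> int y - int x" for \<theta> pre mid a'
        proof -
          have wa: "wt a' = (\<theta>\<^sup>2 * c, z)" using a' by (simp add: wt_def z_def True)
          have tpm: "tableau r d (pre @ mid)" using tab' pm by (auto simp: tableau_def bs')
          show ?thesis
          proof (rule exclude_linked[OF \<theta>(1-4) c0])
            show "WV (map wt pre @ (\<theta>\<^sup>2 * c, z) # map wt mid @ [(c, z), (\<theta>\<^sup>2 * c, z)]) [] w'"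
              using W wa \<theta>(5) by (simp add: bs')
          next
            fix y1 assume "y1 \<in> set (map wt mid)"
            then obtain e where e: "e \<in> set mid" "y1 = wt e" by auto
            show "\<not> linked (\<theta>\<^sup>2 * c, z) y1"
            proof
              assume "linked (\<theta>\<^sup>2 * c, z) y1"
              then have l: "linked (cont a', z) (wt e)" unfolding a'(1) e(2) .
              have "pos_r e \<in> {1..r}" using tab' e(1) unfolding tableau_def bs' by simp
              moreover have "root_k \<zeta> (pos_r e) = root_k \<zeta> p" using l by (simp add: linked_def wt_def z_def)
              ultimately have "pos_r e = p" using root_k_inj less.prems(3) by blast
              moreover have "pos_d e = pos_d a' \<and> \<bar>node_content e - node_content a'\<bar> \<le> 1"
                by (rule linked_D[OF l]) (use e a' in \<open>auto simp: D_def bs' True\<close>)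
              ultimately show False
                using mid[OF e(1)] a' True by simp
            qed
          next
            fix s assume "WV (map wt pre @ (\<theta>\<^sup>2 * c, z) # map wt mid @ [(\<theta>\<^sup>2 * c, z)]) [] s"
            then have "WV (map wt bs' @ [(a, z)]) [] s" using wa \<theta>(5) by (simp add: bs')
            then show "s = 0" by (rule eigen) (use tab' \<theta>(6) in \<open>auto simp: A_def D_def\<close>)
          next
            fix s assume "WV (map wt pre @ map wt mid @ [(c, z)]) [] s"
            then have "WV (map wt (pre @ mid) @ [(c, z)]) [] s" by simp
            moreover have "length (pre @ mid) \<le> length bs'" "set (pre @ mid) \<subseteq> D" by (auto simp: bs' D_def)
            ultimately show "s = 0"
              using eigen[OF _ tpm] not_cont[OF _ next_content, of "pre @ mid"] by blast
          qed
        qed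
        have cont_step: "cont e = q powi (2 * j) * c" if "pos_d e = l" "node_content e = node_content b + j" for e j
          using that q_nz by (simp add: c_def cont_def b pos_d_def power_int_add distrib_left mult_ac)
        have powi2: "q powi 2 = q\<^sup>2" "q powi (- 2) = inverse (q\<^sup>2)"
          using power_int_of_nat[of q 2] power_int_minus[of q 2] by simp_all
        have not_young: "\<not> young (insert e (insert b D))"
          if "cont e = a" "e \<notin> insert b D" "pos_r e = p" "pos_d e \<in> {1..d}" for e
        proof
          assume "young (insert e (insert b D))"
          then have "e \<in> addable d p (insert b D)" using that unfolding addable_def by blast
          then have "a \<in> ?C" using that(1) by blast
          then show False using a by blast
        qed
        note pos = youngD(1,2)[OF std'(3), of x y k l]
        consider "a = c" | "a \<in> A" "a \<noteq> c" | "a = q\<^sup>2 * c" | "a = c / q\<^sup>2" using a by auto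
        then show "w' = 0"
        proof cases
          case 1
          show ?thesis
          proof (rule no_repeat[OF _ c0 kap finA cA])
            show "WV (map wt bs' @ [(c, z), (c, z)]) [] w'" using W 1 by simp
            fix u assume "WV (map wt bs') [z] u"
            from IH[OF less.prems(3) this[unfolded z_def]]
            show "pe (roots_poly A) (X (Suc (length (map wt bs')))) * u = 0" by (simp add: A_def)
          qed
        next
          case 2
          then obtain e where "e \<in> addable d p D" "a = cont e" "e \<noteq> b" by (auto simp: A_def c_def)
          then have "a \<in> ?C" using addable_insert_mono[OF _ std'(3)] by blast
          then show ?thesis using a by blast
        next
          case 3
          let ?R = "((x, Suc y), k, l)"
          have "cont ?R = a"
            using cont_step[of ?R 1] by (simp add: 3 b node_content_def pos_d_def powi2)
          moreover have "?R \<notin> insert b D"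
            using youngD(3)[OF std'(4), of x "Suc y" k l x y] pos std'(2) by (auto simp: b)
          ultimately have na: "\<not> young (insert ?R (insert ((x, y), k, l) (set bs')))"
            using not_young[of ?R] kl by (simp add: True b pos_r_def pos_d_def D_def)
          show ?thesis
          proof (rule addable_right_blocked[OF std[unfolded b] na])
            fix pre mid assume *: "1 < x" "bs' = pre @ ((x - 1, y), k, l) # mid"
              "\<And>x' y'. ((x', y'), k, l) \<in> set mid \<Longrightarrow> 2 \<le> \<bar>(int y' - int x') - (int y - int x + 1)\<bar>"
              "standard (pre @ mid)"
              "\<And>x' y'. young (insert ((x', y'), k, l) (set (pre @ mid))) \<Longrightarrow> ((x', y'), k, l) \<notin> set (pre @ mid) \<Longrightarrow>
                 int y' - int x' \<noteq> int y - int x"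
            let ?a = "((x - 1, y), k, l)"
            have nc: "node_content ?a = int y - int x + 1" using *(1) by (simp add: node_content_def of_nat_diff)
            show "w' = 0"
            proof (rule blocked[OF q_nz q2(2,1) \<kappa>_def 3 _ *(2)])
              show "a \<notin> A" using nA 3 by simp
              show "cont ?a = q\<^sup>2 * c"
                using cont_step[of ?a 1] nc by (simp add: b node_content_def pos_d_def powi2)
              fix e assume e: "e \<in> set mid" "pos_r e = k" "pos_d e = l"
              obtain x' y' where "e = ((x', y'), k, l)" using node_cases[OF e(2,3)] by blast
              then show "2 \<le> \<bar>node_content e - node_content ?a\<bar>"
                using *(3)[of x' y'] e nc by (simp add: node_content_def)
            qed (use *(4,5) in \<open>auto simp: pos_r_def pos_d_def\<close>)
          qed
        next
          case 4
          \<comment> \<open>The second root of the quadratic relation; \<open>\<kappa> = \<theta> - 1 / \<theta>\<close> holds for it as well.\<close>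
          define \<theta> where "\<theta> = - inverse q"
          have \<theta>: "\<theta> \<noteq> 0" "\<theta>\<^sup>2 \<noteq> -1" "\<theta>\<^sup>2 \<noteq> 1" "\<kappa> = \<theta> - inverse \<theta>" "a = \<theta>\<^sup>2 * c" "\<theta>\<^sup>2 = inverse (q\<^sup>2)"
            using q2 q_nz by (auto simp: \<theta>_def \<kappa>_def 4 power_inverse divide_inverse mult.commute)
              (metis inverse_inverse_eq inverse_minus_eq inverse_1)+
          let ?R = "((Suc x, y), k, l)"
          have "cont ?R = a"
            using cont_step[of ?R "-1"] by (simp add: \<theta> b node_content_def pos_d_def powi2)
          moreover have "?R \<notin> insert b D"
            using youngD(3)[OF std'(4), of "Suc x" y k l x y] pos std'(2) by (auto simp: b)
          ultimately have na: "\<not> young (insert ?R (insert ((x, y), k, l) (set bs')))"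
            using not_young[of ?R] kl by (simp add: True b pos_r_def pos_d_def D_def)
          show ?thesis
          proof (rule addable_below_blocked[OF std[unfolded b] na])
            fix pre mid assume *: "1 < y" "bs' = pre @ ((x, y - 1), k, l) # mid"
              "\<And>x' y'. ((x', y'), k, l) \<in> set mid \<Longrightarrow> 2 \<le> \<bar>(int y' - int x') - (int y - int x - 1)\<bar>"
              "standard (pre @ mid)"
              "\<And>x' y'. young (insert ((x', y'), k, l) (set (pre @ mid))) \<Longrightarrow> ((x', y'), k, l) \<notin> set (pre @ mid) \<Longrightarrow>
                 int y' - int x' \<noteq> int y - int x"
            let ?a = "((x, y - 1), k, l)"
            have nc: "node_content ?a = int y - int x - 1" using *(1) by (simp add: node_content_def of_nat_diff)
            show "w' = 0"
            proof (rule blocked[OF \<theta>(1-5) _ *(2)])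
              show "a \<notin> A" using nA 4 by simp
              show "cont ?a = \<theta>\<^sup>2 * c"
                using cont_step[of ?a "-1"] nc by (simp add: \<theta>(6) b node_content_def pos_d_def powi2)
              fix e assume e: "e \<in> set mid" "pos_r e = k" "pos_d e = l"
              obtain x' y' where "e = ((x', y'), k, l)" using node_cases[OF e(2,3)] by blast
              then show "2 \<le> \<bar>node_content e - node_content ?a\<bar>"
                using *(3)[of x' y'] e nc by (simp add: node_content_def)
            qed (use *(4,5) in \<open>auto simp: pos_r_def pos_d_def\<close>)
          qed
        qed
      qed simp
      then have "pe (roots_poly ?C) (X ?i) * w = 0"
        by (rule roots_poly_superset[rotated 2]) (use fin[of "insert b D"] finD in auto)
      then show ?thesis by (simp add: snoc D_def)
    qed
  qed
qed

end

section \<open>Hooks\<close>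

definition row_len :: "node set \<Rightarrow> nat \<Rightarrow> nat \<Rightarrow> nat \<Rightarrow> nat" where
  "row_len D k l x = card {y. ((x, y), k, l) \<in> D}"

definition col_len :: "node set \<Rightarrow> nat \<Rightarrow> nat \<Rightarrow> nat \<Rightarrow> nat" where
  "col_len D k l y = card {x. ((x, y), k, l) \<in> D}"

lemma down_closed_initial:
  fixes A :: "nat set"
  assumes "finite A" "\<And>j. j \<in> A \<Longrightarrow> 1 \<le> j" "\<And>i j. j \<in> A \<Longrightarrow> 1 \<le> i \<Longrightarrow> i \<le> j \<Longrightarrow> i \<in> A"
  shows "A = {1..card A}"
proof (cases "A = {}")
  case False
  have A: "A = {1..Max A}"
    unfolding set_eq_iff
  proof
    show "i \<in> A \<longleftrightarrow> i \<in> {1..Max A}" for i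
      using assms(2)[of i] assms(3)[OF Max_in[OF assms(1) False], of i] Max_ge[OF assms(1), of i] by auto
  qed
  have "card A = Max A" using arg_cong[OF A, of card] by simp
  then show ?thesis using A by metis
qed simp

lemma row_set:
  assumes "young D"
  shows "{y. ((x, y), k, l) \<in> D} = {1..row_len D k l x}"
  unfolding row_len_def
proof (rule down_closed_initial)
  have "inj (\<lambda>y. ((x, y), k, l))" by (simp add: inj_def)
  then show "finite {y. ((x, y), k, l) \<in> D}"
    using finite_vimageI[OF young_finite[OF assms], of "\<lambda>y. ((x, y), k, l)"] by (simp add: vimage_def)
next
  show "1 \<le> j" if "j \<in> {y. ((x, y), k, l) \<in> D}" for j using youngD(2)[OF assms] that by blast
  show "i \<in> {y. ((x, y), k, l) \<in> D}" if "j \<in> {y. ((x, y), k, l) \<in> D}" "1 \<le> i" "i \<le> j" for i j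
    using youngD(3)[OF assms _ youngD(1)[OF assms] order_refl that(2,3)] that(1) by blast
qed

lemma col_set:
  assumes "young D"
  shows "{x. ((x, y), k, l) \<in> D} = {1..col_len D k l y}"
  unfolding col_len_def
proof (rule down_closed_initial)
  have "inj (\<lambda>x. ((x, y), k, l))" by (simp add: inj_def)
  then show "finite {x. ((x, y), k, l) \<in> D}"
    using finite_vimageI[OF young_finite[OF assms], of "\<lambda>x. ((x, y), k, l)"] by (simp add: vimage_def)
next
  show "1 \<le> j" if "j \<in> {x. ((x, y), k, l) \<in> D}" for j using youngD(1)[OF assms] that by blast
  show "i \<in> {x. ((x, y), k, l) \<in> D}" if "j \<in> {x. ((x, y), k, l) \<in> D}" "1 \<le> i" "i \<le> j" for i j
    using youngD(3)[OF assms _ that(2,3) youngD(2)[OF assms] order_refl] that(1) by blast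
qed

lemma mem_row: "young D \<Longrightarrow> ((x, y), k, l) \<in> D \<longleftrightarrow> 1 \<le> y \<and> y \<le> row_len D k l x"
  using arg_cong[OF row_set[of D x k l], of "\<lambda>S. y \<in> S"] by simp

lemma mem_col: "young D \<Longrightarrow> ((x, y), k, l) \<in> D \<longleftrightarrow> 1 \<le> x \<and> x \<le> col_len D k l y"
  using arg_cong[OF col_set[of D y k l], of "\<lambda>S. x \<in> S"] by simp

lemma telescope_up:
  fixes a :: "int \<Rightarrow> 'k::field" and s :: int
  assumes nz: "\<And>j. a j \<noteq> 0"
  shows "(\<Prod>i=1..N. a (s + int i + 1) * a (s + int i - 1) / (a (s + int i))\<^sup>2) =
    a (s + int N + 1) / a (s + 1) * (a s / a (s + int N))"
proof (induction N)
  case (Suc N)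
  define f where "f i = a (s + int i + 1) * a (s + int i - 1) / (a (s + int i))\<^sup>2" for i
  have "(\<Prod>i=1..Suc N. f i) = (\<Prod>i=1..N. f i) * f (Suc N)" by simp
  also have "\<dots> = a (s + int N + 1) / a (s + 1) * (a s / a (s + int N)) *
     (a (s + int N + 1 + 1) * a (s + int N) / (a (s + int N + 1))\<^sup>2)"
    using Suc by (simp add: f_def add_ac)
  also have "\<dots> = a (s + int (Suc N) + 1) / a (s + 1) * (a s / a (s + int (Suc N)))"
    using nz[of "s + int N"] nz[of "s + int N + 1"] by (simp add: field_simps power2_eq_square add_ac)
  finally show ?case unfolding f_def .
qed (use nz in simp)

lemma telescope_down:
  fixes a :: "int \<Rightarrow> 'k::field" and s :: int
  assumes nz: "\<And>j. a j \<noteq> 0"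
  shows "(\<Prod>i=1..N. a (s - int i + 1) * a (s - int i - 1) / (a (s - int i))\<^sup>2) =
    a s / a (s - int N) * (a (s - int N - 1) / a (s - 1))"
  using telescope_up[where a = "\<lambda>j. a (- j)" and N = N and s = "- s"] nz by (simp add: algebra_simps)

lemma telescope_quotient:
  fixes a :: "int \<Rightarrow> 'k::field" and s :: int
  assumes nz: "\<And>j. a j \<noteq> 0"
  shows "(\<Prod>i=1..N. a (s + int i) / a (s + int i - 1)) = a (s + int N) / a s"
proof (induction N)
  case (Suc N)
  then show ?case using nz[of "s + int N"] by (simp add: add_ac)
qed (use nz in simp)

text \<open>The product over the boxes is taken by rows for the columns from \<open>Y\<close> on and by
  columns before \<open>Y\<close>; in both directions it telescopes. The right side only involves the rows
  that meet column \<open>Y\<close>, which are those whose hooks change when a box is added in column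
  \<open>Y\<close>.\<close>

lemma content_product_rows:
  fixes a :: "int \<Rightarrow> 'k::field"
  assumes nz: "\<And>j. a j \<noteq> 0" and D: "young D" and Y: "1 \<le> Y"
  shows "a 0 * (\<Prod>b\<in>{b \<in> D. pos_r b = k \<and> pos_d b = l}.
      a (node_content b + 1) * a (node_content b - 1) / (a (node_content b))\<^sup>2) =
    (\<Prod>x=1..col_len D k l Y. a (int (row_len D k l x) - int x + 1) / a (int (row_len D k l x) - int x)) *
    ((\<Prod>y=1..Y. a (int y - 1 - int (col_len D k l y))) /
     (\<Prod>y=1..<Y. a (int y - int (col_len D k l y))))"
proof -
  let ?C = "{b \<in> D. pos_r b = k \<and> pos_d b = l}" and ?M = "col_len D k l Y"
  define R where "R = row_len D k l"
  define C where "C = col_len D k l"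
  define h where "h j = a (j + 1) * a (j - 1) / (a j)\<^sup>2" for j
  have R: "((x, y), k, l) \<in> D \<longleftrightarrow> 1 \<le> y \<and> y \<le> R x" for x y
    using mem_row[OF D] by (simp add: R_def)
  have C: "((x, y), k, l) \<in> D \<longleftrightarrow> 1 \<le> x \<and> x \<le> C y" for x y
    using mem_col[OF D] by (simp add: C_def)
  have MR: "Y \<le> R x" if "x \<in> {1..C Y}" for x using R[of x Y] C[of x Y] that by simp
  have fin: "finite ?C" using young_finite[OF D] by simp
  have "(\<Prod>b\<in>?C. h (node_content b)) =
      (\<Prod>b\<in>{b \<in> ?C. Y \<le> snd (fst b)}. h (node_content b)) * (\<Prod>b\<in>{b \<in> ?C. snd (fst b) < Y}. h (node_content b))"
    by (subst prod.union_disjoint[symmetric]) (use young_finite[OF D] in \<open>auto intro!: prod.cong\<close>)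
  also have "(\<Prod>b\<in>{b \<in> ?C. Y \<le> snd (fst b)}. h (node_content b)) = (\<Prod>x=1..C Y. \<Prod>y=Y..R x. h (int y - int x))"
    unfolding prod.Sigma[OF finite_atLeastAtMost, simplified] 
    by (subst prod.Sigma, simp, simp,
        rule prod.reindex_bij_witness[where j="\<lambda>((x, y), k, l). (x, y)" and i="\<lambda>(x, y). ((x, y), k, l)"])
      (use R C Y in \<open>auto simp: pos_r_def pos_d_def node_content_def\<close>)
  also have "\<dots> = (\<Prod>x=1..C Y. a (int (R x) - int x + 1) / a (int (R x) - int x) *
      (a (int Y - 1 - int x) / a (int Y - int x)))"
  proof (rule prod.cong[OF refl])
    fix x assume x: "x \<in> {1..C Y}"
    have "(\<Prod>y=Y..R x. h (int y - int x)) = (\<Prod>i=1..R x - (Y - 1). h (int Y - 1 - int x + int i))"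
      by (rule prod.reindex_bij_witness[where j="\<lambda>y. y - (Y - 1)" and i="\<lambda>i. i + (Y - 1)"])
        (use MR[OF x] Y in \<open>auto simp: of_nat_diff algebra_simps\<close>)
    also have "\<dots> = a (int (R x) - int x + 1) / a (int Y - int x) * (a (int Y - 1 - int x) / a (int (R x) - int x))"
      unfolding h_def telescope_up[where a = a, OF nz] using MR[OF x] Y by (simp add: of_nat_diff algebra_simps)
    finally show "(\<Prod>y=Y..R x. h (int y - int x)) = a (int (R x) - int x + 1) / a (int (R x) - int x) *
      (a (int Y - 1 - int x) / a (int Y - int x))" by simp
  qed
  also have "\<dots> = (\<Prod>x=1..C Y. a (int (R x) - int x + 1) / a (int (R x) - int x)) *
      (a (int Y - 1 - int (C Y)) / a (int Y - 1))"
    unfolding prod.distrib using telescope_quotient[where a = "\<lambda>j. a (- j)" and N = "C Y" and s = "1 - int Y"] nz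
    by (simp add: algebra_simps)
  also have "(\<Prod>b\<in>{b \<in> ?C. snd (fst b) < Y}. h (node_content b)) = (\<Prod>y=1..Y - 1. \<Prod>x=1..C y. h (int y - int x))"
    by (subst prod.Sigma, simp, simp,
        rule prod.reindex_bij_witness[where j="\<lambda>((x, y), k, l). (y, x)" and i="\<lambda>(y, x). ((x, y), k, l)"])
      (use R C Y youngD(1,2)[OF D] in \<open>auto simp: pos_r_def pos_d_def node_content_def\<close>)
  also have "\<dots> = (\<Prod>y=1..Y - 1. a (int y - 1 - int (C y)) / a (int y - int (C y)) * (a (int y) / a (int y - 1)))"
    unfolding h_def telescope_down[where a = a, OF nz] by (simp add: algebra_simps)
  also have "\<dots> = (\<Prod>y=1..Y - 1. a (int y - 1 - int (C y)) / a (int y - int (C y))) * (a (int Y - 1) / a 0)"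
    unfolding prod.distrib using telescope_quotient[where a = a and N = "Y - 1" and s = 0] nz Y by (simp add: of_nat_diff)
  finally have "a 0 * (\<Prod>b\<in>?C. h (node_content b)) =
      (\<Prod>x=1..C Y. a (int (R x) - int x + 1) / a (int (R x) - int x)) *
      (a (int Y - 1 - int (C Y)) * (\<Prod>y=1..Y - 1. a (int y - 1 - int (C y)) / a (int y - int (C y))))"
    using nz[of 0] nz[of "int Y - 1"] by simp
  also have "a (int Y - 1 - int (C Y)) * (\<Prod>y=1..Y - 1. a (int y - 1 - int (C y)) / a (int y - int (C y))) =
      (\<Prod>y=1..Y. a (int y - 1 - int (C y))) / (\<Prod>y=1..<Y. a (int y - int (C y)))"
  proof -
    obtain Y' where Y': "Y = Suc Y'" using Y by (cases Y) auto
    have "{1..<Suc Y'} = {1..Y'}" by auto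
    then show ?thesis by (simp add: Y' prod_dividef)
  qed
  finally show ?thesis unfolding h_def R_def C_def .
qed

lemma q_number_closed: 
  assumes "q \<noteq> 0" "0 \<le> m"
  shows "(q - inverse q) * q_number q m = q powi m - q powi (- m)"
proof -
  obtain N where N: "m = int N" using assms(2) nonneg_int_cases by blast
  have "(q - inverse q) * (\<Sum>j<N. q powi (int N - 1 - 2 * int j)) = q powi int N - q powi (- int N)"
  proof -
    have "(q - inverse q) * q powi (int N - 1 - 2 * int j) =
        q powi (int N - 2 * int j) - q powi (int N - 2 * int (Suc j))" for j
    proof -
      have "q * q powi (int N - 1 - 2 * int j) = q powi (1 + (int N - 1 - 2 * int j))"
        using assms(1) by (simp only: power_int_add power_int_1_right simp_thms)
      moreover have "inverse q * q powi (int N - 1 - 2 * int j) = q powi (- 1 + (int N - 1 - 2 * int j))"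
        using assms(1) by (simp only: power_int_add power_int_minus power_int_1_right simp_thms)
      ultimately show ?thesis by (simp add: left_diff_distrib algebra_simps)
    qed
    then have "(q - inverse q) * (\<Sum>j<N. q powi (int N - 1 - 2 * int j)) =
       (\<Sum>j<N. q powi (int N - 2 * int j) - q powi (int N - 2 * int (Suc j)))"
      by (simp add: sum_distrib_left)
    also have "\<dots> = q powi (int N - 2 * int 0) - q powi (int N - 2 * int N)"
      by (rule sum_lessThan_telescope'[where f="\<lambda>j. q powi (int N - 2 * int j)"])
    finally show ?thesis by simp
  qed
  then show ?thesis by (simp add: q_number_def N)
qed

context separated_parameters begin

definition arm_leg :: "node set \<Rightarrow> node \<Rightarrow> nat \<Rightarrow> int" where
  "arm_leg D = (\<lambda>((x, y), k, l) m. int (row_len D k l x) + int (col_len D k m y) - int x - int y + 1)"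

text \<open>The factors of \<open>F_lambda\<close> for a box \<open>b\<close>; the ordinary hook is the case
  \<open>m = pos_d b\<close> of the generalised one.\<close>

definition hook_factor :: "node set \<Rightarrow> node \<Rightarrow> nat \<Rightarrow> 'k" where
  "hook_factor D b m = (if m = pos_d b then q_number q (arm_leg D b m) / q powi node_content b
     else (v (pos_d b) * q powi (arm_leg D b m) - v m * q powi (- arm_leg D b m)) / q powi (- node_content b))"

lemma arm_leg_own:
  assumes "young D" "b \<in> D"
  shows "1 \<le> arm_leg D b (pos_d b)" "arm_leg D b (pos_d b) \<le> int (card D)"
proof -
  obtain x y k l where b: "b = ((x, y), k, l)" by (metis prod.collapse)
  have xy: "((x, y), k, l) \<in> D" using assms(2) by (simp add: b)
  have 1: "y \<le> row_len D k l x" "x \<le> col_len D k l y" "1 \<le> x" "1 \<le> y"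
    using mem_row[OF assms(1)] mem_col[OF assms(1)] xy by auto
  then show "1 \<le> arm_leg D b (pos_d b)" by (simp add: arm_leg_def b pos_d_def)
  have e: "((x, row_len D k l x), k, l) \<in> D" "((col_len D k l y, y), k, l) \<in> D"
    using mem_row[OF assms(1), of x "row_len D k l x"] mem_col[OF assms(1), of "col_len D k l y" y] 1 by auto
  have "card {b \<in> D. pos_r b = k \<and> pos_d b = l} \<le> card D"
    using young_finite[OF assms(1)] by (intro card_mono) auto
  then show "arm_leg D b (pos_d b) \<le> int (card D)"
    using card_component[OF assms(1) e] 1 by (simp add: arm_leg_def b pos_d_def node_content_def)
qed

lemma arm_leg_other:
  assumes "young D" "b \<in> D" "m \<noteq> pos_d b"
  shows "\<bar>arm_leg D b m\<bar> < int (card D)"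
proof -
  obtain x y k l where b: "b = ((x, y), k, l)" by (metis prod.collapse)
  have xy: "((x, y), k, l) \<in> D" using assms(2) by (simp add: b)
  have 1: "y \<le> row_len D k l x" "x \<le> col_len D k l y" "1 \<le> x" "1 \<le> y"
    using mem_row[OF assms(1)] mem_col[OF assms(1)] xy by auto
  let ?A = "(\<lambda>j. ((x, j), k, l)) ` {1..row_len D k l x}" and ?B = "(\<lambda>i. ((i, y), k, m)) ` {1..col_len D k m y}"
  have fin: "finite D" using young_finite[OF assms(1)] .
  have lm: "l \<noteq> m" using assms(3) by (simp add: b pos_d_def)
  have "card (?A \<union> ?B) \<le> card D"
    by (rule card_mono[OF fin]) (use mem_row[OF assms(1)] mem_col[OF assms(1)] in auto)
  moreover have "card (?A \<union> ?B) = card ?A + card ?B"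
    by (rule card_Un_disjoint) (use lm in auto)
  moreover have "card ?A = row_len D k l x" "card ?B = col_len D k m y"
    by (subst card_image; auto simp: inj_on_def)+
  ultimately have A: "row_len D k l x + col_len D k m y \<le> card D" by simp
  let ?E = "(\<lambda>i. ((i, y), k, l)) ` {1..x}"
  have "card ?E \<le> card D"
    by (rule card_mono[OF fin]) (use youngD(3)[OF assms(1) xy] 1 in auto)
  moreover have "card ?E = x" by (subst card_image; auto simp: inj_on_def)
  ultimately have "x \<le> card D" by simp
  then show ?thesis using A 1 by (simp add: arm_leg_def b)
qed

lemma q_square_nonone: "2 \<le> n \<Longrightarrow> q - inverse q \<noteq> 0"
  using q_separated[of 1] q_nonzero by (auto simp: field_simps power2_eq_square)

text \<open>In the component of \<open>b\<close> the hook length is between \<open>1\<close> and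
  \<open>n\<close>. For the other components a generalised hook length has absolute value less than
  \<open>n\<close>, because \<open>b\<close> and the column that it is compared with are in disjoint parts
  of a diagram with at most \<open>n\<close> boxes.\<close>

lemma hook_factor_nonzero:
  assumes D: "young D" "card D \<le> n" and b: "b \<in> D" "pos_d b \<in> {1..d}" "m \<in> {1..d}"
  shows "hook_factor D b m \<noteq> 0"
proof (cases "m = pos_d b")
  case True
  let ?h = "arm_leg D b m"
  have h: "1 \<le> ?h" "?h \<le> int n" using arm_leg_own[OF D(1) b(1)] D(2) True by auto
  have "q_number q ?h \<noteq> 0"
  proof (cases "2 \<le> n")
    case True
    have "q powi ?h - q powi (- ?h) \<noteq> 0"
    proof
      assume "q powi ?h - q powi (- ?h) = 0"
      then have "q powi ?h * q powi ?h = q powi (- ?h) * q powi ?h" by simp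
      then have "q powi (2 * ?h) = 1" using q_nonzero by (simp flip: power_int_add)
      then show False using q_powi_separated[OF True, of ?h] h by simp
    qed
    then show ?thesis using q_number_closed[OF q_nonzero, of ?h] h by auto
  next
    case False
    then have "?h = 1" using h by simp
    then show ?thesis by (simp add: q_number_def)
  qed
  then show ?thesis using True q_nonzero by (simp add: hook_factor_def)
next
  case False
  let ?h = "arm_leg D b m"
  have "v (pos_d b) * q powi ?h - v m * q powi (- ?h) \<noteq> 0"
  proof
    assume "v (pos_d b) * q powi ?h - v m * q powi (- ?h) = 0"
    then have "v (pos_d b) * (q powi ?h * q powi ?h) = v m * (q powi (- ?h) * q powi ?h)" by (simp add: mult.assoc[symmetric])
    then have "v m = q powi (2 * ?h) * v (pos_d b)" using q_nonzero by (simp add: mult.commute flip: power_int_add)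
    moreover have "\<bar>?h\<bar> < int n" using arm_leg_other[OF D(1) b(1) False] D(2) by simp
    ultimately show False using v_separated[OF b(3,2) False] by blast
  qed
  then show ?thesis using False q_nonzero by (simp add: hook_factor_def)
qed

definition hook_product :: "node set \<Rightarrow> 'k" where
  "hook_product D = (\<Prod>b\<in>D. \<Prod>m=1..d. hook_factor D b m)"

lemma hook_product_nonzero:
  assumes "young D" "card D \<le> n" "\<And>b. b \<in> D \<Longrightarrow> pos_d b \<in> {1..d}"
  shows "hook_product D \<noteq> 0"
  unfolding hook_product_def using hook_factor_nonzero[OF assms(1,2)] assms(3) young_finite[OF assms(1)] by simp

end

section \<open>Hooks after adding a box\<close>

context separated_parameters begin

text \<open>The factors of the telescoped spectral factor, as functions of \<open>u\<close>.\<close>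

definition root_factor :: "nat \<Rightarrow> int \<Rightarrow> 'k \<Rightarrow> 'k" where
  "root_factor m j u = u - v m * q powi (2 * j)"

definition ratio_num :: "node set \<Rightarrow> nat \<Rightarrow> nat \<Rightarrow> nat set \<Rightarrow> nat \<Rightarrow> nat \<Rightarrow> 'k \<Rightarrow> 'k" where
  "ratio_num D p m A Y M u =
     (\<Prod>x=1..M. root_factor m (int (row_len D p m x) - int x + 1) u) *
     (\<Prod>y\<in>A. root_factor m (int y - 1 - int (col_len D p m y)) u)"

definition ratio_den :: "node set \<Rightarrow> nat \<Rightarrow> nat \<Rightarrow> nat \<Rightarrow> nat \<Rightarrow> 'k \<Rightarrow> 'k" where
  "ratio_den D p m Y M u =
     (\<Prod>x=1..M. root_factor m (int (row_len D p m x) - int x) u) *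
     (\<Prod>y=1..<Y. root_factor m (int y - int (col_len D p m y)) u)"

lemma root_factor_content:
  "root_factor m j (v l * q powi (2 * t)) = q powi (t + j) * (v l * q powi (t - j) - v m * q powi (j - t))"
  using q_nonzero by (simp add: root_factor_def right_diff_distrib mult.left_commute[of _ "v _"] flip: power_int_add)

context
  fixes D :: "node set" and X Y p l :: nat
  assumes D: "young D" "((X, Y), p, l) \<notin> D" "young (insert ((X, Y), p, l) D)"
    and card: "card (insert ((X, Y), p, l) D) \<le> n" and pos_d: "\<And>b. b \<in> insert ((X, Y), p, l) D \<Longrightarrow> pos_d b \<in> {1..d}"
begin

lemma row_len_insert: "row_len (insert ((X, Y), p, l) D) k m x =
    (if x = X \<and> k = p \<and> m = l then Y else row_len D k m x)"
proof (cases "x = X \<and> k = p \<and> m = l")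
  case True
  have "\<not> (1 \<le> Suc Y \<and> Suc Y \<le> row_len (insert ((X, Y), p, l) D) p l X)"
  proof
    assume "1 \<le> Suc Y \<and> Suc Y \<le> row_len (insert ((X, Y), p, l) D) p l X"
    then have "((X, Suc Y), p, l) \<in> D" using mem_row[OF D(3), of X "Suc Y" p l] by simp
    then show False
      using youngD(3)[OF D(1), of X "Suc Y" p l X Y] youngD(1,2)[OF D(3), of X Y p l] D(2) by simp
  qed
  moreover have "Y \<le> row_len (insert ((X, Y), p, l) D) p l X" using mem_row[OF D(3), of X Y p l] by simp
  ultimately show ?thesis using True by simp
next
  case False
  then have "{y. ((x, y), k, m) \<in> insert ((X, Y), p, l) D} = {y. ((x, y), k, m) \<in> D}" by auto
  then have "row_len (insert ((X, Y), p, l) D) k m x = row_len D k m x" by (simp only: row_len_def)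
  then show ?thesis using False by auto
qed

lemma col_len_insert: "col_len (insert ((X, Y), p, l) D) k m y =
    (if y = Y \<and> k = p \<and> m = l then X else col_len D k m y)"
proof (cases "y = Y \<and> k = p \<and> m = l")
  case True
  have "\<not> (1 \<le> Suc X \<and> Suc X \<le> col_len (insert ((X, Y), p, l) D) p l Y)"
  proof
    assume "1 \<le> Suc X \<and> Suc X \<le> col_len (insert ((X, Y), p, l) D) p l Y"
    then have "((Suc X, Y), p, l) \<in> D" using mem_col[OF D(3), of "Suc X" Y p l] by simp
    then show False
      using youngD(3)[OF D(1), of "Suc X" Y p l X Y] youngD(1,2)[OF D(3), of X Y p l] D(2) by simp
  qed
  moreover have "X \<le> col_len (insert ((X, Y), p, l) D) p l Y" using mem_col[OF D(3), of X Y p l] by simp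
  ultimately show ?thesis using True by simp
next
  case False
  then have "{x. ((x, y), k, m) \<in> insert ((X, Y), p, l) D} = {x. ((x, y), k, m) \<in> D}" by auto
  then have "col_len (insert ((X, Y), p, l) D) k m y = col_len D k m y" by (simp only: col_len_def)
  then show ?thesis using False by auto
qed

lemma XY_pos: "1 \<le> X" "1 \<le> Y"
  using youngD(1,2)[OF D(3), of X Y p l] by auto

lemma row_len_old: "row_len D p l X = Y - 1"
proof -
  have "{y. ((X, y), p, l) \<in> insert ((X, Y), p, l) D} = {1..Y}"
    unfolding row_set[OF D(3)] row_len_insert by simp
  moreover have "{y. ((X, y), p, l) \<in> D} = {y. ((X, y), p, l) \<in> insert ((X, Y), p, l) D} - {Y}"
    using D(2) by blast
  ultimately show ?thesis using XY_pos by (simp add: row_len_def)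
qed

lemma col_len_old: "col_len D p l Y = X - 1"
proof -
  have "{x. ((x, Y), p, l) \<in> insert ((X, Y), p, l) D} = {1..X}"
    unfolding col_set[OF D(3)] col_len_insert by simp
  moreover have "{x. ((x, Y), p, l) \<in> D} = {x. ((x, Y), p, l) \<in> insert ((X, Y), p, l) D} - {X}"
    using D(2) by blast
  ultimately show ?thesis using XY_pos by (simp add: col_len_def)
qed

lemma arm_leg_insert:
  assumes "b \<in> D"
  shows "arm_leg (insert ((X, Y), p, l) D) b m = arm_leg D b m +
    (if (\<exists>y. b = ((X, y), p, l)) \<or> (\<exists>x k. b = ((x, Y), p, k) \<and> m = l) then 1 else 0)"
proof -
  obtain x y k l' where b: "b = ((x, y), k, l')" by (metis prod.collapse)
  have "\<not> (x = X \<and> k = p \<and> l' = l \<and> y = Y)" using assms D(2) by (auto simp: b)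
  then show ?thesis
    using XY_pos by (auto simp: b arm_leg_def row_len_insert col_len_insert row_len_old col_len_old of_nat_diff)
qed

definition added_content :: 'k where "added_content = v l * q powi (2 * (int Y - int X))"

definition added_ratio :: "nat \<Rightarrow> 'k" where
  "added_ratio m = ratio_num D p m (if m = l then {1..<Y} else {1..Y}) Y (col_len D p m Y) added_content /
     ratio_den D p m Y (col_len D p m Y) added_content"

lemma l_range: "l \<in> {1..d}"
  using pos_d[of "((X, Y), p, l)"] by (simp add: pos_d_def)

lemma n_ge_2: "D \<noteq> {} \<Longrightarrow> 2 \<le> n"
  using card D(2) young_finite[OF D(1)] by (cases "card D") auto

text \<open>Adding a box lengthens by one the arms of the boxes in its row, also in the generalised hooks.
  Each such box contributes a quotient of consecutive root factors at the new content.\<close>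

lemma hook_factor_row_ratio:
  assumes y: "1 \<le> y" "y < Y" and m: "m \<in> {1..d}"
  shows "hook_factor (insert ((X, Y), p, l) D) ((X, y), p, l) m / hook_factor D ((X, y), p, l) m =
    q * (root_factor m (int y - 1 - int (col_len D p m y)) added_content / root_factor m (int y - int (col_len D p m y)) added_content)"
    "root_factor m (int y - int (col_len D p m y)) added_content \<noteq> 0"
proof -
  let ?b = "((X, y), p, l)" and ?D' = "insert ((X, Y), p, l) D"
  define t where "t = int Y - int X"
  define j where "j = int y - int (col_len D p m y)"
  have b: "?b \<in> D" using mem_row[OF D(1)] y by (simp add: row_len_old)
  have cD: "card D \<le> n" using card young_finite[OF D(1)] card_insert_le[of D "((X, Y), p, l)"] by linarith
  have nz: "hook_factor D ?b m \<noteq> 0" 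
    by (rule hook_factor_nonzero[OF D(1) cD b _ m]) (use l_range in \<open>simp add: pos_d_def\<close>)
  have h: "arm_leg D ?b m = t - j" "arm_leg ?D' ?b m = t - j + 1"
    using XY_pos arm_leg_insert[OF b, of m] by (auto simp: arm_leg_def row_len_old of_nat_diff t_def j_def)
  have c: "added_content = v l * q powi (2 * t)" by (simp add: added_content_def t_def)
  have e: "j + (t - 1) = t + j - 1" "t - (j - 1) = t - j + 1" "j - 1 - t = - (t - j + 1)" "t + (j - 1) = t + j - 1" by auto
  define \<sigma> where "\<sigma> = (if m = l then v l * (q - inverse q) else 1)"
  define z where "z = (if m = l then q powi node_content ?b else q powi (- node_content ?b))"
  have n2: "2 \<le> n" using n_ge_2 b by auto
  have \<sigma>: "\<sigma> \<noteq> 0" using q_square_nonone[OF n2] v_nonzero[OF l_range] by (simp add: \<sigma>_def)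
  have z: "z \<noteq> 0" using q_nonzero by (simp add: z_def)
  have "root_factor m j added_content = q powi (t + j) * (\<sigma> * z * hook_factor D ?b m)"
  proof (cases "m = l")
    case True
    have "0 \<le> t - j" using arm_leg_own(1)[OF D(1) b] h(1) True by (simp add: pos_d_def)
    then have "v l * q powi (t - j) - v l * q powi (j - t) = v l * (q - inverse q) * q_number q (t - j)"
      by (simp only: mult.assoc q_number_closed[OF q_nonzero] minus_diff_eq right_diff_distrib[symmetric])
    then have "\<sigma> * z * hook_factor D ?b m = v l * q powi (t - j) - v l * q powi (j - t)"
      using True z by (simp add: hook_factor_def h[unfolded True] \<sigma>_def z_def pos_d_def)
    then show ?thesis by (simp only: c root_factor_content True)
  qed (use q_nonzero in \<open>simp add: c root_factor_content hook_factor_def h \<sigma>_def z_def pos_d_def\<close>)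
  moreover have "root_factor m (j - 1) added_content = q powi (t + j - 1) * (\<sigma> * z * hook_factor ?D' ?b m)"
  proof (cases "m = l")
    case True
    have "0 \<le> t - j + 1" using arm_leg_own(1)[OF D(1) b] h(1) True by (simp add: pos_d_def)
    then have "v l * q powi (t - j + 1) - v l * q powi (- (t - j + 1)) = v l * (q - inverse q) * q_number q (t - j + 1)"
      by (simp only: mult.assoc q_number_closed[OF q_nonzero] minus_diff_eq right_diff_distrib[symmetric])
    then have "\<sigma> * z * hook_factor ?D' ?b m = v l * q powi (t - j + 1) - v l * q powi (- (t - j + 1))"
      using True z by (simp add: hook_factor_def h[unfolded True] \<sigma>_def z_def pos_d_def)
    then show ?thesis by (simp only: c root_factor_content True e)
  qed (use q_nonzero in \<open>simp add: c root_factor_content hook_factor_def h \<sigma>_def z_def pos_d_def e\<close>)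
  moreover have "q powi (t + j) = q * q powi (t + j - 1)"
    using q_nonzero power_int_add[of q 1 "t + j - 1"] by simp
  ultimately have "root_factor m j added_content \<noteq> 0 \<and>
     hook_factor ?D' ?b m / hook_factor D ?b m = q * (root_factor m (j - 1) added_content / root_factor m j added_content)"
    using \<sigma> z nz q_nonzero by simp
  moreover have "int y - 1 - int (col_len D p m y) = j - 1" by (simp add: j_def)
  ultimately show "hook_factor ?D' ?b m / hook_factor D ?b m =
    q * (root_factor m (int y - 1 - int (col_len D p m y)) added_content / root_factor m (int y - int (col_len D p m y)) added_content)"
    "root_factor m (int y - int (col_len D p m y)) added_content \<noteq> 0"
    unfolding \<open>int y - 1 - int (col_len D p m y) = j - 1\<close> j_def[symmetric] by blast+
qed

lemma hook_factor_col_ratio: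
  assumes x: "1 \<le> x" "x \<le> col_len D p m Y" and m: "m \<in> {1..d}"
  shows "hook_factor (insert ((X, Y), p, l) D) ((x, Y), p, m) l / hook_factor D ((x, Y), p, m) l =
    inverse q * (root_factor m (int (row_len D p m x) - int x + 1) added_content / root_factor m (int (row_len D p m x) - int x) added_content)"
    "root_factor m (int (row_len D p m x) - int x) added_content \<noteq> 0"
proof -
  let ?b = "((x, Y), p, m)" and ?D' = "insert ((X, Y), p, l) D"
  define t where "t = int Y - int X"
  define j where "j = int (row_len D p m x) - int x"
  have b: "?b \<in> D" using mem_col[OF D(1)] x by simp
  have cD: "card D \<le> n" using card young_finite[OF D(1)] card_insert_le[of D "((X, Y), p, l)"] by linarith
  have nz: "hook_factor D ?b l \<noteq> 0" 
    by (rule hook_factor_nonzero[OF D(1) cD b _ l_range]) (use m in \<open>simp add: pos_d_def\<close>)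
  have h: "arm_leg D ?b l = j - t" "arm_leg ?D' ?b l = j - t + 1"
    using XY_pos arm_leg_insert[OF b, of l] by (auto simp: arm_leg_def col_len_old of_nat_diff t_def j_def)
  have c: "added_content = v l * q powi (2 * t)" by (simp add: added_content_def t_def)
  have e: "t - (j + 1) = - (j - t + 1)" "j + 1 - t = j - t + 1" "t + (j + 1) = t + j + 1" "t - j = - (j - t)" by auto
  define \<sigma> where "\<sigma> = (if m = l then - (v l * (q - inverse q)) else - 1)"
  define z where "z = (if m = l then q powi node_content ?b else q powi (- node_content ?b))"
  have n2: "2 \<le> n" using n_ge_2 b by auto
  have \<sigma>: "\<sigma> \<noteq> 0" using q_square_nonone[OF n2] v_nonzero[OF l_range] by (simp add: \<sigma>_def)
  have z: "z \<noteq> 0" using q_nonzero by (simp add: z_def)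
  have "root_factor m j added_content = q powi (t + j) * (\<sigma> * z * hook_factor D ?b l)"
  proof (cases "m = l")
    case True
    have "0 \<le> j - t" using arm_leg_own(1)[OF D(1) b] h(1) True by (simp add: pos_d_def)
    then have "v l * q powi (- (j - t)) - v l * q powi (j - t) = - (v l * (q - inverse q)) * q_number q (j - t)"
      by (simp only: mult_minus_left mult.assoc q_number_closed[OF q_nonzero] right_diff_distrib[symmetric])
        (simp only: mult_minus_right[symmetric] minus_diff_eq)
    then have "\<sigma> * z * hook_factor D ?b l = v l * q powi (- (j - t)) - v l * q powi (j - t)"
      using True z by (simp add: hook_factor_def h[unfolded True] \<sigma>_def z_def pos_d_def)
    then show ?thesis by (simp only: c root_factor_content True e(4))
  next
    case False
    then have "\<sigma> * z * hook_factor D ?b l = v l * q powi (- (j - t)) - v m * q powi (j - t)"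
      using z by (simp add: hook_factor_def h \<sigma>_def z_def pos_d_def)
    then show ?thesis by (simp only: c root_factor_content e(4))
  qed
  moreover have "root_factor m (j + 1) added_content = q powi (t + j + 1) * (\<sigma> * z * hook_factor ?D' ?b l)"
  proof (cases "m = l")
    case True
    have "0 \<le> j - t + 1" using arm_leg_own(1)[OF D(1) b] h(1) True by (simp add: pos_d_def)
    then have "v l * q powi (- (j - t + 1)) - v l * q powi (j - t + 1) = - (v l * (q - inverse q)) * q_number q (j - t + 1)"
      by (simp only: mult_minus_left mult.assoc q_number_closed[OF q_nonzero] right_diff_distrib[symmetric])
        (simp only: mult_minus_right[symmetric] minus_diff_eq)
    then have "\<sigma> * z * hook_factor ?D' ?b l = v l * q powi (- (j - t + 1)) - v l * q powi (j - t + 1)"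
      using True z by (simp add: hook_factor_def h[unfolded True] \<sigma>_def z_def pos_d_def)
    then show ?thesis by (simp only: c root_factor_content True e(1-3))
  next
    case False
    then have "\<sigma> * z * hook_factor ?D' ?b l = v l * q powi (- (j - t + 1)) - v m * q powi (j - t + 1)"
      using z by (simp add: hook_factor_def h \<sigma>_def z_def pos_d_def)
    then show ?thesis by (simp only: c root_factor_content e(1-3))
  qed
  moreover have "q powi (t + j + 1) = q * q powi (t + j)"
    using q_nonzero power_int_add[of q 1 "t + j"] by (simp add: add_ac)
  ultimately have "root_factor m j added_content \<noteq> 0 \<and>
     hook_factor ?D' ?b l / hook_factor D ?b l = inverse q * (root_factor m (j + 1) added_content / root_factor m j added_content)"
    using \<sigma> z nz q_nonzero by simp
  then show "hook_factor ?D' ?b l / hook_factor D ?b l =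
    inverse q * (root_factor m (int (row_len D p m x) - int x + 1) added_content / root_factor m (int (row_len D p m x) - int x) added_content)"
    "root_factor m (int (row_len D p m x) - int x) added_content \<noteq> 0"
    by (simp_all add: j_def)
qed

lemma hook_factor_new:
  "hook_factor (insert ((X, Y), p, l) D) ((X, Y), p, l) m =
    q powi (int (col_len D p m Y) - int Y + 1) *
    (if m = l then 1 else root_factor m (int Y - 1 - int (col_len D p m Y)) added_content)"
proof (cases "m = l")
  case True
  have "arm_leg (insert ((X, Y), p, l) D) ((X, Y), p, l) l = 1"
    by (simp add: arm_leg_def row_len_insert col_len_insert)
  moreover have "int (col_len D p l Y) - int Y + 1 = int X - int Y" using XY_pos by (simp add: col_len_old of_nat_diff)
  then have "q powi (int (col_len D p l Y) - int Y + 1) = q powi (int X - int Y)" by (simp only:)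
  ultimately show ?thesis using True
    by (simp add: hook_factor_def pos_d_def q_number_def node_content_def divide_inverse flip: power_int_minus)
next
  case False
  define t where "t = int Y - int X"
  define M where "M = int (col_len D p m Y)"
  have "arm_leg (insert ((X, Y), p, l) D) ((X, Y), p, l) m = t - (int Y - 1 - M)"
    using False by (simp add: arm_leg_def row_len_insert col_len_insert t_def M_def)
  moreover have "added_content = v l * q powi (2 * t)" by (simp add: added_content_def t_def)
  moreover have "q powi (M - int Y + 1) * q powi (t + (int Y - 1 - M)) = q powi t"
    using q_nonzero by (simp flip: power_int_add)
  moreover have "node_content ((X, Y), p, l) = t" by (simp add: node_content_def t_def)
  ultimately show ?thesis using False q_nonzero
    by (simp add: hook_factor_def pos_d_def root_factor_content M_def[symmetric] power_int_minus[of _ t] divide_inverse mult.assoc[symmetric])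
qed

lemma ratio_den_nonzero: "m \<in> {1..d} \<Longrightarrow> ratio_den D p m Y (col_len D p m Y) added_content \<noteq> 0"
  using hook_factor_row_ratio(2) hook_factor_col_ratio(2) by (simp add: ratio_den_def)

text \<open>The hook factors that change belong to the row of the new box and to its column, taken in all
  components of its colour, and, up to powers of \<open>q\<close> which cancel, their quotients are the
  factors of the telescoped product.\<close>

lemma hook_product_insert:
  "hook_product (insert ((X, Y), p, l) D) = hook_product D * (\<Prod>m=1..d. added_ratio m)"
proof -
  let ?b0 = "((X, Y), p, l)" and ?D' = "insert ((X, Y), p, l) D"
  define \<rho> where "\<rho> = (\<lambda>(b, m). hook_factor ?D' b m / hook_factor D b m)"
  define M where "M m = col_len D p m Y" for m
  have finD: "finite D" using young_finite[OF D(1)] .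
  have cD: "card D \<le> n" using card finD card_insert_le[of D ?b0] by linarith
  have nz: "hook_factor D b m \<noteq> 0" if "b \<in> D" "m \<in> {1..d}" for b m
    by (rule hook_factor_nonzero[OF D(1) cD that(1) _ that(2)]) (use pos_d that in auto)
  have "hook_product ?D' = (\<Prod>m=1..d. hook_factor ?D' ?b0 m) * (\<Prod>b\<in>D. \<Prod>m=1..d. hook_factor ?D' b m)"
    unfolding hook_product_def using finD D(2) by simp
  also have "(\<Prod>b\<in>D. \<Prod>m=1..d. hook_factor ?D' b m) = (\<Prod>b\<in>D. \<Prod>m=1..d. hook_factor D b m * \<rho> (b, m))"
    by (intro prod.cong refl) (use nz in \<open>simp add: \<rho>_def\<close>)
  also have "\<dots> = hook_product D * (\<Prod>b\<in>D. \<Prod>m=1..d. \<rho> (b, m))"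
    by (simp add: hook_product_def prod.distrib)
  also have "(\<Prod>b\<in>D. \<Prod>m=1..d. \<rho> (b, m)) = prod \<rho> (D \<times> {1..d})"
    by (simp add: prod.cartesian_product)
  also have "\<dots> = (\<Prod>m=1..d. (\<Prod>y=1..<Y. \<rho> (((X, y), p, l), m)) * (\<Prod>x=1..M m. \<rho> (((x, Y), p, m), l)))"
  proof -
    let ?A = "(\<lambda>(m, y). (((X, y), p, l), m)) ` ({1..d} \<times> {1..<Y})"
    let ?B = "(\<lambda>(m, x). (((x, Y), p, m), l)) ` (SIGMA m:{1..d}. {1..M m})"
    have sub: "?A \<union> ?B \<subseteq> D \<times> {1..d}"
      using mem_row[OF D(1)] mem_col[OF D(1)] l_range by (auto simp: row_len_old M_def)
    have "prod \<rho> (D \<times> {1..d}) = prod \<rho> (?A \<union> ?B)"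
    proof (rule prod.mono_neutral_right[OF _ sub])
      show "finite (D \<times> {1..d})" using finD by simp
      show "\<forall>bm\<in>D \<times> {1..d} - (?A \<union> ?B). \<rho> bm = 1"
      proof
        fix bm assume "bm \<in> D \<times> {1..d} - (?A \<union> ?B)"
        then obtain b m where bm: "bm = (b, m)" "b \<in> D" "m \<in> {1..d}" "(b, m) \<notin> ?A" "(b, m) \<notin> ?B" by auto
        have "\<not> (\<exists>y. b = ((X, y), p, l))"
        proof
          assume "\<exists>y. b = ((X, y), p, l)"
          then obtain y where y: "b = ((X, y), p, l)" by blast
          then have "y \<in> {1..<Y}" using mem_row[OF D(1), of X y p l] bm(2) XY_pos by (auto simp: row_len_old)
          then have "(b, m) \<in> ?A" using bm(3) y by (intro image_eqI[of _ _ "(m, y)"]) auto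
          then show False using bm(4) by blast
        qed
        moreover have "\<not> (\<exists>x k. b = ((x, Y), p, k) \<and> m = l)"
        proof
          assume "\<exists>x k. b = ((x, Y), p, k) \<and> m = l"
          then obtain x k where x: "b = ((x, Y), p, k)" "m = l" by blast
          then have "x \<in> {1..M k}" using mem_col[OF D(1), of x Y p k] bm(2) by (auto simp: M_def)
          moreover have "k \<in> {1..d}" using pos_d[of b] bm(2) x by (simp add: pos_d_def)
          ultimately have "(b, m) \<in> ?B" using x by (intro image_eqI[of _ _ "(k, x)"]) auto
          then show False using bm(5) by blast
        qed
        ultimately have "arm_leg ?D' b m = arm_leg D b m" using arm_leg_insert[OF bm(2), of m] by auto
        then have "hook_factor ?D' b m = hook_factor D b m" by (simp only: hook_factor_def)
        then show "\<rho> bm = 1" using nz[OF bm(2,3)] by (simp add: \<rho>_def bm(1))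
      qed
    qed
    also have "\<dots> = prod \<rho> ?A * prod \<rho> ?B"
      by (rule prod.union_disjoint) auto
    also have "prod \<rho> ?A = (\<Prod>m=1..d. \<Prod>y=1..<Y. \<rho> (((X, y), p, l), m))"
      by (subst prod.reindex) (auto simp: inj_on_def prod.cartesian_product intro!: prod.cong)
    also have "prod \<rho> ?B = (\<Prod>m=1..d. \<Prod>x=1..M m. \<rho> (((x, Y), p, m), l))"
      by (subst prod.reindex) (auto simp: inj_on_def prod.Sigma intro!: prod.cong)
    finally show ?thesis by (simp add: prod.distrib)
  qed
  also have "(\<Prod>m=1..d. hook_factor ?D' ?b0 m) * (hook_product D * \<dots>) =
      hook_product D * (\<Prod>m=1..d. hook_factor ?D' ?b0 m *
        ((\<Prod>y=1..<Y. \<rho> (((X, y), p, l), m)) * (\<Prod>x=1..M m. \<rho> (((x, Y), p, m), l))))"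
    by (simp add: prod.distrib mult_ac)
  also have "(\<Prod>m=1..d. hook_factor ?D' ?b0 m *
        ((\<Prod>y=1..<Y. \<rho> (((X, y), p, l), m)) * (\<Prod>x=1..M m. \<rho> (((x, Y), p, m), l)))) = (\<Prod>m=1..d. added_ratio m)"
  proof (rule prod.cong[OF refl])
    fix m assume m: "m \<in> {1..d}"
    have 1: "(\<Prod>y=1..<Y. \<rho> (((X, y), p, l), m)) = q ^ (Y - 1) *
       ((\<Prod>y=1..<Y. root_factor m (int y - 1 - int (col_len D p m y)) added_content) /
        (\<Prod>y=1..<Y. root_factor m (int y - int (col_len D p m y)) added_content))"
      using hook_factor_row_ratio(1)[OF _ _ m] by (simp add: \<rho>_def prod.distrib prod_dividef)
    have 2: "(\<Prod>x=1..M m. \<rho> (((x, Y), p, m), l)) = inverse q ^ M m *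
       ((\<Prod>x=1..M m. root_factor m (int (row_len D p m x) - int x + 1) added_content) /
        (\<Prod>x=1..M m. root_factor m (int (row_len D p m x) - int x) added_content))"
      using hook_factor_col_ratio(1)[OF _ _ m] by (simp add: \<rho>_def M_def prod.distrib prod_dividef)
    have "q powi (int (M m) - int Y + 1) = q powi (int (M m)) * q powi (- int (Y - 1))"
    proof -
      have "int (M m) - int Y + 1 = int (M m) + - int (Y - 1)" using XY_pos by (simp add: of_nat_diff)
      then show ?thesis using q_nonzero by (simp only: power_int_add simp_thms)
    qed
    then have 3: "q powi (int (M m) - int Y + 1) * (q ^ (Y - 1) * inverse q ^ M m) = 1"
      using q_nonzero by (simp add: power_int_minus field_simps)
    obtain Y' where Y': "Y = Suc Y'" using XY_pos by (cases Y) auto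
    have 4: "(if m = l then 1 else root_factor m (int Y - 1 - int (col_len D p m Y)) added_content) *
        (\<Prod>y=1..<Y. root_factor m (int y - 1 - int (col_len D p m y)) added_content) =
      (\<Prod>y\<in>(if m = l then {1..<Y} else {1..Y}). root_factor m (int y - 1 - int (col_len D p m y)) added_content)"
    proof -
      have "{1..<Suc Y'} = {1..Y'}" by auto
      then show ?thesis by (simp add: Y')
    qed
    have "hook_factor ?D' ?b0 m * ((\<Prod>y=1..<Y. \<rho> (((X, y), p, l), m)) * (\<Prod>x=1..M m. \<rho> (((x, Y), p, m), l))) =
      q powi (int (M m) - int Y + 1) * (q ^ (Y - 1) * inverse q ^ M m) * added_ratio m"
      unfolding hook_factor_new 1 2 added_ratio_def ratio_num_def ratio_den_def 4[symmetric]
      by (simp add: M_def mult_ac)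
    then show "hook_factor ?D' ?b0 m * ((\<Prod>y=1..<Y. \<rho> (((X, y), p, l), m)) * (\<Prod>x=1..M m. \<rho> (((x, Y), p, m), l))) = added_ratio m"
      unfolding 3 by simp
  qed
  finally show ?thesis .
qed

end

end

section \<open>The fusion identity\<close>

context separated_parameters begin

text \<open>The scalar \<open>f\<close> of the fusion identity. A box contributes \<open>g(u, c) g(c,
  u)\<close>, which is different from \<open>1\<close> only if its colour is \<open>p\<close>.\<close>

definition spectral_factor :: "node set \<Rightarrow> nat \<Rightarrow> 'k \<Rightarrow> 'k" where
  "spectral_factor D p u = (\<Prod>l=1..d. u - v l) *
     (\<Prod>b\<in>{b \<in> D. pos_r b = p}. (u - q\<^sup>2 * cont b) * (u - cont b / q\<^sup>2) / (u - cont b)\<^sup>2)"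

definition generic :: "'k \<Rightarrow> bool" where
  "generic u \<longleftrightarrow> (\<forall>m\<in>{1..d}. \<forall>j. u \<noteq> v m * q powi (2 * j))"

definition added_function :: "node set \<Rightarrow> nat \<Rightarrow> nat \<Rightarrow> nat \<Rightarrow> 'k \<Rightarrow> 'k" where
  "added_function D p l Y u = (\<Prod>m=1..d. ratio_num D p m (if m = l then {1..<Y} else {1..Y}) Y (col_len D p m Y) u /
     ratio_den D p m Y (col_len D p m Y) u)"

text \<open>The point is the factor \<open>u - cont b\<close>, which cancels the pole of the resolvent at
  the content of the added box; the other factor has a nonzero value there, the quotient of two hook
  products.\<close>

lemma spectral_factor_added:
  assumes D: "young D" "\<And>b. b \<in> D \<Longrightarrow> pos_d b \<in> {1..d}" and b: "((X, Y), p, l) \<notin> D" "young (insert ((X, Y), p, l) D)" "l \<in> {1..d}"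
    and u: "generic u"
  shows "spectral_factor D p u = (u - cont ((X, Y), p, l)) * added_function D p l Y u"
proof -
  have fin: "finite D" using young_finite[OF D(1)] .
  define h where "h b = (u - q\<^sup>2 * cont b) * (u - cont b / q\<^sup>2) / (u - cont b)\<^sup>2" for b
  have Y: "1 \<le> Y" using youngD(2)[OF b(2), of X Y p l] by simp
  have "(\<Prod>b\<in>{b \<in> D. pos_r b = p}. h b) = (\<Prod>m=1..d. \<Prod>b\<in>{b \<in> D. pos_r b = p \<and> pos_d b = m}. h b)"
  proof -
    have "(\<Prod>m=1..d. \<Prod>b\<in>{b \<in> {b \<in> D. pos_r b = p}. pos_d b = m}. h b) = (\<Prod>b\<in>{b \<in> D. pos_r b = p}. h b)"
      by (rule prod.group) (use fin D(2) in auto)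
    then show ?thesis by (simp add: conj_assoc)
  qed
  then have "spectral_factor D p u = (\<Prod>m=1..d. (u - v m) * (\<Prod>b\<in>{b \<in> D. pos_r b = p \<and> pos_d b = m}. h b))"
    by (simp add: spectral_factor_def h_def prod.distrib)
  also have "\<dots> = (\<Prod>m=1..d. ratio_num D p m {1..Y} Y (col_len D p m Y) u / ratio_den D p m Y (col_len D p m Y) u)"
  proof (rule prod.cong[OF refl])
    fix m assume m: "m \<in> {1..d}"
    have nz: "root_factor m j u \<noteq> 0" for j using u m by (simp add: generic_def root_factor_def)
    have step: "v m * q powi (2 * (j + 1)) = q\<^sup>2 * (v m * q powi (2 * j))"
      "v m * q powi (2 * (j - 1)) = v m * q powi (2 * j) / q\<^sup>2" for j
    proof -
      have "q powi (2 * (j + 1)) = q powi (2 * j) * q powi 2" using q_nonzero by (simp add: distrib_left power_int_add)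
      then show "v m * q powi (2 * (j + 1)) = q\<^sup>2 * (v m * q powi (2 * j))" by (simp add: mult_ac)
      have "q powi (2 * (j - 1)) = q powi (2 * j) / q powi 2" using q_nonzero by (simp add: right_diff_distrib power_int_diff)
      then show "v m * q powi (2 * (j - 1)) = v m * q powi (2 * j) / q\<^sup>2" by simp
    qed
    have "(\<Prod>b\<in>{b \<in> D. pos_r b = p \<and> pos_d b = m}. h b) = (\<Prod>b\<in>{b \<in> D. pos_r b = p \<and> pos_d b = m}.
       root_factor m (node_content b + 1) u * root_factor m (node_content b - 1) u / (root_factor m (node_content b) u)\<^sup>2)"
    proof (rule prod.cong[OF refl])
      fix b assume "b \<in> {b \<in> D. pos_r b = p \<and> pos_d b = m}"
      then have "pos_d b = m" by simp
      then show "h b = root_factor m (node_content b + 1) u * root_factor m (node_content b - 1) u / (root_factor m (node_content b) u)\<^sup>2"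
        by (simp only: h_def root_factor_def cont_def step)
    qed
    moreover have "u - v m = root_factor m 0 u" by (simp add: root_factor_def)
    ultimately have "(u - v m) * (\<Prod>b\<in>{b \<in> D. pos_r b = p \<and> pos_d b = m}. h b) =
       root_factor m 0 u * (\<Prod>b\<in>{b \<in> D. pos_r b = p \<and> pos_d b = m}.
       root_factor m (node_content b + 1) u * root_factor m (node_content b - 1) u / (root_factor m (node_content b) u)\<^sup>2)" by simp
    also have "\<dots> = ratio_num D p m {1..Y} Y (col_len D p m Y) u / ratio_den D p m Y (col_len D p m Y) u"
      using content_product_rows[of "\<lambda>j. root_factor m j u", OF nz D(1) Y, of p m]
      by (simp add: ratio_num_def ratio_den_def prod_dividef)
    finally show "(u - v m) * (\<Prod>b\<in>{b \<in> D. pos_r b = p \<and> pos_d b = m}. h b) =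
      ratio_num D p m {1..Y} Y (col_len D p m Y) u / ratio_den D p m Y (col_len D p m Y) u" .
  qed
  also have "\<dots> = (\<Prod>m=1..d. (if m = l then u - cont ((X, Y), p, l) else 1) *
      (ratio_num D p m (if m = l then {1..<Y} else {1..Y}) Y (col_len D p m Y) u / ratio_den D p m Y (col_len D p m Y) u))"
  proof (rule prod.cong[OF refl])
    fix m assume "m \<in> {1..d}"
    have "ratio_num D p l {1..Y} Y (col_len D p l Y) u = (u - cont ((X, Y), p, l)) * ratio_num D p l {1..<Y} Y (col_len D p l Y) u"
    proof -
      have c: "col_len D p l Y = X - 1" 
      proof -
        have "((x, Y), p, l) \<in> D \<longleftrightarrow> 1 \<le> x \<and> x \<le> X - 1" for x
        proof
          assume x: "((x, Y), p, l) \<in> D"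
          have "\<not> X \<le> x" using youngD(3)[OF D(1) x, of X Y] youngD(1,2)[OF b(2), of X Y p l] b(1) by auto
          then show "1 \<le> x \<and> x \<le> X - 1" using youngD(1)[OF D(1) x] by linarith
        next
          assume x: "1 \<le> x \<and> x \<le> X - 1"
          have "((x, Y), p, l) \<in> insert ((X, Y), p, l) D"
            by (rule youngD(3)[OF b(2) insertI1]) (use x Y in linarith)+
          moreover have "x \<noteq> X" using x by linarith
          ultimately show "((x, Y), p, l) \<in> D" by simp
        qed
        then have "{x. ((x, Y), p, l) \<in> D} = {1..X - 1}" unfolding set_eq_iff by simp
        then show ?thesis by (simp add: col_len_def)
      qed
      have X: "1 \<le> X" using youngD(1)[OF b(2), of X Y p l] by simp
      have "{1..Y} = insert Y {1..<Y}" using Y by auto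
      then have "(\<Prod>y=1..Y. root_factor l (int y - 1 - int (col_len D p l y)) u) =
          root_factor l (int Y - 1 - int (col_len D p l Y)) u * (\<Prod>y=1..<Y. root_factor l (int y - 1 - int (col_len D p l y)) u)"
        by simp
      moreover have "root_factor l (int Y - 1 - int (col_len D p l Y)) u = u - cont ((X, Y), p, l)"
        using X by (simp add: c root_factor_def cont_def node_content_def pos_d_def of_nat_diff)
      ultimately show ?thesis by (simp add: ratio_num_def mult_ac)
    qed
    then show "ratio_num D p m {1..Y} Y (col_len D p m Y) u / ratio_den D p m Y (col_len D p m Y) u =
      (if m = l then u - cont ((X, Y), p, l) else 1) *
      (ratio_num D p m (if m = l then {1..<Y} else {1..Y}) Y (col_len D p m Y) u / ratio_den D p m Y (col_len D p m Y) u)"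
      by simp
  qed
  also have "\<dots> = (u - cont ((X, Y), p, l)) * added_function D p l Y u"
    unfolding prod.distrib[of "\<lambda>m. if m = l then _ else _"] added_function_def using b(3) by simp
  finally show ?thesis .
qed

end

context cyclotomic_yokonuma_hecke begin

definition \<phi>\<^sub>1 :: "'k \<Rightarrow> 'b" where
  "\<phi>\<^sub>1 u = (\<Sum>a\<in>v ` {1..d}. sc (\<Prod>b\<in>v ` {1..d} - {a}. u - b) * pe (interpolation (v ` {1..d}) a) X1)"

definition baxter :: "nat \<Rightarrow> 'k \<Rightarrow> 'k \<Rightarrow> 'b" where
  "baxter i a b = G i + sc (\<kappa> * (b / (a - b))) * E i"

fun \<phi> :: "nat \<Rightarrow> (nat \<Rightarrow> 'k) \<Rightarrow> 'k \<Rightarrow> 'b" where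
  "\<phi> 0 us u = 1"
| "\<phi> (Suc 0) us u = \<phi>\<^sub>1 u"
| "\<phi> (Suc (Suc k)) us u = baxter (Suc k) u (us (Suc k)) * \<phi> (Suc k) us u * Ginv (Suc k)"

lemma v_inj: "n \<ge> 1 \<Longrightarrow> inj_on v {1..d}"
proof (rule inj_onI, rule ccontr)
  fix l l' assume "n \<ge> 1" "l \<in> {1..d}" "l' \<in> {1..d}" "v l = v l'" "l \<noteq> l'"
  then show False using v_separated[of l l' 0] by simp
qed

lemma phi1_resolvent:
  assumes "n \<ge> 1" "u \<notin> v ` {1..d}"
  shows "\<phi>\<^sub>1 u = sc (\<Prod>l=1..d. u - v l) * resolvent (v ` {1..d}) u X1"
proof -
  have "(\<Prod>l=1..d. u - v l) = (\<Prod>b\<in>v ` {1..d}. u - b)"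
    using prod.reindex[OF v_inj[OF assms(1)], of "\<lambda>b. u - b"] by (simp add: comp_def)
  moreover have "(\<Prod>b\<in>v ` {1..d} - {a}. u - b) = (\<Prod>b\<in>v ` {1..d}. u - b) * (1 / (u - a))" if "a \<in> v ` {1..d}" for a
  proof -
    have "u - a \<noteq> 0" using that assms(2) by auto
    moreover have "(\<Prod>b\<in>v ` {1..d}. u - b) = (u - a) * (\<Prod>b\<in>v ` {1..d} - {a}. u - b)"
      by (rule prod.remove) (use that in auto)
    ultimately show ?thesis by simp
  qed
  ultimately show ?thesis
    unfolding \<phi>\<^sub>1_def resolvent_def sum_distrib_left by (intro sum.cong refl) (simp add: sc_assoc)
qed

text \<open>Induction over the sequence: \<open>\<phi>\<close> of one more variable is \<open>G(u, c) \<phi>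
  G\<^sup>-\<^sup>1\<close>, the vector \<open>G\<^sup>-\<^sup>1 w\<close> is a weight vector for the
  shorter sequence, and what has to be computed is \<open>G(u, c) (u - X i)\<^sup>-\<^sup>1
  G\<^sup>-\<^sup>1 w\<close>.\<close>

theorem fusion:
  assumes "tableau r d bs" "length bs < n" "p \<in> {1..r}" "WV (map wt bs) [root_k \<zeta> p] w"
    and u: "generic u" and us: "\<And>i. i < length bs \<Longrightarrow> us (Suc i) = cont (bs ! i)"
  shows "\<phi> (Suc (length bs)) us u * w =
    sc (spectral_factor (set bs) p u) * (resolvent (cont ` addable d p (set bs)) u (X (Suc (length bs))) * w)"
  using assms(1-4) us
proof (induction bs arbitrary: w rule: rev_induct)
  case Nil
  have A: "cont ` addable d p {} = v ` {1..d}"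
    unfolding addable_empty by (simp add: image_image cont_def node_content_def pos_d_def)
  have "u \<noteq> v l" if "l \<in> {1..d}" for l
  proof -
    have "u \<noteq> v l * q powi (2 * 0)" using u that unfolding generic_def by blast
    then show ?thesis by simp
  qed
  then have "u \<notin> v ` {1..d}" by blast
  then show ?case using phi1_resolvent[of u] Nil by (simp add: A spectral_factor_def mult.assoc)
next
  case (snoc b bs)
  define i where "i = Suc (length bs)"
  define c where "c = cont b"
  define z where "z = root_k \<zeta> (pos_r b)"
  define z' where "z' = root_k \<zeta> p"
  define \<delta> :: 'k where "\<delta> = (if z = z' then 1 else 0)"
  have i: "i \<in> {1..<n}" using snoc.prems(2) by (simp add: i_def)
  have std: "standard bs" "b \<notin> set bs" using snoc.prems(1) by (auto simp: tableau_def standard_snoc)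
  have tab: "tableau r d bs" using snoc.prems(1) std by (simp add: tableau_def)
  have colour: "pos_r b \<in> {1..r}" "pos_d b \<in> {1..d}" using snoc.prems(1) by (auto simp: tableau_def)
  have w: "WV (map wt bs @ [(c, z)]) [z'] w" using snoc.prems(4) wt_def[of b] by (simp add: c_def z_def z'_def)
  have roots: "z ^ r = 1" "z' ^ r = 1" by (simp_all add: z_def z'_def root_k_power)
  have E: "E i * y = smul \<delta> y" if "WV (map wt bs @ [(c, z)]) [z'] y" for y
    using E_eigen[of i y z z'] WV_last[OF that] WV_next[OF that] roots by (simp add: i_def \<delta>_def smul_def)
  have uA: "u \<notin> cont ` addable d p D" for D
    using u by (auto simp: generic_def addable_def cont_def)
  have uc: "u \<noteq> c" using u colour by (auto simp: generic_def c_def cont_def)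
  have fin: "finite (cont ` addable d p (set D))" for D using finite_addable[of "set D" d p] by simp
  have WG: "WV (map wt bs) [z'] (G i * y + sc (k * \<delta>) * y)" if "WV (map wt bs @ [(c, z)]) [z'] y" for y k
  proof -
    have "WV (map wt bs) (z # z' # []) y" using WV_append[OF that] by simp
    then have "WV (map wt bs) (z' # z # []) (G i * y + sc (k * \<delta>) * y)"
      by (rule WV_G) (simp_all add: i_def \<delta>_def)
    then show ?thesis using WV_drop[of "map wt bs" "[z']" "[z]"] by simp
  qed
  define w1 where "w1 = Ginv i * w"
  have w1: "WV (map wt bs) [z'] w1"
  proof -
    have "w1 = G i * w + sc (- \<kappa> * \<delta>) * w"
      by (simp add: w1_def Ginv_def ring_distribs mult.assoc E[OF w] sc_smul smul_simps)
    then show ?thesis using WG[OF w, of "- \<kappa>"] by simp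
  qed
  define R' where "R' = resolvent (cont ` addable d p (set bs)) u (X i)"
  define R where "R = resolvent (cont ` addable d p (set (bs @ [b]))) u (X (Suc i))"
  define y where "y = R' * w1"
  define w2 where "w2 = R * w"
  have w2: "WV (map wt bs @ [(c, z)]) [z'] w2"
    unfolding w2_def R_def using i by (intro WV_resolvent[OF w]) auto
  have w2': "(sc u - X (Suc i)) * w2 = w"
    using resolvent[OF fin spectrum[OF snoc.prems(1-4)] uA] by (simp add: w2_def R_def i_def)
  have y: "(sc u - X i) * y = w1"
    using resolvent[OF fin spectrum[OF tab _ snoc.prems(3) w1[unfolded z'_def]] uA] snoc.prems(2)
    by (simp add: y_def R'_def i_def)
  have yW: "WV (map wt bs) [z'] y" unfolding y_def R'_def using i by (intro WV_resolvent[OF w1]) auto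
  define k where "k = \<kappa> * (u / (c - u))"
  define k1 where "k1 = \<kappa> * (c / (u - c))"
  have kk: "k * (u - c) = - (\<kappa> * u)" "\<kappa> + (k1 + k) = 0"
  proof -
    have uc': "u - c \<noteq> 0" using uc by simp
    have "u / (c - u) = - (u / (u - c))" using minus_divide_right[of u "u - c"] by simp
    then have k: "k = - (\<kappa> * u) / (u - c)" by (simp add: k_def)
    then show "k * (u - c) = - (\<kappa> * u)" using uc' by simp
    have "k1 + k = \<kappa> * (c - u) / (u - c)"
      unfolding k k1_def by (simp add: diff_divide_distrib right_diff_distrib)
    also have "\<dots> = - \<kappa>" using uc' by (simp add: divide_eq_eq algebra_simps)
    finally show "\<kappa> + (k1 + k) = 0" by simp
  qed
  have X: "X i * w2 = smul c w2" using WV_last(1)[OF w2] by (simp add: i_def sc_smul)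
  \<comment> \<open>The vector \<open>g(c, u) w2\<close>, a second preimage of \<open>w1\<close> under \<open>u - X i\<close>.\<close>
  define h where "h = G i * w2 + sc (k * \<delta>) * w2"
  have h: "(sc u - X i) * h = w1"
  proof -
    have XG: "X i * (G i * w2) = Ginv i * (X (Suc i) * w2)"
      using arg_cong[OF X_G[OF i], of "\<lambda>x. x * w2"] by (simp only: mult.assoc)
    have "(sc u - X i) * h = smul u (G i * w2) + smul (k * (u - c) * \<delta>) w2 - Ginv i * (X (Suc i) * w2)"
      by (simp add: h_def ring_distribs XG X sc_smul smul_simps smul_distrib algebra_simps)
    also have "smul u (G i * w2) + smul (k * (u - c) * \<delta>) w2 = smul u (Ginv i * w2)"
      unfolding kk(1) by (simp add: Ginv_def ring_distribs E[OF w2] sc_smul smul_simps mult.assoc mult_ac)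
    also have "\<dots> - Ginv i * (X (Suc i) * w2) = Ginv i * ((sc u - X (Suc i)) * w2)"
      by (simp add: ring_distribs sc_smul smul_simps)
    finally show ?thesis by (simp only: w2' w1_def)
  qed
  \<comment> \<open>Since \<open>u\<close> is not a content, it is no eigenvalue of \<open>X i\<close>, and preimages under \<open>u - X i\<close> are unique.\<close>
  have "y - h = 0"
  proof (rule eigen_nonroot[OF fin _ _ uA])
    have "WV (map wt bs) [z'] (sc (-1) * h + y)"
      using WV_scale_add[OF WG[OF w2, of k] yW, of "-1"] by (simp add: h_def)
    then have "WV (map wt bs) [root_k \<zeta> p] (y - h)" by (simp add: sc_minus z'_def)
    from spectrum[OF tab _ snoc.prems(3) this] show "pe (roots_poly (cont ` addable d p (set bs))) (X i) * (y - h) = 0"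
      using snoc.prems(2) by (simp add: i_def)
    have "(sc u - X i) * (y - h) = 0" unfolding right_diff_distrib[of "sc u - X i"] by (simp only: y h diff_self)
    then show "X i * (y - h) = sc u * (y - h)" unfolding left_diff_distrib by simp
  qed
  then have yh: "y = h" by simp
  define f' where "f' = spectral_factor (set bs) p u"
  have IH: "\<phi> i us u * w1 = sc f' * y"
    using snoc.IH[OF tab _ snoc.prems(3) w1[unfolded z'_def]] snoc.prems(2,5)
    by (simp add: i_def f'_def y_def R'_def nth_append)
  have bx: "baxter i u c * h = smul (1 + k1 * k * \<delta>) w2"
  proof -
    have GG: "G i * (G i * w2) = w2 + smul \<kappa> (E i * (G i * w2))"
      using arg_cong[OF GGE[OF i], of "\<lambda>x. x * w2"] by (simp add: ring_distribs mult.assoc sc_smul smul_simps)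
    have EG: "E i * (G i * w2) = smul \<delta> (G i * w2)"
      using arg_cong[OF G_E[OF i], of "\<lambda>x. x * w2"] E[OF w2] by (simp add: mult.assoc smul_simps)
    have bx_k1: "baxter i u c = G i + sc k1 * E i" by (simp only: baxter_def k1_def)
    have "\<delta> * \<delta> = \<delta>" by (simp add: \<delta>_def)
    then have dd: "k1 * (k * \<delta>) * \<delta> = k1 * k * \<delta>" by (simp add: mult.assoc)
    have "baxter i u c * h = w2 + (smul (\<kappa> * \<delta>) (G i * w2) + smul (k * \<delta>) (G i * w2) + smul (k1 * \<delta>) (G i * w2)) + smul (k1 * (k * \<delta>) * \<delta>) w2"
      unfolding bx_k1 by (simp add: h_def ring_distribs mult.assoc sc_smul smul_simps GG EG E[OF w2])
        (simp add: mult_ac)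
    also have "smul (\<kappa> * \<delta>) (G i * w2) + smul (k * \<delta>) (G i * w2) + smul (k1 * \<delta>) (G i * w2) = smul ((\<kappa> + (k1 + k)) * \<delta>) (G i * w2)"
      by (simp add: smul_distrib ring_distribs)
    finally show ?thesis unfolding kk dd by (simp add: smul_simps smul_distrib add.assoc)
  qed
  have "\<phi> (Suc (length (bs @ [b]))) us u * w = baxter i u c * (\<phi> i us u * w1)"
    using snoc.prems(5)[of "length bs"] by (simp add: i_def w1_def c_def mult.assoc)
  also have "\<dots> = smul (f' * (1 + k1 * k * \<delta>)) w2"
    by (simp add: IH yh sc_smul smul_simps bx)
  also have "f' * (1 + k1 * k * \<delta>) = spectral_factor (set (bs @ [b])) p u"
  proof (cases "pos_r b = p")
    case True
    have "1 + k1 * k = (u - q\<^sup>2 * c) * (u - c / q\<^sup>2) / (u - c)\<^sup>2"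
    proof -
      have "k1 * k = - (\<kappa>\<^sup>2 * u * c) / (u - c)\<^sup>2"
      proof -
        have "k = - (\<kappa> * u) / (u - c)" unfolding kk(1)[symmetric] using uc by simp
        then show ?thesis by (simp add: k1_def power2_eq_square mult_ac)
      qed
      then have "1 + k1 * k = ((u - c)\<^sup>2 - \<kappa>\<^sup>2 * u * c) / (u - c)\<^sup>2"
        using uc by (simp add: field_simps)
      also have "(u - c)\<^sup>2 - \<kappa>\<^sup>2 * u * c = (u - q\<^sup>2 * c) * (u - c / q\<^sup>2)"
        using q_nz by (simp add: \<kappa>_def field_simps power2_eq_square)
      finally show ?thesis .
    qed
    moreover have "{b' \<in> set (bs @ [b]). pos_r b' = p} = insert b {b' \<in> set bs. pos_r b' = p}" using True by auto
    ultimately show ?thesis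
      using True std(2) by (simp add: spectral_factor_def f'_def \<delta>_def z_def z'_def c_def mult_ac)
  next
    case False
    then have "z \<noteq> z'" using root_k_inj[OF colour(1) snoc.prems(3)] by (auto simp: z_def z'_def)
    moreover have "{b' \<in> set (bs @ [b]). pos_r b' = p} = {b' \<in> set bs. pos_r b' = p}" using False by auto
    ultimately show ?thesis by (simp add: spectral_factor_def f'_def \<delta>_def)
  qed
  finally show ?case by (simp add: w2_def R_def i_def sc_smul)
qed

end

section \<open>The presented algebra inside a ring type\<close>

definition two_sided :: "'a::ring_1 set \<Rightarrow> bool" where
  "two_sided J \<longleftrightarrow> 0 \<in> J \<and> (\<forall>a\<in>J. \<forall>b\<in>J. a - b \<in> J) \<and> (\<forall>a\<in>J. \<forall>x. x * a \<in> J \<and> a * x \<in> J)"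

lemma two_sidedD:
  assumes "two_sided J"
  shows "0 \<in> J" "\<lbrakk>a \<in> J; b \<in> J\<rbrakk> \<Longrightarrow> a - b \<in> J" "a \<in> J \<Longrightarrow> x * a \<in> J" "a \<in> J \<Longrightarrow> a * x \<in> J"
    "a \<in> J \<Longrightarrow> - a \<in> J" "\<lbrakk>a \<in> J; b \<in> J\<rbrakk> \<Longrightarrow> a + b \<in> J"
proof -
  show d: "\<lbrakk>a \<in> J; b \<in> J\<rbrakk> \<Longrightarrow> a - b \<in> J" for a b using assms by (simp add: two_sided_def)
  show z: "0 \<in> J" using assms by (simp add: two_sided_def)
  show m: "a \<in> J \<Longrightarrow> - a \<in> J" for a using d[OF z, of a] by simp
  show "\<lbrakk>a \<in> J; b \<in> J\<rbrakk> \<Longrightarrow> a + b \<in> J" using d[OF _ m, of a b] by simp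
qed (use assms in \<open>simp_all add: two_sided_def\<close>)

text \<open>A quotient by an ideal that depends on parameters is not a type. The product of the quotients of
  \<open>'a\<close> by all its two-sided ideals is one, and it contains each single quotient as a
  component.\<close>

definition same_cosets :: "('a::ring_1 set \<Rightarrow> 'a) \<Rightarrow> ('a set \<Rightarrow> 'a) \<Rightarrow> bool" where
  "same_cosets F H \<longleftrightarrow> (\<forall>J. two_sided J \<longrightarrow> F J - H J \<in> J)"

quotient_type (overloaded) 'a quotients = "('a::ring_1 set \<Rightarrow> 'a)" / same_cosets
proof (rule equivpI)
  show "reflp same_cosets" by (auto simp: reflp_def same_cosets_def two_sided_def)
  show "symp (same_cosets :: ('a set \<Rightarrow> 'a) \<Rightarrow> _)"
    unfolding symp_def same_cosets_def
  proof (intro allI impI)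
    fix F G :: "'a set \<Rightarrow> 'a" and J :: "'a set"
    assume "\<forall>J. two_sided J \<longrightarrow> F J - G J \<in> J" "two_sided J"
    then have "- (F J - G J) \<in> J" by (intro two_sidedD(5)) auto
    then show "G J - F J \<in> J" by simp
  qed
  show "transp (same_cosets :: ('a set \<Rightarrow> 'a) \<Rightarrow> _)"
    unfolding transp_def same_cosets_def
  proof (intro allI impI)
    fix F G H :: "'a set \<Rightarrow> 'a" and J :: "'a set"
    assume "\<forall>J. two_sided J \<longrightarrow> F J - G J \<in> J" "\<forall>J. two_sided J \<longrightarrow> G J - H J \<in> J" "two_sided J"
    then have "(F J - G J) + (G J - H J) \<in> J" by (intro two_sidedD(6)) auto
    then show "F J - H J \<in> J" by simp
  qed
qed

instantiation quotients :: (ring_1) ring_1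
begin

lift_definition zero_quotients :: "'a quotients" is "\<lambda>J. 0" .
lift_definition one_quotients :: "'a quotients" is "\<lambda>J. 1" .

lift_definition plus_quotients :: "'a quotients \<Rightarrow> 'a quotients \<Rightarrow> 'a quotients" is "\<lambda>F G J. F J + G J"
  unfolding same_cosets_def
proof (intro allI impI)
  fix F F' G G' :: "'a set \<Rightarrow> 'a" and J :: "'a set"
  assume "\<forall>J. two_sided J \<longrightarrow> F J - F' J \<in> J" "\<forall>J. two_sided J \<longrightarrow> G J - G' J \<in> J" "two_sided J"
  then have "(F J - F' J) + (G J - G' J) \<in> J" by (intro two_sidedD(6)) auto
  then show "F J + G J - (F' J + G' J) \<in> J" by (simp add: algebra_simps)
qed

lift_definition minus_quotients :: "'a quotients \<Rightarrow> 'a quotients \<Rightarrow> 'a quotients" is "\<lambda>F G J. F J - G J"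
  unfolding same_cosets_def
proof (intro allI impI)
  fix F F' G G' :: "'a set \<Rightarrow> 'a" and J :: "'a set"
  assume "\<forall>J. two_sided J \<longrightarrow> F J - F' J \<in> J" "\<forall>J. two_sided J \<longrightarrow> G J - G' J \<in> J" and J: "two_sided J"
  then have *: "F J - F' J \<in> J" "G J - G' J \<in> J" by auto
  have "(F J - F' J) - (G J - G' J) \<in> J" by (rule two_sidedD(2)[OF J *])
  then show "F J - G J - (F' J - G' J) \<in> J" by (simp add: algebra_simps)
qed

lift_definition uminus_quotients :: "'a quotients \<Rightarrow> 'a quotients" is "\<lambda>F J. - F J"
  unfolding same_cosets_def
proof (intro allI impI)
  fix F F' :: "'a set \<Rightarrow> 'a" and J :: "'a set"
  assume "\<forall>J. two_sided J \<longrightarrow> F J - F' J \<in> J" "two_sided J"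
  then have "- (F J - F' J) \<in> J" by (intro two_sidedD(5)) auto
  then show "- F J - - F' J \<in> J" by simp
qed

lift_definition times_quotients :: "'a quotients \<Rightarrow> 'a quotients \<Rightarrow> 'a quotients" is "\<lambda>F G J. F J * G J"
  unfolding same_cosets_def
proof (intro allI impI)
  fix F F' G G' :: "'a set \<Rightarrow> 'a" and J :: "'a set"
  assume "\<forall>J. two_sided J \<longrightarrow> F J - F' J \<in> J" "\<forall>J. two_sided J \<longrightarrow> G J - G' J \<in> J" and J: "two_sided J"
  then have *: "F J - F' J \<in> J" "G J - G' J \<in> J" by auto
  have "(F J - F' J) * G J + F' J * (G J - G' J) \<in> J"
    by (rule two_sidedD(6)[OF J two_sidedD(4)[OF J *(1)] two_sidedD(3)[OF J *(2)]])
  then show "F J * G J - F' J * G' J \<in> J" by (simp add: algebra_simps)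
qed

instance
proof
  have z: "two_sided {0 :: 'a}" by (simp add: two_sided_def)
  show "(0 :: 'a quotients) \<noteq> 1" by transfer (use z in \<open>force simp: same_cosets_def\<close>)
qed (transfer; simp add: same_cosets_def two_sidedD(1) algebra_simps)+

end

text \<open>The element \<open>a\<close> in the quotient by \<open>J\<^sub>0\<close>, and \<open>s a\<close>
  in all others. With a ring homomorphism \<open>s\<close> this is a homomorphism into the product, and for
  a two-sided ideal \<open>J\<^sub>0\<close> it detects congruence modulo \<open>J\<^sub>0\<close>.\<close>

lift_definition component :: "'a::ring_1 set \<Rightarrow> ('a \<Rightarrow> 'a) \<Rightarrow> 'a \<Rightarrow> 'a quotients" is
  "\<lambda>J\<^sub>0 s a J. if J = J\<^sub>0 then a else s a" .

lemma component_hom: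
  assumes "s 1 = 1" "\<And>a b. s (a + b) = s a + s b" "\<And>a b. s (a * b) = s a * s b"
  shows "component J s 1 = 1" "component J s (a + b) = component J s a + component J s b"
    "component J s (a * b) = component J s a * component J s b"
proof -
  have eq: "same_cosets F F'" if "F = F'" for F F' :: "'a set \<Rightarrow> 'a"
    using that by (simp add: same_cosets_def two_sidedD(1))
  show "component J s 1 = 1"
    using assms by transfer (rule eq, rule ext, simp)
  show "component J s (a + b) = component J s a + component J s b"
    using assms by transfer (rule eq, rule ext, simp)
  show "component J s (a * b) = component J s a * component J s b"
    using assms by transfer (rule eq, rule ext, simp)
qed

lemma component_eqI: "a - b \<in> J \<Longrightarrow> s a = s b \<Longrightarrow> component J s a = component J s b"
  by transfer (simp add: same_cosets_def two_sidedD(1))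

lemma component_eqD:
  assumes "two_sided J" "component J s a = component J s b"
  shows "a - b \<in> J"
proof -
  have "same_cosets (\<lambda>J'. if J' = J then a else s a) (\<lambda>J'. if J' = J then b else s b)"
    using assms(2) by transfer
  from this[unfolded same_cosets_def, rule_format, OF assms(1)] show ?thesis by simp
qed

text \<open>The ideal of relations is an ideal of the subring of those words whose letters have indices in
  range only. Setting all other letters to zero is a homomorphism, and the preimage of the ideal is an ideal
  of the whole ring.\<close>

definition restrict_words :: "nat \<Rightarrow> 'a::field falg \<Rightarrow> 'a falg" where
  "restrict_words n a = (\<Sum>w\<in>{w \<in> Poly_Mapping.keys a. set (letters w) \<subseteq> gens n}. Poly_Mapping.single w (Poly_Mapping.lookup a w))"

lemma lookup_restrict_words:
  "Poly_Mapping.lookup (restrict_words n a) w = (if set (letters w) \<subseteq> gens n then Poly_Mapping.lookup a w else 0)"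
  unfolding restrict_words_def by (auto simp: lookup_sum lookup_single when_def sum.delta in_keys_iff)

lemma restrict_words_simps:
  "restrict_words n 0 = 0" "restrict_words n (a + b) = restrict_words n a + restrict_words n b"
  "restrict_words n (a - b) = restrict_words n a - restrict_words n b"
  "restrict_words n (Poly_Mapping.single w k) = (if set (letters w) \<subseteq> gens n then Poly_Mapping.single w k else 0)"
  by (rule poly_mapping_eqI; simp add: lookup_restrict_words lookup_add lookup_minus lookup_single when_def; fail)+

lemma letters_plus: "letters (u + w) = letters u @ letters w"
  by (simp add: plus_word_def)

lemma restrict_words_mult: "restrict_words n (a * b) = restrict_words n a * restrict_words n b"
proof (induction a rule: poly_mapping_single_induct)
  case (add_single u k a)
  have "restrict_words n (Poly_Mapping.single u k * b) = restrict_words n (Poly_Mapping.single u k) * restrict_words n b"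
    by (induction b rule: poly_mapping_single_induct)
      (simp_all add: ring_distribs restrict_words_simps mult_single letters_plus)
  with add_single show ?case by (simp add: ring_distribs restrict_words_simps)
qed (simp add: restrict_words_simps)

lemma restrict_words_carrier: "restrict_words n a \<in> carrier (free_algebra n)"
  by (auto simp: carrier_free_algebra in_keys_iff lookup_restrict_words split: if_splits)

lemma restrict_words_id: "a \<in> carrier (free_algebra n) \<Longrightarrow> restrict_words n a = a"
  by (rule poly_mapping_eqI) (auto simp: carrier_free_algebra in_keys_iff lookup_restrict_words)

fun letter_value :: "'a::field \<Rightarrow> 'a \<Rightarrow> gen \<Rightarrow> 'a" where
  "letter_value q c (GenT j) = 1"
| "letter_value q c (GenG i) = q"
| "letter_value q c GenX = c"
| "letter_value q c GenXinv = inverse c"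

text \<open>The one-dimensional representation with \<open>t \<mapsto> 1\<close>, \<open>g \<mapsto>
  q\<close>, \<open>X \<mapsto> c\<close>. For \<open>c = v 1\<close> it satisfies all relations, so it may
  be used in the components that are of no interest.\<close>

definition character :: "'a::field \<Rightarrow> 'a \<Rightarrow> 'a falg \<Rightarrow> 'a" where
  "character q c = wpair (\<lambda>w. prod_list (map (letter_value q c) (letters w)))"

lemma character_hom:
  "character q c 0 = 0" "character q c 1 = 1" "character q c (a + b) = character q c a + character q c b"
  "character q c (a * b) = character q c a * character q c b"
  "character q c (scal k) = k" "character q c (letter g) = letter_value q c g"
proof -
  have k: "character q c (scal k) = k" for k by (simp add: character_def scal_def wpair_single zero_word_def)
  then show "character q c (scal k) = k" .
  show "character q c 1 = 1" using k[of 1] by (simp add: scal_hom)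
  show "character q c (letter g) = letter_value q c g" by (simp add: character_def letter_def wpair_single)
  have "character q c (Poly_Mapping.single u k * b) = character q c (Poly_Mapping.single u k) * character q c b" for u k
    unfolding character_def wpair_single_left
    by (induction b rule: poly_mapping_single_induct)
      (simp_all add: wpair_add wpair_single letters_plus algebra_simps)
  then show "character q c (a * b) = character q c a * character q c b"
    by (induction a rule: poly_mapping_single_induct) (simp_all add: ring_distribs character_def wpair_add)
qed (simp_all add: character_def wpair_add)

lemma character_diff: "character q c (a - b) = character q c a - character q c b"
  using character_hom(3)[of q c "a - b" b] by (simp add: algebra_simps)

lemma character_power: "character q c (a ^ k) = character q c a ^ k"
  by (induction k) (simp_all add: character_hom)

lemma character_sum: "character q c (sum f A) = (\<Sum>x\<in>A. character q c (f x))"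
  by (induction A rule: infinite_finite_induct) (simp_all add: character_hom)

lemma character_prod_list: "character q c (prod_list xs) = prod_list (map (character q c) xs)"
  by (induction xs) (simp_all add: character_hom)

definition yh_kernel :: "nat \<Rightarrow> nat \<Rightarrow> nat \<Rightarrow> 'a::field \<Rightarrow> (nat \<Rightarrow> 'a) \<Rightarrow> 'a falg set" where
  "yh_kernel r n d q v = {a. restrict_words n a \<in> yh_ideal r n d q v}"

lemma two_sided_yh_kernel: "two_sided (yh_kernel r n d q v)"
  unfolding two_sided_def yh_kernel_def
proof (intro conjI ballI allI; unfold mem_Collect_eq restrict_words_simps restrict_words_mult)
  show "0 \<in> yh_ideal r n d q v" by (rule yh_ideal_closed(3))
next
  fix a b assume "restrict_words n a \<in> yh_ideal r n d q v" "restrict_words n b \<in> yh_ideal r n d q v"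
  then show "restrict_words n a - restrict_words n b \<in> yh_ideal r n d q v" by (rule yh_ideal_closed(5))
next
  fix a x assume a: "restrict_words n a \<in> yh_ideal r n d q v"
  show "restrict_words n x * restrict_words n a \<in> yh_ideal r n d q v"
    by (rule yh_ideal_closed(7)[OF a restrict_words_carrier])
  show "restrict_words n a * restrict_words n x \<in> yh_ideal r n d q v"
    by (rule yh_ideal_closed(6)[OF a restrict_words_carrier])
qed

definition \<pi> :: "nat \<Rightarrow> nat \<Rightarrow> nat \<Rightarrow> 'a::field \<Rightarrow> (nat \<Rightarrow> 'a) \<Rightarrow> 'a falg \<Rightarrow> 'a falg quotients" where
  "\<pi> r n d q v = component (yh_kernel r n d q v) (\<lambda>a. scal (character q (v 1) a))"

lemma pi_hom:
  "\<pi> r n d q v 1 = 1" "\<pi> r n d q v (a + b) = \<pi> r n d q v a + \<pi> r n d q v b"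
  "\<pi> r n d q v (a * b) = \<pi> r n d q v a * \<pi> r n d q v b"
  unfolding \<pi>_def by (rule component_hom; simp add: character_hom scal_hom)+

lemma pi_0: "\<pi> r n d q v 0 = 0"
  using pi_hom(2)[of r n d q v 0 0] by simp

lemma pi_diff: "\<pi> r n d q v (a - b) = \<pi> r n d q v a - \<pi> r n d q v b"
  using pi_hom(2)[of r n d q v "a - b" b] by (simp add: algebra_simps)

lemma pi_power: "\<pi> r n d q v (a ^ k) = \<pi> r n d q v a ^ k"
  by (induction k) (simp_all add: pi_hom)

lemma pi_sum: "\<pi> r n d q v (sum f A) = (\<Sum>x\<in>A. \<pi> r n d q v (f x))"
  by (induction A rule: infinite_finite_induct) (simp_all add: pi_hom pi_0)

lemma pi_prod_list: "\<pi> r n d q v (prod_list xs) = prod_list (map (\<pi> r n d q v) xs)"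
  by (induction xs) (simp_all add: pi_hom)

lemma pi_eq_imp_class_eq:
  assumes "a \<in> carrier (free_algebra n)" "b \<in> carrier (free_algebra n)" "\<pi> r n d q v a = \<pi> r n d q v b"
  shows "yh_class r n d q v a = yh_class r n d q v b"
proof -
  have "a - b \<in> yh_kernel r n d q v"
    using component_eqD[OF two_sided_yh_kernel assms(3)[unfolded \<pi>_def]] .
  moreover have "a - b \<in> carrier (free_algebra n)" using assms by (intro free_algebra_closed)
  ultimately show ?thesis by (simp add: yh_class_eq_iff yh_kernel_def restrict_words_id)
qed

lemma character_relation:
  assumes r: "of_nat r \<noteq> (0::'a::field)" and q: "q \<noteq> 0" and v: "v 1 \<noteq> 0" and d: "d \<ge> 1"
    and a: "a \<in> yh_relations r n d q (v :: nat \<Rightarrow> 'a)"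
  shows "character q (v 1) a = 0"
proof -
  have e: "character q (v 1) (ee r i) = 1" for i
    using r by (simp add: ee_def character_hom character_sum character_power)
  have cyc: "character q (v 1) (prod_list (map (\<lambda>l. xx - scal (v l)) [1..<d + 1])) = 0"
    unfolding character_prod_list prod_list_zero_iff set_map image_image
  proof (rule image_eqI[of _ _ 1])
    show "1 \<in> set [1..<d + 1]" using d by auto
  qed (simp add: character_diff character_hom)
  have sq: "q\<^sup>2 - (1 + (q - inverse q) * q) = 0" using q by (simp add: field_simps power2_eq_square)
  have vv: "v 1 * inverse (v 1) = 1" "inverse (v 1) * v 1 = 1" using v by simp_all
  from a show ?thesis
    unfolding yh_relations_def
    by (elim UnE CollectE exE conjE insertE emptyE; hypsubst;
        (simp only: character_diff character_hom character_power letter_value.simps e sq cyc vv mult_1 mult_1_right power_one diff_self)?;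
        (simp add: mult_ac)?)
qed

lemma pi_relation:
  assumes "of_nat r \<noteq> (0::'a::field)" "q \<noteq> 0" "v 1 \<noteq> 0" "d \<ge> 1"
    and a: "a \<in> yh_relations r n d q (v :: nat \<Rightarrow> 'a)"
  shows "\<pi> r n d q v a = 0"
proof -
  have "a \<in> carrier (free_algebra n)" using yh_relations_closed a by blast
  then have "a - 0 \<in> yh_kernel r n d q v" using yh_ideal_closed(2)[of r n d q v] a by (auto simp: yh_kernel_def restrict_words_id)
  moreover have "scal (character q (v 1) a) = scal (character q (v 1) 0)"
    by (simp only: character_relation[OF assms] character_hom)
  ultimately show ?thesis unfolding \<pi>_def
    using component_eqI[of a 0 _ "\<lambda>a. scal (character q (v 1) a)"] pi_0[of r n d q v, unfolded \<pi>_def] by metis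
qed

lemma scal_commute: "x * scal c = scal c * (x :: 'a::field falg)"
  by (induction x rule: poly_mapping_single_induct)
    (simp_all add: ring_distribs scal_def mult_single mult.commute)

lemma pi_central: "x * \<pi> r n d q v (scal a) = \<pi> r n d q v (scal a) * x"
  unfolding \<pi>_def
proof (transfer fixing: a q v n r d)
  show "same_cosets (\<lambda>J. x J * (if J = yh_kernel r n d q v then scal a else scal (character q (v 1) (scal a))))
     (\<lambda>J. (if J = yh_kernel r n d q v then scal a else scal (character q (v 1) (scal a))) * x J)"
    for x :: "'a falg set \<Rightarrow> 'a falg"
    by (simp add: same_cosets_def two_sidedD(1) scal_commute)
qed

lemma yh_relationsI:
  "\<lbrakk>i \<in> {1..<n}; j \<in> {1..<n}; i + 2 \<le> j\<rbrakk> \<Longrightarrow> gg i * gg j - gg j * gg i \<in> yh_relations r n d q v"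
  "\<lbrakk>i \<in> {1..<n}; i + 1 \<in> {1..<n}\<rbrakk> \<Longrightarrow> gg i * gg (i + 1) * gg i - gg (i + 1) * gg i * gg (i + 1) \<in> yh_relations r n d q v"
  "\<lbrakk>i \<in> {1..n}; j \<in> {1..n}\<rbrakk> \<Longrightarrow> tt i * tt j - tt j * tt i \<in> yh_relations r n d q v"
  "\<lbrakk>i \<in> {1..<n}; j \<in> {1..n}\<rbrakk> \<Longrightarrow> gg i * tt j - tt (transpose i (i + 1) j) * gg i \<in> yh_relations r n d q v"
  "i \<in> {1..n} \<Longrightarrow> tt i ^ r - 1 \<in> yh_relations r n d q v"
  "i \<in> {1..<n} \<Longrightarrow> gg i ^ 2 - (1 + scal (q - inverse q) * ee r i * gg i) \<in> yh_relations r n d q v"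
  "2 \<le> n \<Longrightarrow> gg 1 * xx * gg 1 * xx - xx * gg 1 * xx * gg 1 \<in> yh_relations r n d q v"
  "\<lbrakk>i \<in> {1..<n}; 2 \<le> i\<rbrakk> \<Longrightarrow> gg i * xx - xx * gg i \<in> yh_relations r n d q v"
  "j \<in> {1..n} \<Longrightarrow> tt j * xx - xx * tt j \<in> yh_relations r n d q v"
  "prod_list (map (\<lambda>l. xx - scal (v l)) [1..<d + 1]) \<in> yh_relations r n d q v"
proof -
  show "gg i * gg j - gg j * gg i \<in> yh_relations r n d q v" (is "?a \<in> _") if "i \<in> {1..<n}" "j \<in> {1..<n}" "i + 2 \<le> j"
  proof -
    have "?a \<in> {gg i * gg j - gg j * gg i | i j.
        i \<in> {1..<n} \<and> j \<in> {1..<n} \<and> \<bar>int i - int j\<bar> \<ge> 2}" 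
      by (rule CollectI, intro exI[of _ i] exI[of _ j]) (use that in simp)
    then show ?thesis unfolding yh_relations_def by (simp only: Un_iff simp_thms)
  qed
  show "gg i * gg (i + 1) * gg i - gg (i + 1) * gg i * gg (i + 1) \<in> yh_relations r n d q v" (is "?a \<in> _")
    if "i \<in> {1..<n}" "i + 1 \<in> {1..<n}"
  proof -
    have "?a \<in>
       {gg i * gg (i + 1) * gg i - gg (i + 1) * gg i * gg (i + 1) | i. i \<in> {1..<n} \<and> i + 1 \<in> {1..<n}}"
      by (rule CollectI, intro exI[of _ i]) (use that in simp)
    then show ?thesis unfolding yh_relations_def by (simp only: Un_iff simp_thms)
  qed
  show "tt i * tt j - tt j * tt i \<in> yh_relations r n d q v" (is "?a \<in> _") if "i \<in> {1..n}" "j \<in> {1..n}"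
  proof -
    have "?a \<in> {tt i * tt j - tt j * tt i | i j. i \<in> {1..n} \<and> j \<in> {1..n}}"
      by (rule CollectI, intro exI[of _ i] exI[of _ j]) (use that in simp)
    then show ?thesis unfolding yh_relations_def by (simp only: Un_iff simp_thms)
  qed
  show "gg i * tt j - tt (transpose i (i + 1) j) * gg i \<in> yh_relations r n d q v" (is "?a \<in> _") if "i \<in> {1..<n}" "j \<in> {1..n}"
  proof -
    have "?a \<in>
       {gg i * tt j - tt (transpose i (i + 1) j) * gg i | i j. i \<in> {1..<n} \<and> j \<in> {1..n}}"
      by (rule CollectI, intro exI[of _ i] exI[of _ j]) (use that in simp)
    then show ?thesis unfolding yh_relations_def by (simp only: Un_iff simp_thms)
  qed
  show "tt i ^ r - 1 \<in> yh_relations r n d q v" (is "?a \<in> _") if "i \<in> {1..n}"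
  proof -
    have "?a \<in> {tt i ^ r - 1 | i. i \<in> {1..n}}"
      by (rule CollectI, intro exI[of _ i]) (use that in simp)
    then show ?thesis unfolding yh_relations_def by (simp only: Un_iff simp_thms)
  qed
  show "gg i ^ 2 - (1 + scal (q - inverse q) * ee r i * gg i) \<in> yh_relations r n d q v" (is "?a \<in> _") if "i \<in> {1..<n}"
  proof -
    have "?a \<in>
       {gg i ^ 2 - (1 + scal (q - inverse q) * ee r i * gg i) | i. i \<in> {1..<n}}"
      by (rule CollectI, intro exI[of _ i]) (use that in simp)
    then show ?thesis unfolding yh_relations_def by (simp only: Un_iff simp_thms)
  qed
  show "gg 1 * xx * gg 1 * xx - xx * gg 1 * xx * gg 1 \<in> yh_relations r n d q v" (is "?a \<in> _") if "2 \<le> n"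
  proof -
    have "?a \<in>
       {gg i * xx * gg i * xx - xx * gg i * xx * gg i | i. i \<in> {1..<n} \<and> i = 1}"
      by (rule CollectI, intro exI[of _ 1]) (use that in simp)
    then show ?thesis unfolding yh_relations_def by (simp only: Un_iff simp_thms)
  qed
  show "gg i * xx - xx * gg i \<in> yh_relations r n d q v" (is "?a \<in> _") if "i \<in> {1..<n}" "2 \<le> i"
  proof -
    have "?a \<in> {gg i * xx - xx * gg i | i. i \<in> {1..<n} \<and> i \<ge> 2}"
      by (rule CollectI, intro exI[of _ i]) (use that in simp)
    then show ?thesis unfolding yh_relations_def by (simp only: Un_iff simp_thms)
  qed
  show "tt j * xx - xx * tt j \<in> yh_relations r n d q v" (is "?a \<in> _") if "j \<in> {1..n}"
  proof -
    have "?a \<in> {tt j * xx - xx * tt j | j. j \<in> {1..n}}"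
      by (rule CollectI, intro exI[of _ j]) (use that in simp)
    then show ?thesis unfolding yh_relations_def by (simp only: Un_iff simp_thms)
  qed
qed (simp add: yh_relations_def)

text \<open>The relations hold in every component: in that of the kernel by definition, in the others
  because they hold for the character.\<close>

theorem yh_realisation:
  fixes \<zeta> q :: "'k::field"
  assumes r: "of_nat r \<noteq> (0::'k)" and d: "d \<ge> 1" and sep: "separated_parameters n d q v"
    and \<zeta>: "\<zeta> ^ r = 1" "\<And>j. 0 < j \<Longrightarrow> j < r \<Longrightarrow> \<zeta> ^ j \<noteq> 1"
  shows "cyclotomic_yokonuma_hecke (\<lambda>c. \<pi> r n d q v (scal c)) r n q (\<lambda>i. \<pi> r n d q v (gg i))
    (\<lambda>j. \<pi> r n d q v (tt j)) (\<pi> r n d q v xx) d v \<zeta>"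
proof -
  interpret separated_parameters n d q v by (rule sep)
  let ?p = "\<pi> r n d q v"
  have v1: "v 1 \<noteq> 0" using v_nonzero[of 1] d by simp
  have rel: "?p a = ?p b" if "a - b \<in> yh_relations r n d q v" for a b
    using pi_relation[OF r q_nonzero v1 d that] by (simp add: pi_diff)
  have ee: "?p (ee r i) = ?p (scal (1 / of_nat r)) * (\<Sum>s<r. ?p (tt i) ^ s * ?p (tt (i + 1)) ^ (r - s))" for i
    by (simp add: ee_def pi_hom pi_sum pi_power)
  show ?thesis
  proof (intro cyclotomic_yokonuma_hecke.intro yokonuma_hecke.intro scalar_ring.intro sep
      yokonuma_hecke_axioms.intro cyclotomic_yokonuma_hecke_axioms.intro r q_nonzero \<zeta>)
    show "?p (scal 1) = 1" by (simp add: scal_hom pi_hom)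
    show "?p (scal (a + b)) = ?p (scal a) + ?p (scal b)" for a b by (simp add: scal_hom pi_hom)
    show "?p (scal (a * b)) = ?p (scal a) * ?p (scal b)" for a b by (simp add: scal_hom pi_hom)
    show "x * ?p (scal a) = ?p (scal a) * x" for x a
      using pi_central .
    show "?p (gg i) * ?p (gg j) = ?p (gg j) * ?p (gg i)" if "i \<in> {1..<n}" "j \<in> {1..<n}" "i + 2 \<le> j" for i j
      using rel[OF yh_relationsI(1)[OF that]] unfolding pi_hom .
    show "?p (gg i) * ?p (gg (i + 1)) * ?p (gg i) = ?p (gg (i + 1)) * ?p (gg i) * ?p (gg (i + 1))"
      if "i \<in> {1..<n}" "i + 1 \<in> {1..<n}" for i
      using rel[OF yh_relationsI(2)[OF that]] unfolding pi_hom .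
    show "?p (tt i) * ?p (tt j) = ?p (tt j) * ?p (tt i)" if "i \<in> {1..n}" "j \<in> {1..n}" for i j
      using rel[OF yh_relationsI(3)[OF that]] unfolding pi_hom .
    show "?p (gg i) * ?p (tt j) = ?p (tt (transpose i (i + 1) j)) * ?p (gg i)" if "i \<in> {1..<n}" "j \<in> {1..n}" for i j
      using rel[OF yh_relationsI(4)[OF that]] unfolding pi_hom .
    show "?p (tt i) ^ r = 1" if "i \<in> {1..n}" for i
      using rel[OF yh_relationsI(5)[OF that]] unfolding pi_hom pi_power .
    show "?p (gg i) ^ 2 = 1 + ?p (scal (q - inverse q)) *
       (?p (scal (1 / of_nat r)) * (\<Sum>s<r. ?p (tt i) ^ s * ?p (tt (i + 1)) ^ (r - s))) * ?p (gg i)" if "i \<in> {1..<n}" for i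
      using rel[OF yh_relationsI(6)[OF that]] unfolding pi_hom pi_power ee .
    show "?p (gg 1) * ?p xx * ?p (gg 1) * ?p xx = ?p xx * ?p (gg 1) * ?p xx * ?p (gg 1)" if "2 \<le> n"
      using rel[OF yh_relationsI(7)[OF that]] unfolding pi_hom .
    show "?p (gg i) * ?p xx = ?p xx * ?p (gg i)" if "i \<in> {1..<n}" "2 \<le> i" for i
      using rel[OF yh_relationsI(8)[OF that]] unfolding pi_hom .
    show "?p (tt j) * ?p xx = ?p xx * ?p (tt j)" if "j \<in> {1..n}" for j
      using rel[OF yh_relationsI(9)[OF that]] unfolding pi_hom .
    have "?p (prod_list (map (\<lambda>l. xx - scal (v l)) [1..<d + 1])) = 0"
      by (rule pi_relation[where v = v, OF r q_nonzero v1 d], rule yh_relationsI(10))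
    then show "prod_list (map (\<lambda>l. ?p xx - ?p (scal (v l))) [1..<d + 1]) = 0"
      by (simp add: pi_prod_list comp_def pi_diff)
  qed
qed

section \<open>Inverses without denominators\<close>

context scalar_ring begin

text \<open>The quotient of \<open>\<Prod>a\<in>A. u - a\<close> by \<open>u - x\<close>. It is polynomial
  in \<open>u\<close>, so it can be evaluated at every point.\<close>

definition adjugate :: "'k set \<Rightarrow> 'k \<Rightarrow> 'b \<Rightarrow> 'b" where
  "adjugate A u x = (\<Sum>a\<in>A. sc (\<Prod>b\<in>A - {a}. u - b) * pe (interpolation A a) x)"

lemma adjugate_resolvent:
  assumes "finite A" "u \<notin> A"
  shows "adjugate A u x = sc (\<Prod>a\<in>A. u - a) * resolvent A u x"
proof -
  have "(\<Prod>b\<in>A - {a}. u - b) = (\<Prod>b\<in>A. u - b) * (1 / (u - a))" if "a \<in> A" for a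
  proof -
    have "u - a \<noteq> 0" using that assms(2) by auto
    moreover have "(\<Prod>b\<in>A. u - b) = (u - a) * (\<Prod>b\<in>A - {a}. u - b)"
      by (rule prod.remove) (use that assms in auto)
    ultimately show ?thesis by simp
  qed
  then show ?thesis
    unfolding adjugate_def resolvent_def sum_distrib_left by (intro sum.cong refl) (simp add: sc_assoc)
qed

lemma adjugate_inverse:
  assumes "finite A" "u \<notin> A" "pe (roots_poly A) x = 0"
  shows "(sc u - x) * (sc (inverse (\<Prod>a\<in>A. u - a)) * adjugate A u x) = 1"
    "(sc (inverse (\<Prod>a\<in>A. u - a)) * adjugate A u x) * (sc u - x) = 1"
proof -
  have nz: "(\<Prod>a\<in>A. u - a) \<noteq> 0" using assms(1,2) by auto
  then have eq: "sc (inverse (\<Prod>a\<in>A. u - a)) * adjugate A u x = resolvent A u x"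
    by (simp add: adjugate_resolvent[OF assms(1,2)] sc_assoc)
  have 1: "(sc u - x) * resolvent A u x = 1"
    using resolvent[OF assms(1) _ assms(2), of x 1] assms(3) by simp
  then show "(sc u - x) * (sc (inverse (\<Prod>a\<in>A. u - a)) * adjugate A u x) = 1" unfolding eq .
  have "x * resolvent A u x = resolvent A u x * x" by (rule resolvent_commute) simp
  then have "resolvent A u x * (sc u - x) = (sc u - x) * resolvent A u x"
    by (simp add: ring_distribs sc_comm)
  then show "(sc (inverse (\<Prod>a\<in>A. u - a)) * adjugate A u x) * (sc u - x) = 1" unfolding eq using 1 by simp
qed

end

context cyclotomic_yokonuma_hecke begin

lemma roots_of_unity: "roots_poly (root_set r \<zeta>) = monom 1 r - 1"
proof (rule poly_eqI_degree_lead_coeff[where n = r and A = "root_set r \<zeta>"])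
  have inj: "inj_on (root_k \<zeta>) {1..r}" using root_k_inj by (auto simp: inj_on_def)
  have card: "card (root_set r \<zeta>) = r" unfolding root_set_def by (subst card_image[OF inj]) simp
  then show "r \<le> card (root_set r \<zeta>)" by simp
  have fin: "finite (root_set r \<zeta>)" by (simp add: root_set_def)
  have deg: "degree (roots_poly (root_set r \<zeta>)) = r"
    unfolding roots_poly_def by (subst degree_prod_eq_sum_degree) (use card in auto)
  have "lead_coeff (roots_poly (root_set r \<zeta>)) = 1"
    unfolding roots_poly_def by (subst lead_coeff_prod) simp
  then show "coeff (roots_poly (root_set r \<zeta>)) r = coeff (monom 1 r - 1) r" using deg r_pos by simp
  show "degree (roots_poly (root_set r \<zeta>)) \<le> r" using deg by simp
  show "degree (monom 1 r - 1 :: 'k poly) \<le> r"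
    by (rule degree_diff_le) (simp_all add: degree_monom_le)
  show "poly (roots_poly (root_set r \<zeta>)) z = poly (monom 1 r - 1) z" if "z \<in> root_set r \<zeta>" for z
    using that root_k_power poly_roots_poly[OF fin, of z] by (auto simp: root_set_def poly_monom)
qed

lemma pe_monom: "pe (monom 1 k) x = x ^ k"
  by (induction k) (simp_all add: monom_Suc pe_pCons)

lemma pe_T: "i \<in> {1..n} \<Longrightarrow> pe (roots_poly (root_set r \<zeta>)) (T i) = 0"
  using pe_add[of "monom 1 r - 1" 1 "T i"] T_power[of i] by (simp add: roots_of_unity pe_monom)

end

section \<open>Evaluation of coefficients\<close>

lemma mvar_neq: "x \<noteq> y \<Longrightarrow> (mvar x :: 'a::field mpoly) \<noteq> mvar y"
proof
  assume "x \<noteq> y" "(mvar x :: 'a mpoly) = mvar y"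
  then have "Poly_Mapping.lookup (mvar x :: 'a mpoly) (Poly_Mapping.single x 1) = Poly_Mapping.lookup (mvar y :: 'a mpoly) (Poly_Mapping.single x 1)" by simp
  moreover have "Poly_Mapping.single x (1::nat) \<noteq> Poly_Mapping.single y 1"
    using \<open>x \<noteq> y\<close> by (metis lookup_single_eq lookup_single_not_eq zero_neq_one)
  ultimately show False by (simp add: mvar_def lookup_single when_def)
qed

lemma mvar_neq_mconst: "(mvar x :: 'a::field mpoly) \<noteq> mconst c"
proof
  assume "(mvar x :: 'a mpoly) = mconst c"
  then have "Poly_Mapping.lookup (mvar x :: 'a mpoly) (Poly_Mapping.single x 1) = Poly_Mapping.lookup (mconst c) (Poly_Mapping.single x 1)" by simp
  moreover have "(0 :: nat \<Rightarrow>\<^sub>0 nat) \<noteq> Poly_Mapping.single x 1"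
    by (metis lookup_single_eq lookup_zero zero_neq_one)
  ultimately show False by (simp add: mvar_def mconst_def lookup_single when_def)
qed

lemma rvar_neq: "x \<noteq> y \<Longrightarrow> (rvar x :: 'a::field ratfun) \<noteq> rvar y"
  using mvar_neq[of x y] by (simp add: rvar_def eq_fract)

lemma rvar_neq_rconst: "(rvar x :: 'a::field ratfun) \<noteq> rconst c"
  using mvar_neq_mconst[of x c] by (simp add: rvar_def rconst_def eq_fract)

lemma msubst_mvar: "msubst x c (mvar y) = (if y = x then mconst c else mvar y)"
proof -
  have "Poly_Mapping.keys (Poly_Mapping.single y (1::nat)) = {y}" by simp
  then show ?thesis unfolding mvar_def[of y] msubst_single
    by (simp add: mmonom_def mvar_def)
qed

lemma rat_evaluates_rvar: "rat_evaluates x c (rvar y) (if y = x then rconst c else rvar y)"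
  unfolding rat_evaluates_def rvar_def rconst_def
  by (rule exI[of _ "mvar y"], rule exI[of _ 1]) (simp add: msubst_mvar)

lemma rat_evaluates_inverse:
  assumes "rat_evaluates x c f g" "g \<noteq> 0"
  shows "rat_evaluates x c (inverse f) (inverse g)"
proof -
  obtain a b where ab: "f = Fraction_Field.Fract a b" "msubst x c b \<noteq> 0"
      "g = Fraction_Field.Fract (msubst x c a) (msubst x c b)"
    using assms(1) by (auto simp: rat_evaluates_def)
  have "msubst x c a \<noteq> 0" using assms(2) ab(2,3) by (auto simp: Zero_fract_def eq_fract)
  then show ?thesis unfolding rat_evaluates_def
    by (intro exI[of _ b] exI[of _ a]) (use ab in simp)
qed

lemma rat_evaluates_divide:
  assumes "rat_evaluates x c f g" "rat_evaluates x c f' g'" "g' \<noteq> 0"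
  shows "rat_evaluates x c (f / f') (g / g')"
  unfolding divide_inverse by (intro rat_evaluates_mult rat_evaluates_inverse assms)

lemma rat_evaluates_prod:
  assumes "\<And>i. i \<in> A \<Longrightarrow> rat_evaluates x c (f i) (g i)"
  shows "rat_evaluates x c (prod f A) (prod g A)"
  using assms rat_evaluates_rconst[of x c 1]
  by (induction A rule: infinite_finite_induct) (simp_all add: rat_evaluates_mult rconst_hom)

text \<open>Evaluation of all coefficients of a representative.\<close>

definition evaluates :: "nat \<Rightarrow> 'a::field \<Rightarrow> 'a ratfun falg \<Rightarrow> 'a ratfun falg \<Rightarrow> bool" where
  "evaluates x c a b \<longleftrightarrow> (\<forall>w. rat_evaluates x c (Poly_Mapping.lookup a w) (Poly_Mapping.lookup b w))"

lemma evaluates_add: "evaluates x c a b \<Longrightarrow> evaluates x c a' b' \<Longrightarrow> evaluates x c (a + a') (b + b')"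
  by (simp add: evaluates_def lookup_add rat_evaluates_add)

lemma evaluates_0: "evaluates x c 0 0"
  by (simp add: evaluates_def)

lemma evaluates_sum: "(\<And>i. i \<in> A \<Longrightarrow> evaluates x c (f i) (g i)) \<Longrightarrow> evaluates x c (sum f A) (sum g A)"
  by (induction A rule: infinite_finite_induct) (simp_all add: evaluates_add evaluates_0)

lemma evaluates_single: "rat_evaluates x c k k' \<Longrightarrow> evaluates x c (Poly_Mapping.single w k) (Poly_Mapping.single w k')"
  by (simp add: evaluates_def lookup_single when_def)

lemma poly_mapping_sum_superset:
  assumes "finite A" "Poly_Mapping.keys p \<subseteq> A"
  shows "p = (\<Sum>m\<in>A. Poly_Mapping.single m (Poly_Mapping.lookup p m))"
  by (rule poly_mapping_eqI)
    (use assms in \<open>auto simp: lookup_sum lookup_single when_def sum.delta in_keys_iff\<close>)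

text \<open>The coefficients of a product are finite sums over pairs of words; the words that occur before
  or after the evaluation are taken together, since coefficients may vanish under it.\<close>

lemma evaluates_mult:
  assumes "evaluates x c a b" "evaluates x c a' b'"
  shows "evaluates x c (a * a') (b * b')"
proof -
  let ?A = "Poly_Mapping.keys a \<union> Poly_Mapping.keys b" and ?B = "Poly_Mapping.keys a' \<union> Poly_Mapping.keys b'"
  have m: "(\<Sum>m\<in>?A. Poly_Mapping.single m (Poly_Mapping.lookup p m)) * (\<Sum>m\<in>?B. Poly_Mapping.single m (Poly_Mapping.lookup p' m)) =
    (\<Sum>m\<in>?A. \<Sum>m'\<in>?B. Poly_Mapping.single (m + m') (Poly_Mapping.lookup p m * Poly_Mapping.lookup p' m'))"
    for p p' :: "'a ratfun falg"
    by (simp add: sum_product mult_single)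
  have "a * a' = (\<Sum>m\<in>?A. \<Sum>m'\<in>?B. Poly_Mapping.single (m + m') (Poly_Mapping.lookup a m * Poly_Mapping.lookup a' m'))"
    unfolding m[symmetric] by (rule arg_cong2[where f = "(*)"]; rule poly_mapping_sum_superset; simp)
  moreover have "b * b' = (\<Sum>m\<in>?A. \<Sum>m'\<in>?B. Poly_Mapping.single (m + m') (Poly_Mapping.lookup b m * Poly_Mapping.lookup b' m'))"
    unfolding m[symmetric] by (rule arg_cong2[where f = "(*)"]; rule poly_mapping_sum_superset; simp)
  moreover have "evaluates x c (\<Sum>m\<in>?A. \<Sum>m'\<in>?B. Poly_Mapping.single (m + m') (Poly_Mapping.lookup a m * Poly_Mapping.lookup a' m'))
     (\<Sum>m\<in>?A. \<Sum>m'\<in>?B. Poly_Mapping.single (m + m') (Poly_Mapping.lookup b m * Poly_Mapping.lookup b' m'))"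
    using assms by (intro evaluates_sum evaluates_single rat_evaluates_mult) (simp_all add: evaluates_def)
  ultimately show ?thesis by simp
qed

lemma evaluates_scal: "rat_evaluates x c k k' \<Longrightarrow> evaluates x c (scal k) (scal k')"
  by (simp add: scal_def evaluates_single)

lemma evaluates_cmap: "evaluates x c (cmap a) (cmap a)"
  by (simp add: evaluates_def rat_evaluates_rconst)

lemma evaluates_letter: "evaluates x c (letter g) (letter g)"
  using evaluates_cmap[of x c "letter g"] by (simp add: cmap_letter)

lemma evaluates_ee: "evaluates x c (ee r i) (ee r i)"
  using evaluates_cmap[of x c "ee r i"] by (simp add: cmap_ee)

lemma evaluates_1: "evaluates x c 1 1"
  using evaluates_cmap[of x c 1] by (simp add: cmap_1)

lemma evaluates_prod_list:
  "(\<And>i. i \<in> set is \<Longrightarrow> evaluates x c (f i) (g i)) \<Longrightarrow> evaluates x c (prod_list (map f is)) (prod_list (map g is))"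
  by (induction "is") (simp_all add: evaluates_1 evaluates_mult)

lemma yh_evaluatesI:
  assumes "a \<in> carrier (free_algebra n)" "evaluates x c a b"
  shows "yh_evaluates r n d q v x c (yh_rclass r n d q v a) (yh_rclass r n d q v b)"
  unfolding yh_evaluates_def
proof (intro conjI bexI[of _ a] exI[of _ b])
  show "yh_rclass r n d q v a \<in> carrier (yh_ratfun r n d q v)"
    using assms(1) by (simp add: yh_ratfun_def yh_rclass_def carrier_yh_algebra)
  show "a \<in> yh_rclass r n d q v a" by (simp add: yh_rclass_def mem_yh_class_iff yh_ideal_closed)
qed (use assms(2) in \<open>simp_all add: evaluates_def\<close>)

section \<open>Classes in the quotient\<close>

lemma yh_class_mult:
  "a \<in> carrier (free_algebra n) \<Longrightarrow> b \<in> carrier (free_algebra n) \<Longrightarrow>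
    yh_class r n d q v a \<otimes>\<^bsub>yh_algebra r n d q v\<^esub> yh_class r n d q v b = yh_class r n d q v (a * b)"
  using ideal.rcoset_mult_add[OF ideal_yh_ideal, of a n b]
  by (simp add: yh_algebra_def yh_class_def FactRing_def)

lemma yh_class_one: "\<one>\<^bsub>yh_algebra r n d q v\<^esub> = yh_class r n d q v 1"
  by (simp add: yh_algebra_def yh_class_def FactRing_def)

lemma yh_class_closed: "a \<in> carrier (free_algebra n) \<Longrightarrow> yh_class r n d q v a \<in> carrier (yh_algebra r n d q v)"
  by (simp add: carrier_yh_algebra)

lemma yh_class_inv:
  assumes "a \<in> carrier (free_algebra n)" "b \<in> carrier (free_algebra n)"
    "\<pi> r n d q v a * \<pi> r n d q v b = 1" "\<pi> r n d q v b * \<pi> r n d q v a = 1"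
  shows "inv\<^bsub>yh_algebra r n d q v\<^esub> (yh_class r n d q v a) = yh_class r n d q v b"
proof -
  interpret ring "yh_algebra r n d q v" by (rule ring_yh_algebra)
  have "yh_class r n d q v (a * b) = yh_class r n d q v 1" "yh_class r n d q v (b * a) = yh_class r n d q v 1"
    by (rule pi_eq_imp_class_eq; use assms in \<open>simp add: pi_hom free_algebra_closed\<close>)+
  then show ?thesis
    using inv_unique'[of "yh_class r n d q v a" "yh_class r n d q v b"] assms(1,2)
    by (simp add: yh_class_closed yh_class_mult yh_class_one)
qed

lemma list_mult_yh_class:
  "(\<And>a. a \<in> set as \<Longrightarrow> a \<in> carrier (free_algebra n)) \<Longrightarrow>
    list_mult (yh_algebra r n d q v) (map (yh_class r n d q v) as) = yh_class r n d q v (prod_list as)"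
proof (induction as)
  case (Cons a as)
  have "prod_list as \<in> carrier (free_algebra n)" using Cons.prems by (intro free_algebra_closed') auto
  then show ?case using Cons by (simp add: list_mult_def yh_class_mult)
qed (simp add: list_mult_def yh_class_one)

section \<open>Representatives of the rational functions\<close>

lemma rconst_power: "rconst (a ^ k) = rconst a ^ k"
  by (induction k) (simp_all add: rconst_hom)

lemma rconst_powi: "rconst (a powi k) = rconst a powi k"
  by (simp add: power_int_def rconst_power rconst_inverse)

lemma rconst_prod: "rconst (prod f A) = (\<Prod>x\<in>A. rconst (f x))"
  by (induction A rule: infinite_finite_induct) (simp_all add: rconst_hom)

lemma rconst_divide: "rconst (a / b) = rconst a / rconst b"
  by (simp add: divide_inverse rconst_hom rconst_inverse)

text \<open>The parameters over the field of constants. Over rational functions they satisfy the same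
  conditions, and this gives the interpretation \<open>L\<close>; \<open>K\<close> is the same ring with
  constant scalars.\<close>

locale fusion_parameters = separated_parameters n d q v for n d :: nat and q :: "'a::field" and v +
  fixes r :: nat and \<zeta> :: 'a
  assumes r_nonzero: "of_nat r \<noteq> (0 :: 'a)" and d_pos: "1 \<le> d"
    and zeta: "\<zeta> ^ r = 1" "\<And>j. 0 < j \<Longrightarrow> j < r \<Longrightarrow> \<zeta> ^ j \<noteq> 1"
begin

abbreviation rv :: "nat \<Rightarrow> 'a ratfun" where "rv \<equiv> \<lambda>l. rconst (v l)"

lemma separated_ratfun: "separated_parameters n d (rconst q) rv"
proof
  show "rconst q \<noteq> 0" using q_nonzero by simp
  show "rconst (v l) \<noteq> 0" if "l \<in> {1..d}" for l using v_nonzero[OF that] by simp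
  show "rconst q ^ (2 * j) \<noteq> 1" if "2 \<le> n" "1 \<le> j" "j \<le> n" for j
    using q_separated[OF that] rconst_eq_iff[of "q ^ (2 * j)" 1] by (simp only: rconst_power rconst_hom) simp
  show "rconst (v l) \<noteq> rconst q powi (2 * m) * rconst (v l')" if "l \<in> {1..d}" "l' \<in> {1..d}" "l \<noteq> l'" "\<bar>m\<bar> < int n" for l l' m
    using v_separated[OF that] rconst_eq_iff[of "v l" "q powi (2 * m) * v l'"] by (simp only: rconst_powi rconst_hom) simp
qed

abbreviation P :: "'a ratfun falg \<Rightarrow> 'a ratfun falg quotients" where
  "P \<equiv> \<pi> r n d (rconst q) rv"

sublocale L: cyclotomic_yokonuma_hecke "\<lambda>c. P (scal c)" r n "rconst q" "\<lambda>i. P (gg i)" "\<lambda>j. P (tt j)" "P xx" d rv "rconst \<zeta>"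
proof (rule yh_realisation[OF _ d_pos separated_ratfun])
  show "of_nat r \<noteq> (0 :: 'a ratfun)"
  proof -
    have "rconst (of_nat r :: 'a) \<noteq> 0" using r_nonzero by simp
    then show ?thesis by (simp only: rconst_of_nat not_False_eq_True)
  qed
  show "rconst \<zeta> ^ r = 1" using zeta(1) rconst_power[of \<zeta> r] by (simp add: rconst_hom)
  show "rconst \<zeta> ^ j \<noteq> 1" if "0 < j" "j < r" for j
    using zeta(2)[OF that] rconst_eq_iff[of "\<zeta> ^ j" 1] by (simp only: rconst_power rconst_hom) simp
qed

sublocale K: scalar_ring "\<lambda>c. P (scal (rconst c))"
proof
  show "P (scal (rconst 1)) = 1" by (simp only: rconst_hom L.sc_1)
  show "P (scal (rconst (a + b))) = P (scal (rconst a)) + P (scal (rconst b))" for a b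
    by (simp only: rconst_hom L.sc_add)
  show "P (scal (rconst (a * b))) = P (scal (rconst a)) * P (scal (rconst b))" for a b
    by (simp only: rconst_hom L.sc_mult)
  show "x * P (scal (rconst a)) = P (scal (rconst a)) * x" for x a by (rule L.sc_comm)
qed

lemma L_cont: "L.cont b = rconst (cont b)"
  by (simp add: L.cont_def cont_def rconst_hom rconst_powi)

lemma L_root_k: "root_k (rconst \<zeta>) k = rconst (root_k \<zeta> k)"
  by (simp add: root_k_def rconst_power)

lemma P_jm: "L.X i = P (jm i)"
proof (induction i rule: jm.induct)
  case (3 i)
  then show ?case by (simp only: L.X.simps jm.simps pi_hom)
qed (simp_all add: pi_hom)

lemma cmap_jm: "cmap (jm i) = jm i"
  by (induction i rule: jm.induct) (simp_all add: cmap_1 cmap_mult cmap_letter)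

lemma P_ee: "P (ee r i) = L.E i"
  by (simp only: ee_def L.E_def pi_hom pi_sum pi_power)

lemma P_poly_at: "P (cmap (poly_at p a)) = K.pe p (P (cmap a))"
  by (simp only: poly_at_def K.pe_def cmap_sum cmap_mult cmap_scal cmap_power pi_sum pi_hom pi_power)

lemma pe_rconst: "L.pe (\<Prod>b\<in>B. smult (rconst (f b)) [:- rconst b, 1:]) x = K.pe (\<Prod>b\<in>B. smult (f b) [:- b, 1:]) x"
proof (induction B rule: infinite_finite_induct)
  case (insert b B)
  show ?case
    unfolding prod.insert[OF insert.hyps] L.pe_mult K.pe_mult L.pe_smult K.pe_smult L.pe_linear K.pe_linear insert.IH ..
qed simp_all

lemma inj_rconst: "inj_on rconst A"
  by (simp add: inj_on_def)

lemma pe_interpolation: "K.pe (interpolation A a) x = L.pe (interpolation (rconst ` A) (rconst a)) x"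
proof -
  have "rconst ` A - {rconst a} = rconst ` (A - {a})" by auto
  then have "interpolation (rconst ` A) (rconst a) = (\<Prod>b\<in>A - {a}. smult (rconst (1 / (a - b))) [:- rconst b, 1:])"
    unfolding interpolation_def
    by (simp only:, subst prod.reindex[OF inj_rconst]) (simp add: comp_def rconst_divide rconst_diff rconst_hom)
  then show ?thesis unfolding interpolation_def by (simp only: pe_rconst)
qed

lemma P_interpolation: "P (cmap (poly_at (interpolation A a) g)) = L.pe (interpolation (rconst ` A) (rconst a)) (P (cmap g))"
  by (simp only: P_poly_at pe_interpolation)

text \<open>The representative of \<open>(\<Prod>a\<in>A. u - a) / (u - g)\<close> for a constant element
  \<open>g\<close>, with coefficients polynomial in \<open>u\<close>.\<close>

definition adjugate_rep :: "'a set \<Rightarrow> 'a ratfun \<Rightarrow> 'a falg \<Rightarrow> 'a ratfun falg" where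
  "adjugate_rep A u g = (\<Sum>a\<in>A. scal (\<Prod>b\<in>A - {a}. u - rconst b) * cmap (poly_at (interpolation A a) g))"

lemma P_adjugate_rep: "P (adjugate_rep A u g) = L.adjugate (rconst ` A) u (P (cmap g))"
proof -
  have "(\<Prod>b\<in>rconst ` A - {rconst a}. u - b) = (\<Prod>b\<in>A - {a}. u - rconst b)" for a
  proof -
    have "rconst ` A - {rconst a} = rconst ` (A - {a})" by auto
    then show ?thesis by (simp only:, subst prod.reindex[OF inj_rconst]) (simp add: comp_def)
  qed
  then show ?thesis
    unfolding adjugate_rep_def L.adjugate_def pi_sum pi_hom P_interpolation
    by (subst sum.reindex[OF inj_rconst]) (simp add: comp_def)
qed

lemma closed_poly_at: "g \<in> carrier (free_algebra n) \<Longrightarrow> poly_at p g \<in> carrier (free_algebra n)"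
  unfolding poly_at_def by (intro free_algebra_closed' free_algebra_closed(6,7))

lemma closed_cmap: "g \<in> carrier (free_algebra n) \<Longrightarrow> cmap g \<in> carrier (free_algebra n)"
  by (simp add: carrier_free_algebra)

lemma closed_letters:
  "xx \<in> carrier (free_algebra n)" "j \<in> {1..n} \<Longrightarrow> tt j \<in> carrier (free_algebra n)"
  "i \<in> {1..<n} \<Longrightarrow> gg i \<in> carrier (free_algebra n)"
  by (rule free_algebra_closed(8); simp add: gens_def)+

lemma closed_ee: "i \<in> {1..<n} \<Longrightarrow> ee r i \<in> carrier (free_algebra n)"
  unfolding ee_def by (intro free_algebra_closed free_algebra_closed' closed_letters) auto

lemma closed_jm: "1 \<le> i \<Longrightarrow> i \<le> n \<Longrightarrow> jm i \<in> carrier (free_algebra n)"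
proof (induction i rule: jm.induct)
  case (3 i)
  have i: "Suc i \<in> {1..<n}" using 3(3) by simp
  show ?case unfolding jm.simps
    by (intro free_algebra_closed(6) closed_letters(3) i 3(1)) (use i in auto)
qed (simp_all add: closed_letters)

lemma closed_adjugate_rep: "g \<in> carrier (free_algebra n) \<Longrightarrow> adjugate_rep A u g \<in> carrier (free_algebra n)"
  unfolding adjugate_rep_def by (intro free_algebra_closed' free_algebra_closed(6,7) closed_cmap closed_poly_at)

lemma class_adjugate:
  assumes A: "finite A" "u \<notin> rconst ` A" and g: "g \<in> carrier (free_algebra n)" "cmap g = g'"
    and x: "L.pe (L.roots_poly (rconst ` A)) (P g') = 0"
  shows "yh_rclass r n d q v (scal (\<Prod>a\<in>A. u - rconst a)) \<otimes>\<^bsub>yh_ratfun r n d q v\<^esub>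
      inv\<^bsub>yh_ratfun r n d q v\<^esub> (yh_rclass r n d q v (scal u - g')) = yh_rclass r n d q v (adjugate_rep A u g)"
proof -
  let ?F = "\<Prod>a\<in>A. u - rconst a"
  let ?b = "scal (inverse ?F) * adjugate_rep A u g"
  have nz: "?F \<noteq> 0" using A by auto
  have F: "(\<Prod>a\<in>rconst ` A. u - a) = ?F" by (subst prod.reindex[OF inj_rconst]) (simp add: comp_def)
  have g': "g' \<in> carrier (free_algebra n)" using closed_cmap[OF g(1)] g(2) by simp
  have b: "?b \<in> carrier (free_algebra n)" by (intro free_algebra_closed(6,7) closed_adjugate_rep g)
  have "inv\<^bsub>yh_algebra r n d (rconst q) rv\<^esub> (yh_class r n d (rconst q) rv (scal u - g')) = yh_class r n d (rconst q) rv ?b"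
  proof (rule yh_class_inv)
    show "scal u - g' \<in> carrier (free_algebra n)" by (intro free_algebra_closed(5,7) g')
    show "P (scal u - g') * P ?b = 1" "P ?b * P (scal u - g') = 1"
      using L.adjugate_inverse[OF _ A(2) x] A(1) unfolding pi_diff pi_hom P_adjugate_rep g(2) F by auto
  qed (rule b)
  moreover have "yh_class r n d (rconst q) rv (scal ?F * ?b) = yh_class r n d (rconst q) rv (adjugate_rep A u g)"
    using nz by (simp add: mult.assoc[symmetric] scal_hom(2) flip: scal_hom(4))
  ultimately show ?thesis
    unfolding yh_rclass_def yh_ratfun_def by (simp add: yh_class_mult[OF free_algebra_closed(7) b])
qed

abbreviation V :: "'a set" where "V \<equiv> v ` {1..d}"

fun phi_rep :: "nat \<Rightarrow> (nat \<Rightarrow> 'a ratfun) \<Rightarrow> 'a ratfun \<Rightarrow> 'a ratfun falg" where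
  "phi_rep 0 us u = 1"
| "phi_rep (Suc 0) us u = adjugate_rep V u xx"
| "phi_rep (Suc (Suc k)) us u = baxter_g r q (Suc k) u (us (Suc k)) * phi_rep (Suc k) us u *
     (gg (Suc k) - scal (rconst q - inverse (rconst q)) * ee r (Suc k))"

lemma P_phi_rep: "P (phi_rep k us u) = L.\<phi> k us u"
proof (induction k rule: jm.induct)
  case 2
  have "rconst ` V = rv ` {1..d}" by (simp add: image_image)
  then show ?case by (simp add: P_adjugate_rep L.\<phi>\<^sub>1_def L.adjugate_def cmap_letter)
next
  case (3 k)
  then show ?case
    by (simp only: phi_rep.simps L.\<phi>.simps pi_hom pi_diff P_ee baxter_g_def L.baxter_def L.Ginv_def L.\<kappa>_def)
qed (simp add: pi_hom)

lemma closed_baxter: "i \<in> {1..<n} \<Longrightarrow> baxter_g r q i a b \<in> carrier (free_algebra n)"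
  unfolding baxter_g_def by (intro free_algebra_closed closed_letters closed_ee) (auto simp: gens_def)

lemma closed_ginv: "i \<in> {1..<n} \<Longrightarrow> gg i - scal c * ee r i \<in> carrier (free_algebra n)"
  by (rule free_algebra_closed(5)[OF closed_letters(3) free_algebra_closed(6)[OF free_algebra_closed(7) closed_ee]])

lemma closed_phi_rep: "k \<le> n \<Longrightarrow> phi_rep k us u \<in> carrier (free_algebra n)"
proof (induction k rule: jm.induct)
  case (3 k)
  have k: "Suc k \<in> {1..<n}" using 3 by simp
  have "phi_rep (Suc k) us u \<in> carrier (free_algebra n)" using 3 by simp
  then show ?case by (simp only: phi_rep.simps) (intro free_algebra_closed(6) closed_baxter closed_ginv k)
qed (simp_all add: free_algebra_closed closed_adjugate_rep closed_letters)

lemma phi_rep_list: "1 \<le> k \<Longrightarrow> phi_rep k us u = prod_list (map (\<lambda>i. baxter_g r q i u (us i)) (rev [1..<k]) @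
   [adjugate_rep V u xx] @ map (\<lambda>i. gg i - scal (rconst q - inverse (rconst q)) * ee r i) [1..<k])"
proof (induction k rule: jm.induct)
  case (3 k)
  then have IH: "phi_rep (Suc k) us u = prod_list (map (\<lambda>i. baxter_g r q i u (us i)) (rev [1..<Suc k]) @
   [adjugate_rep V u xx] @ map (\<lambda>i. gg i - scal (rconst q - inverse (rconst q)) * ee r i) [1..<Suc k])" by simp
  have "[1..<Suc (Suc k)] = [1..<Suc k] @ [Suc k]" by simp
  then show ?case unfolding phi_rep.simps IH by (simp only: rev_append map_append prod_list.append) (simp add: mult.assoc)
qed simp_all

text \<open>The representative avoids all inverses: \<open>\<phi>\<^sub>1\<close> is given by an adjugate
  and \<open>g\<^sup>-\<^sup>1\<close> by \<open>g - (q - q\<^sup>-\<^sup>1) e\<close>.\<close>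

lemma class_phi:
  assumes k: "1 \<le> k" "k \<le> n" and u: "u \<notin> rconst ` V"
  shows "phi r n d q v k us u = yh_rclass r n d q v (phi_rep k us u)"
proof -
  let ?c = "yh_class r n d (rconst q) rv"
  let ?gi = "\<lambda>i. gg i - scal (rconst q - inverse (rconst q)) * ee r i"
  have V: "rconst ` V = rv ` {1..d}" by (simp add: image_image)
  have n: "1 \<le> n" using k by simp
  have "(\<Prod>l=1..d. u - rconst (v l)) = (\<Prod>a\<in>V. u - rconst a)"
  proof -
    have "inj_on v {1..d}"
    proof (rule inj_onI)
      fix l l' assume l: "l \<in> {1..d}" "l' \<in> {1..d}" "v l = v l'"
      show "l = l'" by (rule inj_onD[OF L.v_inj[OF n] _ l(1,2)]) (simp only: l(3))
    qed
    from prod.reindex[OF this, of "\<lambda>a. u - rconst a"] show ?thesis by (simp only: comp_def)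
  qed
  moreover have "L.pe (L.roots_poly (rconst ` V)) (P xx) = 0" using L.pe_X1[OF n] by (simp only: V)
  ultimately have phi1: "phi_1 r n d q v u = yh_rclass r n d q v (adjugate_rep V u xx)"
    using class_adjugate[OF _ u closed_letters(1) cmap_letter] unfolding phi_1_def by (simp only: finite_imageI finite_atLeastAtMost)
  have inv: "inv\<^bsub>yh_algebra r n d (rconst q) rv\<^esub> (?c (gg i)) = ?c (?gi i)" if "i \<in> {1..<n}" for i
  proof (rule yh_class_inv[OF closed_letters(3)[OF that] closed_ginv[OF that]])
    have "P (?gi i) = L.Ginv i" by (simp only: pi_diff pi_hom P_ee L.Ginv_def L.\<kappa>_def)
    then show "P (gg i) * P (?gi i) = 1" "P (?gi i) * P (gg i) = 1" using L.G_Ginv[OF that] by (simp_all only:)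
  qed
  have "map (\<lambda>i. inv\<^bsub>yh_algebra r n d (rconst q) rv\<^esub> (?c (gg i))) [1..<k] = map (\<lambda>i. ?c (?gi i)) [1..<k]"
    by (rule map_cong[OF refl], rule inv) (use k(2) in auto)
  then have "phi r n d q v k us u = list_mult (yh_algebra r n d (rconst q) rv) (map ?c
      (map (\<lambda>i. baxter_g r q i u (us i)) (rev [1..<k]) @ [adjugate_rep V u xx] @ map ?gi [1..<k]))"
    unfolding phi_def phi1 yh_ratfun_def yh_rclass_def by (simp only: map_append map_map comp_def list.map)
  also have "\<dots> = ?c (phi_rep k us u)"
    unfolding phi_rep_list[OF k(1)]
  proof (rule list_mult_yh_class)
    fix a assume "a \<in> set (map (\<lambda>i. baxter_g r q i u (us i)) (rev [1..<k]) @ [adjugate_rep V u xx] @ map ?gi [1..<k])"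
    then consider i where "i \<in> {1..<k}" "a = baxter_g r q i u (us i)" | "a = adjugate_rep V u xx"
      | i where "i \<in> {1..<k}" "a = ?gi i" by force
    then show "a \<in> carrier (free_algebra n)"
    proof cases
      case 1
      then show ?thesis using closed_baxter[of i] k(2) by simp
    next
      case 2
      then show ?thesis using closed_adjugate_rep[OF closed_letters(1)] by simp
    next
      case 3
      then show ?thesis using closed_ginv[of i] k(2) by simp
    qed
  qed
  finally show ?thesis by (simp only: yh_rclass_def)
qed

lemma evaluates_adjugate_rep:
  assumes "rat_evaluates x c u u'"
  shows "evaluates x c (adjugate_rep A u g) (adjugate_rep A u' g)"
  unfolding adjugate_rep_def
  by (intro evaluates_sum evaluates_mult evaluates_scal evaluates_cmap rat_evaluates_prod rat_evaluates_diff rat_evaluates_rconst assms)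

lemma evaluates_phi_rep:
  assumes "rat_evaluates x c u u'" "\<And>i. 1 \<le> i \<Longrightarrow> i < k \<Longrightarrow> rat_evaluates x c (us i) (us' i) \<and> u' \<noteq> us' i"
  shows "evaluates x c (phi_rep k us u) (phi_rep k us' u')"
  using assms(2)
proof (induction k rule: jm.induct)
  case (3 k)
  have us: "rat_evaluates x c (us (Suc k)) (us' (Suc k))" "u' - us' (Suc k) \<noteq> 0" using 3(2)[of "Suc k"] by auto
  have c: "rat_evaluates x c (rconst q - inverse (rconst q)) (rconst q - inverse (rconst q))"
    using rat_evaluates_rconst[of x c "q - inverse q"] by (simp add: rconst_diff rconst_inverse)
  have "evaluates x c (baxter_g r q (Suc k) u (us (Suc k))) (baxter_g r q (Suc k) u' (us' (Suc k)))"
    unfolding baxter_g_def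
    by (intro evaluates_add evaluates_letter evaluates_mult evaluates_scal evaluates_ee rat_evaluates_mult c
        rat_evaluates_divide rat_evaluates_diff us assms(1))
  moreover have "evaluates x c (phi_rep (Suc k) us u) (phi_rep (Suc k) us' u')" using 3 by auto
  moreover have "evaluates x c (gg (Suc k) - scal (rconst q - inverse (rconst q)) * ee r (Suc k))
      (gg (Suc k) - scal (rconst q - inverse (rconst q)) * ee r (Suc k))"
    using evaluates_cmap[of x c "gg (Suc k) - scal (q - inverse q) * ee r (Suc k)"]
    by (simp add: cmap_hom cmap_mult cmap_scal cmap_letter cmap_ee rconst_diff rconst_inverse)
  ultimately show ?case by (simp only: phi_rep.simps) (intro evaluates_mult)
qed (simp_all add: evaluates_1 evaluates_adjugate_rep assms(1))

end

section \<open>The evaluated product\<close>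

context separated_parameters begin

lemma hook_product_added:
  assumes D: "young D" "b \<notin> D" "young (insert b D)" "card (insert b D) \<le> n" "\<And>b'. b' \<in> insert b D \<Longrightarrow> pos_d b' \<in> {1..d}"
    and b: "b = ((X, Y), p, l)"
  shows "hook_product (insert b D) = hook_product D * added_function D p l Y (cont b)"
    "m \<in> {1..d} \<Longrightarrow> ratio_den D p m Y (col_len D p m Y) (cont b) \<noteq> 0"
proof -
  note D' = D[unfolded b]
  have c: "added_content X Y l = cont b" by (simp only: added_content_def[OF D'] b cont_def node_content_def pos_d_def prod.case)
  show "hook_product (insert b D) = hook_product D * added_function D p l Y (cont b)"
  proof -
    have "hook_product (insert b D) = hook_product D * prod (added_ratio D X Y p l) {1..d}"
      unfolding b by (rule hook_product_insert[OF D'(1-4)]) (fact D'(5))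
    moreover have "added_ratio D X Y p l = (\<lambda>m. ratio_num D p m (if m = l then {1..<Y} else {1..Y}) Y (col_len D p m Y) (cont b) /
        ratio_den D p m Y (col_len D p m Y) (cont b))"
      by (rule ext, subst added_ratio_def[OF D'(1-4)]) (use D'(5) in \<open>simp_all only: c\<close>)
    ultimately show ?thesis by (simp only: added_function_def)
  qed
  show "m \<in> {1..d} \<Longrightarrow> ratio_den D p m Y (col_len D p m Y) (cont b) \<noteq> 0"
    using ratio_den_nonzero[OF D'(1-4)] D'(5) unfolding c by blast
qed

end

lemma prod_list_commute:
  fixes x :: "'b::ring_1"
  shows "(\<And>j. j \<in> set is \<Longrightarrow> x * f j = f j * x) \<Longrightarrow> x * prod_list (map f is) = prod_list (map f is) * x"
proof (induction "is")
  case (Cons j "is")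
  then have "x * prod_list (map f is) = prod_list (map f is) * x" "x * f j = f j * x" by simp_all
  then show ?case by (simp only: list.map prod_list.Cons) (rule commute_mult)
qed simp

lemma prod_list_mult:
  fixes f g :: "nat \<Rightarrow> 'b::ring_1"
  shows "(\<And>i j. i \<in> set is \<Longrightarrow> j \<in> set is \<Longrightarrow> g i * f j = f j * g i) \<Longrightarrow>
    prod_list (map (\<lambda>k. f k * g k) is) = prod_list (map f is) * prod_list (map g is)"
proof (induction "is")
  case (Cons j "is")
  have IH: "prod_list (map (\<lambda>k. f k * g k) is) = prod_list (map f is) * prod_list (map g is)"
    using Cons by simp
  have c: "g j * prod_list (map f is) = prod_list (map f is) * g j"
    by (rule prod_list_commute) (use Cons.prems in simp)
  have "f j * g j * (prod_list (map f is) * prod_list (map g is)) =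
      f j * (g j * prod_list (map f is)) * prod_list (map g is)" by (simp only: mult.assoc)
  also have "\<dots> = f j * prod_list (map f is) * (g j * prod_list (map g is))" unfolding c by (simp only: mult.assoc)
  finally show ?case by (simp only: list.map prod_list.Cons IH)
qed simp

lemma (in scalar_ring) prod_list_eigen:
  assumes "i \<in> set is" "\<And>j. j \<in> set is \<Longrightarrow> x * f j = f j * x" "\<And>w. x * (f i * w) = sc a * (f i * w)"
  shows "x * prod_list (map f is) = sc a * prod_list (map f is)"
  using assms(1,2)
proof (induction "is")
  case (Cons j "is")
  show ?case
  proof (cases "j = i")
    case True
    then show ?thesis using assms(3) by simp
  next
    case False
    then have IH: "x * prod_list (map f is) = sc a * prod_list (map f is)" using Cons by simp
    have "x * (f j * prod_list (map f is)) = f j * (x * prod_list (map f is))"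
      using Cons.prems(2)[of j] by (simp add: mult.assoc[symmetric])
    also have "\<dots> = sc a * (f j * prod_list (map f is))" unfolding IH by (rule sc_left_commute)
    finally show ?thesis by simp
  qed
qed simp

lemma (in scalar_ring) prod_list_scale:
  "prod_list (map (\<lambda>k. sc (h k) * f k) is) = sc (prod_list (map h is)) * prod_list (map f is)"
proof (induction "is")
  case (Cons j "is")
  have "sc (h j) * f j * (sc (prod_list (map h is)) * prod_list (map f is)) =
     sc (h j) * (sc (prod_list (map h is)) * (f j * prod_list (map f is)))"
    unfolding mult.assoc sc_left_commute[of "f j"] ..
  then show ?case by (simp only: list.map prod_list.Cons Cons sc_mult mult.assoc)
qed simp

lemma yh_evaluates_seq_append:
  "yh_evaluates_seq r n d q v xs \<Psi> \<Theta> \<Longrightarrow> yh_evaluates_seq r n d q v ys \<Theta> \<Omega> \<Longrightarrow> yh_evaluates_seq r n d q v (xs @ ys) \<Psi> \<Omega>"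
proof (induction xs arbitrary: \<Psi>)
  case (Cons p xs)
  then show ?case by (cases p) auto
qed simp

lemma yh_evaluates_seq_chain:
  assumes "\<And>j. k \<le> j \<Longrightarrow> j < N \<Longrightarrow> yh_evaluates r n d q v (x (Suc j)) (c (Suc j)) (\<Psi> j) (\<Psi> (Suc j))" "k \<le> N"
  shows "yh_evaluates_seq r n d q v (map (\<lambda>i. (x i, c i)) [Suc k..<N + 1]) (\<Psi> k) (\<Psi> N)"
  using assms(2,1)
proof (induction k rule: inc_induct)
  case (step k)
  have eq: "[Suc k..<N + 1] = Suc k # [Suc (Suc k)..<N + 1]" using step.hyps by (simp add: upt_conv_Cons)
  have "yh_evaluates r n d q v (x (Suc k)) (c (Suc k)) (\<Psi> k) (\<Psi> (Suc k))"
    using step.prems[of k] step.hyps by simp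
  moreover have "yh_evaluates_seq r n d q v (map (\<lambda>i. (x i, c i)) [Suc (Suc k)..<N + 1]) (\<Psi> (Suc k)) (\<Psi> N)"
    by (rule step.IH, rule step.prems) simp_all
  ultimately show ?case unfolding eq list.map yh_evaluates_seq.simps by blast
qed simp

text \<open>The sets \<open>C k\<close> are the contents over which the idempotents interpolate. They may be
  any finite sets that contain the contents of the boxes of the given colour that could have been added in
  position \<open>k\<close>.\<close>

locale tableau_fusion = fusion_parameters n d q v r \<zeta> for n d :: nat and q :: "'a::field" and v r \<zeta> +
  fixes bs :: "node list" and C :: "nat \<Rightarrow> 'a set"
  assumes tab: "tableau r d bs" and len: "length bs = n" and n_pos: "1 \<le> n"
    and C_finite: "\<And>k. k \<in> {1..n} \<Longrightarrow> finite (C k)"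
    and C_addable: "\<And>k. k \<in> {1..n} \<Longrightarrow> cont ` addable d (pos_r (bs ! (k - 1))) (set (take (k - 1) bs)) \<subseteq> C k"
begin

definition "c k = cont (bs ! (k - 1))"
definition "z k = root_k \<zeta> (pos_r (bs ! (k - 1)))"
definition "TI k = poly_at (interpolation (root_set r \<zeta>) (z k)) (tt k)"
definition "XI k = poly_at (interpolation (C k) (c k)) (jm k)"
definition "Fz k = (\<Prod>\<xi>\<in>root_set r \<zeta> - {z k}. z k - \<xi>)"
definition "hh k = hook_product (set (take k bs)) / hook_product (set (take (k - 1) bs))"

text \<open>The result of the evaluations, up to the relations: \<open>Z 0\<close> comes from the factors
  with \<open>t\<close>, and each evaluation at a content contributes the scalar \<open>hh\<close> and the
  factor \<open>XI\<close> of the idempotent.\<close>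

fun Z :: "nat \<Rightarrow> 'a falg" where
  "Z 0 = prod_list (map (\<lambda>i. scal (Fz i) * TI i) [1..<n + 1])"
| "Z (Suc k) = scal (hh (Suc k)) * XI (Suc k) * Z k"

definition "x k = P (cmap (XI k))"
definition "t k = P (cmap (TI k))"

lemma root_set_finite: "finite (root_set r \<zeta>)"
  by (simp add: root_set_def)

lemma root_set_rconst: "root_set r (rconst \<zeta>) = rconst ` root_set r \<zeta>"
  by (simp add: root_set_def image_image L_root_k)

lemma colour: "k \<in> {1..n} \<Longrightarrow> pos_r (bs ! (k - 1)) \<in> {1..r}" "k \<in> {1..n} \<Longrightarrow> pos_d (bs ! (k - 1)) \<in> {1..d}"
  using tab nth_mem[of "k - 1" bs] len unfolding tableau_def by auto

lemma z_mem: "k \<in> {1..n} \<Longrightarrow> z k \<in> root_set r \<zeta>"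
  using colour(1) by (auto simp: z_def root_set_def)

lemma x_eq: "x k = L.pe (interpolation (rconst ` C k) (rconst (c k))) (L.X k)"
  unfolding x_def XI_def P_interpolation cmap_jm P_jm ..

lemma t_eq: "t k = L.pe (interpolation (rconst ` root_set r \<zeta>) (rconst (z k))) (P (tt k))"
  unfolding t_def TI_def P_interpolation cmap_letter ..

lemma T_roots: "k \<in> {1..n} \<Longrightarrow> L.pe (L.roots_poly (rconst ` root_set r \<zeta>)) (P (tt k)) = 0"
  using L.pe_T[of k] unfolding root_set_rconst .

lemma T_t: "i \<in> {1..n} \<Longrightarrow> j \<in> {1..n} \<Longrightarrow> P (tt i) * t j = t j * P (tt i)"
  unfolding t_eq by (rule L.pe_commute) (rule L.TT)

lemma t_x: "i \<in> {1..n} \<Longrightarrow> j \<in> {1..n} \<Longrightarrow> t i * x j = x j * t i"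
proof -
  assume i: "i \<in> {1..n}" "j \<in> {1..n}"
  have "P (tt i) * x j = x j * P (tt i)" unfolding x_eq by (rule L.pe_commute, rule L.T_X) (use i in auto)
  then show ?thesis unfolding t_eq by (rule L.pe_commute[OF sym, symmetric])
qed

lemma x_x: "i \<in> {1..n} \<Longrightarrow> j \<in> {1..n} \<Longrightarrow> x i * x j = x j * x i"
proof -
  assume i: "i \<in> {1..n}" "j \<in> {1..n}"
  have "L.X i * x j = x j * L.X i" unfolding x_eq[of j] by (rule L.pe_commute, rule L.X_X) (use i in auto)
  then show ?thesis unfolding x_eq[of i] by (rule L.pe_commute[OF sym, symmetric])
qed

lemma P_Z_0: "P (cmap (Z 0)) = prod_list (map (\<lambda>i. P (scal (rconst (Fz i))) * t i) [1..<n + 1])"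
  unfolding Z.simps cmap_prod_list pi_prod_list map_map comp_def cmap_mult cmap_scal pi_hom t_def ..

lemma P_Z_Suc: "P (cmap (Z (Suc k))) = P (scal (rconst (hh (Suc k)))) * (x (Suc k) * P (cmap (Z k)))"
  unfolding Z.simps cmap_mult cmap_scal pi_hom x_def mult.assoc ..

lemma T_Z_0:
  assumes i: "i \<in> {1..n}"
  shows "P (tt i) * P (cmap (Z 0)) = P (scal (rconst (z i))) * P (cmap (Z 0))"
  unfolding P_Z_0
proof (rule L.prod_list_eigen)
  show "i \<in> set [1..<n + 1]" using i by auto
  fix j assume "j \<in> set [1..<n + 1]"
  then have j: "j \<in> {1..n}" by auto
  show "P (tt i) * (P (scal (rconst (Fz j))) * t j) = P (scal (rconst (Fz j))) * t j * P (tt i)"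
    unfolding L.sc_left_commute T_t[OF i j] mult.assoc ..
next
  fix w
  let ?R = "rconst ` root_set r \<zeta>"
  have "P (tt i) * (t i * w) = P (scal (rconst (z i))) * (t i * w)"
    unfolding t_eq by (rule L.interpolation_eigen) (use root_set_finite z_mem[OF i] T_roots[OF i] in auto)
  then show "P (tt i) * (P (scal (rconst (Fz i))) * t i * w) = P (scal (rconst (z i))) * (P (scal (rconst (Fz i))) * t i * w)"
    unfolding mult.assoc L.sc_left_commute[of "P (tt i)"] by (simp only:) (rule L.sc_left_commute)
qed

definition "A j = cont ` addable d (pos_r (bs ! j)) (set (take j bs))"

lemma A_finite: "finite (A j)"
  by (simp add: A_def finite_addable)

lemma L_A: "L.cont ` addable d (pos_r (bs ! j)) (set (take j bs)) = rconst ` A j"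
  by (simp add: A_def image_image L_cont)

lemma take_tableau: "tableau r d (take j bs)"
  using tab standard_take[of bs j] set_take_subset[of j bs] by (auto simp: tableau_def)

lemma node_add:
  assumes j: "j < n"
  shows "young (set (take j bs))" "bs ! j \<notin> set (take j bs)" "young (insert (bs ! j) (set (take j bs)))"
    "set (take (Suc j) bs) = insert (bs ! j) (set (take j bs))" "bs ! j \<in> addable d (pos_r (bs ! j)) (set (take j bs))"
    "card (set (take j bs)) = j"
proof -
  have t: "take (Suc j) bs = take j bs @ [bs ! j]" using j len by (simp add: take_Suc_conv_app_nth)
  have s: "standard (take j bs @ [bs ! j])" using tab standard_take[of bs "Suc j"] unfolding t[symmetric] by (simp add: tableau_def)
  then show *: "young (set (take j bs))" "bs ! j \<notin> set (take j bs)" "young (insert (bs ! j) (set (take j bs)))"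
    using standard_young[of "take j bs"] by (simp_all add: standard_snoc)
  show "set (take (Suc j) bs) = insert (bs ! j) (set (take j bs))" unfolding t by simp
  show "bs ! j \<in> addable d (pos_r (bs ! j)) (set (take j bs))"
    using * colour(2)[of "Suc j"] j by (simp add: addable_def)
  have "distinct (take j bs)" using s by (simp add: standard_def)
  then show "card (set (take j bs)) = j" using j len by (simp add: distinct_card)
qed

lemma A_subset: "j < n \<Longrightarrow> A j \<subseteq> C (Suc j)" "j < n \<Longrightarrow> c (Suc j) \<in> A j"
  using C_addable[of "Suc j"] node_add(5)[of j] by (auto simp: A_def c_def)

lemma spectrum_Z:
  assumes j: "j < n" and W: "L.WV (map L.wt (take j bs)) (map (\<lambda>b. root_k (rconst \<zeta>) (pos_r b)) (drop j bs)) w"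
  shows "L.WV (map L.wt (take j bs)) [root_k (rconst \<zeta>) (pos_r (bs ! j))] w"
    "L.pe (L.roots_poly (rconst ` A j)) (L.X (Suc j)) * w = 0"
proof -
  have "map (\<lambda>b. root_k (rconst \<zeta>) (pos_r b)) (drop j bs) = [root_k (rconst \<zeta>) (pos_r (bs ! j))] @
      map (\<lambda>b. root_k (rconst \<zeta>) (pos_r b)) (drop (Suc j) bs)"
    using Cons_nth_drop_Suc[of j bs] j len by (metis append_Cons append_Nil list.map(2))
  then show 1: "L.WV (map L.wt (take j bs)) [root_k (rconst \<zeta>) (pos_r (bs ! j))] w" using W by (metis L.WV_drop)
  have "L.pe (L.roots_poly (L.cont ` addable d (pos_r (bs ! j)) (set (take j bs)))) (L.X (Suc (length (take j bs)))) * w = 0"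
    by (rule L.spectrum[OF take_tableau _ _ 1]) (use j len colour(1)[of "Suc j"] in auto)
  then show "L.pe (L.roots_poly (rconst ` A j)) (L.X (Suc j)) * w = 0" using j len unfolding L_A by simp
qed

lemma x_on_weight:
  assumes j: "j < n" and W: "L.WV (map L.wt (take j bs)) (map (\<lambda>b. root_k (rconst \<zeta>) (pos_r b)) (drop j bs)) w"
  shows "x (Suc j) * w = L.pe (interpolation (rconst ` A j) (rconst (c (Suc j)))) (L.X (Suc j)) * w"
  unfolding x_eq
  by (rule L.interpolation_superset[OF _ _ _ spectrum_Z(2)[OF j W]])
    (use C_finite[of "Suc j"] A_subset[OF j] j in auto)

text \<open>The Lagrange polynomial in \<open>X\<close> projects to the eigenspace of the next
  content.\<close>

lemma weight_Z: "j \<le> n \<Longrightarrow> L.WV (map L.wt (take j bs)) (map (\<lambda>b. root_k (rconst \<zeta>) (pos_r b)) (drop j bs)) (P (cmap (Z j)))"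
proof (induction j)
  case 0
  have "P (tt (Suc j)) * P (cmap (Z 0)) = P (scal (root_k (rconst \<zeta>) (pos_r (bs ! j)))) * P (cmap (Z 0))" if "j < n" for j
    using T_Z_0[of "Suc j"] that by (simp add: z_def L_root_k)
  then show ?case using L.root_k_power by (simp add: L.WV_def len del: Z.simps)
next
  case (Suc j)
  let ?w = "P (cmap (Z j))" and ?zs = "map (\<lambda>b. root_k (rconst \<zeta>) (pos_r b)) (drop (Suc j) bs)"
  let ?e = "L.pe (interpolation (rconst ` A j) (rconst (c (Suc j)))) (L.X (Suc j)) * ?w"
  have j: "j < n" using Suc by simp
  have W: "L.WV (map L.wt (take j bs)) (map (\<lambda>b. root_k (rconst \<zeta>) (pos_r b)) (drop j bs)) ?w" using Suc by simp
  have d: "map (\<lambda>b. root_k (rconst \<zeta>) (pos_r b)) (drop j bs) = root_k (rconst \<zeta>) (pos_r (bs ! j)) # ?zs"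
    using Cons_nth_drop_Suc[of j bs] j len by (metis list.map(2))
  have e: "L.X (Suc j) * ?e = P (scal (rconst (c (Suc j)))) * ?e"
    by (rule L.interpolation_eigen[OF _ _ spectrum_Z(2)[OF j W]]) (use A_finite A_subset(2)[OF j] in auto)
  have "L.WV (map L.wt (take j bs)) (root_k (rconst \<zeta>) (pos_r (bs ! j)) # ?zs) ?e"
    by (rule L.WV_pe_X[OF W[unfolded d]]) (use j in auto)
  then have "L.WV (map L.wt (take j bs) @ [(rconst (c (Suc j)), root_k (rconst \<zeta>) (pos_r (bs ! j)))]) ?zs ?e"
    by (rule L.WV_snoc) (use e j len in simp)
  moreover have "take (Suc j) bs = take j bs @ [bs ! j]" using j len by (simp add: take_Suc_conv_app_nth)
  moreover have "L.wt (bs ! j) = (rconst (c (Suc j)), root_k (rconst \<zeta>) (pos_r (bs ! j)))"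
    by (simp add: L.wt_def L_cont c_def)
  ultimately have "L.WV (map L.wt (take (Suc j) bs)) ?zs ?e" by (simp only: map_append list.map)
  then show ?case unfolding P_Z_Suc x_on_weight[OF j W] by (rule L.WV_scale)
qed

text \<open>The arguments after \<open>j\<close> evaluations at contents.\<close>

definition "us j i = (if 1 \<le> i \<and> i \<le> j then rconst (c i) else rvar (u_ix i))"
text \<open>The factors \<open>\<phi>\<close> that are not yet evaluated.\<close>

definition "rest j u = prod_list (map (\<lambda>k. phi_rep k u (rvar (u_ix k))) (rev [j + 1..<n + 1]))"

lemma rest_step: "j < n \<Longrightarrow> rest j u = rest (Suc j) u * phi_rep (Suc j) u (rvar (u_ix (Suc j)))"
proof -
  assume "j < n"
  then have "[j + 1..<n + 1] = Suc j # [Suc j + 1..<n + 1]" by (simp add: upt_conv_Cons)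
  then show ?thesis unfolding rest_def by (simp only: rev.simps map_append prod_list.append list.map prod_list.Cons prod_list.Nil mult_1_right)
qed

lemma closed_rest: "rest j u \<in> carrier (free_algebra n)"
  unfolding rest_def by (rule free_algebra_closed'(3)) (auto intro: closed_phi_rep)

lemma closed_XI: "k \<in> {1..n} \<Longrightarrow> XI k \<in> carrier (free_algebra n)"
  unfolding XI_def by (intro closed_poly_at closed_jm) auto

lemma closed_TI: "k \<in> {1..n} \<Longrightarrow> TI k \<in> carrier (free_algebra n)"
  unfolding TI_def by (intro closed_poly_at closed_letters)

lemma closed_Z: "k \<le> n \<Longrightarrow> Z k \<in> carrier (free_algebra n)"
proof (induction k)
  case 0
  show ?case unfolding Z.simps
    by (rule free_algebra_closed'(3)) (auto intro!: free_algebra_closed(6,7) closed_TI)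
next
  case (Suc k)
  show ?case unfolding Z.simps
    by (rule free_algebra_closed(6)[OF free_algebra_closed(6)[OF free_algebra_closed(7) closed_XI]]) (use Suc in auto)
qed

end

section \<open>Consecutive evaluations\<close>

context fusion_parameters begin

lemma rat_evaluates_root_factor: "rat_evaluates x a (L.root_factor m j (rvar x)) (rconst (root_factor m j a))"
  unfolding L.root_factor_def root_factor_def rconst_diff
  using rat_evaluates_diff[OF rat_evaluates_rvar[of x a x] rat_evaluates_rconst[of x a "v m * q powi (2 * j)"]]
  by (simp add: rconst_hom rconst_powi)

lemma rat_evaluates_ratio:
  "rat_evaluates x a (L.ratio_num D p m B Y M (rvar x)) (rconst (ratio_num D p m B Y M a))"
  "rat_evaluates x a (L.ratio_den D p m Y M (rvar x)) (rconst (ratio_den D p m Y M a))"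
  unfolding L.ratio_num_def ratio_num_def L.ratio_den_def ratio_den_def rconst_hom rconst_prod
  by (intro rat_evaluates_mult rat_evaluates_prod rat_evaluates_root_factor)+

lemma rat_evaluates_added:
  assumes "\<And>m. m \<in> {1..d} \<Longrightarrow> ratio_den D p m Y (col_len D p m Y) a \<noteq> 0"
  shows "rat_evaluates x a (L.added_function D p l Y (rvar x)) (rconst (added_function D p l Y a))"
  unfolding L.added_function_def added_function_def rconst_prod rconst_divide
  by (intro rat_evaluates_prod rat_evaluates_divide rat_evaluates_ratio) (use assms in simp)

lemma generic_rvar: "L.generic (rvar x)"
proof -
  have "rvar x \<noteq> rconst (v m) * rconst q powi (2 * j)" for m j
    using rvar_neq_rconst[of x "v m * q powi (2 * j)"] by (simp add: rconst_hom rconst_powi)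
  then show ?thesis by (simp add: L.generic_def)
qed

end

context tableau_fusion begin

definition "f j = L.spectral_factor (set (take j bs)) (pos_r (bs ! j)) (rvar (u_ix (Suc j)))"

lemma take_pos: "b \<in> set (take j bs) \<Longrightarrow> pos_d b \<in> {1..d}"
  using take_tableau by (auto simp: tableau_def)

lemma hook_nonzero: "j \<le> n \<Longrightarrow> hook_product (set (take j bs)) \<noteq> 0"
proof (cases j)
  case 0
  then show ?thesis by (simp add: hook_product_def)
next
  case (Suc i)
  assume j: "j \<le> n"
  have "young (set (take (Suc i) bs))" using node_add(3,4)[of i] j Suc by simp
  moreover have "card (set (take (Suc i) bs)) \<le> n" using card_length[of "take (Suc i) bs"] len by simp
  ultimately show ?thesis unfolding Suc by (rule hook_product_nonzero) (rule take_pos)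
qed

text \<open>The spectral factor has a simple zero at the content of the next box. It cancels the pole in the
  summand of this box and kills the other summands.\<close>

lemma coefficient:
  assumes j: "j < n" and a: "a \<in> A j"
  shows "rat_evaluates (u_ix (Suc j)) (c (Suc j)) (f j / (rvar (u_ix (Suc j)) - rconst a))
     (rconst (if a = c (Suc j) then hh (Suc j) else 0))"
proof -
  let ?D = "set (take j bs)" and ?u = "rvar (u_ix (Suc j))"
  obtain X Y p l where b: "bs ! j = ((X, Y), p, l)" by (metis surj_pair)
  have pr: "pos_r (bs ! j) = p" by (simp add: b pos_r_def)
  have c: "c (Suc j) = cont (bs ! j)" by (simp add: c_def)
  have l: "l \<in> {1..d}" using colour(2)[of "Suc j"] j by (simp add: b pos_d_def)
  have pd: "pos_d b' \<in> {1..d}" if "b' \<in> insert (bs ! j) ?D" for b'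
    using that take_pos[of b' j] colour(2)[of "Suc j"] j by auto
  have card: "card (insert (bs ! j) ?D) \<le> n"
    using node_add(2,6)[OF j] j by simp
  note D = node_add(1-3)[OF j] card pd b
  define g where "g = L.added_function ?D p l Y ?u"
  have g: "rat_evaluates (u_ix (Suc j)) (c (Suc j)) g (rconst (hh (Suc j)))"
  proof -
    have "hook_product (insert (bs ! j) ?D) = hook_product ?D * added_function ?D p l Y (c (Suc j))"
      unfolding c by (rule hook_product_added(1)[OF node_add(1-3)[OF j] card _ b]) (rule pd)
    then have h: "hh (Suc j) = added_function ?D p l Y (c (Suc j))"
      using hook_nonzero[of j] j node_add(4)[OF j] by (simp add: hh_def)
    have den: "ratio_den ?D p m Y (col_len ?D p m Y) (c (Suc j)) \<noteq> 0" if "m \<in> {1..d}" for m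
      unfolding c by (rule hook_product_added(2)[OF node_add(1-3)[OF j] card _ b that]) (rule pd)
    show ?thesis unfolding g_def h by (rule rat_evaluates_added) (rule den)
  qed
  have f: "f j = (?u - rconst (c (Suc j))) * g"
    unfolding f_def g_def c L_cont[symmetric] b pr[unfolded b]
    by (rule L.spectral_factor_added) (use D[unfolded b] l generic_rvar in auto)
  show ?thesis
  proof (cases "a = c (Suc j)")
    case True
    have "?u - rconst a \<noteq> 0" using rvar_neq_rconst[of "u_ix (Suc j)" a] by simp
    then have "f j / (?u - rconst a) = g" unfolding f True by simp
    then show ?thesis using g True by simp
  next
    case False
    have d: "rat_evaluates (u_ix (Suc j)) (c (Suc j)) (?u - rconst b) (rconst (c (Suc j)) - rconst b)" for b
      using rat_evaluates_diff[OF rat_evaluates_rvar[of "u_ix (Suc j)" "c (Suc j)" "u_ix (Suc j)"] rat_evaluates_rconst] by simp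
    have "rat_evaluates (u_ix (Suc j)) (c (Suc j)) ((?u - rconst (c (Suc j))) * g / (?u - rconst a))
        ((rconst (c (Suc j)) - rconst (c (Suc j))) * rconst (hh (Suc j)) / (rconst (c (Suc j)) - rconst a))"
      by (intro rat_evaluates_divide rat_evaluates_mult d g) (use False in simp)
    then show ?thesis using False unfolding f by (simp add: rconst_hom)
  qed
qed

text \<open>The Lagrange form of the resolvent, with arbitrary coefficients instead of \<open>1 / (u -
  a)\<close>.\<close>

definition "residue_sum h j = (\<Sum>a\<in>A j. scal (h a) * cmap (poly_at (interpolation (A j) a) (jm (Suc j))))"

lemma closed_residue_sum: "j < n \<Longrightarrow> residue_sum h j \<in> carrier (free_algebra n)"
  unfolding residue_sum_def by (intro free_algebra_closed' free_algebra_closed(6,7) closed_cmap closed_poly_at closed_jm) auto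

lemma P_residue_sum: "P (residue_sum h j) = (\<Sum>a\<in>A j. P (scal (h a)) * L.pe (interpolation (rconst ` A j) (rconst a)) (L.X (Suc j)))"
  unfolding residue_sum_def pi_sum pi_hom P_interpolation cmap_jm P_jm ..

text \<open>Before the evaluation, \<open>\<phi>\<close> applied to the weight vector \<open>Z j\<close> is
  replaced by an expression whose coefficients are regular at the point of evaluation.\<close>

lemma fusion_class:
  assumes j: "j < n"
  shows "P (rest j (us j) * cmap (Z j)) =
    P (rest (Suc j) (us j) * residue_sum (\<lambda>a. f j / (rvar (u_ix (Suc j)) - rconst a)) j * cmap (Z j))"
proof -
  let ?u = "rvar (u_ix (Suc j))" and ?w = "P (cmap (Z j))"
  have len': "length (take j bs) = j" using j len by simp
  have "L.\<phi> (Suc (length (take j bs))) (us j) ?u * ?w =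
    P (scal (L.spectral_factor (set (take j bs)) (pos_r (bs ! j)) ?u)) *
      (L.resolvent (L.cont ` addable d (pos_r (bs ! j)) (set (take j bs))) ?u (L.X (Suc (length (take j bs)))) * ?w)"
  proof (rule L.fusion[OF take_tableau])
    show "length (take j bs) < n" using j len by simp
    show "pos_r (bs ! j) \<in> {1..r}" using colour(1)[of "Suc j"] j by simp
    show "L.WV (map L.wt (take j bs)) [root_k (rconst \<zeta>) (pos_r (bs ! j))] ?w"
      by (rule spectrum_Z(1)[OF j weight_Z]) (use j in simp)
    show "us j (Suc i) = L.cont (take j bs ! i)" if "i < length (take j bs)" for i
      using that len' by (simp add: us_def L_cont c_def)
  qed (rule generic_rvar)
  then have 1: "L.\<phi> (Suc j) (us j) ?u * ?w = P (scal (f j)) * (L.resolvent (rconst ` A j) ?u (L.X (Suc j)) * ?w)"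
    unfolding len' L_A f_def .
  have "P (scal (f j)) * L.resolvent (rconst ` A j) ?u (L.X (Suc j)) = P (residue_sum (\<lambda>a. f j / (?u - rconst a)) j)"
  proof -
    have "L.resolvent (rconst ` A j) ?u (L.X (Suc j)) =
        (\<Sum>a\<in>A j. P (scal (1 / (?u - rconst a))) * L.pe (interpolation (rconst ` A j) (rconst a)) (L.X (Suc j)))"
      unfolding L.resolvent_def by (subst sum.reindex[OF inj_rconst]) (simp add: comp_def)
    moreover have "P (scal (f j)) * (P (scal (1 / (?u - rconst a))) * y) = P (scal (f j / (?u - rconst a))) * y" for a y
      using L.sc_assoc[of "f j" "1 / (?u - rconst a)" y] by simp
    ultimately show ?thesis unfolding P_residue_sum by (simp only: sum_distrib_left)
  qed
  then have "L.\<phi> (Suc j) (us j) ?u * ?w = P (residue_sum (\<lambda>a. f j / (?u - rconst a)) j) * ?w"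
    unfolding 1 by (simp only: mult.assoc[symmetric])
  then show ?thesis unfolding rest_step[OF j] pi_hom P_phi_rep mult.assoc by (simp only:)
qed

lemma us_evaluates: "rat_evaluates (u_ix (Suc j)) (c (Suc j)) (us j i) (us (Suc j) i)"
proof -
  have "u_ix i = u_ix (Suc j) \<longleftrightarrow> i = Suc j" unfolding u_ix_def by presburger
  then show ?thesis using rat_evaluates_rconst[of "u_ix (Suc j)" "c (Suc j)" "c i"] rat_evaluates_rvar[of "u_ix (Suc j)" "c (Suc j)" "u_ix i"]
    by (auto simp: us_def)
qed

lemma evaluates_rest:
  assumes "\<And>m. rat_evaluates s a (us i m) (us i' m)" "\<And>k. j < k \<Longrightarrow> s \<noteq> u_ix k"
  shows "evaluates s a (rest j (us i)) (rest j (us i'))"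
  unfolding rest_def
proof (rule evaluates_prod_list)
  fix k assume "k \<in> set (rev [j + 1..<n + 1])"
  then have k: "j < k" by auto
  show "evaluates s a (phi_rep k (us i) (rvar (u_ix k))) (phi_rep k (us i') (rvar (u_ix k)))"
  proof (rule evaluates_phi_rep)
    show "rat_evaluates s a (rvar (u_ix k)) (rvar (u_ix k))"
      using rat_evaluates_rvar[of s a "u_ix k"] assms(2)[OF k] by simp
    fix m assume "1 \<le> m" "m < k"
    then have "u_ix k \<noteq> u_ix m" by (simp add: u_ix_def)
    then have "(rvar (u_ix k) :: 'a ratfun) \<noteq> rvar (u_ix m)" by (rule rvar_neq)
    then have "rvar (u_ix k) \<noteq> us i' m" using rvar_neq_rconst[of "u_ix k" "c m"] by (simp add: us_def)
    then show "rat_evaluates s a (us i m) (us i' m) \<and> rvar (u_ix k) \<noteq> us i' m" using assms(1) by blast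
  qed
qed

lemma u_step:
  assumes j: "j < n"
  shows "yh_evaluates r n d q v (u_ix (Suc j)) (c (Suc j)) (yh_rclass r n d q v (rest j (us j) * cmap (Z j)))
    (yh_rclass r n d q v (rest (Suc j) (us (Suc j)) * cmap (Z (Suc j))))"
proof -
  let ?S = "residue_sum (\<lambda>a. f j / (rvar (u_ix (Suc j)) - rconst a)) j"
  let ?h = "\<lambda>a. rconst (if a = c (Suc j) then hh (Suc j) else 0)"
  have cZ: "cmap (Z k) \<in> carrier (free_algebra n)" if "k \<le> n" for k by (rule closed_cmap[OF closed_Z[OF that]])
  have 1: "yh_rclass r n d q v (rest j (us j) * cmap (Z j)) = yh_rclass r n d q v (rest (Suc j) (us j) * ?S * cmap (Z j))"
    unfolding yh_rclass_def
    by (rule pi_eq_imp_class_eq[OF _ _ fusion_class[OF j]]; intro free_algebra_closed(6) closed_rest cZ closed_residue_sum)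
      (use j in auto)
  have "P (residue_sum ?h j * cmap (Z j)) = P (cmap (Z (Suc j)))"
  proof -
    have W: "L.WV (map L.wt (take j bs)) (map (\<lambda>b. root_k (rconst \<zeta>) (pos_r b)) (drop j bs)) (P (cmap (Z j)))"
      by (rule weight_Z) (use j in simp)
    let ?p = "\<lambda>a. L.pe (interpolation (rconst ` A j) (rconst a)) (L.X (Suc j))"
    have "P (residue_sum ?h j) = (\<Sum>a\<in>A j. if a = c (Suc j) then P (scal (rconst (hh (Suc j)))) * ?p (c (Suc j)) else 0)"
      unfolding P_residue_sum by (intro sum.cong refl) (simp add: rconst_hom L.sc_0)
    also have "\<dots> = P (scal (rconst (hh (Suc j)))) * ?p (c (Suc j))"
      using A_finite A_subset(2)[OF j] by (simp add: sum.delta)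
    finally have "P (residue_sum ?h j) = P (scal (rconst (hh (Suc j)))) * ?p (c (Suc j))" .
    then show ?thesis unfolding P_Z_Suc x_on_weight[OF j W] pi_hom by (simp only: mult.assoc)
  qed
  then have "P (rest (Suc j) (us (Suc j)) * residue_sum ?h j * cmap (Z j)) = P (rest (Suc j) (us (Suc j)) * cmap (Z (Suc j)))"
    unfolding mult.assoc pi_hom(3)[of _ _ _ _ _ "rest (Suc j) (us (Suc j))"] by (simp only:)
  then have 2: "yh_rclass r n d q v (rest (Suc j) (us (Suc j)) * residue_sum ?h j * cmap (Z j)) =
      yh_rclass r n d q v (rest (Suc j) (us (Suc j)) * cmap (Z (Suc j)))"
    unfolding yh_rclass_def
    by (rule pi_eq_imp_class_eq[rotated 2]; intro free_algebra_closed(6) closed_rest cZ closed_residue_sum)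
      (use j in auto)
  have "evaluates (u_ix (Suc j)) (c (Suc j)) (rest (Suc j) (us j)) (rest (Suc j) (us (Suc j)))"
    by (rule evaluates_rest[OF us_evaluates]) (simp add: u_ix_def)
  moreover have "evaluates (u_ix (Suc j)) (c (Suc j)) ?S (residue_sum ?h j)"
    unfolding residue_sum_def by (intro evaluates_sum evaluates_mult evaluates_scal evaluates_cmap coefficient[OF j])
  ultimately have "evaluates (u_ix (Suc j)) (c (Suc j)) (rest (Suc j) (us j) * ?S * cmap (Z j)) (rest (Suc j) (us (Suc j)) * residue_sum ?h j * cmap (Z j))"
    by (intro evaluates_mult evaluates_cmap)
  then show ?thesis unfolding 1 2[symmetric]
    by (rule yh_evaluatesI[rotated]) (intro free_algebra_closed(6) closed_rest cZ closed_residue_sum; use j in simp)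
qed

definition "TA i = adjugate_rep (root_set r \<zeta>) (rvar (v_ix i)) (tt i)"
definition "TF i = cmap (scal (Fz i) * TI i)"
text \<open>The state after \<open>j\<close> evaluations at roots of unity.\<close>

definition "B j = rest 0 (us 0) * prod_list (map (\<lambda>i. if i \<le> j then TF i else TA i) [1..<n + 1])"

lemma closed_TA: "i \<in> {1..n} \<Longrightarrow> TA i \<in> carrier (free_algebra n)"
  unfolding TA_def by (rule closed_adjugate_rep[OF closed_letters(2)])

lemma closed_TF: "i \<in> {1..n} \<Longrightarrow> TF i \<in> carrier (free_algebra n)"
  unfolding TF_def by (rule closed_cmap[OF free_algebra_closed(6)[OF free_algebra_closed(7) closed_TI]])

lemma closed_B: "B j \<in> carrier (free_algebra n)"
  unfolding B_def by (intro free_algebra_closed(6) closed_rest free_algebra_closed'(3)) (auto simp: closed_TA closed_TF simp del: carrier_free_algebra)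

text \<open>At a root of unity all summands of the adjugate but one contain a vanishing factor.\<close>

lemma adjugate_at_root:
  assumes "i \<in> {1..n}"
  shows "adjugate_rep (root_set r \<zeta>) (rconst (z i)) (tt i) = TF i"
proof -
  let ?S = "root_set r \<zeta>"
  have "(\<Prod>b\<in>?S - {a}. rconst (z i) - rconst b) = (if a = z i then rconst (Fz i) else 0)" for a
  proof (cases "a = z i")
    case True
    then show ?thesis by (simp add: Fz_def rconst_prod rconst_diff)
  next
    case False
    then have "\<exists>b\<in>?S - {a}. rconst (z i) - rconst b = 0" using z_mem[OF assms] by (intro bexI[of _ "z i"]) auto
    moreover have "finite (?S - {a})" using root_set_finite by simp
    ultimately have "(\<Prod>b\<in>?S - {a}. rconst (z i) - rconst b) = 0" by (simp only: prod_zero_iff)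
    then show ?thesis using False by simp
  qed
  then have "adjugate_rep ?S (rconst (z i)) (tt i) =
      (\<Sum>a\<in>?S. if a = z i then scal (rconst (Fz i)) * cmap (poly_at (interpolation ?S (z i)) (tt i)) else 0)"
    unfolding adjugate_rep_def by (intro sum.cong refl) (simp add: scal_def)
  also have "\<dots> = scal (rconst (Fz i)) * cmap (poly_at (interpolation ?S (z i)) (tt i))"
    using root_set_finite z_mem[OF assms] by (simp add: sum.delta)
  finally show ?thesis unfolding TF_def TI_def cmap_mult cmap_scal .
qed

lemma v_step:
  assumes j: "j < n"
  shows "yh_evaluates r n d q v (v_ix (Suc j)) (z (Suc j)) (yh_rclass r n d q v (B j)) (yh_rclass r n d q v (B (Suc j)))"
proof (rule yh_evaluatesI[OF closed_B])
  have uv: "u_ix i \<noteq> v_ix k" for i k unfolding u_ix_def v_ix_def by presburger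
  have us0: "rat_evaluates (v_ix (Suc j)) (z (Suc j)) (us 0 i) (us 0 i)" for i
    using rat_evaluates_rvar[of "v_ix (Suc j)" "z (Suc j)" "u_ix i"] uv by (auto simp: us_def)
  have "evaluates (v_ix (Suc j)) (z (Suc j)) (rest 0 (us 0)) (rest 0 (us 0))"
    by (rule evaluates_rest[OF us0]) (use uv in metis)
  moreover have "evaluates (v_ix (Suc j)) (z (Suc j)) (if i \<le> j then TF i else TA i) (if i \<le> Suc j then TF i else TA i)"
    if "i \<in> set [1..<n + 1]" for i
  proof -
    have i: "i \<in> {1..n}" using that by auto
    have TF: "evaluates (v_ix (Suc j)) (z (Suc j)) (TF i) (TF i)" unfolding TF_def by (rule evaluates_cmap)
    have v: "v_ix i = v_ix (Suc j) \<longleftrightarrow> i = Suc j" unfolding v_ix_def by presburger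
    have "evaluates (v_ix (Suc j)) (z (Suc j)) (TA i)
        (adjugate_rep (root_set r \<zeta>) (if i = Suc j then rconst (z (Suc j)) else rvar (v_ix i)) (tt i))"
      unfolding TA_def using rat_evaluates_rvar[of "v_ix (Suc j)" "z (Suc j)" "v_ix i"] unfolding v by (rule evaluates_adjugate_rep)
    then have "i = Suc j \<Longrightarrow> evaluates (v_ix (Suc j)) (z (Suc j)) (TA i) (TF i)"
      "i \<noteq> Suc j \<Longrightarrow> evaluates (v_ix (Suc j)) (z (Suc j)) (TA i) (TA i)"
      using adjugate_at_root[OF i] by (simp_all add: TA_def)
    then show ?thesis using TF by (cases "i \<le> j"; cases "i = Suc j") auto
  qed
  ultimately show "evaluates (v_ix (Suc j)) (z (Suc j)) (B j) (B (Suc j))"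
    unfolding B_def by (intro evaluates_mult evaluates_prod_list)
qed

lemma B_n: "B n = rest 0 (us 0) * cmap (Z 0)"
proof -
  have "map (\<lambda>i. if i \<le> n then TF i else TA i) [1..<n + 1] = map (\<lambda>i. cmap (scal (Fz i) * TI i)) [1..<n + 1]"
    by (rule map_cong) (auto simp: TF_def)
  then show ?thesis unfolding B_def Z.simps cmap_prod_list map_map comp_def by (simp only:)
qed

lemma us_0: "us 0 = (\<lambda>i. rvar (u_ix i))"
  by (rule ext) (auto simp: us_def)

lemma B_0: "Phi r n d \<zeta> q v (\<lambda>i. rvar (u_ix i)) (\<lambda>i. rvar (v_ix i)) = yh_rclass r n d q v (B 0)"
proof -
  let ?c = "yh_class r n d (rconst q) rv"
  have "map (\<lambda>i. yh_rclass r n d q v (scal (\<Prod>\<xi>\<in>root_set r \<zeta>. rvar (v_ix i) - rconst \<xi>))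
        \<otimes>\<^bsub>yh_ratfun r n d q v\<^esub> inv\<^bsub>yh_ratfun r n d q v\<^esub> (yh_rclass r n d q v (scal (rvar (v_ix i)) - tt i))) [1..<n + 1] =
      map (\<lambda>i. ?c (TA i)) [1..<n + 1]"
  proof (rule map_cong[OF refl])
    fix i assume "i \<in> set [1..<n + 1]"
    then have i: "i \<in> {1..n}" by auto
    show "yh_rclass r n d q v (scal (\<Prod>\<xi>\<in>root_set r \<zeta>. rvar (v_ix i) - rconst \<xi>))
        \<otimes>\<^bsub>yh_ratfun r n d q v\<^esub> inv\<^bsub>yh_ratfun r n d q v\<^esub> (yh_rclass r n d q v (scal (rvar (v_ix i)) - tt i)) = ?c (TA i)"
      unfolding TA_def yh_rclass_def[symmetric]
      by (rule class_adjugate[OF root_set_finite _ closed_letters(2)[OF i] cmap_letter T_roots[OF i]])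
        (use rvar_neq_rconst in auto)
  qed
  then have "Gamma_T r n d \<zeta> q v (\<lambda>i. rvar (v_ix i)) = list_mult (yh_algebra r n d (rconst q) rv) (map ?c (map TA [1..<n + 1]))"
    unfolding Gamma_T_def by (simp only: yh_ratfun_def map_map comp_def)
  also have "\<dots> = ?c (prod_list (map TA [1..<n + 1]))"
    by (rule list_mult_yh_class) (auto simp: closed_TA simp del: carrier_free_algebra)
  finally have G: "Gamma_T r n d \<zeta> q v (\<lambda>i. rvar (v_ix i)) = ?c (prod_list (map TA [1..<n + 1]))" .
  have "map (\<lambda>k. phi r n d q v k (\<lambda>i. rvar (u_ix i)) (rvar (u_ix k))) (rev [1..<n + 1]) =
      map (\<lambda>k. ?c (phi_rep k (us 0) (rvar (u_ix k)))) (rev [1..<n + 1])"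
  proof (rule map_cong[OF refl])
    fix k assume "k \<in> set (rev [1..<n + 1])"
    then have k: "1 \<le> k" "k \<le> n" by auto
    show "phi r n d q v k (\<lambda>i. rvar (u_ix i)) (rvar (u_ix k)) = ?c (phi_rep k (us 0) (rvar (u_ix k)))"
      unfolding us_0 yh_rclass_def[symmetric] by (rule class_phi[OF k]) (use rvar_neq_rconst in auto)
  qed
  then have "Phi r n d \<zeta> q v (\<lambda>i. rvar (u_ix i)) (\<lambda>i. rvar (v_ix i)) = list_mult (yh_algebra r n d (rconst q) rv)
      (map ?c (map (\<lambda>k. phi_rep k (us 0) (rvar (u_ix k))) (rev [1..<n + 1]) @ [prod_list (map TA [1..<n + 1])]))"
    unfolding Phi_def G by (simp only: yh_ratfun_def map_append list.map map_map comp_def)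
  also have "\<dots> = ?c (prod_list (map (\<lambda>k. phi_rep k (us 0) (rvar (u_ix k))) (rev [1..<n + 1]) @ [prod_list (map TA [1..<n + 1])]))"
  proof (rule list_mult_yh_class)
    fix a :: "'a ratfun falg" assume a: "a \<in> set (map (\<lambda>k. phi_rep k (us 0) (rvar (u_ix k))) (rev [1..<n + 1]) @ [prod_list (map TA [1..<n + 1])])"
    have "prod_list (map TA [1..<n + 1]) \<in> carrier (free_algebra n)"
      by (rule free_algebra_closed'(3)) (auto simp: closed_TA simp del: carrier_free_algebra)
    moreover have "phi_rep k (us 0) (rvar (u_ix k)) \<in> carrier (free_algebra n)" if "k < n + 1" for k
      by (rule closed_phi_rep) (use that in simp)
    ultimately show "a \<in> carrier (free_algebra n)" using a by (auto simp del: carrier_free_algebra)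
  qed
  also have "map TA [1..<n + 1] = map (\<lambda>i. if i \<le> 0 then TF i else TA i) [1..<n + 1]" by (rule map_cong) auto
  finally show ?thesis unfolding B_def rest_def yh_rclass_def by (simp only: prod_list.append prod_list.Cons prod_list.Nil mult_1_right add_0)
qed

theorem Phi_evaluates:
  "yh_evaluates_seq r n d q v (map (\<lambda>i. (v_ix i, z i)) [1..<n + 1] @ map (\<lambda>i. (u_ix i, c i)) [1..<n + 1])
    (Phi r n d \<zeta> q v (\<lambda>i. rvar (u_ix i)) (\<lambda>i. rvar (v_ix i))) (yh_const r n d q v (yh_class r n d q v (Z n)))"
proof (rule yh_evaluates_seq_append)
  have "yh_evaluates_seq r n d q v (map (\<lambda>i. (v_ix i, z i)) [Suc 0..<n + 1]) (yh_rclass r n d q v (B 0)) (yh_rclass r n d q v (B n))"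
    by (rule yh_evaluates_seq_chain[where \<Psi> = "\<lambda>j. yh_rclass r n d q v (B j)"]) (simp_all add: v_step)
  then show "yh_evaluates_seq r n d q v (map (\<lambda>i. (v_ix i, z i)) [1..<n + 1])
      (Phi r n d \<zeta> q v (\<lambda>i. rvar (u_ix i)) (\<lambda>i. rvar (v_ix i))) (yh_rclass r n d q v (rest 0 (us 0) * cmap (Z 0)))"
    unfolding B_0 B_n One_nat_def .
  have "yh_evaluates_seq r n d q v (map (\<lambda>i. (u_ix i, c i)) [Suc 0..<n + 1]) (yh_rclass r n d q v (rest 0 (us 0) * cmap (Z 0)))
      (yh_rclass r n d q v (rest n (us n) * cmap (Z n)))"
    by (rule yh_evaluates_seq_chain[where \<Psi> = "\<lambda>j. yh_rclass r n d q v (rest j (us j) * cmap (Z j))"]) (use u_step in \<open>simp_all only: le0\<close>)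
  moreover have "rest n (us n) = 1" by (simp add: rest_def)
  ultimately show "yh_evaluates_seq r n d q v (map (\<lambda>i. (u_ix i, c i)) [1..<n + 1])
      (yh_rclass r n d q v (rest 0 (us 0) * cmap (Z 0))) (yh_const r n d q v (yh_class r n d q v (Z n)))"
    unfolding yh_const_class One_nat_def by (simp only: mult_1_left)
qed

lemma P_Z: "k \<le> n \<Longrightarrow> P (cmap (Z k)) = P (scal (rconst (\<Prod>i=1..k. hh i))) * (prod_list (map x [1..<k + 1]) * P (cmap (Z 0)))"
proof (induction k)
  case (Suc k)
  have "x (Suc k) * prod_list (map x [1..<k + 1]) = prod_list (map x [1..<k + 1]) * x (Suc k)"
    by (rule prod_list_commute, rule x_x) (use Suc.prems in auto)
  moreover have "[1..<Suc k + 1] = [1..<k + 1] @ [Suc k]" by simp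
  ultimately have x: "prod_list (map x [1..<Suc k + 1]) = x (Suc k) * prod_list (map x [1..<k + 1])"
    by (simp only: map_append prod_list.append list.map prod_list.Cons prod_list.Nil mult_1_right)
  have h: "(\<Prod>i=1..Suc k. hh i) = hh (Suc k) * (\<Prod>i=1..k. hh i)" by (simp add: mult.commute)
  have IH: "P (cmap (Z k)) = P (scal (rconst (\<Prod>i=1..k. hh i))) * (prod_list (map x [1..<k + 1]) * P (cmap (Z 0)))"
    using Suc by simp
  show ?case unfolding P_Z_Suc IH x h rconst_hom(4) K.sc_mult L.sc_mult by (simp only: mult.assoc L.sc_left_commute[of "x (Suc k)"])
qed (simp add: rconst_hom L.sc_1 del: Z.simps)

lemma hook_product_telescope: "k \<le> n \<Longrightarrow> (\<Prod>i=1..k. hh i) = hook_product (set (take k bs))"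
proof (induction k)
  case (Suc k)
  then show ?case using hook_nonzero[of k] by (simp add: hh_def)
qed (simp add: hook_product_def)

lemma prod_list_interval:
  fixes g :: "nat \<Rightarrow> 'b::comm_monoid_mult"
  shows "prod_list (map g [1..<k + 1]) = (\<Prod>i=1..k. g i)"
  by (induction k) (simp_all add: mult.commute)

text \<open>The commuting factors are collected into the scalars, the \<open>XI\<close> and the
  \<open>TI\<close>; the scalars \<open>hh\<close> telescope to the hook product. The equation is proved
  over rational functions and descends because the embedding of constants is injective.\<close>

theorem Z_idempotent:
  fixes F defines "F \<equiv> (\<Prod>i=1..n. Fz i) * hook_product (set bs)"
  shows "F \<noteq> 0"
    "yh_class r n d q v (prod_list (map (\<lambda>k. XI k * TI k) [1..<n + 1])) =
      yh_class r n d q v (scal (1 / F)) \<otimes>\<^bsub>yh_algebra r n d q v\<^esub> yh_class r n d q v (Z n)"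
proof -
  have "Fz i \<noteq> 0" for i using root_set_finite by (auto simp: Fz_def)
  then show F: "F \<noteq> 0" using hook_nonzero[of n] len by (simp add: F_def)
  let ?p = "prod_list (map (\<lambda>k. XI k * TI k) [1..<n + 1])"
  have Zn: "Z n \<in> carrier (free_algebra n)" by (rule closed_Z) simp
  have p: "?p \<in> carrier (free_algebra n)"
    by (rule free_algebra_closed'(3)) (auto intro!: free_algebra_closed(6) closed_XI closed_TI simp del: carrier_free_algebra)
  have sZ: "scal (1 / F) * Z n \<in> carrier (free_algebra n)" by (rule free_algebra_closed(6)[OF free_algebra_closed(7) Zn])
  have "P (cmap ?p) = prod_list (map (\<lambda>k. x k * t k) [1..<n + 1])"
    unfolding cmap_prod_list pi_prod_list map_map comp_def cmap_mult pi_hom x_def t_def ..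
  also have "\<dots> = prod_list (map x [1..<n + 1]) * prod_list (map t [1..<n + 1])"
    by (rule prod_list_mult, rule t_x) auto
  finally have 1: "P (cmap ?p) = prod_list (map x [1..<n + 1]) * prod_list (map t [1..<n + 1])" .
  have "P (cmap (Z 0)) = P (scal (rconst (\<Prod>i=1..n. Fz i))) * prod_list (map t [1..<n + 1])"
    unfolding P_Z_0 L.prod_list_scale rconst_prod prod_list_interval ..
  then have "P (cmap (Z n)) = P (scal (rconst (hook_product (set bs)))) *
      (prod_list (map x [1..<n + 1]) * (P (scal (rconst (\<Prod>i=1..n. Fz i))) * prod_list (map t [1..<n + 1])))"
    using P_Z[of n] hook_product_telescope[of n] len by (simp only: le_refl take_all_iff) simp
  also have "\<dots> = P (scal (rconst F)) * P (cmap ?p)"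
  proof -
    have "P (scal (rconst F)) = P (scal (rconst (hook_product (set bs)))) * P (scal (rconst (\<Prod>i=1..n. Fz i)))"
      unfolding F_def mult.commute[of "prod Fz {1..n}"] by (rule K.sc_mult)
    then show ?thesis unfolding 1 L.sc_left_commute[of "prod_list (map x [1..<n + 1])"] by (simp only: mult.assoc)
  qed
  finally have "P (cmap (scal (1 / F) * Z n)) = P (scal (rconst (1 / F))) * (P (scal (rconst F)) * P (cmap ?p))"
    by (simp only: cmap_mult cmap_scal pi_hom)
  also have "\<dots> = P (cmap ?p)" unfolding mult.assoc[symmetric] K.sc_mult[symmetric] using F by (simp add: K.sc_1)
  finally have "yh_rclass r n d q v (cmap ?p) = yh_rclass r n d q v (cmap (scal (1 / F) * Z n))"
    unfolding yh_rclass_def by (intro pi_eq_imp_class_eq closed_cmap p sZ) simp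
  then have "yh_class r n d q v ?p = yh_class r n d q v (scal (1 / F) * Z n)"
    unfolding yh_const_class[symmetric] by (rule inj_onD[OF inj_on_yh_const _ yh_class_closed[OF p] yh_class_closed[OF sZ]])
  then show "yh_class r n d q v ?p = yh_class r n d q v (scal (1 / F)) \<otimes>\<^bsub>yh_algebra r n d q v\<^esub> yh_class r n d q v (Z n)"
    by (simp only: yh_class_mult[OF free_algebra_closed(7) Zn])
qed

end

section \<open>Tableaux as sequences of boxes\<close>

lemma part_antimono:
  assumes "is_partition p" "1 \<le> x'" "x' \<le> x"
  shows "part p x \<le> part p x'"
proof (cases "x \<le> length p \<and> x' \<noteq> x")
  case True
  then have "x' - 1 < x - 1" "x - 1 < length p" using assms(2,3) by auto
  then have "p ! (x - 1) \<le> p ! (x' - 1)"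
    using assms(1) sorted_wrt_nth_less[of "(\<ge>)" p "x' - 1" "x - 1"] by (simp add: is_partition_def)
  then show ?thesis using True assms(2,3) by (simp add: part_def)
next
  case False
  then show ?thesis using assms(2,3) by (auto simp: part_def)
qed

lemma nodes_closed:
  assumes "\<Lambda> \<in> rd_partitions r d n" "((x, y), k, l) \<in> nodes \<Lambda>" "1 \<le> x'" "x' \<le> x" "1 \<le> y'" "y' \<le> y"
  shows "((x', y'), k, l) \<in> nodes \<Lambda>"
  using part_antimono[of "\<Lambda> k l" x' x] assms by (simp add: rd_partitions_def nodes_def)

lemma nodes_range:
  assumes "\<Lambda> \<in> rd_partitions r d n" "b \<in> nodes \<Lambda>"
  shows "pos_r b \<in> {1..r}" "pos_d b \<in> {1..d}"
proof -
  obtain x y k l where b: "b = ((x, y), k, l)" by (metis surj_pair)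
  have "\<Lambda> k l \<noteq> []" using assms(2) by (auto simp: b nodes_def part_def)
  then have "k \<in> {1..r} \<and> l \<in> {1..d}" using assms(1) unfolding rd_partitions_def by blast
  then show "pos_r b \<in> {1..r}" "pos_d b \<in> {1..d}" by (simp_all add: b pos_r_def pos_d_def)
qed

context
  fixes r d n :: nat and \<Lambda> :: multipartition and T :: "node \<Rightarrow> nat"
  assumes \<Lambda>: "\<Lambda> \<in> rd_partitions r d n" and T: "T \<in> standard_tableaux n \<Lambda>"
begin

text \<open>The boxes in the order in which the tableau fills them. All of its prefixes are
  diagrams.\<close>

definition entries :: "node list" where "entries = map (node_of \<Lambda> T) [1..<n + 1]"

lemma T_bij: "bij_betw T (nodes \<Lambda>) {1..n}"
  using T by (simp add: standard_tableaux_def)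

lemma node_of_bij: "bij_betw (node_of \<Lambda> T) {1..n} (nodes \<Lambda>)"
  unfolding node_of_def by (rule bij_betw_inv_into[OF T_bij])

lemma length_entries: "length entries = n"
  by (simp add: entries_def)

lemma nth_entries: "k \<in> {1..n} \<Longrightarrow> entries ! (k - 1) = node_of \<Lambda> T k"
  unfolding entries_def by (subst nth_map) (auto simp del: upt_Suc)

lemma set_take_entries: "j \<le> n \<Longrightarrow> set (take j entries) = {b \<in> nodes \<Lambda>. T b \<le> j}"
proof -
  assume j: "j \<le> n"
  have "take j entries = map (node_of \<Lambda> T) [1..<j + 1]" using j by (simp add: entries_def take_map take_upt del: upt_Suc)
  moreover have "set [1..<j + 1] = {1..j}" by auto
  ultimately have "set (take j entries) = node_of \<Lambda> T ` {1..j}" by (simp only: set_map)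
  also have "\<dots> = {b \<in> nodes \<Lambda>. T b \<le> j}"
  proof (intro equalityI subsetI)
    fix b assume "b \<in> node_of \<Lambda> T ` {1..j}"
    then obtain i where i: "i \<in> {1..j}" "b = node_of \<Lambda> T i" by blast
    have "T (node_of \<Lambda> T i) = i" "node_of \<Lambda> T i \<in> nodes \<Lambda>"
      using bij_betw_inv_into_right[OF T_bij, of i] bij_betwE[OF node_of_bij] i j by (auto simp: node_of_def)
    then show "b \<in> {b \<in> nodes \<Lambda>. T b \<le> j}" using i by simp
  next
    fix b assume b: "b \<in> {b \<in> nodes \<Lambda>. T b \<le> j}"
    then have "T b \<in> {1..n}" "node_of \<Lambda> T (T b) = b"
      using bij_betwE[OF T_bij] bij_betw_inv_into_left[OF T_bij, of b] by (auto simp: node_of_def)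
    then show "b \<in> node_of \<Lambda> T ` {1..j}" using b by (intro image_eqI[of _ _ "T b"]) auto
  qed
  finally show ?thesis .
qed

lemma set_entries: "set entries = nodes \<Lambda>"
proof -
  have "T b \<le> n" if "b \<in> nodes \<Lambda>" for b using bij_betwE[OF T_bij] that by simp
  then show ?thesis using set_take_entries[of n] length_entries by auto
qed

lemma tableau_entries: "tableau r d entries"
  unfolding tableau_def standard_def
proof (intro conjI allI impI ballI)
  have "set [1..<n + 1] = {1..n}" by auto
  then show "distinct entries" using bij_betw_imp_inj_on[OF node_of_bij] by (simp add: entries_def distinct_map)
  show "pos_r b \<in> {1..r}" "pos_d b \<in> {1..d}" if "b \<in> set entries" for b
    using nodes_range[OF \<Lambda>] that by (simp_all add: set_entries)
  fix j assume "j \<le> length entries"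
  then have j: "j \<le> n" by (simp add: length_entries)
  show "young (set (take j entries))"
    unfolding young_def
  proof (intro conjI allI impI)
    fix x y k l assume "((x, y), k, l) \<in> set (take j entries)"
    then have b: "((x, y), k, l) \<in> nodes \<Lambda>" "T ((x, y), k, l) \<le> j" by (simp_all add: set_take_entries[OF j])
    show "1 \<le> x" "1 \<le> y" using b(1) by (simp_all add: nodes_def)
    fix x' y' assume *: "1 \<le> x' \<and> x' \<le> x \<and> 1 \<le> y' \<and> y' \<le> y"
    have n: "((x', y), k, l) \<in> nodes \<Lambda>" "((x', y'), k, l) \<in> nodes \<Lambda>"
      using nodes_closed[OF \<Lambda> b(1), of x' y] nodes_closed[OF \<Lambda> b(1), of x' y'] * by auto
    have "T ((x', y), k, l) \<le> T ((x, y), k, l)"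
    proof (cases "x' = x")
      case False
      then have "x' < x" using * by simp
      then have "T ((x', y), k, l) < T ((x, y), k, l)" using T n(1) b(1) unfolding standard_tableaux_def by blast
      then show ?thesis by simp
    qed simp
    moreover have "T ((x', y'), k, l) \<le> T ((x', y), k, l)"
    proof (cases "y' = y")
      case False
      then have "y' < y" using * by simp
      then have "T ((x', y'), k, l) < T ((x', y), k, l)" using T n unfolding standard_tableaux_def by blast
      then show ?thesis by simp
    qed simp
    ultimately show "((x', y'), k, l) \<in> set (take j entries)" using n b by (simp add: set_take_entries[OF j])
  qed simp
qed

lemma row_len_nodes: "1 \<le> x \<Longrightarrow> row_len (nodes \<Lambda>) k l x = part (\<Lambda> k l) x"
proof -
  assume "1 \<le> x"
  then have "{y. ((x, y), k, l) \<in> nodes \<Lambda>} = {1..part (\<Lambda> k l) x}" by (auto simp: nodes_def)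
  then show ?thesis by (simp add: row_len_def)
qed

lemma col_len_nodes: "1 \<le> y \<Longrightarrow> col_len (nodes \<Lambda>) k l y = conj_part (\<Lambda> k l) y"
proof -
  assume "1 \<le> y"
  then have "{x. ((x, y), k, l) \<in> nodes \<Lambda>} = {x. 1 \<le> x \<and> x \<le> length (\<Lambda> k l) \<and> y \<le> part (\<Lambda> k l) x}"
    by (auto simp: nodes_def part_def split: if_splits)
  then show ?thesis by (simp add: col_len_def conj_part_def)
qed

lemma F_T_entries: "F_T r \<zeta> \<Lambda> = (\<Prod>i=1..n. \<Prod>\<xi>\<in>root_set r \<zeta> - {root_k \<zeta> (pos_r (entries ! (i - 1)))}.
    root_k \<zeta> (pos_r (entries ! (i - 1))) - \<xi>)"
proof -
  have "F_T r \<zeta> \<Lambda> = (\<Prod>i=1..n. \<Prod>\<xi>\<in>root_set r \<zeta> - {root_k \<zeta> (pos_r (node_of \<Lambda> T i))}. root_k \<zeta> (pos_r (node_of \<Lambda> T i)) - \<xi>)"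
    unfolding F_T_def by (rule prod.reindex_bij_betw[OF node_of_bij, symmetric])
  also have "\<dots> = (\<Prod>i=1..n. \<Prod>\<xi>\<in>root_set r \<zeta> - {root_k \<zeta> (pos_r (entries ! (i - 1)))}.
    root_k \<zeta> (pos_r (entries ! (i - 1))) - \<xi>)"
    by (rule prod.cong[OF refl]) (simp only: nth_entries)
  finally show ?thesis .
qed

end

lemma (in separated_parameters) F_lambda_hook_product:
  assumes "\<Lambda>' \<in> rd_partitions r' d n'" "T' \<in> standard_tableaux n' \<Lambda>'"
  shows "F_lambda d q v \<Lambda>' = hook_product (nodes \<Lambda>')"
  unfolding F_lambda_def hook_product_def
proof (rule prod.cong[OF refl])
  fix b assume bn: "b \<in> nodes \<Lambda>'"
  obtain x y k l where b: "b = ((x, y), k, l)" by (metis surj_pair)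
  have xy: "1 \<le> x" "1 \<le> y" using bn by (simp_all add: b nodes_def)
  have h: "gen_hook \<Lambda>' (\<Lambda>' (pos_r b) m) b = arm_leg (nodes \<Lambda>') b m" for m
    using row_len_nodes[OF assms xy(1)] col_len_nodes[OF assms xy(2)] by (simp add: b gen_hook_def arm_leg_def pos_r_def)
  have "(\<Prod>m=1..d. hook_factor (nodes \<Lambda>') b m) =
      hook_factor (nodes \<Lambda>') b (pos_d b) * (\<Prod>m\<in>{1..d} - {pos_d b}. hook_factor (nodes \<Lambda>') b m)"
    by (rule prod.remove) (use nodes_range[OF assms(1) bn] in simp_all)
  also have "(\<Prod>m\<in>{1..d} - {pos_d b}. hook_factor (nodes \<Lambda>') b m) =
      (\<Prod>k\<in>{1..d} - {pos_d b}. let h = gen_hook \<Lambda>' (\<Lambda>' (pos_r b) k) b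
        in (v (pos_d b) * q powi h - v k * q powi (- h)) / q powi (- node_content b))"
    by (rule prod.cong[OF refl]) (simp add: hook_factor_def h Let_def)
  also have "hook_factor (nodes \<Lambda>') b (pos_d b) = q_number q (hook \<Lambda>' b) / q powi node_content b"
    by (simp add: hook_factor_def hook_def h)
  finally show "q_number q (hook \<Lambda>' b) / q powi node_content b *
     (\<Prod>k\<in>{1..d} - {pos_d b}. let h = gen_hook \<Lambda>' (\<Lambda>' (pos_r b) k) b
        in (v (pos_d b) * q powi h - v k * q powi (- h)) / q powi (- node_content b)) =
     (\<Prod>m=1..d. hook_factor (nodes \<Lambda>') b m)" by (simp only:)
qed

text \<open>Conversely, the row lengths of the diagram form the multipartition, and the position of a box in
  the sequence is its entry.\<close>

lemma tableau_realised:
  assumes tab: "tableau r d bs"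
  obtains \<Lambda> T where "\<Lambda> \<in> rd_partitions r d (length bs)" "T \<in> standard_tableaux (length bs) \<Lambda>"
    "\<And>k. k \<in> {1..length bs} \<Longrightarrow> node_of \<Lambda> T k = bs ! (k - 1)"
proof -
  let ?n = "length bs"
  define D where "D = set bs"
  have std: "standard bs" using tab by (simp add: tableau_def)
  have D: "young D" using standard_young[OF std] by (simp add: D_def)
  have range: "k \<in> {1..r} \<and> l \<in> {1..d}" if "((x, y), k, l) \<in> D" for x y k l
    using tab that by (force simp: tableau_def D_def pos_r_def pos_d_def)
  define \<Lambda> :: multipartition where "\<Lambda> k l = map (row_len D k l) [1..<Suc (col_len D k l 1)]" for k l
  have row_pos: "1 \<le> row_len D k l x \<longleftrightarrow> 1 \<le> x \<and> x \<le> col_len D k l 1" for k l x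
    using mem_row[OF D, of x 1 k l] mem_col[OF D, of x 1 k l] by simp
  have part: "part (\<Lambda> k l) x = row_len D k l x" if "1 \<le> x" for k l x
    using that row_pos[of k l x] by (auto simp: part_def \<Lambda>_def nth_append simp del: upt_Suc)
  have nodes: "nodes \<Lambda> = D"
  proof (rule Set.set_eqI)
    fix b :: node
    obtain x y k l where b: "b = ((x, y), k, l)" by (metis surj_pair)
    have "b \<in> nodes \<Lambda> \<longleftrightarrow> 1 \<le> x \<and> 1 \<le> y \<and> y \<le> row_len D k l x" using part[of x k l] by (auto simp: b nodes_def)
    also have "\<dots> \<longleftrightarrow> b \<in> D" using mem_row[OF D, of x y k l] youngD(1)[OF D, of x y k l] by (auto simp: b)
    finally show "b \<in> nodes \<Lambda> \<longleftrightarrow> b \<in> D" .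
  qed
  have mono: "row_len D k l x' \<le> row_len D k l x" if "1 \<le> x" "x \<le> x'" for k l x x'
  proof (cases "row_len D k l x' = 0")
    case False
    then have "((x', row_len D k l x'), k, l) \<in> D" by (simp add: mem_row[OF D])
    then have "((x, row_len D k l x'), k, l) \<in> D" by (rule youngD(3)[OF D]) (use that False in auto)
    then show ?thesis by (simp add: mem_row[OF D])
  qed simp
  have "\<Lambda> \<in> rd_partitions r d ?n"
    unfolding rd_partitions_def mem_Collect_eq
  proof (intro conjI allI impI)
    show "is_partition (\<Lambda> k l)" for k l
    proof -
      have "sorted_wrt (\<ge>) (\<Lambda> k l)"
        unfolding \<Lambda>_def sorted_wrt_iff_nth_less by (auto simp del: upt_Suc intro!: mono)
      moreover have "0 \<notin> set (\<Lambda> k l)"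
      proof
        assume "0 \<in> set (\<Lambda> k l)"
        then obtain x where "1 \<le> x" "x \<le> col_len D k l 1" "row_len D k l x = 0"
          by (auto simp: \<Lambda>_def simp del: upt_Suc)
        then show False using row_pos[of k l x] by simp
      qed
      ultimately show ?thesis by (simp add: is_partition_def)
    qed
    show "\<Lambda> k l = []" if "\<not> (k \<in> {1..r} \<and> l \<in> {1..d})" for k l
    proof -
      have "((1, 1), k, l) \<notin> D" using range that by blast
      then have "col_len D k l 1 = 0" by (simp add: mem_col[OF D])
      then show ?thesis by (simp add: \<Lambda>_def)
    qed
    have sl: "sum_list (\<Lambda> k l) = (\<Sum>x\<in>{1..col_len D k l 1}. row_len D k l x)" for k l
    proof -
      have "set [1..<Suc (col_len D k l 1)] = {1..col_len D k l 1}" by auto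
      then show ?thesis unfolding \<Lambda>_def by (subst sum_list_distinct_conv_sum_set) (simp_all del: upt_Suc)
    qed
    \<comment> \<open>Count the boxes by component and row.\<close>
    let ?S = "SIGMA k:{1..r}. SIGMA l:{1..d}. SIGMA x:{1..col_len D k l 1}. {1..row_len D k l x}"
    have "D = (\<lambda>(k, l, x, y). ((x, y), k, l)) ` ?S"
    proof (rule Set.set_eqI)
      fix b :: node
      obtain x y k l where b: "b = ((x, y), k, l)" by (metis surj_pair)
      have "b \<in> D \<longleftrightarrow> (k, l, x, y) \<in> ?S"
      proof
        assume "b \<in> D"
        then have m: "((x, y), k, l) \<in> D" by (simp add: b)
        then have y: "1 \<le> y" "y \<le> row_len D k l x" by (simp_all add: mem_row[OF D])
        then have "1 \<le> row_len D k l x" by linarith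
        then show "(k, l, x, y) \<in> ?S" using y range[OF m] row_pos[of k l x] by simp
      next
        assume "(k, l, x, y) \<in> ?S"
        then show "b \<in> D" by (simp add: b mem_row[OF D])
      qed
      then show "b \<in> D \<longleftrightarrow> b \<in> (\<lambda>(k, l, x, y). ((x, y), k, l)) ` ?S" by (force simp: b)
    qed
    then have "card D = card ((\<lambda>(k, l, x, y). ((x, y), k, l) :: node) ` ?S)" by simp
    also have "\<dots> = card ?S" by (rule card_image) (auto simp: inj_on_def)
    also have "\<dots> = (\<Sum>k=1..r. \<Sum>l=1..d. sum_list (\<Lambda> k l))" unfolding sl by (subst card_SigmaI; simp)+
    finally show "(\<Sum>k=1..r. \<Sum>l=1..d. sum_list (\<Lambda> k l)) = ?n"
      using std by (simp add: standard_def D_def distinct_card)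
  qed
  define e where "e k = bs ! (k - 1)" for k
  have bij: "bij_betw e {1..?n} D"
  proof -
    have "bij_betw (\<lambda>k. k - 1) {1..?n} {..<?n}" by (rule bij_betw_byWitness[where f' = Suc]) auto
    moreover have "bij_betw (\<lambda>i. bs ! i) {..<?n} D" using std unfolding D_def standard_def by (intro bij_betw_nth) auto
    ultimately have "bij_betw ((\<lambda>i. bs ! i) \<circ> (\<lambda>k. k - 1)) {1..?n} D" by (rule bij_betw_trans)
    then show ?thesis unfolding e_def comp_def .
  qed
  define T where "T = inv_into {1..?n} e"
  have Tbij: "bij_betw T D {1..?n}" unfolding T_def by (rule bij_betw_inv_into[OF bij])
  have Te: "T (e k) = k" if "k \<in> {1..?n}" for k unfolding T_def by (rule bij_betw_inv_into_left[OF bij that])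
  have less: "T b < T b'" if "b = ((x, y), k, l)" "b' = ((x', y'), k, l)" "b \<in> D" "b' \<in> D" "x \<le> x'" "y \<le> y'" "b \<noteq> b'" for b b' x y x' y' k l
  proof -
    have Tb: "T b' \<in> {1..?n}" "T b \<in> {1..?n}" using bij_betwE[OF Tbij] that by auto
    have eT: "e (T b') = b'" unfolding T_def by (rule bij_betw_inv_into_right[OF bij that(4)])
    have "take (T b') bs ! (T b' - 1) = b'" using Tb eT by (simp add: e_def)
    then have "b' \<in> set (take (T b') bs)" using Tb nth_mem[of "T b' - 1" "take (T b') bs"] by simp
    moreover have "young (set (take (T b') bs))" using std Tb unfolding standard_def by simp
    ultimately have "b \<in> set (take (T b') bs)"
      using youngD(3)[of "set (take (T b') bs)" x' y' k l x y] that youngD(1,2)[OF D, of x y k l] by simp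
    then obtain i where i: "i < T b'" "i < ?n" "bs ! i = b" by (auto simp: in_set_conv_nth)
    then have "T b = Suc i" using Te[of "Suc i"] by (simp add: e_def)
    moreover have "T b \<noteq> T b'" using bij_betw_imp_inj_on[OF Tbij] that by (auto simp: inj_on_def)
    ultimately show ?thesis using i(1) by simp
  qed
  have "T \<in> standard_tableaux ?n \<Lambda>"
    unfolding standard_tableaux_def nodes using Tbij less by auto
  moreover have "node_of \<Lambda> T k = bs ! (k - 1)" if "k \<in> {1..?n}" for k
  proof -
    have "e k \<in> D" using bij_betwE[OF bij] that by blast
    then have "inv_into D T (T (e k)) = e k" by (rule bij_betw_inv_into_left[OF Tbij])
    then have "inv_into D T k = e k" by (simp only: Te[OF that])
    then show ?thesis unfolding node_of_def nodes e_def .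
  qed
  ultimately show thesis using that \<open>\<Lambda> \<in> rd_partitions r d ?n\<close> by blast
qed

text \<open>A box can always be added at the end of the first row of a component.\<close>

lemma tableau_add:
  assumes tab: "tableau r d bs" and p: "p \<in> {1..r}" and d: "1 \<le> d"
  obtains b where "tableau r d (bs @ [b])" "pos_r b = p"
proof -
  define D where "D = set bs"
  have D: "young D" using tab standard_young by (simp add: tableau_def D_def)
  let ?b = "((1, Suc (row_len D p 1 1)), p, 1) :: node"
  have "?b \<notin> D" by (simp add: mem_row[OF D])
  moreover have "young (insert ?b D)"
    unfolding young_def
  proof (intro conjI allI impI)
    show "finite (insert ?b D)" using young_finite[OF D] by simp
    fix x y k l assume m: "((x, y), k, l) \<in> insert ?b D"
    show "1 \<le> x" "1 \<le> y" using m youngD(1,2)[OF D, of x y k l] by auto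
    fix x' y' assume *: "1 \<le> x' \<and> x' \<le> x \<and> 1 \<le> y' \<and> y' \<le> y"
    show "((x', y'), k, l) \<in> insert ?b D"
    proof (cases "((x, y), k, l) \<in> D")
      case True
      then show ?thesis using youngD(3)[OF D True, of x' y'] * by simp
    next
      case False
      then have t: "x = 1" "y = Suc (row_len D p 1 1)" "k = p" "l = 1" using m by auto
      show ?thesis using * by (auto simp: t mem_row[OF D] le_Suc_eq)
    qed
  qed
  ultimately have "tableau r d (bs @ [?b])"
    using tab p d by (auto simp: tableau_def standard_snoc D_def pos_r_def pos_d_def)
  then show thesis using that by (simp add: pos_r_def)
qed

lemma tableau_extend:
  assumes "tableau r d bs" "length bs \<le> n" "1 \<le> r" "1 \<le> d"
  obtains bs' where "tableau r d bs'" "length bs' = n" "take (length bs) bs' = bs"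
proof -
  have "\<exists>bs'. tableau r d bs' \<and> length bs' = length bs + m \<and> take (length bs) bs' = bs" for m
  proof (induction m)
    case 0
    then show ?case using assms(1) by (intro exI[of _ bs]) simp
  next
    case (Suc m)
    then obtain bs' where bs': "tableau r d bs'" "length bs' = length bs + m" "take (length bs) bs' = bs" by blast
    obtain b where "tableau r d (bs' @ [b])" by (rule tableau_add[OF bs'(1), of 1]) (use assms in auto)
    then show ?case using bs' by (intro exI[of _ "bs' @ [b]"]) simp
  qed
  from this[of "n - length bs"] show thesis using that assms(2) by auto
qed

text \<open>Since every sequence can be extended to length \<open>n\<close>, each box that is addable in
  position \<open>k\<close> occurs there in some tableau with \<open>n\<close> boxes.\<close>

lemma entry_attained:
  assumes "tableau r d (bs @ [b])" "k = Suc (length bs)" "k \<le> n" "1 \<le> r" "1 \<le> d"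
  obtains \<Lambda> T where "\<Lambda> \<in> rd_partitions r d n" "T \<in> standard_tableaux n \<Lambda>" "node_of \<Lambda> T k = b"
proof -
  obtain bs' where bs': "tableau r d bs'" "length bs' = n" "take (length (bs @ [b])) bs' = bs @ [b]"
    by (rule tableau_extend[OF assms(1), of n]) (use assms in auto)
  have "bs' ! length bs = take (length (bs @ [b])) bs' ! length bs" by simp
  also have "\<dots> = b" unfolding bs'(3) by simp
  finally have "bs' ! (k - 1) = b" using assms(2) by simp
  moreover obtain \<Lambda> T where "\<Lambda> \<in> rd_partitions r d n" "T \<in> standard_tableaux n \<Lambda>"
    "\<And>k. k \<in> {1..n} \<Longrightarrow> node_of \<Lambda> T k = bs' ! (k - 1)"
    using tableau_realised[OF bs'(1)] unfolding bs'(2) by blast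
  ultimately show thesis using that assms(2,3) by auto
qed

text \<open>Every colour occurs in every position.\<close>

lemma cbar_set_eq:
  assumes "k \<in> {1..n}" "1 \<le> r" "1 \<le> d"
  shows "cbar_set r n d \<zeta> k = root_set r \<zeta>"
proof (intro equalityI subsetI)
  fix z assume "z \<in> cbar_set r n d \<zeta> k"
  then obtain \<Lambda> T where T: "\<Lambda> \<in> rd_partitions r d n" "T \<in> standard_tableaux n \<Lambda>" "z = root_k \<zeta> (tab_p \<Lambda> T k)"
    by (auto simp: cbar_set_def)
  have "node_of \<Lambda> T k \<in> nodes \<Lambda>" using bij_betwE[OF node_of_bij[OF T(1,2)]] assms(1) by blast
  then show "z \<in> root_set r \<zeta>" using nodes_range(1)[OF T(1)] by (simp add: T(3) tab_p_def root_set_def)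
next
  fix z assume "z \<in> root_set r \<zeta>"
  then obtain p where p: "p \<in> {1..r}" "z = root_k \<zeta> p" by (auto simp: root_set_def)
  obtain bs where bs: "tableau r d bs" "length bs = k - 1"
    by (rule tableau_extend[of r d "[]" "k - 1"]) (use assms in \<open>auto simp: tableau_def\<close>)
  obtain b where b: "tableau r d (bs @ [b])" "pos_r b = p" by (rule tableau_add[OF bs(1) p(1) assms(3)])
  obtain \<Lambda> T where "\<Lambda> \<in> rd_partitions r d n" "T \<in> standard_tableaux n \<Lambda>" "node_of \<Lambda> T k = b"
    by (rule entry_attained[OF b(1), of k n]) (use assms bs in auto)
  then show "z \<in> cbar_set r n d \<zeta> k" using b(2) p(2) unfolding cbar_set_def tab_p_def by blast
qed

lemma (in separated_parameters) tab_c_eq: "tab_c q v \<Lambda> T k = cont (node_of \<Lambda> T k)"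
  by (simp add: tab_c_def cont_def)

lemma (in separated_parameters) finite_c_set:
  assumes "k \<in> {1..m}"
  shows "finite (c_set r m d q v k)"
proof (rule finite_subset)
  let ?h = "\<lambda>(l, j). v l * q powi (2 * j)"
  show "c_set r m d q v k \<subseteq> ?h ` ({1..d} \<times> {- int m..int m})"
  proof
    fix a assume "a \<in> c_set r m d q v k"
    then obtain \<Lambda> T where T: "\<Lambda> \<in> rd_partitions r d m" "T \<in> standard_tableaux m \<Lambda>" "a = cont (node_of \<Lambda> T k)"
      by (auto simp: c_set_def tab_c_eq)
    let ?b = "node_of \<Lambda> T k"
    have b: "?b \<in> nodes \<Lambda>" using bij_betwE[OF node_of_bij[OF T(1,2)]] assms(1) by blast
    obtain x y p l where b': "?b = ((x, y), p, l)" by (metis surj_pair)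
    have Y: "young (nodes \<Lambda>)"
      using tableau_entries[OF T(1,2)] standard_young unfolding tableau_def set_entries[OF T(1,2), symmetric] by blast
    have "\<bar>node_content ?b\<bar> + 1 \<le> int (card {b \<in> nodes \<Lambda>. pos_r b = p \<and> pos_d b = l})"
      using content_bound[OF Y, of x y p l] b by (simp add: b')
    also have "\<dots> \<le> int (card (nodes \<Lambda>))" using young_finite[OF Y] by (intro of_nat_mono card_mono) auto
    also have "card (nodes \<Lambda>) = m" using bij_betw_same_card[OF T_bij[OF T(1,2)]] by simp
    finally show "a \<in> ?h ` ({1..d} \<times> {- int m..int m})"
      using nodes_range(2)[OF T(1) b] by (intro image_eqI[of _ _ "(pos_d ?b, node_content ?b)"]) (auto simp: T(3) cont_def)
  qed
qed simp

lemma (in separated_parameters) addable_contents_attained: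
  assumes tab: "tableau r d bs" and k: "k \<in> {1..m}" "length bs = m" and r: "1 \<le> d"
  shows "cont ` addable d (pos_r (bs ! (k - 1))) (set (take (k - 1) bs)) \<subseteq> c_set r m d q v k"
proof
  fix a assume "a \<in> cont ` addable d (pos_r (bs ! (k - 1))) (set (take (k - 1) bs))"
  then obtain b where b: "b \<in> addable d (pos_r (bs ! (k - 1))) (set (take (k - 1) bs))" "a = cont b" by blast
  have pr: "pos_r (bs ! (k - 1)) \<in> {1..r}" using tab nth_mem[of "k - 1" bs] k by (auto simp: tableau_def)
  have "standard (take (k - 1) bs)" using tab by (simp add: tableau_def standard_take)
  then have "tableau r d (take (k - 1) bs @ [b])"
    using b(1) tab pr set_take_subset[of "k - 1" bs] by (auto simp: tableau_def standard_snoc addable_def)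
  then obtain \<Lambda> T where "\<Lambda> \<in> rd_partitions r d m" "T \<in> standard_tableaux m \<Lambda>" "node_of \<Lambda> T k = b"
    by (rule entry_attained[of r d _ b k m]) (use k r pr in auto)
  then show "a \<in> c_set r m d q v k" unfolding c_set_def tab_c_eq b(2) by blast
qed

text \<open>A factor of the first product times \<open>q\<^sup>2 - 1\<close> is \<open>q ^ (2 * j) -
  1\<close>. In the second product, the pairs of indices are ordered; exchanging them changes the sign of
  \<open>l\<close>.\<close>

lemma separated_parameters_of_product:
  fixes q :: "'a::field"
  assumes "q \<noteq> 0" "q ^ 2 \<noteq> 1 \<or> n = 1" "\<And>l. l \<in> {1..d} \<Longrightarrow> v l \<noteq> 0"
    and p: "(\<Prod>k=1..n. \<Sum>j<k. q ^ (2 * j)) *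
         (\<Prod>j=1..d. \<Prod>i=1..<j. \<Prod>l\<in>{- int n<..<int n}. q powi (2 * l) * v i - v j) \<noteq> 0"
  shows "separated_parameters n d q v"
proof
  show "q ^ (2 * j) \<noteq> 1" if "2 \<le> n" "1 \<le> j" "j \<le> n" for j
  proof -
    have "(\<Prod>k=1..n. \<Sum>j<k. q ^ (2 * j)) \<noteq> 0" using p by (simp only: mult_eq_0_iff) blast
    then have "(\<Sum>i<j. q ^ (2 * i)) \<noteq> 0" using that by (simp add: prod_zero_iff)
    moreover have "q ^ (2 * j) - 1 = (q ^ 2 - 1) * (\<Sum>i<j. q ^ (2 * i))"
      using power_diff_1_eq[of "q ^ 2" j] by (simp only: power_mult)
    moreover have "q ^ 2 - 1 \<noteq> 0" using assms(2) that(1) by auto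
    ultimately show ?thesis by auto
  qed
  have *: "q powi (2 * m) * v i \<noteq> v j" if "i \<in> {1..d}" "j \<in> {1..d}" "i < j" "\<bar>m\<bar> < int n" for i j m
  proof -
    have "(\<Prod>j=1..d. \<Prod>i=1..<j. \<Prod>l\<in>{- int n<..<int n}. q powi (2 * l) * v i - v j) \<noteq> 0"
      using p by (simp only: mult_eq_0_iff) blast
    then have "(\<Prod>i=1..<j. \<Prod>l\<in>{- int n<..<int n}. q powi (2 * l) * v i - v j) \<noteq> 0" using that(2) by (simp only: prod_zero_iff finite_atLeastAtMost) blast
    moreover have "i \<in> {1..<j}" using that(1,3) by simp
    ultimately have "(\<Prod>l\<in>{- int n<..<int n}. q powi (2 * l) * v i - v j) \<noteq> 0"
      by (simp only: prod_zero_iff finite_atLeastLessThan) blast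
    moreover have "m \<in> {- int n<..<int n}" using that(4) by auto
    ultimately have "q powi (2 * m) * v i - v j \<noteq> 0" by (simp only: prod_zero_iff finite_greaterThanLessThan_int) blast
    then show ?thesis by simp
  qed
  show "v l \<noteq> q powi (2 * m) * v l'" if "l \<in> {1..d}" "l' \<in> {1..d}" "l \<noteq> l'" "\<bar>m\<bar> < int n" for l l' m
  proof (cases "l' < l")
    case True
    then show ?thesis using *[OF that(2,1) True that(4)] by metis
  next
    case False
    then have "q powi (2 * (- m)) * v l \<noteq> v l'" using *[of l l' "- m"] that by simp
    moreover have "q powi (2 * (- m)) * (q powi (2 * m) * v l') = v l'"
      using assms(1) by (simp add: power_int_minus)
    ultimately show ?thesis by metis
  qed
qed (use assms in auto)

theorem theorem8p7:
  fixes r n d :: nat and \<zeta> q :: "'a::alg_closed_field" and v :: "nat \<Rightarrow> 'a"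
    and \<Lambda> :: multipartition and T :: "node \<Rightarrow> nat"
  assumes "r \<ge> 1" and "n \<ge> 1" and "d \<ge> 1"
    and "\<not> CHAR('a) dvd r"
    and "\<zeta> ^ r = 1" and "\<And>j. 0 < j \<Longrightarrow> j < r \<Longrightarrow> \<zeta> ^ j \<noteq> 1"
    and "q \<noteq> 0" and "q ^ 2 \<noteq> 1 \<or> n = 1" and "\<And>l. l \<in> {1..d} \<Longrightarrow> v l \<noteq> 0"
    and "(\<Prod>k=1..n. \<Sum>j<k. q ^ (2 * j)) *
         (\<Prod>j=1..d. \<Prod>i=1..<j. \<Prod>l\<in>{- int n<..<int n}. q powi (2 * l) * v i - v j) \<noteq> 0"
    and "\<Lambda> \<in> rd_partitions r d n"
    and "T \<in> standard_tableaux n \<Lambda>"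
  shows "F_T r \<zeta> \<Lambda> * F_lambda d q v \<Lambda> \<noteq> 0 \<and>
    (\<exists>y \<in> carrier (yh_algebra r n d q v).
      yh_evaluates_seq r n d q v
        (map (\<lambda>i. (v_ix i, root_k \<zeta> (tab_p \<Lambda> T i))) [1..<n + 1] @
         map (\<lambda>i. (u_ix i, tab_c q v \<Lambda> T i)) [1..<n + 1])
        (Phi r n d \<zeta> q v (\<lambda>i. rvar (u_ix i)) (\<lambda>i. rvar (v_ix i)))
        (yh_const r n d q v y) \<and>
      idempotent_E r n d \<zeta> q v \<Lambda> T =
        yh_class r n d q v (scal (1 / (F_T r \<zeta> \<Lambda> * F_lambda d q v \<Lambda>)))
          \<otimes>\<^bsub>yh_algebra r n d q v\<^esub> y)"
proof -
  note \<Lambda> = assms(11,12)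
  interpret sp: separated_parameters n d q v by (rule separated_parameters_of_product[OF assms(7-10)])
  let ?bs = "entries n \<Lambda> T"
  have tab: "tableau r d ?bs" by (rule tableau_entries[OF \<Lambda>])
  have len: "length ?bs = n" by (rule length_entries[OF \<Lambda>])
  interpret tableau_fusion n d q v r \<zeta> ?bs "c_set r n d q v"
  proof
    show "of_nat r \<noteq> (0 :: 'a)" using assms(4) by (simp add: of_nat_eq_0_iff_char_dvd)
    show "1 \<le> d" "\<zeta> ^ r = 1" "1 \<le> n" by fact+
    show "\<zeta> ^ j \<noteq> 1" if "0 < j" "j < r" for j using assms(6) that .
    show "tableau r d ?bs" "length ?bs = n" by fact+
    show "finite (c_set r n d q v k)" if "k \<in> {1..n}" for k by (rule sp.finite_c_set[OF that])
    show "sp.cont ` addable d (pos_r (?bs ! (k - 1))) (set (take (k - 1) ?bs)) \<subseteq> c_set r n d q v k" if "k \<in> {1..n}" for k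
      by (rule sp.addable_contents_attained[OF tab that len assms(3)])
  qed
  have nth: "?bs ! (k - 1) = node_of \<Lambda> T k" if "k \<in> {1..n}" for k by (rule nth_entries[OF \<Lambda> that])
  have c: "c k = tab_c q v \<Lambda> T k" and z: "z k = root_k \<zeta> (tab_p \<Lambda> T k)" if "k \<in> {1..n}" for k
    by (simp_all only: c_def z_def nth[OF that] sp.tab_c_eq tab_p_def)
  have mem: "k \<in> {1..n}" if "k \<in> set [1..<n + 1]" for k using that by auto
  have lists: "map (\<lambda>i. (v_ix i, z i)) [1..<n + 1] = map (\<lambda>i. (v_ix i, root_k \<zeta> (tab_p \<Lambda> T i))) [1..<n + 1]"
    "map (\<lambda>i. (u_ix i, c i)) [1..<n + 1] = map (\<lambda>i. (u_ix i, tab_c q v \<Lambda> T i)) [1..<n + 1]"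
    by (rule map_cong[OF refl], simp only: c[OF mem] z[OF mem])+
  have "map (\<lambda>k. XI k * TI k) [1..<n + 1] = map (\<lambda>k.
        poly_at (interpolation (c_set r n d q v k) (tab_c q v \<Lambda> T k)) (jm k) *
        poly_at (interpolation (cbar_set r n d \<zeta> k) (root_k \<zeta> (tab_p \<Lambda> T k))) (tt k)) [1..<n + 1]"
    by (rule map_cong[OF refl]) (simp only: XI_def TI_def c[OF mem] z[OF mem] cbar_set_eq[OF mem assms(1,3)])
  then have E: "idempotent_E r n d \<zeta> q v \<Lambda> T = yh_class r n d q v (prod_list (map (\<lambda>k. XI k * TI k) [1..<n + 1]))"
    by (simp only: idempotent_E_def)
  have FT: "F_T r \<zeta> \<Lambda> = (\<Prod>i=1..n. Fz i)" unfolding F_T_entries[OF \<Lambda>] Fz_def z_def ..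
  have FL: "F_lambda d q v \<Lambda> = sp.hook_product (set ?bs)"
    unfolding set_entries[OF \<Lambda>] by (rule sp.F_lambda_hook_product[OF \<Lambda>])
  show ?thesis
    unfolding E FT FL
    using Z_idempotent Phi_evaluates[unfolded lists] yh_class_closed[OF closed_Z[of n]] by blast
qed

end
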